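(* Let $2\le p<\infty$ and let $(k_n)_{n\in\mathbb N}$ be a sequence of integers with $1\le k_n\le n$ and $\lim_{n\to\infty}\frac{k_n}{n}=\lambda\in[0,1]$. Assume that $k_n=\omega(1)$ and that the sequence $(t_n)_{n\in\mathbb N}$ of positive real numbers satisfies $t_n=\omega(1)$, $t_n=o(\sqrt{k_n})$, and either $t_n=o(\sqrt{n-k_n})$ or $(n-k_n)=o\big(\frac{\sqrt{k_n}}{t_n}\big)$. For each $n\in\mathbb N$ let $\mathbf W_n$ be a probability measure on $[0,\infty)$ such that $$\lim_{n\to\infty}t_n^{-2}\log\mathbf W_n\big((\delta t_n\sqrt n,\infty)\big)=-\infty\qquad\text{for every }\delta>0.$$ Further, let $X_n$ be a random point with distribution $\mathbf P_{\mathbf W_n,n,p}$ and let $E_n$ be a uniformly distributed (Haar) random $k_n$-dimensional linear subspace of $\mathbb R^n$, with $X_n$ and $E_n$ independent, and put $$\mathscr X_{n,p}:=n^{1/p}\sqrt{\frac{\Gamma(\frac1p)}{p^{2/p}\Gamma(\frac3p)}}\;\|P_{E_n}X_n\|_2-\sqrt{k_n}.$$ Then the sequence of random variables $t_n^{-1}\mathscr X_{n,p}$ satisfies an MDP on $\mathbb R$ with speed $t_n^2$ and rate function $\mathbb I:\mathbb R\to[0,\infty)$, $\mathbb I(x)=\alpha_{p,\lambda}x^2$, where $$\alpha_{p,\lambda}=\frac{2\Gamma(\frac1p)\Gamma(\frac3p)^2}{(2p-\lambda(4+3p))\Gamma(1+\frac1p)\Gamma(\frac3p)^2+\lambda\G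amma(\frac1p)^2\Gamma(\frac5p)}.$$
   Context: $\mathbb B_p^n=\{x\in\mathbb R^n:\|x\|_p\le1\}$ with $\|x\|_p=(\sum_{i=1}^n|x_i|^p)^{1/p}$; $P_E$ denotes orthogonal projection onto the subspace $E$. The measures $\mathbf P_{\mathbf W,n,p}$: let $\mathbf U_{n,p}$ be the uniform distribution on $\mathbb B_p^n$ and $\mathbf C_{n,p}$ the cone probability measure on $\mathbb S_p^{n-1}=\{x\in\mathbb R^n:\|x\|_p=1\}$, i.e. $\mathbf C_{n,p}(A)=\mathbf U_{n,p}(\{rx:x\in A,0\le r\le1\})$ for measurable $A\subseteq\mathbb S_p^{n-1}$. For a Borel probability measure $\mathbf W$ on $[0,\infty)$, $$\mathbf P_{\mathbf W,n,p}:=\mathbf W(\{0\})\,\mathbf C_{n,p}+H\,\mathbf U_{n,p},\qquad H(x)=h(\|x\|_p),$$ $$h(r)=\frac{1}{p^{n/p}\Gamma(1+\frac np)}\frac{1}{(1-r^p)^{1+n/p}}\int_0^\infty s^{n/p}e^{-\frac1p s r^p(1-r^p)^{-1}}\,\mathbf W(\mathrm ds),\qquad r\in[0,1],$$ where $H\,\mathbf U_{n,p}$ is the measure with density $H$ with respect to $\mathbf U_{n,p}$. Landau notation: $x_n=o(y_n)$ means $\lim_{n\to\infty} x_n/y_n=0$; $x_n=\omega(y_n)$ means $\lim_{n\to\infty}|x_n/y_n|=+\infty$. A moderate deviations principle (MDP) is formally the same as a large deviations principle: given positive reals $(s_n)$, a sequence $(X_n)$ of random vectors in $\mathbb R^d$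 satisfies it with speed $s_n$ and rate function $\mathbb I:\mathbb R^d\to[0,\infty]$ if $\mathbb I$ is lower semi-continuous with compact level sets $\{\mathbb I\le\alpha\}$, $\alpha\in\mathbb R$, and for all Borel sets $A\subseteq\mathbb R^d$ $$-\inf_{x\in A^\circ}\mathbb I(x)\le\liminf_{n\to\infty}s_n^{-1}\log\mathbb P[X_n\in A]\le\limsup_{n\to\infty}s_n^{-1}\log\mathbb P[X_n\in A]\le-\inf_{x\in\overline A}\mathbb I(x),$$ where $A^\circ$ is the interior and $\overline A$ the closure of $A$.
   Formalization: For p=2, λ=1 the denominator of α is zero, so α is undefined and no rate function into [0,∞) can hold (e.g. k_n=n); there α is read as +∞, so the rate function is 0 at 0 and ∞ elsewhere. All other cases are unchanged. *)

theory Defs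
  imports "HOL-Probability.Probability" "HOL-Library.Landau_Symbols"
begin

section \<open>Euclidean space of varying dimension\<close>

text \<open>
  The dimension \<open>n\<close> runs through a sequence, so a vector of \<open>\<real>\<^sup>n\<close> is a function
  \<open>nat \<Rightarrow> real\<close> that is extensional on \<open>{..<n}\<close>, i.e. a point of the
  product measurable space below.
\<close>

definition Rn :: "nat \<Rightarrow> (nat \<Rightarrow> real) measure" where
  "Rn n = Pi\<^sub>M {..<n} (\<lambda>_. borel)"

definition lebesgue_Rn :: "nat \<Rightarrow> (nat \<Rightarrow> real) measure" where
  "lebesgue_Rn n = Pi\<^sub>M {..<n} (\<lambda>_. lborel)"

definition pnorm :: "nat \<Rightarrow> real \<Rightarrow> (nat \<Rightarrow> real) \<Rightarrow> real" where
  "pnorm n p x = (\<Sum>i<n. \<bar>x i\<bar> powr p) powr (1 / p)"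

definition p_ball :: "nat \<Rightarrow> real \<Rightarrow> (nat \<Rightarrow> real) set" where
  "p_ball n p = {x \<in> space (Rn n). pnorm n p x \<le> 1}"

definition p_sphere :: "nat \<Rightarrow> real \<Rightarrow> (nat \<Rightarrow> real) set" where
  "p_sphere n p = {x \<in> space (Rn n). pnorm n p x = 1}"

definition scale_Rn :: "nat \<Rightarrow> real \<Rightarrow> (nat \<Rightarrow> real) \<Rightarrow> (nat \<Rightarrow> real)" where
  "scale_Rn n r x = (\<lambda>i\<in>{..<n}. r * x i)"


section \<open>The distributions on the ball\<close>

definition uniform_ball :: "nat \<Rightarrow> real \<Rightarrow> (nat \<Rightarrow> real) measure" where
  "uniform_ball n p = uniform_measure (lebesgue_Rn n) (p_ball n p)"

definition cone_over :: "nat \<Rightarrow> real \<Rightarrow> (nat \<Rightarrow> real) set \<Rightarrow> (nat \<Rightarrow> real) set" where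
  "cone_over n p A = {scale_Rn n r x | r x. x \<in> A \<inter> p_sphere n p \<and> 0 \<le> r \<and> r \<le> 1}"

text \<open>
  The cone measure is regarded as a measure on all of \<open>\<real>\<^sup>n\<close>, concentrated on the sphere.
  That the set function is a measure, so that \<^const>\<open>measure_of\<close> does not degenerate,
  is \<open>emeasure_cone_measure\<close> below.
\<close>

definition cone_measure :: "nat \<Rightarrow> real \<Rightarrow> (nat \<Rightarrow> real) measure" where
  "cone_measure n p = measure_of (space (Rn n)) (sets (Rn n))
     (\<lambda>A. emeasure (uniform_ball n p) (cone_over n p A))"

text \<open>
  The integral may be infinite at \<open>r = 0\<close> and the value at \<open>r = 1\<close> is an arbitrary one given
  by division by zero; both cases concern null sets of the uniform distribution.
\<close>

definition h_density :: "real measure \<Rightarrow> nat \<Rightarrow> real \<Rightarrow> real \<Rightarrow> ennreal" where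
  "h_density W n p r =
     ennreal (1 / (p powr (n / p) * Gamma (1 + n / p)) * (1 / (1 - r powr p) powr (1 + n / p))) *
     (\<integral>\<^sup>+ s. ennreal (s powr (n / p) * exp (- (1 / p) * s * r powr p * inverse (1 - r powr p))) \<partial>W)"

definition P_dist :: "real measure \<Rightarrow> nat \<Rightarrow> real \<Rightarrow> (nat \<Rightarrow> real) measure" where
  "P_dist W n p = measure_of (space (Rn n)) (sets (Rn n))
     (\<lambda>A. emeasure W {0} * emeasure (cone_measure n p) A +
          emeasure (density (uniform_ball n p) (\<lambda>x. h_density W n p (pnorm n p x))) A)"


section \<open>Random subspaces and orthogonal projections\<close>

definition lin_comb :: "nat \<Rightarrow> nat \<Rightarrow> (nat \<Rightarrow> nat \<Rightarrow> real) \<Rightarrow> (nat \<Rightarrow> real) \<Rightarrow> (nat \<Rightarrow> real)" where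
  "lin_comb n k b c = (\<lambda>i\<in>{..<n}. \<Sum>j<k. c j * b j i)"

definition lin_indep :: "nat \<Rightarrow> nat \<Rightarrow> (nat \<Rightarrow> nat \<Rightarrow> real) \<Rightarrow> bool" where
  "lin_indep n k b \<longleftrightarrow>
     (\<forall>c. lin_comb n k b c = (\<lambda>i\<in>{..<n}. 0) \<longrightarrow> (\<forall>j<k. c j = 0))"

text \<open>The \<open>k\<close>-dimensional linear subspaces of \<open>\<real>\<^sup>n\<close>: those with a basis \<open>b 0, \<dots>, b (k - 1)\<close>.\<close>

definition subspaces :: "nat \<Rightarrow> nat \<Rightarrow> (nat \<Rightarrow> real) set set" where
  "subspaces n k = {range (lin_comb n k b) | b.
     (\<forall>j<k. b j \<in> space (Rn n)) \<and> lin_indep n k b}"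

definition proj :: "nat \<Rightarrow> (nat \<Rightarrow> real) set \<Rightarrow> (nat \<Rightarrow> real) \<Rightarrow> (nat \<Rightarrow> real)" where
  "proj n E x = (THE y. y \<in> E \<and> (\<forall>z\<in>E. (\<Sum>i<n. (x i - y i) * z i) = 0))"

definition unit_vec :: "nat \<Rightarrow> nat \<Rightarrow> (nat \<Rightarrow> real)" where
  "unit_vec n j = (\<lambda>i\<in>{..<n}. if i = j then 1 else 0)"

definition proj_matrix :: "nat \<Rightarrow> (nat \<Rightarrow> real) set \<Rightarrow> (nat \<times> nat \<Rightarrow> real)" where
  "proj_matrix n E = (\<lambda>(i, j)\<in>{..<n} \<times> {..<n}. proj n E (unit_vec n j) i)"

text \<open>
  The Grassmannian with its Borel sets: its topology is the one for which assigning to a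
  subspace the matrix of its orthogonal projection is a homeomorphism onto the image.
\<close>

definition grassmannian :: "nat \<Rightarrow> nat \<Rightarrow> (nat \<Rightarrow> real) set measure" where
  "grassmannian n k =
     vimage_algebra (subspaces n k) (proj_matrix n) (Pi\<^sub>M ({..<n} \<times> {..<n}) (\<lambda>_. borel))"

definition orthogonal_mat :: "nat \<Rightarrow> (nat \<Rightarrow> nat \<Rightarrow> real) \<Rightarrow> bool" where
  "orthogonal_mat n Q \<longleftrightarrow> (\<forall>i<n. \<forall>j<n. (\<Sum>l<n. Q i l * Q j l) = (if i = j then 1 else 0))"

definition mat_apply :: "nat \<Rightarrow> (nat \<Rightarrow> nat \<Rightarrow> real) \<Rightarrow> (nat \<Rightarrow> real) \<Rightarrow> (nat \<Rightarrow> real)" where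
  "mat_apply n Q x = (\<lambda>i\<in>{..<n}. \<Sum>j<n. Q i j * x j)"

text \<open>
  The uniform (Haar) distribution is the Borel probability measure on the Grassmannian that is
  invariant under the action of the orthogonal group; it is unique.
\<close>

definition haar_grassmannian :: "nat \<Rightarrow> nat \<Rightarrow> (nat \<Rightarrow> real) set measure \<Rightarrow> bool" where
  "haar_grassmannian n k \<mu> \<longleftrightarrow>
     prob_space \<mu> \<and> sets \<mu> = sets (grassmannian n k) \<and>
     (\<forall>Q. orthogonal_mat n Q \<longrightarrow> distr \<mu> (grassmannian n k) (\<lambda>E. mat_apply n Q ` E) = \<mu>)"


section \<open>Moderate deviations\<close>

text \<open>The logarithm with \<open>log 0 = -\<infinity>\<close>, in contrast to \<^term>\<open>ln 0 = (0::real)\<close>.\<close>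

definition elog :: "real \<Rightarrow> ereal" where
  "elog x = (if x \<le> 0 then -\<infinity> else ereal (ln x))"

text \<open>
  Only the law of each single random vector matters, so each one may live on a
  probability space of its own.
\<close>

definition satisfies_MDP ::
  "(nat \<Rightarrow> 'w measure) \<Rightarrow> (nat \<Rightarrow> 'w \<Rightarrow> 'a::euclidean_space) \<Rightarrow> (nat \<Rightarrow> real) \<Rightarrow> ('a \<Rightarrow> ereal) \<Rightarrow> bool"
where
  "satisfies_MDP M X s I \<longleftrightarrow>
     (\<forall>x. 0 \<le> I x) \<and>
     (\<forall>x. I x \<le> Liminf (at x) I) \<and>
     (\<forall>\<alpha>::real. compact {x. I x \<le> ereal \<alpha>}) \<and>
     (\<forall>A\<in>sets borel.
        - (INF x\<in>interior A. I x)
          \<le> liminf (\<lambda>n. ereal (1 / s n) * elog (measure (M n) {\<omega> \<in> space (M n). X n \<omega> \<in> A})) \<and>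
        limsup (\<lambda>n. ereal (1 / s n) * elog (measure (M n) {\<omega> \<in> space (M n). X n \<omega> \<in> A}))
          \<le> - (INF x\<in>closure A. I x))"

text \<open>
  For \<open>p \<ge> 2\<close> and \<open>0 \<le> \<lambda> \<le> 1\<close> the denominator is positive except for \<open>p = 2\<close>, \<open>\<lambda> = 1\<close>, where it vanishes. There the
  quotient in \<^typ>\<open>ereal\<close> is \<open>\<infinity>\<close>, and \<open>x \<mapsto> \<alpha> * x\<^sup>2\<close> is \<open>0\<close> at the origin and \<open>\<infinity>\<close>
  elsewhere.
\<close>

definition mdp_const :: "real \<Rightarrow> real \<Rightarrow> ereal" where
  "mdp_const p lam =
     ereal (2 * Gamma (1 / p) * (Gamma (3 / p))\<^sup>2) /
     ereal ((2 * p - lam * (4 + 3 * p)) * Gamma (1 + 1 / p) * (Gamma (3 / p))\<^sup>2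
            + lam * (Gamma (1 / p))\<^sup>2 * Gamma (5 / p))"


section \<open>Well-definedness of the measures\<close>

lemma space_Rn: "space (Rn n) = {..<n} \<rightarrow>\<^sub>E UNIV"
  by (simp add: Rn_def space_PiM)

lemma sets_lebesgue_Rn: "sets (lebesgue_Rn n) = sets (Rn n)"
  unfolding lebesgue_Rn_def Rn_def by (intro sets_PiM_cong) auto

lemma sets_uniform_ball: "sets (uniform_ball n p) = sets (Rn n)"
  by (simp add: uniform_ball_def sets_lebesgue_Rn)

lemma space_uniform_ball: "space (uniform_ball n p) = space (Rn n)"
  by (rule sets_eq_imp_space_eq[OF sets_uniform_ball])

lemma measurable_component_Rn: "i < n \<Longrightarrow> (\<lambda>x. x i) \<in> borel_measurable (Rn n)"
  unfolding Rn_def by measurable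

lemma measurable_pnorm [measurable]: "pnorm n p \<in> borel_measurable (Rn n)"
proof -
  have [measurable]: "(\<lambda>x. x i) \<in> borel_measurable (Rn n)" if "i \<in> {..<n}" for i
    using that measurable_component_Rn by simp
  show ?thesis
    unfolding pnorm_def by measurable
qed

lemma pnorm_scale:
  assumes "p > 0" "r \<ge> 0"
  shows "pnorm n p (scale_Rn n r x) = r * pnorm n p x"
proof -
  have "(\<Sum>i<n. \<bar>scale_Rn n r x i\<bar> powr p) = r powr p * (\<Sum>i<n. \<bar>x i\<bar> powr p)"
    using assms by (simp add: scale_Rn_def abs_mult powr_mult sum_distrib_left)
  then show ?thesis
    using assms by (simp add: pnorm_def powr_mult powr_powr sum_nonneg)
qed

lemma pnorm_eq_0_iff:
  assumes "p > 0" "x \<in> space (Rn n)"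
  shows "pnorm n p x = 0 \<longleftrightarrow> x = (\<lambda>i\<in>{..<n}. 0)"
proof
  assume "pnorm n p x = 0"
  then have "\<forall>i\<in>{..<n}. \<bar>x i\<bar> powr p = 0"
    by (subst sum_nonneg_eq_0_iff[symmetric]) (auto simp: pnorm_def)
  then show "x = (\<lambda>i\<in>{..<n}. 0)"
    using assms by (auto simp: space_Rn fun_eq_iff PiE_def extensional_def)
qed (simp add: pnorm_def)

lemma null_sets_origin:
  assumes "n \<ge> 1"
  shows "{\<lambda>i\<in>{..<n}. 0} \<in> null_sets (uniform_ball n p)"
proof -
  interpret finite_product_sigma_finite "\<lambda>_. lborel :: real measure" "{..<n}"
    by standard auto
  have eq: "{\<lambda>i\<in>{..<n}. 0} = (\<Pi>\<^sub>E i\<in>{..<n}. {0::real})"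
    using PiE_singleton[of "\<lambda>i\<in>{..<n}. 0::real" "{..<n}"] by (auto cong: PiE_cong)
  have 1: "emeasure (lebesgue_Rn n) {\<lambda>i\<in>{..<n}. 0} = 0"
    unfolding eq lebesgue_Rn_def using assms by (subst measure_times) auto
  have 2: "{\<lambda>i\<in>{..<n}. 0::real} \<in> sets (lebesgue_Rn n)"
    unfolding eq lebesgue_Rn_def by (intro sets_PiM_I_finite) auto
  have 3: "(\<lambda>x. indicator (p_ball n p) x / emeasure (lebesgue_Rn n) (p_ball n p) :: ennreal)
             \<in> borel_measurable (lebesgue_Rn n)"
  proof -
    have "p_ball n p \<in> sets (Rn n)"
      unfolding p_ball_def by measurable
    then have [measurable]: "p_ball n p \<in> sets (lebesgue_Rn n)"
      by (simp add: sets_lebesgue_Rn)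
    show ?thesis by measurable
  qed
  show ?thesis
    using absolutely_continuousI_density[OF 3] 1 2
    unfolding uniform_ball_def uniform_measure_def absolutely_continuous_def by blast
qed

text \<open>The cone over a set without the origin, as the preimage of the set under radial projection.\<close>

lemma cone_over_minus_origin:
  assumes "p > 0" "A \<subseteq> space (Rn n)"
  shows "cone_over n p A - {\<lambda>i\<in>{..<n}. 0} =
    {y \<in> space (Rn n). 0 < pnorm n p y \<and> pnorm n p y \<le> 1 \<and> scale_Rn n (inverse (pnorm n p y)) y \<in> A}"
  (is "?L = ?R")
proof (intro equalityI subsetI)
  fix y assume y: "y \<in> ?L"
  then obtain r x where rx: "y = scale_Rn n r x" "x \<in> A" "x \<in> p_sphere n p" "0 \<le> r" "r \<le> 1"
    by (auto simp: cone_over_def)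
  then have r: "pnorm n p y = r"
    using assms pnorm_scale[of p r n x] by (simp add: p_sphere_def)
  have ysp: "y \<in> space (Rn n)"
    using rx by (auto simp: space_Rn scale_Rn_def)
  have "r \<noteq> 0"
    using y r pnorm_eq_0_iff[OF assms(1) ysp] by auto
  moreover from this have "scale_Rn n (inverse r) y = x"
    using rx assms by (auto simp: scale_Rn_def fun_eq_iff p_sphere_def space_Rn PiE_def extensional_def)
  ultimately show "y \<in> ?R"
    using rx r ysp by auto
next
  fix y assume y: "y \<in> ?R"
  let ?r = "pnorm n p y" and ?x = "scale_Rn n (inverse (pnorm n p y)) y"
  have "y = scale_Rn n ?r ?x"
    using y by (auto simp: scale_Rn_def fun_eq_iff space_Rn PiE_def extensional_def)
  moreover have "?x \<in> A \<inter> p_sphere n p"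
    using y assms pnorm_scale[of p "inverse ?r" n y] by (auto simp: p_sphere_def)
  ultimately have "y \<in> cone_over n p A"
    using y unfolding cone_over_def by (intro CollectI exI[of _ ?r] exI[of _ ?x]) auto
  moreover have "y \<noteq> (\<lambda>i\<in>{..<n}. 0)"
    using y pnorm_eq_0_iff[of p y n] assms by auto
  ultimately show "y \<in> ?L" by auto
qed

lemma emeasure_cone_measure:
  assumes "n \<ge> 1" "p > 0" "A \<in> sets (Rn n)"
  shows "emeasure (cone_measure n p) A = emeasure (uniform_ball n p) (cone_over n p A)"
proof -
  define U where "U = uniform_ball n p"
  define Z where "Z = {\<lambda>i\<in>{..<n}. 0::real}"
  define S where "S = {y \<in> space (Rn n). 0 < pnorm n p y \<and> pnorm n p y \<le> 1}"
  define g where "g y = scale_Rn n (inverse (pnorm n p y)) y" for y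
  have [measurable_cong]: "sets U = sets (Rn n)"
    by (simp add: U_def sets_uniform_ball)
  have spU: "space U = space (Rn n)"
    by (simp add: U_def space_uniform_ball)
  have Z: "Z \<in> null_sets U"
    unfolding Z_def U_def using assms by (intro null_sets_origin)
  have S [measurable]: "S \<in> sets U"
    unfolding S_def by measurable
  have g [measurable]: "g \<in> U \<rightarrow>\<^sub>M Rn n"
  proof -
    have [measurable]: "(\<lambda>x. x i) \<in> borel_measurable (Rn n)" if "i \<in> {..<n}" for i
      using that measurable_component_Rn by simp
    have "g \<in> Rn n \<rightarrow>\<^sub>M Pi\<^sub>M {..<n} (\<lambda>_. borel)"
      unfolding g_def scale_Rn_def by (intro measurable_restrict) measurable
    then show ?thesis
      by (simp add: Rn_def[symmetric] measurable_cong_sets[OF \<open>sets U = sets (Rn n)\<close> refl])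
  qed
  define \<nu> where "\<nu> = distr (density U (indicator S)) (Rn n) g"
  have \<nu>: "emeasure \<nu> B = emeasure U (cone_over n p B)" if B [measurable]: "B \<in> sets (Rn n)" for B
  proof -
    have eq: "cone_over n p B - Z = S \<inter> (g -` B \<inter> space U)"
      using cone_over_minus_origin[OF assms(2) sets.sets_into_space[OF B]]
      unfolding S_def g_def Z_def spU by auto
    have gB: "g -` B \<inter> space U \<in> sets U"
      by measurable
    have "cone_over n p B \<inter> Z \<in> {{}, Z}"
      by (auto simp: Z_def)
    then have "cone_over n p B \<inter> Z \<in> null_sets U"
      using Z by auto
    then have "emeasure U ((cone_over n p B - Z) \<union> (cone_over n p B \<inter> Z)) = emeasure U (cone_over n p B - Z)"
      by (intro emeasure_Un_null_set) (use eq gB S in auto)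
    moreover have "(cone_over n p B - Z) \<union> (cone_over n p B \<inter> Z) = cone_over n p B"
      by blast
    ultimately have "emeasure U (cone_over n p B) = emeasure U (S \<inter> (g -` B \<inter> space U))"
      by (simp only: eq)
    also have "\<dots> = (\<integral>\<^sup>+ y. indicator S y * indicator (g -` B \<inter> space U) y \<partial>U)"
      using gB S by (simp add: indicator_inter_arith[symmetric])
    also have "\<dots> = emeasure (density U (indicator S)) (g -` B \<inter> space U)"
      using gB S by (subst emeasure_density) auto
    also have "\<dots> = emeasure \<nu> B"
      unfolding \<nu>_def by (subst emeasure_distr) (use B g in auto)
    finally show ?thesis ..
  qed
  have sp: "space \<nu> = space (Rn n)" "sets \<nu> = sets (Rn n)"
    by (simp_all add: \<nu>_def)
  have "cone_measure n p = measure_of (space \<nu>) (sets \<nu>) (emeasure \<nu>)"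
    unfolding cone_measure_def sp U_def[symmetric]
    by (rule measure_of_eq) (simp_all add: \<nu> sets.space_closed sets.sigma_sets_eq)
  then show ?thesis
    using \<nu>[OF assms(3)] by (simp add: measure_of_of_measure U_def)
qed

lemma sets_P_dist: "sets (P_dist W n p) = sets (Rn n)"
  by (simp add: P_dist_def sets.space_closed sets.sigma_sets_eq)

lemma emeasure_P_dist:
  assumes "A \<in> sets (Rn n)"
  shows "emeasure (P_dist W n p) A =
    emeasure W {0} * emeasure (cone_measure n p) A +
    emeasure (density (uniform_ball n p) (\<lambda>x. h_density W n p (pnorm n p x))) A"
proof (rule emeasure_measure_of[OF P_dist_def])
  let ?C = "cone_measure n p"
  let ?D = "density (uniform_ball n p) (\<lambda>x. h_density W n p (pnorm n p x))"
  have sC: "sets ?C = sets (Rn n)"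
    by (simp add: cone_measure_def sets.space_closed sets.sigma_sets_eq)
  have sD: "sets ?D = sets (Rn n)"
    by (simp add: sets_uniform_ball)
  show "countably_additive (sets (P_dist W n p)) (\<lambda>A. emeasure W {0} * emeasure ?C A + emeasure ?D A)"
    unfolding countably_additive_def sets_P_dist
  proof (intro allI impI)
    fix F :: "nat \<Rightarrow> (nat \<Rightarrow> real) set"
    assume F: "range F \<subseteq> sets (Rn n)" "disjoint_family F"
    have "(\<Sum>i. emeasure W {0} * emeasure ?C (F i) + emeasure ?D (F i)) =
          emeasure W {0} * (\<Sum>i. emeasure ?C (F i)) + (\<Sum>i. emeasure ?D (F i))"
      by (simp add: suminf_add[symmetric])
    also have "\<dots> = emeasure W {0} * emeasure ?C (\<Union>(range F)) + emeasure ?D (\<Union>(range F))"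
      using F sC sD by (simp add: suminf_emeasure)
    finally show "(\<Sum>i. emeasure W {0} * emeasure ?C (F i) + emeasure ?D (F i)) =
          emeasure W {0} * emeasure ?C (\<Union>(range F)) + emeasure ?D (\<Union>(range F))" .
  qed
qed (use assms in \<open>auto simp: positive_def sets_P_dist sets.space_closed dest: sets.sets_into_space\<close>)

end

theory Submission
  imports Defs
begin

text \<open>
  Why the theorem holds. Write \<open>X = \<rho> \<Theta>\<close> with \<open>\<rho>\<close> the \<open>p\<close>-norm of \<open>X\<close>, and let \<open>R\<close> be the squared
  Euclidean length of the projection of \<open>X / \<parallel>X\<parallel>\<^sub>2\<close> to \<open>E\<close>. Then
  \<open>\<parallel>P\<^sub>E X\<parallel>\<^sub>2 = \<rho> \<parallel>\<Theta>\<parallel>\<^sub>2 sqrt R\<close> (\<open>radial_factor\<close>), and the three factors are treated separately.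

  The radius \<open>\<rho>\<close> is invisible at speed \<open>t\<^sup>2\<close>. Conditionally on a value \<open>s\<close> of the mixing measure,
  \<open>\<rho>\<^sup>p\<close> has the law of \<open>G / (G + s)\<close> with a Gamma variable \<open>G\<close> of mean \<open>n\<close>. So
  \<open>1 - \<rho>\<^sup>p\<close> exceeds \<open>\<delta> t / sqrt n\<close> only if \<open>s\<close> exceeds \<open>\<delta> t sqrt n / 2\<close>, which is excluded by the
  hypothesis on \<open>W\<close>, or if \<open>G \<le> n / 2\<close>, which has probability exponentially small in \<open>n\<close>
  (\<open>P_dist_radial_tail\<close>).

  The direction \<open>\<Theta>\<close> has the cone measure as its law for every mixing measure (\<open>P_dist_normalize\<close>),
  and so has \<open>Y / \<parallel>Y\<parallel>\<^sub>p\<close> for a vector \<open>Y\<close> with independent coordinates of density proportional to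
  \<open>exp (- \<bar>x\<bar>\<^sup>p / p)\<close> (\<open>gauss_p_vec_normalize\<close>). Both follow from the polar decomposition of Lebesgue
  measure (\<open>polar_nn_integral\<close>), itself a consequence of scaling.

  The ratio \<open>R\<close> is independent of \<open>X\<close>: by invariance of the Haar distribution under reflections the law
  of \<open>R\<close> given \<open>X\<close> is the same for all values of \<open>X\<close>. It is the law of \<open>A / (A + B)\<close> for independent
  chi-square variables with \<open>k\<close> and \<open>n - k\<close> degrees of freedom (\<open>haar_qform_law\<close>). This is proved by
  moments. The function sending \<open>x\<close> to the mean of \<open>\<parallel>P\<^sub>E x\<parallel>\<^sup>2\<^sup>j\<close> is a multiple of \<open>\<parallel>x\<parallel>\<^sup>2\<^sup>j\<close>; applying the
  Laplacian to both sides relates the multiples for \<open>j\<close> and \<open>j + 1\<close> (\<open>haar_moment_Suc\<close>), and the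
  moments of the Beta law satisfy the same recursion.

  Hence the statistic without \<open>\<rho>\<close> has the law of a smooth function of four averages of independent
  variables (\<open>direction_law\<close>, \<open>reference_statistic_eq\<close>). Each average deviates from its mean by at most
  a multiple of \<open>t / sqrt k\<close> up to events that are negligible at speed \<open>t\<^sup>2\<close>, so the quadratic error of
  the linearization is negligible (\<open>reference_equivalent\<close>). The linear part is a weighted sum of
  independent centred variables with exponential moments, because \<open>p \<ge> 2\<close>. In the exponent of the
  moment generating function at speed \<open>t\<^sup>2\<close> the weights are at most of order \<open>t / sqrt k\<close>, hence tend
  to \<open>0\<close>, and only the variances matter. So the scaled cumulant generating function converges to a quadratic
  \<open>v \<theta>\<^sup>2 / 2\<close> (\<open>linear_part_cumulant\<close>), with
  \<open>v = (1 - \<lambda>) / 2 + \<lambda> Var (Y\<^sub>1\<^sup>2 / (2 E Y\<^sub>1\<^sup>2) - \<bar>Y\<^sub>1\<bar>\<^sup>p / p)\<close>. Exponential tilting turns this into the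
  deviation bounds of the rate function \<open>x\<^sup>2 / (2 v)\<close> (\<open>quadratic_cumulant_imp_gauss_mdp\<close>), and
  \<open>1 / (2 v)\<close> is the constant of the theorem (\<open>mdp_const_limit\<close>).
\<close>


section \<open>Orthogonal projections in coordinates\<close>

definition dotp :: "nat \<Rightarrow> (nat \<Rightarrow> real) \<Rightarrow> (nat \<Rightarrow> real) \<Rightarrow> real" where
  "dotp n x y = (\<Sum>i<n. x i * y i)"

lemma dotp_lin_comb: "dotp n (lin_comb n k b c) y = (\<Sum>j<k. c j * dotp n (b j) y)"
proof -
  have "dotp n (lin_comb n k b c) y = (\<Sum>i<n. \<Sum>j<k. c j * b j i * y i)"
    by (simp add: dotp_def lin_comb_def sum_distrib_right)
  also have "\<dots> = (\<Sum>j<k. \<Sum>i<n. c j * b j i * y i)"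
    by (rule sum.swap)
  finally show ?thesis
    by (simp add: dotp_def sum_distrib_left mult.assoc)
qed

lemma dotp_commute: "dotp n x y = dotp n y x"
  by (simp add: dotp_def mult.commute)

lemma dotp_cong: "(\<And>i. i < n \<Longrightarrow> x i = x' i) \<Longrightarrow> (\<And>i. i < n \<Longrightarrow> y i = y' i) \<Longrightarrow> dotp n x y = dotp n x' y'"
  by (simp add: dotp_def)

lemma dotp_add_left: "dotp n (\<lambda>i. x i + y i) z = dotp n x z + dotp n y z"
  and dotp_diff_left: "dotp n (\<lambda>i. x i - y i) z = dotp n x z - dotp n y z"
  and dotp_scale_left: "dotp n (\<lambda>i. r * x i) z = r * dotp n x z"
  by (simp_all add: dotp_def algebra_simps sum.distrib sum_subtractf sum_distrib_left)

lemma dotp_self_nonneg: "0 \<le> dotp n x x"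
  by (simp add: dotp_def sum_nonneg)

lemma dotp_self_eq_0: "dotp n x x = 0 \<longleftrightarrow> (\<forall>i<n. x i = 0)"
  by (auto simp: dotp_def sum_nonneg_eq_0_iff)

definition orthonormal :: "nat \<Rightarrow> nat \<Rightarrow> (nat \<Rightarrow> nat \<Rightarrow> real) \<Rightarrow> bool" where
  "orthonormal n k u \<longleftrightarrow>
     (\<forall>i<k. u i \<in> space (Rn n)) \<and> (\<forall>i<k. \<forall>j<k. dotp n (u i) (u j) = (if i = j then 1 else 0))"

lemma dotp_orthonormal_comb:
  assumes "orthonormal n k u" "j < k"
  shows "dotp n (lin_comb n k u c) (u j) = c j"
proof -
  have "dotp n (lin_comb n k u c) (u j) = (\<Sum>i<k. c i * (if i = j then 1 else 0))"
    unfolding dotp_lin_comb using assms by (intro sum.cong) (auto simp: orthonormal_def)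
  also have "\<dots> = c j"
    using assms by (simp add: if_distrib cong: if_cong)
  finally show ?thesis .
qed

lemma orthonormal_lin_indep:
  assumes u: "orthonormal n k u"
  shows "lin_indep n k u"
  unfolding lin_indep_def
proof (intro allI impI)
  fix c j assume c: "lin_comb n k u c = (\<lambda>i\<in>{..<n}. 0)" and j: "j < k"
  have "c j = dotp n (\<lambda>i\<in>{..<n}. 0) (u j)"
    using dotp_orthonormal_comb[OF u j, of c] c by simp
  then show "c j = 0" by (simp add: dotp_def)
qed

lemma lin_comb_Suc: "lin_comb n (Suc k) b c = (\<lambda>i\<in>{..<n}. lin_comb n k b c i + c k * b k i)"
  by (auto simp: lin_comb_def fun_eq_iff)

lemma lin_comb_upd: "lin_comb n k b (c(k := r)) = lin_comb n k b c"
  by (simp add: lin_comb_def)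

lemma lin_comb_upd_vec: "lin_comb n k (b(k := r)) c = lin_comb n k b c"
  by (simp add: lin_comb_def)

lemma lin_comb_cong:
  assumes "\<And>j i. j < k \<Longrightarrow> i < n \<Longrightarrow> c j * b j i = c' j * b' j i"
  shows "lin_comb n k b c = lin_comb n k b' c'"
  using assms by (auto simp: lin_comb_def fun_eq_iff intro!: sum.cong)

lemma range_lin_comb_scale:
  assumes "x \<in> range (lin_comb n k b)"
  shows "(\<lambda>i\<in>{..<n}. r * x i) \<in> range (lin_comb n k b)"
proof -
  from assms obtain c where "x = lin_comb n k b c" by auto
  then have "(\<lambda>i\<in>{..<n}. r * x i) = lin_comb n k b (\<lambda>j. r * c j)"
    by (auto simp: lin_comb_def fun_eq_iff sum_distrib_left mult.assoc)
  then show ?thesis by blast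
qed

lemma range_lin_comb_add:
  assumes "x \<in> range (lin_comb n k b)" "y \<in> range (lin_comb n k b)"
  shows "(\<lambda>i\<in>{..<n}. x i + y i) \<in> range (lin_comb n k b)"
proof -
  from assms obtain c d where "x = lin_comb n k b c" "y = lin_comb n k b d" by auto
  then have "(\<lambda>i\<in>{..<n}. x i + y i) = lin_comb n k b (\<lambda>j. c j + d j)"
    by (auto simp: lin_comb_def fun_eq_iff sum.distrib distrib_right)
  then show ?thesis by blast
qed

lemma range_lin_comb_Suc:
  "range (lin_comb n (Suc k) b) =
     {\<lambda>i\<in>{..<n}. y i + r * b k i | y r. y \<in> range (lin_comb n k b)}"
proof (intro equalityI subsetI)
  fix x assume "x \<in> range (lin_comb n (Suc k) b)"
  then show "x \<in> {\<lambda>i\<in>{..<n}. y i + r * b k i | y r. y \<in> range (lin_comb n k b)}"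
    by (auto simp: lin_comb_Suc)
next
  fix x assume "x \<in> {\<lambda>i\<in>{..<n}. y i + r * b k i | y r. y \<in> range (lin_comb n k b)}"
  then obtain c r where "x = (\<lambda>i\<in>{..<n}. lin_comb n k b c i + r * b k i)" by auto
  then have "x = lin_comb n (Suc k) b (c(k := r))"
    by (simp add: lin_comb_Suc lin_comb_upd)
  then show "x \<in> range (lin_comb n (Suc k) b)" by blast
qed

lemma gram_schmidt:
  assumes "\<And>j. j < k \<Longrightarrow> b j \<in> space (Rn n)" "lin_indep n k b"
  shows "\<exists>u. orthonormal n k u \<and> range (lin_comb n k u) = range (lin_comb n k b)"
  using assms
proof (induction k)
  case 0
  then show ?case
    by (intro exI[of _ b]) (simp add: orthonormal_def)
next
  case (Suc k)
  have "lin_indep n k b"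
    unfolding lin_indep_def
  proof (intro allI impI)
    fix c j assume c: "lin_comb n k b c = (\<lambda>i\<in>{..<n}. 0)" and j: "j < k"
    have "lin_comb n (Suc k) b (c(k := 0)) = (\<lambda>i\<in>{..<n}. 0)"
      using c by (auto simp: lin_comb_Suc lin_comb_upd)
    then have "(c(k := 0)) j = 0"
      using Suc.prems(2) j less_SucI unfolding lin_indep_def by blast
    then show "c j = 0" using j by simp
  qed
  then obtain u where u: "orthonormal n k u" and ran: "range (lin_comb n k u) = range (lin_comb n k b)"
    using Suc by auto
  \<comment> \<open>\<open>q\<close> is the projection of the new vector to the span of the old ones, \<open>w\<close> the remainder.\<close>
  define q where "q = lin_comb n k u (\<lambda>j. dotp n (b k) (u j))"
  define w where "w i = b k i - q i" for i
  have wu: "dotp n w (u j) = 0" if "j < k" for j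
    unfolding w_def dotp_diff_left q_def using dotp_orthonormal_comb[OF u that] by simp
  have q: "q \<in> range (lin_comb n k b)"
    unfolding ran[symmetric] q_def by blast
  have w0: "dotp n w w \<noteq> 0"
  proof
    assume "dotp n w w = 0"
    then have eq: "b k i = q i" if "i < n" for i
      using that by (auto simp: dotp_self_eq_0 w_def)
    from q obtain c where c: "q = lin_comb n k b c" by blast
    have "lin_comb n (Suc k) b (c(k := -1)) = (\<lambda>i\<in>{..<n}. 0)"
      using eq c by (auto simp: lin_comb_Suc lin_comb_upd)
    then have "(c(k := -1)) k = 0"
      using Suc.prems(2) unfolding lin_indep_def by blast
    then show False by simp
  qed
  define r where "r = sqrt (dotp n w w)"
  have r: "r > 0" "r * r = dotp n w w"
    using w0 dotp_self_nonneg[of n w] by (auto simp: r_def)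
  define v where "v = (\<lambda>i\<in>{..<n}. inverse r * w i)"
  have vdot: "dotp n v x = inverse r * dotp n w x" for x
  proof -
    have "dotp n v x = dotp n (\<lambda>i. inverse r * w i) x"
      by (rule dotp_cong) (auto simp: v_def)
    then show ?thesis by (simp add: dotp_scale_left)
  qed
  define u' where "u' = u(k := v)"
  have "orthonormal n (Suc k) u'"
    unfolding orthonormal_def
  proof (intro conjI allI impI)
    fix i assume "i < Suc k"
    then show "u' i \<in> space (Rn n)"
      using u by (cases "i = k") (auto simp: u'_def orthonormal_def v_def space_Rn)
  next
    fix i j assume ij: "i < Suc k" "j < Suc k"
    have vv: "dotp n v v = 1"
      using vdot[of v] vdot[of w] dotp_commute[of n w v] r w0 by (simp add: field_simps)
    have vu: "dotp n v (u j) = 0" if "j < k" for j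
      using vdot wu[OF that] by simp
    have uv: "dotp n (u j) v = 0" if "j < k" for j
      using vu[OF that] dotp_commute[of n v "u j"] by simp
    show "dotp n (u' i) (u' j) = (if i = j then 1 else 0)"
      using ij u vv vu uv unfolding u'_def orthonormal_def by (cases "i = k"; cases "j = k") auto
  qed
  moreover have "range (lin_comb n (Suc k) u') = range (lin_comb n (Suc k) b)"
  proof -
    have ran': "range (lin_comb n k u') = range (lin_comb n k b)"
      unfolding ran[symmetric] u'_def by (intro arg_cong[where f=range] ext) (simp add: lin_comb_upd_vec)
    have neg: "(\<lambda>i\<in>{..<n}. y i + s * q i) \<in> range (lin_comb n k b)"
      if "y \<in> range (lin_comb n k b)" for y s
    proof -
      have "(\<lambda>i\<in>{..<n}. y i + s * q i) = (\<lambda>i\<in>{..<n}. y i + (\<lambda>i\<in>{..<n}. s * q i) i)" by auto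
      then show ?thesis
        using range_lin_comb_add[OF that range_lin_comb_scale[OF q, of s]] by simp
    qed
    show ?thesis
      unfolding range_lin_comb_Suc ran'
    proof (intro equalityI subsetI)
      fix x assume "x \<in> {\<lambda>i\<in>{..<n}. y i + r * u' k i |y r. y \<in> range (lin_comb n k b)}"
      then obtain y s where x: "x = (\<lambda>i\<in>{..<n}. y i + s * u' k i)" "y \<in> range (lin_comb n k b)" by auto
      have "x = (\<lambda>i\<in>{..<n}. (\<lambda>i\<in>{..<n}. y i + (- s * inverse r) * q i) i + (s * inverse r) * b k i)"
        unfolding x(1) by (auto simp: u'_def v_def w_def fun_eq_iff algebra_simps)
      then show "x \<in> {\<lambda>i\<in>{..<n}. y i + r * b k i |y r. y \<in> range (lin_comb n k b)}"
        using neg[OF x(2)] by blast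
    next
      fix x assume "x \<in> {\<lambda>i\<in>{..<n}. y i + r * b k i |y r. y \<in> range (lin_comb n k b)}"
      then obtain y s where x: "x = (\<lambda>i\<in>{..<n}. y i + s * b k i)" "y \<in> range (lin_comb n k b)" by auto
      have "x = (\<lambda>i\<in>{..<n}. (\<lambda>i\<in>{..<n}. y i + s * q i) i + (s * r) * u' k i)"
        unfolding x(1) using r(1) by (auto simp: u'_def v_def w_def fun_eq_iff field_simps)
      then show "x \<in> {\<lambda>i\<in>{..<n}. y i + r * u' k i |y r. y \<in> range (lin_comb n k b)}"
        using neg[OF x(2)] by blast
    qed
  qed
  ultimately show ?case by blast
qed

lemma subspace_orthonormal_basis:
  assumes "E \<in> subspaces n k"
  obtains u where "orthonormal n k u" "E = range (lin_comb n k u)"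
  using assms gram_schmidt unfolding subspaces_def by (auto) metis

text \<open>
  For a combination of an orthonormal system, orthogonality of the remainder to the span amounts to the
  coefficients being the inner products, so the definite description picks exactly one vector.
\<close>

lemma proj_orthonormal:
  assumes u: "orthonormal n k u" and E: "E = range (lin_comb n k u)"
  shows "proj n E x = lin_comb n k u (\<lambda>j. dotp n x (u j))"
proof -
  have orth: "(\<forall>z\<in>E. (\<Sum>i<n. (x i - lin_comb n k u c i) * z i) = 0) \<longleftrightarrow> (\<forall>j<k. c j = dotp n x (u j))" for c
  proof -
    define y where "y i = x i - lin_comb n k u c i" for i
    have yu: "dotp n y (u j) = dotp n x (u j) - c j" if "j < k" for j
      unfolding y_def dotp_diff_left using dotp_orthonormal_comb[OF u that] by simp
    have *: "dotp n y (lin_comb n k u d) = (\<Sum>j<k. d j * (dotp n x (u j) - c j))" for d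
    proof -
      have "dotp n y (lin_comb n k u d) = (\<Sum>j<k. d j * dotp n (u j) y)"
        by (subst dotp_commute) (rule dotp_lin_comb)
      also have "\<dots> = (\<Sum>j<k. d j * (dotp n x (u j) - c j))"
        using yu by (intro sum.cong) (auto simp: dotp_commute)
      finally show ?thesis .
    qed
    have "(\<forall>z\<in>E. dotp n y z = 0) \<longleftrightarrow> (\<forall>j<k. c j = dotp n x (u j))"
    proof
      assume "\<forall>z\<in>E. dotp n y z = 0"
      then have "(\<Sum>j<k. (dotp n x (u j) - c j) * (dotp n x (u j) - c j)) = 0"
        unfolding *[symmetric] E by blast
      then have "\<forall>j\<in>{..<k}. (dotp n x (u j) - c j) * (dotp n x (u j) - c j) = 0"
        by (subst (asm) sum_nonneg_eq_0_iff) auto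
      then show "\<forall>j<k. c j = dotp n x (u j)" by auto
    next
      assume "\<forall>j<k. c j = dotp n x (u j)"
      then show "\<forall>z\<in>E. dotp n y z = 0" by (auto simp: E *)
    qed
    then show ?thesis by (simp add: dotp_def y_def)
  qed
  show ?thesis
    unfolding proj_def
  proof (rule the_equality)
    show "lin_comb n k u (\<lambda>j. dotp n x (u j)) \<in> E \<and>
      (\<forall>z\<in>E. (\<Sum>i<n. (x i - lin_comb n k u (\<lambda>j. dotp n x (u j)) i) * z i) = 0)"
      using orth by (auto simp: E)
  next
    fix y assume y: "y \<in> E \<and> (\<forall>z\<in>E. (\<Sum>i<n. (x i - y i) * z i) = 0)"
    then obtain c where c: "y = lin_comb n k u c" by (auto simp: E)
    with y have "\<forall>j<k. c j = dotp n x (u j)" using orth by blast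
    then show "y = lin_comb n k u (\<lambda>j. dotp n x (u j))"
      unfolding c by (intro lin_comb_cong) auto
  qed
qed

text \<open>
  The squared length of the projection of \<open>x\<close>, written as a polynomial in the entries of the projection
  matrix because these generate the Borel sets of the Grassmannian (\<open>pnorm_proj_eq_qform\<close>).
\<close>

definition qform :: "nat \<Rightarrow> (nat \<Rightarrow> real) set \<Rightarrow> (nat \<Rightarrow> real) \<Rightarrow> real" where
  "qform n E x = (\<Sum>i<n. \<Sum>l<n. x i * proj_matrix n E (i, l) * x l)"

lemma proj_matrix_orthonormal:
  assumes u: "orthonormal n k u" and E: "E = range (lin_comb n k u)" and "i < n" "l < n"
  shows "proj_matrix n E (i, l) = (\<Sum>j<k. u j i * u j l)"
proof -
  have "dotp n (unit_vec n l) (u j) = u j l" for j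
  proof -
    have "dotp n (unit_vec n l) (u j) = (\<Sum>i<n. if i = l then u j i else 0)"
      unfolding dotp_def unit_vec_def by (intro sum.cong) auto
    then show ?thesis using \<open>l < n\<close> by simp
  qed
  then show ?thesis
    using assms(3,4) by (simp add: proj_matrix_def proj_orthonormal[OF u E] lin_comb_def mult.commute)
qed

lemma qform_orthonormal:
  assumes u: "orthonormal n k u" and E: "E = range (lin_comb n k u)"
  shows "qform n E x = (\<Sum>j<k. (dotp n x (u j))\<^sup>2)"
proof -
  have "qform n E x = (\<Sum>i<n. \<Sum>l<n. \<Sum>j<k. (x i * u j i) * (x l * u j l))"
    unfolding qform_def
    by (intro sum.cong refl) (simp add: proj_matrix_orthonormal[OF u E] sum_distrib_left sum_distrib_right mult_ac)
  also have "\<dots> = (\<Sum>i<n. \<Sum>j<k. \<Sum>l<n. (x i * u j i) * (x l * u j l))"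
    by (intro sum.cong refl sum.swap)
  also have "\<dots> = (\<Sum>j<k. \<Sum>i<n. \<Sum>l<n. (x i * u j i) * (x l * u j l))"
    by (rule sum.swap)
  also have "\<dots> = (\<Sum>j<k. (dotp n x (u j))\<^sup>2)"
    by (simp add: dotp_def power2_eq_square sum_product)
  finally show ?thesis .
qed

lemma dotp_self_lin_comb:
  assumes u: "orthonormal n k u"
  shows "dotp n (lin_comb n k u c) (lin_comb n k u c) = (\<Sum>j<k. (c j)\<^sup>2)"
proof -
  have "dotp n (lin_comb n k u c) (lin_comb n k u c) = (\<Sum>j<k. c j * dotp n (u j) (lin_comb n k u c))"
    by (rule dotp_lin_comb)
  also have "\<dots> = (\<Sum>j<k. c j * c j)"
    by (intro sum.cong refl) (simp add: dotp_commute[of n "u _"] dotp_orthonormal_comb[OF u])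
  finally show ?thesis by (simp add: power2_eq_square)
qed

lemma pnorm_2_eq: "pnorm n 2 x = sqrt (dotp n x x)"
proof -
  have "(\<Sum>i<n. \<bar>x i\<bar> powr 2) = dotp n x x"
    unfolding dotp_def by (intro sum.cong) (auto simp: power2_eq_square)
  then show ?thesis by (simp add: pnorm_def powr_half_sqrt dotp_self_nonneg)
qed

lemma pnorm_proj_eq_qform:
  assumes "E \<in> subspaces n k"
  shows "pnorm n 2 (proj n E x) = sqrt (qform n E x)"
proof -
  obtain u where u: "orthonormal n k u" "E = range (lin_comb n k u)"
    using subspace_orthonormal_basis[OF assms] .
  show ?thesis
    unfolding pnorm_2_eq proj_orthonormal[OF u] qform_orthonormal[OF u] dotp_self_lin_comb[OF u(1)] ..
qed

text \<open>
  Bessel's inequality: the difference of the two sides is the squared length of the remainder.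
\<close>

lemma qform_bounds:
  assumes "E \<in> subspaces n k"
  shows "0 \<le> qform n E x" "qform n E x \<le> dotp n x x"
proof -
  obtain u where u: "orthonormal n k u" "E = range (lin_comb n k u)"
    using subspace_orthonormal_basis[OF assms] .
  show "0 \<le> qform n E x"
    unfolding qform_orthonormal[OF u] by (simp add: sum_nonneg)
  define y where "y = lin_comb n k u (\<lambda>j. dotp n x (u j))"
  have yx: "dotp n y x = qform n E x"
    unfolding y_def dotp_lin_comb qform_orthonormal[OF u]
    by (simp add: power2_eq_square dotp_commute)
  have yy: "dotp n y y = qform n E x"
    unfolding y_def dotp_self_lin_comb[OF u(1)] qform_orthonormal[OF u] ..
  have "0 \<le> dotp n (\<lambda>i. x i - y i) (\<lambda>i. x i - y i)" by (rule dotp_self_nonneg)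
  also have "\<dots> = dotp n x x - 2 * dotp n y x + dotp n y y"
    unfolding dotp_diff_left
    by (subst (1 2) dotp_commute, unfold dotp_diff_left) (simp add: dotp_commute)
  finally show "qform n E x \<le> dotp n x x" using yx yy by simp
qed

lemma proj_matrix_symmetric:
  assumes "E \<in> subspaces n k" "i < n" "l < n"
  shows "proj_matrix n E (i, l) = proj_matrix n E (l, i)"
proof -
  obtain u where u: "orthonormal n k u" "E = range (lin_comb n k u)"
    using subspace_orthonormal_basis[OF assms(1)] .
  show ?thesis using assms by (simp add: proj_matrix_orthonormal[OF u] mult.commute)
qed

lemma proj_matrix_trace:
  assumes "E \<in> subspaces n k"
  shows "(\<Sum>i<n. proj_matrix n E (i, i)) = real k"
proof -
  obtain u where u: "orthonormal n k u" "E = range (lin_comb n k u)"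
    using subspace_orthonormal_basis[OF assms] .
  have "(\<Sum>i<n. proj_matrix n E (i, i)) = (\<Sum>i<n. \<Sum>j<k. u j i * u j i)"
    by (intro sum.cong refl) (simp add: proj_matrix_orthonormal[OF u])
  also have "\<dots> = (\<Sum>j<k. dotp n (u j) (u j))"
    unfolding dotp_def by (rule sum.swap)
  also have "\<dots> = real k"
    using u(1) by (simp add: orthonormal_def)
  finally show ?thesis .
qed

lemma proj_matrix_apply_norm:
  assumes "E \<in> subspaces n k"
  shows "(\<Sum>i<n. (\<Sum>l<n. proj_matrix n E (i, l) * x l)\<^sup>2) = qform n E x"
proof -
  obtain u where u: "orthonormal n k u" "E = range (lin_comb n k u)"
    using subspace_orthonormal_basis[OF assms] .
  have "(\<Sum>l<n. proj_matrix n E (i, l) * x l) = lin_comb n k u (\<lambda>j. dotp n x (u j)) i" if "i < n" for i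
  proof -
    have "(\<Sum>l<n. proj_matrix n E (i, l) * x l) = (\<Sum>l<n. \<Sum>j<k. u j i * (u j l * x l))"
      using that by (intro sum.cong refl) (simp add: proj_matrix_orthonormal[OF u] sum_distrib_right mult.assoc)
    also have "\<dots> = (\<Sum>j<k. \<Sum>l<n. u j i * (u j l * x l))"
      by (rule sum.swap)
    finally show ?thesis
      using that by (simp add: lin_comb_def dotp_def sum_distrib_left sum_distrib_right mult_ac)
  qed
  then have "(\<Sum>i<n. (\<Sum>l<n. proj_matrix n E (i, l) * x l)\<^sup>2) =
    dotp n (lin_comb n k u (\<lambda>j. dotp n x (u j))) (lin_comb n k u (\<lambda>j. dotp n x (u j)))"
    unfolding dotp_def by (intro sum.cong) (auto simp: power2_eq_square)
  then show ?thesis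
    unfolding dotp_self_lin_comb[OF u(1)] qform_orthonormal[OF u] .
qed

text \<open>
  The restriction of the quadratic form to a line parallel to a coordinate axis. Its second order
  coefficients are what the Laplacian is computed from in \<open>haar_moment_Suc\<close>.
\<close>

lemma qform_shift:
  assumes E: "E \<in> subspaces n k" and i: "i < n"
  shows "qform n E (\<lambda>j. x j + s * (if j = i then 1 else 0)) =
    qform n E x + 2 * s * (\<Sum>l<n. proj_matrix n E (i, l) * x l) + s\<^sup>2 * proj_matrix n E (i, i)"
proof -
  let ?P = "\<lambda>a b. proj_matrix n E (a, b)" and ?e = "\<lambda>j. (if j = i then 1 else 0::real)"
  have *: "(\<Sum>a<n. ?e a * f a) = f i" for f
  proof -
    have "(\<Sum>a<n. ?e a * f a) = (\<Sum>a<n. if a = i then f a else 0)"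
      by (intro sum.cong) auto
    then show ?thesis using i by simp
  qed
  have "qform n E (\<lambda>j. x j + s * ?e j) =
    (\<Sum>a<n. \<Sum>b<n. x a * ?P a b * x b + s * (?e b * (x a * ?P a b)) + s * (?e a * (?P a b * x b))
       + s\<^sup>2 * (?e a * (?e b * ?P a b)))"
    unfolding qform_def by (intro sum.cong refl) (simp add: algebra_simps power2_eq_square)
  also have "\<dots> = qform n E x + s * (\<Sum>a<n. x a * ?P a i) + s * (\<Sum>b<n. ?P i b * x b) + s\<^sup>2 * ?P i i"
    unfolding sum.distrib qform_def sum_distrib_left[symmetric] * ..
  also have "(\<Sum>a<n. x a * ?P a i) = (\<Sum>b<n. ?P i b * x b)"
    using proj_matrix_symmetric[OF E] i by (intro sum.cong) (auto simp: mult.commute)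
  finally show ?thesis by simp
qed

lemma qform_scale: "qform n E (\<lambda>i. r * x i) = r\<^sup>2 * qform n E x"
  by (simp add: qform_def sum_distrib_left power2_eq_square mult_ac)

lemma qform_cong: "(\<And>i. i < n \<Longrightarrow> x i = y i) \<Longrightarrow> qform n E x = qform n E y"
  by (simp add: qform_def)


section \<open>Invariance of the Haar distribution under reflections\<close>

definition symmetric_mat :: "nat \<Rightarrow> (nat \<Rightarrow> nat \<Rightarrow> real) \<Rightarrow> bool" where
  "symmetric_mat n H \<longleftrightarrow> (\<forall>i<n. \<forall>l<n. H i l = H l i)"

lemma mat_apply_adjoint:
  assumes "symmetric_mat n H"
  shows "dotp n (mat_apply n H x) y = dotp n x (mat_apply n H y)"
proof -
  have "dotp n (mat_apply n H x) y = (\<Sum>i<n. \<Sum>l<n. H i l * x l * y i)"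
    by (simp add: dotp_def mat_apply_def sum_distrib_right)
  also have "\<dots> = (\<Sum>l<n. \<Sum>i<n. H i l * x l * y i)"
    by (rule sum.swap)
  also have "\<dots> = (\<Sum>l<n. \<Sum>i<n. x l * (H l i * y i))"
    using assms by (intro sum.cong refl) (simp add: symmetric_mat_def)
  also have "\<dots> = dotp n x (mat_apply n H y)"
    by (simp add: dotp_def mat_apply_def sum_distrib_left)
  finally show ?thesis .
qed

lemma mat_apply_isometry:
  assumes H: "symmetric_mat n H" "orthogonal_mat n H"
  shows "dotp n (mat_apply n H x) (mat_apply n H y) = dotp n x y"
proof -
  have inv: "mat_apply n H (mat_apply n H y) i = y i" if "i < n" for i
  proof -
    have "mat_apply n H (mat_apply n H y) i = (\<Sum>j<n. \<Sum>l<n. H i j * H j l * y l)"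
      using that by (simp add: mat_apply_def sum_distrib_left mult.assoc)
    also have "\<dots> = (\<Sum>l<n. \<Sum>j<n. H i j * H j l * y l)"
      by (rule sum.swap)
    also have "\<dots> = (\<Sum>l<n. (\<Sum>j<n. H i j * H l j) * y l)"
      using H(1) by (simp add: symmetric_mat_def sum_distrib_right)
    also have "\<dots> = (\<Sum>l<n. if i = l then y l else 0)"
      using H(2) that by (intro sum.cong) (auto simp: orthogonal_mat_def)
    finally show ?thesis using that by simp
  qed
  have "dotp n (mat_apply n H x) (mat_apply n H y) = dotp n x (mat_apply n H (mat_apply n H y))"
    by (rule mat_apply_adjoint[OF H(1)])
  also have "\<dots> = dotp n x y"
    using inv by (intro dotp_cong) auto
  finally show ?thesis .
qed

text \<open>
  The reflection in the hyperplane orthogonal to \<open>x - y\<close> exchanges two vectors of equal length. Since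
  reflections are symmetric, the action on subspaces translates into the action on vectors without
  passing to a transposed or inverse matrix.
\<close>

lemma householder_exists:
  assumes xy: "dotp n x x = dotp n y y"
  shows "\<exists>H. symmetric_mat n H \<and> orthogonal_mat n H \<and> (\<forall>i<n. mat_apply n H x i = y i)"
proof -
  define w where "w i = x i - y i" for i
  \<comment> \<open>Division by zero makes \<open>H\<close> the identity when \<open>x\<close> and \<open>y\<close> coincide.\<close>
  define c where "c = 2 / dotp n w w"
  define H where "H i l = (if i = l then 1 else 0) - c * w i * w l" for i l
  have delta: "(\<Sum>l<n. (if i = l then 1 else 0) * f l) = f i" if "i < n" for i and f :: "nat \<Rightarrow> real"
  proof -
    have "(\<Sum>l<n. (if i = l then 1 else 0) * f l) = (\<Sum>l<n. if i = l then f l else 0)"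
      by (intro sum.cong) auto
    then show ?thesis using that by simp
  qed
  have sym: "symmetric_mat n H"
    by (auto simp: symmetric_mat_def H_def)
  have app: "mat_apply n H z i = z i - c * dotp n w z * w i" if "i < n" for z i
  proof -
    have "mat_apply n H z i = (\<Sum>l<n. (if i = l then 1 else 0) * z l) - (\<Sum>l<n. c * w i * (w l * z l))"
      using that by (simp add: mat_apply_def H_def algebra_simps sum_subtractf)
    also have "\<dots> = z i - c * dotp n w z * w i"
      unfolding delta[OF that] by (simp add: dotp_def sum_distrib_left[symmetric])
    finally show ?thesis .
  qed
  have cw: "c * (c * dotp n w w) = 2 * c"
    by (simp add: c_def)
  have orth: "orthogonal_mat n H"
    unfolding orthogonal_mat_def
  proof (intro allI impI)
    fix i j assume ij: "i < n" "j < n"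
    have "(\<Sum>l<n. H i l * H j l) = mat_apply n H (\<lambda>l. H j l) i"
      using ij by (simp add: mat_apply_def)
    also have "\<dots> = H j i - c * dotp n w (H j) * w i"
      by (rule app[OF ij(1)])
    also have "dotp n w (H j) = mat_apply n H w j"
      using ij by (simp add: dotp_def mat_apply_def mult.commute)
    also have "\<dots> = w j - c * dotp n w w * w j"
      by (rule app[OF ij(2)])
    also have "H j i - c * (w j - c * dotp n w w * w j) * w i =
        (if j = i then 1 else 0) - 2 * c * w i * w j + c * (c * dotp n w w) * w i * w j"
      by (simp add: H_def algebra_simps)
    also have "\<dots> = (if i = j then 1 else 0)"
      unfolding cw by simp
    finally show "(\<Sum>l<n. H i l * H j l) = (if i = j then 1 else 0)" .
  qed
  have "mat_apply n H x i = y i" if i: "i < n" for i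
  proof (cases "dotp n w w = 0")
    case True
    then show ?thesis using app[OF i, of x] i by (simp add: dotp_self_eq_0 w_def)
  next
    case False
    have "dotp n w w = dotp n w x - dotp n w y"
      by (subst dotp_commute) (simp add: dotp_commute dotp_diff_left w_def[abs_def])
    moreover have "dotp n w x + dotp n w y = 0"
      using xy by (simp add: w_def[abs_def] dotp_diff_left dotp_commute[of n y x])
    ultimately have "dotp n w w = 2 * dotp n w x" by simp
    then have "c * dotp n w x = 1"
      using False by (simp add: c_def)
    then show ?thesis using app[OF i, of x] by (simp add: w_def)
  qed
  then show ?thesis using sym orth by blast
qed

lemma mat_apply_lin_comb:
  "mat_apply n Q (lin_comb n k u c) = lin_comb n k (\<lambda>j. mat_apply n Q (u j)) c"
proof
  fix i
  show "mat_apply n Q (lin_comb n k u c) i = lin_comb n k (\<lambda>j. mat_apply n Q (u j)) c i"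
  proof (cases "i < n")
    case True
    then have "mat_apply n Q (lin_comb n k u c) i = (\<Sum>l<n. \<Sum>j<k. Q i l * (c j * u j l))"
      by (simp add: mat_apply_def lin_comb_def sum_distrib_left)
    also have "\<dots> = (\<Sum>j<k. \<Sum>l<n. Q i l * (c j * u j l))"
      by (rule sum.swap)
    finally show ?thesis
      using True by (simp add: mat_apply_def lin_comb_def sum_distrib_left mult_ac)
  qed (simp add: mat_apply_def lin_comb_def)
qed

lemma orthonormal_mat_apply:
  assumes "symmetric_mat n H" "orthogonal_mat n H" "orthonormal n k u"
  shows "orthonormal n k (\<lambda>j. mat_apply n H (u j))"
proof -
  have "mat_apply n H (u i) \<in> space (Rn n)" for i
    by (simp add: mat_apply_def space_Rn)
  then show ?thesis
    using assms by (simp add: orthonormal_def mat_apply_isometry)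
qed

lemma orthonormal_range_in_subspaces:
  assumes "orthonormal n k u"
  shows "range (lin_comb n k u) \<in> subspaces n k"
  using assms orthonormal_lin_indep[OF assms] by (auto simp: subspaces_def orthonormal_def)

lemma qform_image:
  assumes H: "symmetric_mat n H" "orthogonal_mat n H" and E: "E \<in> subspaces n k"
  shows "mat_apply n H ` E \<in> subspaces n k"
    and "qform n (mat_apply n H ` E) x = qform n E (mat_apply n H x)"
    and "\<lbrakk>i < n; l < n\<rbrakk> \<Longrightarrow> proj_matrix n (mat_apply n H ` E) (i, l) =
      (\<Sum>a<n. \<Sum>b<n. H i a * proj_matrix n E (a, b) * H l b)"
proof -
  obtain u where u: "orthonormal n k u" "E = range (lin_comb n k u)"
    using subspace_orthonormal_basis[OF E] .
  define u' where "u' = (\<lambda>j. mat_apply n H (u j))"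
  have u': "orthonormal n k u'"
    unfolding u'_def by (rule orthonormal_mat_apply[OF H u(1)])
  have im: "mat_apply n H ` E = range (lin_comb n k u')"
    unfolding u(2) image_image mat_apply_lin_comb u'_def ..
  show "mat_apply n H ` E \<in> subspaces n k"
    unfolding im by (rule orthonormal_range_in_subspaces[OF u'])
  show "qform n (mat_apply n H ` E) x = qform n E (mat_apply n H x)"
    unfolding qform_orthonormal[OF u' im] qform_orthonormal[OF u]
    by (simp add: u'_def mat_apply_adjoint[OF H(1)])
  assume il: "i < n" "l < n"
  have "proj_matrix n (mat_apply n H ` E) (i, l) = (\<Sum>j<k. \<Sum>a<n. \<Sum>b<n. (H i a * u j a) * (H l b * u j b))"
    unfolding proj_matrix_orthonormal[OF u' im il] using il
    by (simp add: u'_def mat_apply_def sum_product)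
  also have "\<dots> = (\<Sum>a<n. \<Sum>j<k. \<Sum>b<n. (H i a * u j a) * (H l b * u j b))"
    by (rule sum.swap)
  also have "\<dots> = (\<Sum>a<n. \<Sum>b<n. \<Sum>j<k. (H i a * u j a) * (H l b * u j b))"
    by (intro sum.cong refl sum.swap)
  also have "\<dots> = (\<Sum>a<n. \<Sum>b<n. H i a * proj_matrix n E (a, b) * H l b)"
    by (intro sum.cong refl) (simp add: proj_matrix_orthonormal[OF u] sum_distrib_left sum_distrib_right mult_ac)
  finally show "proj_matrix n (mat_apply n H ` E) (i, l) =
      (\<Sum>a<n. \<Sum>b<n. H i a * proj_matrix n E (a, b) * H l b)" .
qed

lemma space_grassmannian: "space (grassmannian n k) = subspaces n k"
  by (simp add: grassmannian_def)

lemma proj_matrix_in_space: "proj_matrix n E \<in> space (Pi\<^sub>M ({..<n} \<times> {..<n}) (\<lambda>_. borel))"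
  by (auto simp: proj_matrix_def space_PiM)

lemma measurable_proj_matrix [measurable]:
  "proj_matrix n \<in> grassmannian n k \<rightarrow>\<^sub>M Pi\<^sub>M ({..<n} \<times> {..<n}) (\<lambda>_. borel)"
  unfolding grassmannian_def by (intro measurable_vimage_algebra1) (use proj_matrix_in_space in auto)

lemma measurable_proj_matrix_entry:
  assumes "i < n" "l < n"
  shows "(\<lambda>E. proj_matrix n E (i, l)) \<in> borel_measurable (grassmannian n k)"
proof -
  have [measurable]: "(i, l) \<in> {..<n} \<times> {..<n}" using assms by auto
  show ?thesis by measurable
qed

lemma measurable_qform [measurable]: "(\<lambda>E. qform n E x) \<in> borel_measurable (grassmannian n k)"
proof -
  have [measurable]: "(\<lambda>E. proj_matrix n E (i, l)) \<in> borel_measurable (grassmannian n k)"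
    if "i \<in> {..<n}" "l \<in> {..<n}" for i l
    using that measurable_proj_matrix_entry by auto
  show ?thesis unfolding qform_def by measurable
qed

lemma measurable_qform_pair [measurable]:
  "(\<lambda>(x, E). qform n E x) \<in> borel_measurable (Rn n \<Otimes>\<^sub>M grassmannian n k)"
proof -
  have 1 [measurable]: "(\<lambda>E. proj_matrix n E (i, l)) \<in> borel_measurable (grassmannian n k)"
    if "i \<in> {..<n}" "l \<in> {..<n}" for i l
    using that measurable_proj_matrix_entry by auto
  have 2 [measurable]: "(\<lambda>x. x i) \<in> borel_measurable (Rn n)" if "i \<in> {..<n}" for i
    using that measurable_component_Rn by auto
  show ?thesis unfolding qform_def split_beta' by measurable
qed

lemma measurable_image_subspace:
  assumes H: "symmetric_mat n H" "orthogonal_mat n H"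
  shows "(\<lambda>E. mat_apply n H ` E) \<in> grassmannian n k \<rightarrow>\<^sub>M grassmannian n k"
proof -
  have "(\<lambda>E. mat_apply n H ` E) \<in> grassmannian n k \<rightarrow>\<^sub>M
      vimage_algebra (subspaces n k) (proj_matrix n) (Pi\<^sub>M ({..<n} \<times> {..<n}) (\<lambda>_. borel))"
  proof (rule measurable_vimage_algebra2)
    show "(\<lambda>E. mat_apply n H ` E) \<in> space (grassmannian n k) \<rightarrow> subspaces n k"
      using qform_image(1)[OF H] by (auto simp: space_grassmannian)
    have 1: "(\<lambda>E. \<lambda>il\<in>{..<n} \<times> {..<n}. \<Sum>a<n. \<Sum>b<n. H (fst il) a * proj_matrix n E (a, b) * H (snd il) b)
      \<in> grassmannian n k \<rightarrow>\<^sub>M Pi\<^sub>M ({..<n} \<times> {..<n}) (\<lambda>_. borel)"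
    proof (intro measurable_restrict)
      fix il
      have [measurable]: "(\<lambda>E. proj_matrix n E (i, l)) \<in> borel_measurable (grassmannian n k)"
        if "i \<in> {..<n}" "l \<in> {..<n}" for i l
        using that measurable_proj_matrix_entry by auto
      show "(\<lambda>E. \<Sum>a<n. \<Sum>b<n. H (fst il) a * proj_matrix n E (a, b) * H (snd il) b)
        \<in> borel_measurable (grassmannian n k)" by measurable
    qed
    have 2: "proj_matrix n (mat_apply n H ` E) =
      (\<lambda>il\<in>{..<n} \<times> {..<n}. \<Sum>a<n. \<Sum>b<n. H (fst il) a * proj_matrix n E (a, b) * H (snd il) b)"
      if "E \<in> space (grassmannian n k)" for E
    proof
      fix il :: "nat \<times> nat"
      show "proj_matrix n (mat_apply n H ` E) il =
        (\<lambda>il\<in>{..<n} \<times> {..<n}. \<Sum>a<n. \<Sum>b<n. H (fst il) a * proj_matrix n E (a, b) * H (snd il) b) il"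
      proof (cases "il \<in> {..<n} \<times> {..<n}")
        case True
        then obtain i l where il: "il = (i, l)" "i < n" "l < n" by auto
        then show ?thesis using qform_image(3)[OF H] that by (simp add: space_grassmannian)
      next
        case False
        then show ?thesis unfolding proj_matrix_def by (simp add: restrict_def)
      qed
    qed
    show "(\<lambda>E. proj_matrix n (mat_apply n H ` E)) \<in> grassmannian n k \<rightarrow>\<^sub>M Pi\<^sub>M ({..<n} \<times> {..<n}) (\<lambda>_. borel)"
      using 1 by (subst measurable_cong[OF 2])
  qed
  then show ?thesis by (simp add: grassmannian_def)
qed

lemma haar_space: "haar_grassmannian n k \<mu> \<Longrightarrow> space \<mu> = subspaces n k"
  using sets_eq_imp_space_eq[of \<mu> "grassmannian n k"] by (auto simp: haar_grassmannian_def space_grassmannian)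

lemma haar_measurable:
  "haar_grassmannian n k \<mu> \<Longrightarrow> f \<in> grassmannian n k \<rightarrow>\<^sub>M N \<Longrightarrow> f \<in> \<mu> \<rightarrow>\<^sub>M N"
  using measurable_cong_sets[of \<mu> "grassmannian n k" N N] by (auto simp: haar_grassmannian_def)

text \<open>
  Moving the subspace by a reflection amounts to moving the vector, and the Haar distribution does not
  see the former.
\<close>

lemma haar_qform_distr:
  assumes haar: "haar_grassmannian n k \<mu>" and xy: "dotp n x x = dotp n y y"
  shows "distr \<mu> borel (\<lambda>E. qform n E x) = distr \<mu> borel (\<lambda>E. qform n E y)"
proof -
  obtain H where H: "symmetric_mat n H" "orthogonal_mat n H" "\<And>i. i < n \<Longrightarrow> mat_apply n H x i = y i"
    using householder_exists[OF xy] by blast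
  have m: "(\<lambda>E. mat_apply n H ` E) \<in> \<mu> \<rightarrow>\<^sub>M grassmannian n k"
    by (rule haar_measurable[OF haar measurable_image_subspace[OF H(1,2)]])
  have "distr \<mu> borel (\<lambda>E. qform n E x) =
      distr (distr \<mu> (grassmannian n k) (\<lambda>E. mat_apply n H ` E)) borel (\<lambda>E. qform n E x)"
    using haar H(2) by (simp add: haar_grassmannian_def)
  also have "\<dots> = distr \<mu> borel ((\<lambda>E. qform n E x) \<circ> (\<lambda>E. mat_apply n H ` E))"
    by (rule distr_distr[OF measurable_qform m])
  also have "\<dots> = distr \<mu> borel (\<lambda>E. qform n E y)"
  proof (rule distr_cong)
    fix E assume "E \<in> space \<mu>"
    then have "E \<in> subspaces n k" using haar_space[OF haar] by simp
    then show "((\<lambda>E. qform n E x) \<circ> (\<lambda>E. mat_apply n H ` E)) E = qform n E y"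
      using H by (simp add: qform_image(2)) (rule qform_cong, simp)
  qed auto
  finally show ?thesis .
qed

text \<open>
  The first unit vector stands for an arbitrary one, see \<open>haar_moment_eq\<close>.
\<close>

definition haar_moment :: "nat \<Rightarrow> (nat \<Rightarrow> real) set measure \<Rightarrow> nat \<Rightarrow> real" where
  "haar_moment n \<mu> j = (\<integral>E. qform n E (unit_vec n 0) ^ j \<partial>\<mu>)"

lemma dotp_unit_vec: "i < n \<Longrightarrow> dotp n (unit_vec n i) x = x i"
proof -
  assume i: "i < n"
  have "dotp n (unit_vec n i) x = (\<Sum>a<n. if a = i then x a else 0)"
    unfolding dotp_def unit_vec_def by (intro sum.cong) auto
  then show ?thesis using i by simp
qed

lemma haar_moment_eq:
  assumes haar: "haar_grassmannian n k \<mu>" and n: "n \<ge> 1"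
  shows "(\<integral>E. qform n E x ^ j \<partial>\<mu>) = haar_moment n \<mu> j * dotp n x x ^ j"
proof -
  define r where "r = sqrt (dotp n x x)"
  have r: "r\<^sup>2 = dotp n x x" using dotp_self_nonneg by (simp add: r_def)
  define y where "y = (\<lambda>i. r * unit_vec n 0 i)"
  have "dotp n y y = r\<^sup>2"
    unfolding y_def dotp_scale_left
    by (subst dotp_commute, unfold dotp_scale_left) (use n in \<open>simp add: dotp_unit_vec, simp add: unit_vec_def power2_eq_square\<close>)
  then have eq: "distr \<mu> borel (\<lambda>E. qform n E x) = distr \<mu> borel (\<lambda>E. qform n E y)"
    using r by (intro haar_qform_distr[OF haar]) simp
  have m: "(\<lambda>E. qform n E z) \<in> borel_measurable \<mu>" for z
    by (rule haar_measurable[OF haar measurable_qform])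
  have "(\<integral>E. qform n E x ^ j \<partial>\<mu>) = (\<integral>v. v ^ j \<partial>distr \<mu> borel (\<lambda>E. qform n E x))"
    by (subst integral_distr[OF m]) auto
  also have "\<dots> = (\<integral>E. qform n E y ^ j \<partial>\<mu>)"
    unfolding eq by (subst integral_distr[OF m]) auto
  also have "\<dots> = haar_moment n \<mu> j * (r\<^sup>2) ^ j"
    unfolding y_def qform_scale haar_moment_def by (simp add: power_mult_distrib mult.commute)
  finally show ?thesis by (simp add: r)
qed

text \<open>
  The remainder is bounded uniformly in the coefficients, so the expansion may be integrated over the
  Grassmannian.
\<close>

lemma power_quadratic_expansion:
  "\<exists>B. \<forall>a b c s :: real. \<bar>a\<bar> \<le> 1 \<longrightarrow> \<bar>b\<bar> \<le> 1 \<longrightarrow> \<bar>c\<bar> \<le> 1 \<longrightarrow> \<bar>s\<bar> \<le> 1 \<longrightarrow>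
     \<bar>(a + 2 * s * b + s\<^sup>2 * c) ^ N - (a ^ N + s * (2 * real N * a ^ (N - 1) * b)
        + s\<^sup>2 * (real N * a ^ (N - 1) * c + 2 * (real N * (real N - 1)) * a ^ (N - 2) * b\<^sup>2))\<bar> \<le> B * \<bar>s\<bar> ^ 3"
proof (induction N)
  case 0
  show ?case by (rule exI[of _ 0]) simp
next
  case (Suc N)
  then obtain B where B: "\<And>a b c s :: real. \<bar>a\<bar> \<le> 1 \<Longrightarrow> \<bar>b\<bar> \<le> 1 \<Longrightarrow> \<bar>c\<bar> \<le> 1 \<Longrightarrow> \<bar>s\<bar> \<le> 1 \<Longrightarrow>
     \<bar>(a + 2 * s * b + s\<^sup>2 * c) ^ N - (a ^ N + s * (2 * real N * a ^ (N - 1) * b)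
        + s\<^sup>2 * (real N * a ^ (N - 1) * c + 2 * (real N * (real N - 1)) * a ^ (N - 2) * b\<^sup>2))\<bar> \<le> B * \<bar>s\<bar> ^ 3"
    by blast
  define K where "K = 4 * B + 3 * (real N + 2 * (real N * real N)) + 2 * real N"
  show ?case
  proof (rule exI[of _ K], intro allI impI)
    fix a b c s :: real
    assume le: "\<bar>a\<bar> \<le> 1" "\<bar>b\<bar> \<le> 1" "\<bar>c\<bar> \<le> 1" "\<bar>s\<bar> \<le> 1"
    define P where "P = 2 * real N * a ^ (N - 1) * b"
    define Q where "Q = real N * a ^ (N - 1) * c + 2 * (real N * (real N - 1)) * a ^ (N - 2) * b\<^sup>2"
    define F where "F = a + 2 * s * b + s\<^sup>2 * c"
    define R where "R = F ^ N - (a ^ N + s * P + s\<^sup>2 * Q)"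
    have R: "\<bar>R\<bar> \<le> B * \<bar>s\<bar> ^ 3"
      unfolding R_def F_def P_def Q_def using B[OF le] by simp
    have aN: "\<bar>a ^ m\<bar> \<le> 1" for m
      using le(1) by (simp add: power_abs power_le_one)
    have P: "\<bar>P\<bar> \<le> 2 * real N"
    proof -
      have "\<bar>P\<bar> = 2 * real N * (\<bar>a ^ (N - 1)\<bar> * \<bar>b\<bar>)" by (simp add: P_def abs_mult)
      also have "\<dots> \<le> 2 * real N * 1"
        using aN le by (intro mult_left_mono mult_le_one) auto
      finally show ?thesis by simp
    qed
    have Q: "\<bar>Q\<bar> \<le> real N + 2 * (real N * real N)"
    proof -
      have b2: "\<bar>b\<^sup>2\<bar> \<le> 1" using le(2) by (simp add: abs_square_le_1)
      have "\<bar>Q\<bar> \<le> \<bar>real N * a ^ (N - 1) * c\<bar> + \<bar>2 * (real N * (real N - 1)) * a ^ (N - 2) * b\<^sup>2\<bar>"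
        unfolding Q_def by (rule abs_triangle_ineq)
      also have "\<dots> = real N * (\<bar>a ^ (N - 1)\<bar> * \<bar>c\<bar>) + 2 * (real N * \<bar>real N - 1\<bar>) * (\<bar>a ^ (N - 2)\<bar> * \<bar>b\<^sup>2\<bar>)"
        by (simp add: abs_mult)
      also have "\<dots> \<le> real N * 1 + 2 * (real N * \<bar>real N - 1\<bar>) * 1"
        using aN le b2 by (intro add_mono mult_left_mono mult_le_one) auto
      also have "\<dots> \<le> real N + 2 * (real N * real N)"
        by (cases N) (auto intro!: mult_left_mono)
      finally show ?thesis .
    qed
    have F: "\<bar>F\<bar> \<le> 4"
    proof -
      have "\<bar>s * b\<bar> \<le> 1" "\<bar>s\<^sup>2 * c\<bar> \<le> 1"
        using le by (auto simp: abs_mult mult_le_one abs_square_le_1 power_abs power_le_one)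
      then show ?thesis using le unfolding F_def by (simp add: abs_le_iff)
    qed
    have a1: "a * (real N * a ^ (N - 1)) = real N * a ^ N"
      by (cases N) auto
    have a2: "a * (real N * (real N - 1) * a ^ (N - 2)) = real N * (real N - 1) * a ^ (N - 1)"
      by (cases N; cases "N - 1") auto
    define P' where "P' = 2 * real (Suc N) * a ^ (Suc N - 1) * b"
    define Q' where "Q' = real (Suc N) * a ^ (Suc N - 1) * c + 2 * (real (Suc N) * (real (Suc N) - 1)) * a ^ (Suc N - 2) * b\<^sup>2"
    have P': "P' = a * P + 2 * b * a ^ N"
    proof -
      have "a * P = 2 * b * (a * (real N * a ^ (N - 1)))" by (simp add: P_def)
      then show ?thesis unfolding a1 by (simp add: P'_def algebra_simps)
    qed
    have Q': "Q' = a * Q + 2 * b * P + c * a ^ N"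
    proof -
      have "a * Q = c * (a * (real N * a ^ (N - 1))) + 2 * b\<^sup>2 * (a * (real N * (real N - 1) * a ^ (N - 2)))"
        by (simp add: Q_def algebra_simps)
      then show ?thesis unfolding a1 a2
        by (simp add: Q'_def P_def algebra_simps power2_eq_square)
    qed
    have "F ^ Suc N - (a ^ Suc N + s * P' + s\<^sup>2 * Q') =
        s ^ 3 * (2 * b * Q + c * P + s * c * Q) + R * F"
    proof -
      have "F ^ Suc N = (a ^ N + s * P + s\<^sup>2 * Q) * F + R * F"
        by (simp add: R_def algebra_simps)
      then show ?thesis
        unfolding P' Q' F_def by (simp add: algebra_simps power2_eq_square power3_eq_cube)
    qed
    also have "\<bar>\<dots>\<bar> \<le> \<bar>s\<bar> ^ 3 * (3 * (real N + 2 * (real N * real N)) + 2 * real N) + B * \<bar>s\<bar> ^ 3 * 4"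
    proof -
      have "\<bar>2 * b * Q + c * P + s * c * Q\<bar> \<le> \<bar>2 * b * Q\<bar> + \<bar>c * P\<bar> + \<bar>s * c * Q\<bar>"
        by linarith
      also have "\<dots> = 2 * (\<bar>b\<bar> * \<bar>Q\<bar>) + \<bar>c\<bar> * \<bar>P\<bar> + \<bar>s\<bar> * \<bar>c\<bar> * \<bar>Q\<bar>"
        by (simp add: abs_mult)
      also have "\<dots> \<le> 2 * (1 * \<bar>Q\<bar>) + 1 * \<bar>P\<bar> + 1 * \<bar>Q\<bar>"
        using le by (intro add_mono mult_left_mono mult_right_mono mult_le_one) auto
      also have "\<dots> \<le> 3 * (real N + 2 * (real N * real N)) + 2 * real N"
      proof -
        have "z * 3 + w \<ge> 2 * (1 * x) + 1 * y + 1 * x" if "x \<le> z" "y \<le> w" for x y z w :: real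
          using that by simp
        from this[OF Q P] show ?thesis by (simp only: mult.commute[of 3])
      qed
      finally have 1: "\<bar>2 * b * Q + c * P + s * c * Q\<bar> \<le> 3 * (real N + 2 * (real N * real N)) + 2 * real N" .
      have "\<bar>s ^ 3 * (2 * b * Q + c * P + s * c * Q) + R * F\<bar> \<le>
          \<bar>s\<bar> ^ 3 * \<bar>2 * b * Q + c * P + s * c * Q\<bar> + \<bar>R\<bar> * \<bar>F\<bar>"
        by (intro order_trans[OF abs_triangle_ineq]) (simp add: abs_mult power_abs)
      also have "\<dots> \<le> \<bar>s\<bar> ^ 3 * (3 * (real N + 2 * (real N * real N)) + 2 * real N) + B * \<bar>s\<bar> ^ 3 * 4"
        using 1 R F by (intro add_mono mult_mono) auto
      finally show ?thesis .
    qed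
    also have "\<dots> = K * \<bar>s\<bar> ^ 3" by (simp add: K_def algebra_simps)
    finally show "\<bar>(a + 2 * s * b + s\<^sup>2 * c) ^ Suc N - (a ^ Suc N + s * (2 * real (Suc N) * a ^ (Suc N - 1) * b)
        + s\<^sup>2 * (real (Suc N) * a ^ (Suc N - 1) * c + 2 * (real (Suc N) * (real (Suc N) - 1)) * a ^ (Suc N - 2) * b\<^sup>2))\<bar>
        \<le> K * \<bar>s\<bar> ^ 3"
      unfolding F_def P'_def Q'_def .
  qed
qed


section \<open>Moments of the squared length of a random projection\<close>

lemma quadratic_coeff_eq_0:
  fixes A0 A1 A2 B :: real
  assumes "\<And>s. \<bar>s\<bar> \<le> 1 \<Longrightarrow> \<bar>A0 + s * A1 + s\<^sup>2 * A2\<bar> \<le> B * \<bar>s\<bar> ^ 3"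
  shows "A2 = 0"
proof -
  have A0: "A0 = 0" using assms[of 0] by simp
  have *: "\<bar>A2\<bar> \<le> B * s" if s: "0 < s" "s \<le> 1" for s
  proof -
    have "2 * (s\<^sup>2 * \<bar>A2\<bar>) = \<bar>(s * A1 + s\<^sup>2 * A2) + (- s * A1 + s\<^sup>2 * A2)\<bar>"
      by (simp add: abs_mult)
    also have "\<dots> \<le> \<bar>s * A1 + s\<^sup>2 * A2\<bar> + \<bar>- s * A1 + s\<^sup>2 * A2\<bar>"
      by (rule abs_triangle_ineq)
    also have "\<dots> \<le> B * s ^ 3 + B * s ^ 3"
      using assms[of s] assms[of "-s"] s A0 by (intro add_mono) auto
    finally have "s\<^sup>2 * \<bar>A2\<bar> \<le> s\<^sup>2 * (B * s)"
      by (simp add: power2_eq_square power3_eq_cube mult_ac)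
    then show ?thesis using s by simp
  qed
  have "((\<lambda>s. B * s) \<longlongrightarrow> B * 0) (at_right 0)"
    by (intro tendsto_intros)
  moreover have "\<forall>\<^sub>F s in at_right 0. \<bar>A2\<bar> \<le> B * s"
    using eventually_at_right_less[of "0::real"] eventually_at_right_real[of 0 "1::real", simplified]
    by eventually_elim (auto intro: *)
  ultimately have "\<bar>A2\<bar> \<le> B * 0"
    by (intro tendsto_lowerbound) auto
  then show ?thesis by simp
qed

text \<open>
  Both sides of \<open>haar_moment_eq\<close> with exponent \<open>N = j + 1\<close> are polynomials in \<open>x\<close>; compare their
  Laplacians at a unit vector. For a projection \<open>P\<close> of trace \<open>k\<close>, the Laplacian of
  \<open>x \<mapsto> (x \<bullet> P x)\<^sup>N\<close> is \<open>2 N (k + 2 j) (x \<bullet> P x)\<^sup>j\<close>, because the squared length of \<open>P x\<close> is again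
  \<open>x \<bullet> P x\<close>; that of \<open>x \<mapsto> (x \<bullet> x)\<^sup>N\<close> is the case \<open>P = 1\<close>, \<open>k = n\<close>. Half the Laplacian is computed
  as the sum of the second order coefficients along the coordinate axes, which avoids differentiating under
  the integral.
\<close>

lemma haar_moment_Suc:
  assumes haar: "haar_grassmannian n k \<mu>" and n: "n \<ge> 1"
  shows "(real n + 2 * real j) * haar_moment n \<mu> (Suc j) = (real k + 2 * real j) * haar_moment n \<mu> j"
proof -
  define N where "N = Suc j"
  define x where "x = unit_vec n 0"
  define q where "q E = qform n E x" for E
  define b where "b i E = (\<Sum>l<n. proj_matrix n E (i, l) * x l)" for i E
  define d where "d i E = proj_matrix n E (i, i)" for i E
  interpret prob_space \<mu> using haar by (simp add: haar_grassmannian_def)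
  have sp: "E \<in> subspaces n k" if "E \<in> space \<mu>" for E
    using that haar_space[OF haar] by simp
  have x1: "dotp n x x = 1"
    using n dotp_unit_vec[of 0 n x] by (simp add: x_def) (simp add: unit_vec_def)
  have xi: "\<bar>x i\<bar> \<le> 1" if "i < n" for i
    using that by (simp add: x_def unit_vec_def)
  have qm [measurable]: "q \<in> borel_measurable \<mu>"
    unfolding q_def by (rule haar_measurable[OF haar measurable_qform])
  have pm [measurable]: "(\<lambda>E. proj_matrix n E (i, l)) \<in> borel_measurable \<mu>"
    if "i \<in> {..<n}" "l \<in> {..<n}" for i l
    using that by (intro haar_measurable[OF haar measurable_proj_matrix_entry]) auto
  have bm [measurable]: "b i \<in> borel_measurable \<mu>" if "i \<in> {..<n}" for i
    unfolding b_def using that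
    by (intro borel_measurable_sum borel_measurable_times borel_measurable_const pm) auto
  have dm [measurable]: "d i \<in> borel_measurable \<mu>" if "i \<in> {..<n}" for i
    unfolding d_def using that by (intro pm)
  have q01: "0 \<le> q E" "q E \<le> 1" if "E \<in> space \<mu>" for E
    using qform_bounds[OF sp[OF that], of x] x1 by (auto simp: q_def)
  have d01: "\<bar>d i E\<bar> \<le> 1" if E: "E \<in> space \<mu>" and i: "i < n" for E i
  proof -
    have "qform n E (unit_vec n i) = qform n E (\<lambda>j. 0 + 1 * (if j = i then 1 else 0))"
      by (rule qform_cong) (auto simp: unit_vec_def)
    also have "\<dots> = d i E"
      unfolding qform_shift[OF sp[OF E] i] by (simp add: d_def qform_def)
    finally have "d i E = qform n E (unit_vec n i)" ..
    then show ?thesis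
      using qform_bounds[OF sp[OF E], of "unit_vec n i"] i by (simp add: dotp_unit_vec, simp add: unit_vec_def)
  qed
  have bsum: "(\<Sum>i<n. (b i E)\<^sup>2) = q E" if "E \<in> space \<mu>" for E
    unfolding b_def q_def by (rule proj_matrix_apply_norm[OF sp[OF that]])
  have b01: "\<bar>b i E\<bar> \<le> 1" if E: "E \<in> space \<mu>" and i: "i < n" for E i
  proof -
    have "(b i E)\<^sup>2 \<le> (\<Sum>i<n. (b i E)\<^sup>2)"
      using i by (intro member_le_sum) auto
    also have "\<dots> \<le> 1" using bsum[OF E] q01[OF E] by simp
    finally show ?thesis by (simp add: abs_square_le_1)
  qed
  have q_le: "\<bar>q E ^ m\<bar> \<le> 1" if "E \<in> space \<mu>" for E m
    using q01[OF that] by (simp add: power_le_one)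
  have int0: "integrable \<mu> (\<lambda>E. q E ^ m)" for m
    by (rule integrable_const_bound[where B=1]) (use q_le in auto)
  have int1: "integrable \<mu> (\<lambda>E. q E ^ m * b i E)" if "i < n" for m i
    using that by (intro integrable_const_bound[where B=1])
      (use q_le b01 in \<open>auto simp: abs_mult intro!: mult_le_one\<close>)
  have int2: "integrable \<mu> (\<lambda>E. q E ^ m * d i E)" if "i < n" for m i
    using that by (intro integrable_const_bound[where B=1])
      (use q_le d01 in \<open>auto simp: abs_mult intro!: mult_le_one\<close>)
  have int3: "integrable \<mu> (\<lambda>E. q E ^ m * (b i E)\<^sup>2)" if "i < n" for m i
    using that by (intro integrable_const_bound[where B=1])
      (use q_le b01 in \<open>auto simp: abs_mult abs_square_le_1 intro!: mult_le_one\<close>)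
  define c where "c = haar_moment n \<mu>"
  \<comment> \<open>The second order coefficients at \<open>x\<close> in the direction of the \<open>i\<close>-th unit vector agree.\<close>
  have coeff: "real N * (\<integral>E. q E ^ j * d i E \<partial>\<mu>) + 2 * (real N * real j) * (\<integral>E. q E ^ (j - 1) * (b i E)\<^sup>2 \<partial>\<mu>) =
     c N * (real N + 2 * (real N * real j) * (x i)\<^sup>2)" if i: "i < n" for i
  proof -
    obtain B where B: "\<And>a b c s :: real. \<bar>a\<bar> \<le> 1 \<Longrightarrow> \<bar>b\<bar> \<le> 1 \<Longrightarrow> \<bar>c\<bar> \<le> 1 \<Longrightarrow> \<bar>s\<bar> \<le> 1 \<Longrightarrow>
     \<bar>(a + 2 * s * b + s\<^sup>2 * c) ^ N - (a ^ N + s * (2 * real N * a ^ (N - 1) * b)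
        + s\<^sup>2 * (real N * a ^ (N - 1) * c + 2 * (real N * (real N - 1)) * a ^ (N - 2) * b\<^sup>2))\<bar> \<le> B * \<bar>s\<bar> ^ 3"
      using power_quadratic_expansion[of N] by blast
    define y where "y s = (\<lambda>j. x j + s * (if j = i then 1 else 0))" for s :: real
    have yy: "dotp n (y s) (y s) = 1 + 2 * s * x i + s\<^sup>2 * 1" for s
    proof -
      have e: "dotp n (\<lambda>j. if j = i then 1 else 0) z = z i" for z
      proof -
        have "dotp n (\<lambda>j. if j = i then 1 else 0) z = dotp n (unit_vec n i) z"
          by (rule dotp_cong) (auto simp: unit_vec_def)
        then show ?thesis using dotp_unit_vec[OF i] by simp
      qed
      have "dotp n (y s) z = dotp n x z + s * z i" for z
        unfolding y_def dotp_add_left dotp_scale_left e ..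
      from this[of "y s"] this[of x] have "dotp n (y s) (y s) = 1 + s * x i + s * y s i"
        using x1 dotp_commute[of n x "y s"] by simp
      also have "y s i = x i + s" by (simp add: y_def)
      finally show ?thesis by (simp add: algebra_simps power2_eq_square)
    qed
    define F where "F s E = q E ^ N + s * (2 * real N * q E ^ (N - 1) * b i E)
        + s\<^sup>2 * (real N * q E ^ (N - 1) * d i E + 2 * (real N * (real N - 1)) * q E ^ (N - 2) * (b i E)\<^sup>2)" for s E
    have F_int: "integrable \<mu> (F s)" for s
      unfolding F_def mult.assoc
      by (intro Bochner_Integration.integrable_add integrable_mult_right int0 int1 int2 int3 i)
    have F_eq: "(\<integral>E. F s E \<partial>\<mu>) = c N + s * (2 * real N * (\<integral>E. q E ^ (N - 1) * b i E \<partial>\<mu>))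
      + s\<^sup>2 * (real N * (\<integral>E. q E ^ (N - 1) * d i E \<partial>\<mu>) + 2 * (real N * (real N - 1)) * (\<integral>E. q E ^ (N - 2) * (b i E)\<^sup>2 \<partial>\<mu>))" for s
      unfolding F_def mult.assoc
      by (simp add: int0 int1 int2 int3 i Bochner_Integration.integral_add integrable_mult_right)
         (simp add: c_def haar_moment_def q_def x_def)
    have G: "(\<integral>E. qform n E (y s) ^ N \<partial>\<mu>) = c N * (1 + 2 * s * x i + s\<^sup>2 * 1) ^ N" for s
      unfolding c_def haar_moment_eq[OF haar n] yy ..
    have "B * \<bar>s\<bar> ^ 3 \<ge> \<bar>c N * (1 + 2 * s * x i + s\<^sup>2 * 1) ^ N - (\<integral>E. F s E \<partial>\<mu>)\<bar>" if s: "\<bar>s\<bar> \<le> 1" for s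
    proof -
      have ym: "(\<lambda>E. qform n E (y s)) \<in> borel_measurable \<mu>"
        by (rule haar_measurable[OF haar measurable_qform])
      have pt: "\<bar>qform n E (y s) ^ N - F s E\<bar> \<le> B * \<bar>s\<bar> ^ 3" if E: "E \<in> space \<mu>" for E
        using B[of "q E" "b i E" "d i E" s] q01[OF E] b01[OF E i] d01[OF E i] s
        unfolding y_def qform_shift[OF sp[OF E] i] F_def q_def b_def d_def by simp
      have yint: "integrable \<mu> (\<lambda>E. qform n E (y s) ^ N)"
      proof (rule integrable_const_bound)
        show "AE E in \<mu>. norm (qform n E (y s) ^ N) \<le> dotp n (y s) (y s) ^ N"
          using qform_bounds[OF sp] by (auto intro!: power_mono)
      qed (use ym in measurable)
      have "\<bar>(\<integral>E. qform n E (y s) ^ N - F s E \<partial>\<mu>)\<bar> \<le> (\<integral>E. \<bar>qform n E (y s) ^ N - F s E\<bar> \<partial>\<mu>)"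
        by (rule integral_abs_bound)
      also have "\<dots> \<le> (\<integral>E. B * \<bar>s\<bar> ^ 3 \<partial>\<mu>)"
        using yint F_int pt by (intro integral_mono) auto
      also have "\<dots> = B * \<bar>s\<bar> ^ 3"
        by (simp add: prob_space)
      finally show ?thesis
        using yint F_int G by simp
    qed note main = this
    define f1 where "f1 = 2 * real N * x i"
    define f2 where "f2 = real N + 2 * (real N * (real N - 1)) * (x i)\<^sup>2"
    define g1 where "g1 = 2 * real N * (\<integral>E. q E ^ (N - 1) * b i E \<partial>\<mu>)"
    define g2 where "g2 = real N * (\<integral>E. q E ^ (N - 1) * d i E \<partial>\<mu>) + 2 * (real N * (real N - 1)) * (\<integral>E. q E ^ (N - 2) * (b i E)\<^sup>2 \<partial>\<mu>)"
    have "c N * f2 - g2 = 0"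
    proof (rule quadratic_coeff_eq_0)
      fix s :: real assume s: "\<bar>s\<bar> \<le> 1"
      have 1: "\<bar>(1 + 2 * s * x i + s\<^sup>2 * 1) ^ N - (1 + s * f1 + s\<^sup>2 * f2)\<bar> \<le> B * \<bar>s\<bar> ^ 3"
        using B[of 1 "x i" 1 s] xi[OF i] s by (simp add: f1_def f2_def)
      have 2: "\<bar>c N * (1 + 2 * s * x i + s\<^sup>2 * 1) ^ N - (c N + s * g1 + s\<^sup>2 * g2)\<bar> \<le> B * \<bar>s\<bar> ^ 3"
        using main[OF s] unfolding F_eq g1_def g2_def .
      have "\<bar>0 + s * (c N * f1 - g1) + s\<^sup>2 * (c N * f2 - g2)\<bar> =
         \<bar>(c N * (1 + 2 * s * x i + s\<^sup>2 * 1) ^ N - (c N + s * g1 + s\<^sup>2 * g2))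
          - c N * ((1 + 2 * s * x i + s\<^sup>2 * 1) ^ N - (1 + s * f1 + s\<^sup>2 * f2))\<bar>"
        by (rule arg_cong[where f=abs]) (simp add: algebra_simps)
      also have "\<dots> \<le> \<bar>c N * (1 + 2 * s * x i + s\<^sup>2 * 1) ^ N - (c N + s * g1 + s\<^sup>2 * g2)\<bar>
          + \<bar>c N * ((1 + 2 * s * x i + s\<^sup>2 * 1) ^ N - (1 + s * f1 + s\<^sup>2 * f2))\<bar>"
        by (rule abs_triangle_ineq4)
      also have "\<dots> \<le> B * \<bar>s\<bar> ^ 3 + \<bar>c N\<bar> * (B * \<bar>s\<bar> ^ 3)"
        unfolding abs_mult using 1 2 by (intro add_mono mult_left_mono) auto
      finally show "\<bar>0 + s * (c N * f1 - g1) + s\<^sup>2 * (c N * f2 - g2)\<bar> \<le> (B + \<bar>c N\<bar> * B) * \<bar>s\<bar> ^ 3"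
        by (simp add: algebra_simps)
    qed
    then show ?thesis
      by (simp add: f2_def g2_def N_def)
  qed
  define SD where "SD = (\<Sum>i<n. \<integral>E. q E ^ j * d i E \<partial>\<mu>)"
  define SB where "SB = (\<Sum>i<n. \<integral>E. q E ^ (j - 1) * (b i E)\<^sup>2 \<partial>\<mu>)"
  have "(\<Sum>i<n. real N * (\<integral>E. q E ^ j * d i E \<partial>\<mu>) + 2 * (real N * real j) * (\<integral>E. q E ^ (j - 1) * (b i E)\<^sup>2 \<partial>\<mu>)) =
     (\<Sum>i<n. c N * (real N + 2 * (real N * real j) * (x i)\<^sup>2))"
    using coeff by (intro sum.cong) auto
  then have "real N * SD + 2 * (real N * real j) * SB = c N * (real n * real N + 2 * (real N * real j) * (\<Sum>i<n. (x i)\<^sup>2))"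
    by (simp add: SD_def SB_def sum.distrib sum_distrib_left[symmetric])
  moreover have "SD = real k * c j"
  proof -
    have "(\<Sum>i<n. \<integral>E. q E ^ j * d i E \<partial>\<mu>) = (\<integral>E. (\<Sum>i<n. q E ^ j * d i E) \<partial>\<mu>)"
      by (rule Bochner_Integration.integral_sum[symmetric]) (use int2 in auto)
    also have "\<dots> = (\<integral>E. q E ^ j * real k \<partial>\<mu>)"
      using proj_matrix_trace[OF sp]
      by (intro Bochner_Integration.integral_cong refl) (simp add: sum_distrib_left[symmetric] d_def)
    finally show ?thesis by (simp add: SD_def SB_def c_def haar_moment_def q_def x_def)
  qed
  moreover have "real j * SB = real j * c j"
  proof (cases j)
    case (Suc m)
    have "(\<Sum>i<n. \<integral>E. q E ^ (j - 1) * (b i E)\<^sup>2 \<partial>\<mu>) = (\<integral>E. (\<Sum>i<n. q E ^ (j - 1) * (b i E)\<^sup>2) \<partial>\<mu>)"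
      by (rule Bochner_Integration.integral_sum[symmetric]) (use int3 in auto)
    also have "\<dots> = (\<integral>E. q E ^ j \<partial>\<mu>)"
      using bsum Suc by (intro Bochner_Integration.integral_cong refl) (simp add: sum_distrib_left[symmetric])
    finally show ?thesis by (simp add: SD_def SB_def c_def haar_moment_def q_def x_def)
  qed simp
  moreover have "(\<Sum>i<n. (x i)\<^sup>2) = 1"
    using x1 by (simp add: dotp_def power2_eq_square)
  ultimately have "real N * (real k * c j) + 2 * (real N * (real j * c j)) = c N * (real n * real N + 2 * (real N * real j))"
    by (metis mult.assoc mult.right_neutral)
  then have "real N * ((real k + 2 * real j) * c j) = real N * ((real n + 2 * real j) * c N)"
    by (simp add: algebra_simps)
  moreover have "real N \<noteq> 0" by (simp add: N_def)
  ultimately show ?thesis unfolding c_def N_def by (metis mult_left_cancel)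
qed

text \<open>
  On a bounded interval the Taylor polynomials of the characteristic function, which only involve moments,
  converge to it.
\<close>

lemma moments_determine_law_unit_interval:
  fixes \<mu> \<nu> :: "real measure"
  assumes \<mu>: "real_distribution \<mu>" "AE x in \<mu>. \<bar>x\<bar> \<le> 1"
    and \<nu>: "real_distribution \<nu>" "AE x in \<nu>. \<bar>x\<bar> \<le> 1"
    and moments: "\<And>j. (\<integral>x. x ^ j \<partial>\<mu>) = (\<integral>x. x ^ j \<partial>\<nu>)"
  shows "\<mu> = \<nu>"
proof (rule Levy_uniqueness[OF \<mu>(1) \<nu>(1)], rule ext)
  fix t :: real
  have approx: "cmod (char M t - (\<Sum>k\<le>n. ((\<i> * t) ^ k / fact k) * of_real (\<integral>x. x ^ k \<partial>M))) \<le> 2 * \<bar>t\<bar> ^ n / fact n"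
    if M: "real_distribution M" and bd: "AE x in M. \<bar>x\<bar> \<le> 1" for M n
  proof -
    interpret real_distribution M by (rule M)
    have le: "AE x in M. \<bar>x ^ k\<bar> \<le> 1" for k
      using bd by eventually_elim (simp add: power_abs power_le_one)
    have int: "integrable M (\<lambda>x. x ^ k)" for k
      by (rule integrable_const_bound[where B=1]) (use le in auto)
    have "cmod (char M t - (\<Sum>k\<le>n. ((\<i> * t) ^ k / fact k) * of_real (\<integral>x. x ^ k \<partial>M)))
      \<le> (2 * \<bar>t\<bar> ^ n / fact n) * (\<integral>x. \<bar>x\<bar> ^ n \<partial>M)"
      by (rule char_approx1) (rule int)
    also have "\<dots> \<le> (2 * \<bar>t\<bar> ^ n / fact n) * (\<integral>x. 1 \<partial>M)"
      using le[of n] integrable_abs[OF int[of n]]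
      by (intro mult_left_mono integral_mono_AE) (auto simp: power_abs)
    also have "(\<integral>x. 1 \<partial>M) = (1::real)"
      using prob_space by simp
    finally show ?thesis by simp
  qed
  have "cmod (char \<mu> t - char \<nu> t) \<le> 4 * (\<bar>t\<bar> ^ n / fact n)" for n
  proof -
    define S where "S = (\<Sum>k\<le>n. ((\<i> * t) ^ k / fact k) * complex_of_real (\<integral>x. x ^ k \<partial>\<nu>))"
    have "cmod (char \<mu> t - char \<nu> t) \<le> cmod (char \<mu> t - S) + cmod (char \<nu> t - S)"
      using dist_triangle2[of "char \<mu> t" "char \<nu> t" S] by (simp add: dist_norm)
    also have "\<dots> \<le> 2 * \<bar>t\<bar> ^ n / fact n + 2 * \<bar>t\<bar> ^ n / fact n"
      using approx[OF \<mu>, of n, unfolded moments] approx[OF \<nu>, of n]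
      unfolding S_def by (rule add_mono)
    finally show ?thesis by simp
  qed
  moreover have "(\<lambda>n. 4 * (\<bar>t\<bar> ^ n / fact n)) \<longlonglongrightarrow> 4 * 0"
    using summable_LIMSEQ_zero[OF summable_exp[of "\<bar>t\<bar>"]]
    by (intro tendsto_mult_left) (simp add: divide_inverse mult.commute)
  ultimately have "cmod (char \<mu> t - char \<nu> t) \<le> 4 * 0"
    by (intro LIMSEQ_le_const) auto
  then show "char \<mu> t = char \<nu> t" by simp
qed


section \<open>Polar decomposition of Lebesgue measure\<close>

lemma measurable_scale_Rn:
  assumes [measurable]: "f \<in> borel_measurable (Rn n)"
  shows "(\<lambda>x. scale_Rn n (f x) x) \<in> Rn n \<rightarrow>\<^sub>M Rn n"
proof -
  have [measurable]: "(\<lambda>x. x i) \<in> borel_measurable (Rn n)" if "i \<in> {..<n}" for i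
    using that measurable_component_Rn by simp
  have "(\<lambda>x. scale_Rn n (f x) x) \<in> Rn n \<rightarrow>\<^sub>M Pi\<^sub>M {..<n} (\<lambda>_. borel)"
    unfolding scale_Rn_def by (intro measurable_restrict) measurable
  then show ?thesis by (simp add: Rn_def[symmetric])
qed

definition normalize_p :: "nat \<Rightarrow> real \<Rightarrow> (nat \<Rightarrow> real) \<Rightarrow> (nat \<Rightarrow> real)" where
  "normalize_p n p x = scale_Rn n (inverse (pnorm n p x)) x"

lemma measurable_normalize_p [measurable]: "normalize_p n p \<in> Rn n \<rightarrow>\<^sub>M Rn n"
  unfolding normalize_p_def[abs_def] by (intro measurable_scale_Rn) measurable

lemma measurable_lebesgue_Rn_cong: "measurable (lebesgue_Rn n) M = measurable (Rn n) M"
  by (rule measurable_cong_sets) (simp_all add: sets_lebesgue_Rn)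

lemma space_lebesgue_Rn: "space (lebesgue_Rn n) = space (Rn n)"
  by (rule sets_eq_imp_space_eq[OF sets_lebesgue_Rn])

lemma emeasure_lebesgue_Rn_scale:
  assumes r: "r > 0" and A: "A \<in> sets (Rn n)"
  shows "emeasure (lebesgue_Rn n) A =
    ennreal (r ^ n) * emeasure (lebesgue_Rn n) {x \<in> space (Rn n). scale_Rn n r x \<in> A}"
proof -
  interpret product_sigma_finite "\<lambda>_::nat. lborel :: real measure" by standard
  let ?L = "lebesgue_Rn n"
  have m: "scale_Rn n r \<in> ?L \<rightarrow>\<^sub>M ?L"
    using measurable_scale_Rn[of "\<lambda>_. r" n] measurable_cong_sets[OF sets_lebesgue_Rn sets_lebesgue_Rn] by simp
  have "density (distr ?L ?L (scale_Rn n r)) (\<lambda>_. ennreal (r ^ n)) = Pi\<^sub>M {..<n} (\<lambda>_. lborel)"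
  proof (rule PiM_eqI)
    fix B :: "nat \<Rightarrow> real set"
    assume B: "\<And>i. i \<in> {..<n} \<Longrightarrow> B i \<in> sets lborel"
    have "emeasure (density (distr ?L ?L (scale_Rn n r)) (\<lambda>_. ennreal (r ^ n))) (Pi\<^sub>E {..<n} B)
      = ennreal (r ^ n) * emeasure (distr ?L ?L (scale_Rn n r)) (Pi\<^sub>E {..<n} B)"
    proof -
      have "Pi\<^sub>E {..<n} B \<in> sets ?L"
        unfolding lebesgue_Rn_def using B by (intro sets_PiM_I_finite) auto
      then show ?thesis
        by (subst emeasure_density_const) auto
    qed
    also have "emeasure (distr ?L ?L (scale_Rn n r)) (Pi\<^sub>E {..<n} B)
        = emeasure ?L (scale_Rn n r -` (Pi\<^sub>E {..<n} B) \<inter> space ?L)"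
      using B m by (subst emeasure_distr) (auto simp: lebesgue_Rn_def intro!: sets_PiM_I_finite)
    also have "scale_Rn n r -` (Pi\<^sub>E {..<n} B) \<inter> space ?L = Pi\<^sub>E {..<n} (\<lambda>i. (\<lambda>x. r * x) -` B i)"
      by (auto simp: scale_Rn_def space_lebesgue_Rn space_Rn PiE_iff extensional_def)
    also have "emeasure ?L \<dots> = (\<Prod>i<n. emeasure lborel ((\<lambda>x. r * x) -` B i))"
      unfolding lebesgue_Rn_def
    proof (subst emeasure_PiM)
      fix i assume "i \<in> {..<n}"
      then have [measurable]: "B i \<in> sets borel" using B by simp
      have "(\<lambda>x. r * x) -` B i \<inter> space borel \<in> sets borel" by measurable
      then show "(\<lambda>x. r * x) -` B i \<in> sets lborel" by simp
    qed auto
    also have "ennreal (r ^ n) * \<dots> = (\<Prod>i<n. ennreal r * emeasure lborel ((\<lambda>x. r * x) -` B i))"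
      using r by (simp add: prod.distrib ennreal_power)
    also have "\<dots> = (\<Prod>i\<in>{..<n}. emeasure lborel (B i))"
    proof (rule prod.cong[OF refl])
      fix i assume "i \<in> {..<n}"
      then have [measurable]: "B i \<in> sets borel" using B by simp
      have "emeasure lborel (B i) = emeasure (density (distr lborel borel ((*) r)) (\<lambda>_. \<bar>r\<bar>)) (B i)"
        using r by (subst lborel_distr_mult'[of r]) auto
      also have "\<dots> = ennreal r * emeasure lborel ((\<lambda>x. r * x) -` B i)"
        using r by (subst emeasure_density_const) (auto simp: emeasure_distr)
      finally show "ennreal r * emeasure lborel ((\<lambda>x. r * x) -` B i) = emeasure lborel (B i)" ..
    qed
    finally show "emeasure (density (distr ?L ?L (scale_Rn n r)) (\<lambda>_. ennreal (r ^ n))) (Pi\<^sub>E {..<n} B)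
      = (\<Prod>i\<in>{..<n}. emeasure lborel (B i))" .
  qed (auto simp: lebesgue_Rn_def)
  then have "emeasure ?L A = emeasure (density (distr ?L ?L (scale_Rn n r)) (\<lambda>_. ennreal (r ^ n))) A"
    by (simp add: lebesgue_Rn_def)
  also have "\<dots> = ennreal (r ^ n) * emeasure ?L (scale_Rn n r -` A \<inter> space ?L)"
    using A m by (subst emeasure_density_const) (auto simp: sets_lebesgue_Rn emeasure_distr)
  also have "scale_Rn n r -` A \<inter> space ?L = {x \<in> space (Rn n). scale_Rn n r x \<in> A}"
    by (auto simp: space_lebesgue_Rn)
  finally show ?thesis .
qed

lemma pnorm_nonneg: "0 \<le> pnorm n p x"
  by (simp add: pnorm_def)

lemma pnorm_powr: "p > 0 \<Longrightarrow> pnorm n p x powr p = (\<Sum>i<n. \<bar>x i\<bar> powr p)"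
  by (simp add: pnorm_def powr_powr sum_nonneg)

lemma sets_p_ball: "p_ball n p \<in> sets (Rn n)"
  unfolding p_ball_def by measurable

lemma emeasure_p_ball:
  assumes p: "p > 0" and n: "n \<ge> 1"
  shows "emeasure (lebesgue_Rn n) (p_ball n p) \<noteq> 0" "emeasure (lebesgue_Rn n) (p_ball n p) \<noteq> \<infinity>"
proof -
  interpret product_sigma_finite "\<lambda>_::nat. lborel :: real measure" by standard
  have cube: "emeasure (lebesgue_Rn n) (Pi\<^sub>E {..<n} (\<lambda>_. {-a..a})) = ennreal ((2 * a) ^ n)" if "a > 0" for a :: real
    unfolding lebesgue_Rn_def using that
    by (subst emeasure_PiM) (auto simp: ennreal_power simp flip: ennreal_mult')
  have cube_sets: "Pi\<^sub>E {..<n} (\<lambda>_. {-a..a}) \<in> sets (Rn n)" for a :: real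
    unfolding Rn_def by (intro sets_PiM_I_finite) auto
  have "p_ball n p \<subseteq> Pi\<^sub>E {..<n} (\<lambda>_. {-1..1})"
  proof
    fix x assume x: "x \<in> p_ball n p"
    have "\<bar>x i\<bar> \<le> 1" if "i < n" for i
    proof -
      have "\<bar>x i\<bar> powr p \<le> (\<Sum>i<n. \<bar>x i\<bar> powr p)"
        using that by (intro member_le_sum) auto
      also have "\<dots> = pnorm n p x powr p" using pnorm_powr[OF p] by simp
      also have "\<dots> \<le> 1 powr p" using x p by (intro powr_mono2) (auto simp: p_ball_def pnorm_nonneg)
      finally have "\<bar>x i\<bar> powr p \<le> 1 powr p" .
      then have "\<not> 1 < \<bar>x i\<bar>"
        using powr_less_mono2[OF p, of 1 "\<bar>x i\<bar>"] by fastforce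
      then show ?thesis by simp
    qed
    then show "x \<in> Pi\<^sub>E {..<n} (\<lambda>_. {-1..1})"
      using x by (auto simp: p_ball_def space_Rn PiE_iff abs_le_iff)
  qed
  then have "emeasure (lebesgue_Rn n) (p_ball n p) \<le> ennreal ((2 * 1) ^ n)"
    unfolding cube[OF zero_less_one, symmetric]
    by (intro emeasure_mono) (auto simp: sets_lebesgue_Rn cube_sets)
  then show "emeasure (lebesgue_Rn n) (p_ball n p) \<noteq> \<infinity>"
    by (auto simp: top_unique)
  define a where "a = (1 / real n) powr (1 / p)"
  have a: "a > 0" using n by (simp add: a_def)
  have "Pi\<^sub>E {..<n} (\<lambda>_. {-a..a}) \<subseteq> p_ball n p"
  proof
    fix x assume x: "x \<in> Pi\<^sub>E {..<n} (\<lambda>_. {-a..a})"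
    have "(\<Sum>i<n. \<bar>x i\<bar> powr p) \<le> (\<Sum>i<n. a powr p)"
      using x p by (intro sum_mono powr_mono2) (auto simp: PiE_iff abs_le_iff minus_le_iff)
    also have "\<dots> = 1" using n p by (simp add: a_def powr_powr)
    finally have "(\<Sum>i<n. \<bar>x i\<bar> powr p) powr (1 / p) \<le> 1 powr (1 / p)"
      using p by (intro powr_mono2) (auto simp: sum_nonneg)
    then show "x \<in> p_ball n p"
      using x by (auto simp: p_ball_def pnorm_def space_Rn PiE_iff)
  qed
  then have "ennreal ((2 * a) ^ n) \<le> emeasure (lebesgue_Rn n) (p_ball n p)"
    unfolding cube[OF a, symmetric]
    by (intro emeasure_mono) (auto simp: sets_lebesgue_Rn sets_p_ball)
  moreover have "ennreal ((2 * a) ^ n) > 0" using a by simp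
  ultimately have "0 < emeasure (lebesgue_Rn n) (p_ball n p)" by (rule less_le_trans[rotated])
  then show "emeasure (lebesgue_Rn n) (p_ball n p) \<noteq> 0" by simp
qed

lemma emeasure_uniform_ball:
  assumes "A \<in> sets (Rn n)"
  shows "emeasure (uniform_ball n p) A =
    emeasure (lebesgue_Rn n) (p_ball n p \<inter> A) / emeasure (lebesgue_Rn n) (p_ball n p)"
  unfolding uniform_ball_def using assms
  by (intro emeasure_uniform_measure) (auto simp: sets_lebesgue_Rn sets_p_ball)

lemma null_sets_origin_lebesgue:
  assumes "n \<ge> 1"
  shows "{\<lambda>i\<in>{..<n}. 0} \<in> null_sets (lebesgue_Rn n)"
proof -
  interpret product_sigma_finite "\<lambda>_::nat. lborel :: real measure" by standard
  have eq: "{\<lambda>i\<in>{..<n}. 0} = (\<Pi>\<^sub>E i\<in>{..<n}. {0::real})"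
    using PiE_singleton[of "\<lambda>i\<in>{..<n}. 0::real" "{..<n}"] by (auto cong: PiE_cong)
  have 1: "emeasure (lebesgue_Rn n) {\<lambda>i\<in>{..<n}. 0} = 0"
    unfolding eq lebesgue_Rn_def using assms by (subst emeasure_PiM) auto
  have 2: "{\<lambda>i\<in>{..<n}. 0::real} \<in> sets (lebesgue_Rn n)"
    unfolding eq lebesgue_Rn_def by (intro sets_PiM_I_finite) auto
  show ?thesis using 1 2 by (simp add: null_sets_def)
qed

text \<open>
  The cone of height \<open>r\<close> over a set of directions is the cone of height \<open>1\<close> scaled by \<open>r\<close>, and the
  volume of the latter defines the cone measure.
\<close>

lemma emeasure_lebesgue_cone:
  assumes n: "n \<ge> 1" and p: "p > 0" and A: "A \<in> sets (Rn n)" and r: "r > 0"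
  shows "emeasure (lebesgue_Rn n) {y \<in> space (Rn n). 0 < pnorm n p y \<and> pnorm n p y \<le> r \<and> normalize_p n p y \<in> A}
    = ennreal (r ^ n) * (emeasure (lebesgue_Rn n) (p_ball n p) * emeasure (cone_measure n p) A)"
proof -
  let ?L = "lebesgue_Rn n" and ?S = "\<lambda>r. {y \<in> space (Rn n). 0 < pnorm n p y \<and> pnorm n p y \<le> r \<and> normalize_p n p y \<in> A}"
  have S: "?S r \<in> sets (Rn n)" for r
    using A by measurable
  let ?Z = "{\<lambda>i\<in>{..<n}. 0::real}"
  have Z: "?Z \<in> null_sets ?L" by (rule null_sets_origin_lebesgue[OF n])
  have cone: "cone_over n p A - ?Z = ?S 1"
    using cone_over_minus_origin[OF p sets.sets_into_space[OF A]] by (simp add: normalize_p_def)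
  have CZ: "cone_over n p A \<inter> ?Z \<in> null_sets ?L"
  proof -
    have "cone_over n p A \<inter> ?Z = {} \<or> cone_over n p A \<inter> ?Z = ?Z" by auto
    then show ?thesis
    proof
      assume e: "cone_over n p A \<inter> ?Z = {}"
      show ?thesis unfolding e by simp
    next
      assume e: "cone_over n p A \<inter> ?Z = ?Z"
      show ?thesis unfolding e by (rule Z)
    qed
  qed
  have cone_eq: "cone_over n p A = ?S 1 \<union> (cone_over n p A \<inter> ?Z)"
    using cone by auto
  have cone_sets: "cone_over n p A \<in> sets (Rn n)"
  proof (subst cone_eq, rule sets.Un)
    show "cone_over n p A \<inter> ?Z \<in> sets (Rn n)"
      using null_setsD2[OF CZ] by (simp only: sets_lebesgue_Rn)
  qed (rule S)
  have sub: "p_ball n p \<inter> cone_over n p A = cone_over n p A"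
  proof -
    have "cone_over n p A \<subseteq> p_ball n p"
      using p pnorm_scale[of p _ n] by (auto simp: cone_over_def p_ball_def p_sphere_def space_Rn scale_Rn_def[of n])
    then show ?thesis by auto
  qed
  have "emeasure ?L (p_ball n p) * emeasure (cone_measure n p) A
      = emeasure ?L (p_ball n p) * (emeasure ?L (cone_over n p A) / emeasure ?L (p_ball n p))"
    unfolding emeasure_cone_measure[OF n p A] emeasure_uniform_ball[OF cone_sets] sub ..
  also have "\<dots> = emeasure ?L (cone_over n p A)"
    using emeasure_p_ball[OF p n] by (simp add: ennreal_times_divide mult.commute[of "emeasure ?L (p_ball n p)"]
        mult_divide_eq_ennreal)
  also have "\<dots> = emeasure ?L (?S 1)"
    by (subst cone_eq) (rule emeasure_Un_null_set[OF _ CZ], simp add: S sets_lebesgue_Rn)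
  finally have 1: "emeasure ?L (p_ball n p) * emeasure (cone_measure n p) A = emeasure ?L (?S 1)" .
  have "emeasure ?L (?S r) = ennreal (r ^ n) * emeasure ?L {x \<in> space (Rn n). scale_Rn n r x \<in> ?S r}"
    by (rule emeasure_lebesgue_Rn_scale[OF r S])
  also have "{x \<in> space (Rn n). scale_Rn n r x \<in> ?S r} = ?S 1"
  proof -
    have "scale_Rn n r x \<in> ?S r \<longleftrightarrow> x \<in> ?S 1" if "x \<in> space (Rn n)" for x
    proof -
      have n1: "pnorm n p (scale_Rn n r x) = r * pnorm n p x"
        using p r by (intro pnorm_scale) auto
      have "normalize_p n p (scale_Rn n r x) = normalize_p n p x"
        using r unfolding normalize_p_def n1 by (auto simp: scale_Rn_def fun_eq_iff)
      moreover have "scale_Rn n r x \<in> space (Rn n)"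
        by (simp add: scale_Rn_def space_Rn)
      moreover have "0 < r * pnorm n p x \<longleftrightarrow> 0 < pnorm n p x" "r * pnorm n p x \<le> r \<longleftrightarrow> pnorm n p x \<le> 1"
        using r by (simp_all add: zero_less_mult_iff)
      ultimately show ?thesis
        using that by (simp only: mem_Collect_eq n1 simp_thms)
    qed
    then show ?thesis
    proof (intro set_eqI)
      fix x
      assume *: "\<And>x. x \<in> space (Rn n) \<Longrightarrow> scale_Rn n r x \<in> ?S r \<longleftrightarrow> x \<in> ?S 1"
      have "x \<in> ?S 1 \<Longrightarrow> x \<in> space (Rn n)" by (drule CollectD) (erule conjunct1)
      then show "x \<in> {x \<in> space (Rn n). scale_Rn n r x \<in> ?S r} \<longleftrightarrow> x \<in> ?S 1"
        using *[of x] by (subst mem_Collect_eq) argo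
    qed
  qed
  finally show ?thesis unfolding 1[symmetric] .
qed

lemma cone_measure_basic:
  assumes n: "n \<ge> 1" and p: "p > 0"
  shows "sets (cone_measure n p) = sets (Rn n)" "emeasure (cone_measure n p) (space (Rn n)) = 1"
    "prob_space (cone_measure n p)"
proof -
  show sC: "sets (cone_measure n p) = sets (Rn n)"
    by (simp add: cone_measure_def sets.space_closed sets.sigma_sets_eq)
  let ?L = "lebesgue_Rn n"
  have "{y \<in> space (Rn n). 0 < pnorm n p y \<and> pnorm n p y \<le> 1 \<and> normalize_p n p y \<in> space (Rn n)}
      = p_ball n p - {\<lambda>i\<in>{..<n}. 0}"
    using pnorm_eq_0_iff[OF p] pnorm_nonneg[of n p]
    by (auto simp: p_ball_def normalize_p_def scale_Rn_def[of n] space_Rn less_le)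
  moreover have "emeasure ?L (p_ball n p - {\<lambda>i\<in>{..<n}. 0}) = emeasure ?L (p_ball n p)"
    by (rule emeasure_Diff_null_set[OF null_sets_origin_lebesgue[OF n]]) (simp add: sets_lebesgue_Rn sets_p_ball)
  ultimately have "emeasure ?L (p_ball n p) = emeasure ?L (p_ball n p) * emeasure (cone_measure n p) (space (Rn n))"
    using emeasure_lebesgue_cone[OF n p sets.top, of 1] by simp
  then show 1: "emeasure (cone_measure n p) (space (Rn n)) = 1"
    using emeasure_p_ball[OF p n] ennreal_mult_cancel_left[of "emeasure ?L (p_ball n p)" 1]
    by (auto simp: infinity_ennreal_def)
  show "prob_space (cone_measure n p)"
    using 1 sets_eq_imp_space_eq[OF sC] by (intro prob_spaceI) simp
qed

text \<open>
  For a fixed set \<open>A\<close> of directions, \<open>emeasure_lebesgue_cone\<close> gives the distribution function of the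
  norm, hence its law. Taking \<open>A\<close> as a parameter rather than stating an equality of product measures
  is enough for all later uses.
\<close>

lemma polar_nn_integral:
  assumes n: "n \<ge> 1" and p: "p > 0" and A: "A \<in> sets (Rn n)" and f [measurable]: "f \<in> borel_measurable borel"
  shows "(\<integral>\<^sup>+y. f (pnorm n p y) * indicator A (normalize_p n p y) \<partial>lebesgue_Rn n) =
    emeasure (lebesgue_Rn n) (p_ball n p) * emeasure (cone_measure n p) A *
      (\<integral>\<^sup>+r. f r * ennreal (real n * r ^ (n - 1)) * indicator {0<..} r \<partial>lborel)"
proof -
  let ?L = "lebesgue_Rn n"
  define V where "V = emeasure ?L (p_ball n p) * emeasure (cone_measure n p) A"
  interpret C: prob_space "cone_measure n p" by (rule cone_measure_basic(3)[OF n p])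
  have V: "V \<noteq> \<infinity>"
    using emeasure_p_ball[OF p n] C.emeasure_finite by (simp add: V_def ennreal_mult_eq_top_iff)
  note measurable_lebesgue_Rn_cong[simp]
  have nA [measurable]: "(\<lambda>y. indicator A (normalize_p n p y) :: ennreal) \<in> borel_measurable ?L"
    using A by simp measurable
  have pm [measurable]: "pnorm n p \<in> borel_measurable ?L" by simp
  have "distr (density ?L (\<lambda>y. indicator A (normalize_p n p y))) borel (pnorm n p) =
    density lborel (\<lambda>r. V * (ennreal (real n * r ^ (n - 1)) * indicator {0<..} r))" (is "?M = ?N")
  proof (rule measure_eqI_generator_eq[where E="range atMost" and \<Omega>=UNIV and A="\<lambda>i. {..real i}"])
    have Mr: "emeasure ?M {..r} = (if r > 0 then ennreal (r ^ n) * V else 0)" for r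
    proof -
      let ?B = "{y \<in> space (Rn n). 0 < pnorm n p y \<and> pnorm n p y \<le> r \<and> normalize_p n p y \<in> A}"
      let ?Z = "{\<lambda>i\<in>{..<n}. 0::real}"
      have Bs: "?B \<in> sets (Rn n)" using A by measurable
      have sL: "pnorm n p -` {..r} \<inter> space ?L \<in> sets ?L"
        by measurable
      have "emeasure ?M {..r} = (\<integral>\<^sup>+y. indicator A (normalize_p n p y) * indicator (pnorm n p -` {..r} \<inter> space ?L) y \<partial>?L)"
        by (subst emeasure_distr) (simp_all add: emeasure_density[OF nA sL])
      also have "\<dots> = (\<integral>\<^sup>+y. indicator ?B y \<partial>?L)"
      proof (rule nn_integral_cong_AE)
        have "AE y in ?L. y \<notin> ?Z"
          using null_sets_origin_lebesgue[OF n] by (rule AE_not_in)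
        then show "AE y in ?L. indicator A (normalize_p n p y) * indicator (pnorm n p -` {..r} \<inter> space ?L) y = (indicator ?B y :: ennreal)"
          using AE_space
        proof eventually_elim
          case (elim y)
          then have "0 < pnorm n p y"
            using pnorm_eq_0_iff[OF p, of y n] pnorm_nonneg[of n p y] by (auto simp: space_lebesgue_Rn less_le)
          then show ?case using elim(2) by (auto simp: indicator_def space_lebesgue_Rn)
        qed
      qed
      also have "\<dots> = emeasure ?L ?B"
        using Bs by (simp add: sets_lebesgue_Rn)
      also have "\<dots> = (if r > 0 then ennreal (r ^ n) * V else 0)"
      proof (cases "r > 0")
        case True
        then show ?thesis using emeasure_lebesgue_cone[OF n p A True] by (simp add: V_def)
      next
        case False
        then have "?B = {}" by auto
        then show ?thesis using False by (metis emeasure_empty)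
      qed
      finally show ?thesis .
    qed
    have Nr: "emeasure ?N {..r} = (if r > 0 then ennreal (r ^ n) * V else 0)" for r
    proof -
      have "emeasure ?N {..r} = (\<integral>\<^sup>+x. V * (ennreal (real n * x ^ (n - 1)) * indicator {0<..} x) * indicator {..r} x \<partial>lborel)"
        by (subst emeasure_density) auto
      also have "\<dots> = V * (\<integral>\<^sup>+x. ennreal (real n * x ^ (n - 1)) * indicator {0<..r} x \<partial>lborel)"
        by (subst nn_integral_cmult[symmetric]) (auto intro!: nn_integral_cong simp: indicator_def)
      also have "(\<integral>\<^sup>+x. ennreal (real n * x ^ (n - 1)) * indicator {0<..r} x \<partial>lborel) = (if r > 0 then ennreal (r ^ n) else 0)"
      proof (cases "r > 0")
        case True
        have "(\<integral>\<^sup>+x. ennreal (real n * x ^ (n - 1)) * indicator {0<..r} x \<partial>lborel) =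
          (\<integral>\<^sup>+x. ennreal (real n * x ^ (n - 1)) * indicator {0..r} x \<partial>lborel)"
          by (rule nn_integral_cong_AE) (use AE_lborel_singleton[of "0::real"] in eventually_elim, auto simp: indicator_def)
        also have "\<dots> = r ^ n - 0 ^ n"
          using True by (intro nn_integral_FTC_Icc) (auto intro!: derivative_eq_intros)
        finally show ?thesis using True n by (simp add: zero_power)
      qed (auto simp: indicator_def)
      finally show ?thesis by (simp add: mult.commute)
    qed
    show "emeasure ?M X = emeasure ?N X" if "X \<in> range atMost" for X
      using that Mr Nr by auto
    show "emeasure ?M {..real i} \<noteq> \<infinity>" for i
      using V by (simp add: Mr ennreal_mult_eq_top_iff)
    show "(\<Union>i. {..real i}) = (UNIV :: real set)"
      using real_arch_simple by auto
    show "sets ?M = sigma_sets UNIV (range atMost)" "sets ?N = sigma_sets UNIV (range atMost)"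
      by (simp_all add: borel_eq_atMost)
    show "Int_stable (range (atMost :: real \<Rightarrow> real set))"
      by (auto simp: Int_stable_def)
  qed auto
  then have "(\<integral>\<^sup>+r. f r \<partial>?M) = (\<integral>\<^sup>+r. f r \<partial>?N)" by simp
  moreover have "(\<integral>\<^sup>+r. f r \<partial>?M) = (\<integral>\<^sup>+y. f (pnorm n p y) * indicator A (normalize_p n p y) \<partial>?L)"
  proof -
    have "(\<integral>\<^sup>+r. f r \<partial>?M) = (\<integral>\<^sup>+y. f (pnorm n p y) \<partial>density ?L (\<lambda>y. indicator A (normalize_p n p y)))"
      by (rule nn_integral_distr) (auto simp: pm)
    also have "\<dots> = (\<integral>\<^sup>+y. indicator A (normalize_p n p y) * f (pnorm n p y) \<partial>?L)"
      by (rule nn_integral_density[OF nA]) measurable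
    finally show ?thesis by (simp only: mult.commute)
  qed
  moreover have "(\<integral>\<^sup>+r. f r \<partial>?N) = V * (\<integral>\<^sup>+r. f r * ennreal (real n * r ^ (n - 1)) * indicator {0<..} r \<partial>lborel)"
    by (subst nn_integral_density) (auto simp: nn_integral_cmult[symmetric] mult_ac intro!: nn_integral_cong)
  ultimately show ?thesis by (simp add: V_def)
qed


section \<open>Generalized Gaussian vectors\<close>

lemma Gamma_plus1_pos:
  assumes "(a::real) > 0"
  shows "Gamma (a + 1) = a * Gamma a"
proof -
  have "a \<notin> \<int>\<^sub>\<le>\<^sub>0" using assms by (auto elim!: nonpos_Ints_cases)
  then show ?thesis by (rule Gamma_plus1)
qed

text \<open>
  Used twice: for the moments of the generalized Gaussian density and for the total mass of the radial
  density of \<open>P_dist\<close>, whose integrand is the Gamma integrand in another variable.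
\<close>

lemma Gamma_integral_change_of_variables:
  fixes a :: real and g :: "real \<Rightarrow> real"
  assumes a: "a > 0" and S: "S \<in> sets lebesgue"
    and der: "\<And>x. x \<in> S \<Longrightarrow> (g has_field_derivative g' x) (at x within S)"
    and inj: "inj_on g S" and im: "g ` S = {0<..}"
  shows "((\<lambda>x. \<bar>g' x\<bar> * (g x powr (a - 1) / exp (g x))) has_integral Gamma a) S"
proof -
  define f where "f t = t powr (a - 1) / exp t" for t :: real
  have f: "(f has_integral Gamma a) {0<..}"
  proof -
    have "(f has_integral Gamma a) {0..}"
      unfolding f_def by (rule Gamma_integral_real[OF a])
    then have "((\<lambda>t. if t \<in> {0<..} then f t else 0) has_integral Gamma a) {0..}"
      by (rule has_integral_spike[of "{0}", rotated 2]) auto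
    also have "?this = ?thesis"
      by (subst has_integral_restrict) auto
    finally show ?thesis .
  qed
  have f_abs: "f absolutely_integrable_on {0<..}"
    using f by (intro nonnegative_absolutely_integrable_1) (auto simp: f_def)
  have "(\<lambda>x. \<bar>g' x\<bar> * f (g x)) absolutely_integrable_on S \<and>
        integral S (\<lambda>x. \<bar>g' x\<bar> * f (g x)) = Gamma a"
    by (subst has_absolute_integral_change_of_variables_1'[OF S der inj])
       (use f_abs f im in \<open>auto simp: integral_unique\<close>)
  then have "((\<lambda>x. \<bar>g' x\<bar> * f (g x)) has_integral Gamma a) S"
    by (metis absolutely_integrable_on_def integrable_integral)
  then show ?thesis by (simp add: f_def)
qed

lemma Gamma_nn_integral_powr:
  fixes a c p :: real
  assumes a: "a > 0" and p: "p > 0" and c: "c > 0"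
  shows "(\<integral>\<^sup>+x. ennreal (indicator {0<..} x * (x powr (a - 1) * exp (- c * x powr p))) \<partial>lborel) =
    ennreal (Gamma (a / p) / (p * c powr (a / p)))"
proof -
  define f where "f t = t powr (a / p - 1) / exp t" for t :: real
  define g where "g x = c * x powr p" for x :: real
  define g' where "g' x = c * (p * x powr (p - 1))" for x :: real
  have ap: "a / p > 0" using a p by simp
  have im: "g ` {0<..} = {0<..}"
  proof (intro equalityI subsetI)
    fix y :: real assume "y \<in> {0<..}"
    then have "y = g ((y / c) powr (1 / p))" "(y / c) powr (1 / p) \<in> {0<..}"
      using p c by (auto simp: g_def powr_powr)
    then show "y \<in> g ` {0<..}" by blast
  qed (use c in \<open>auto simp: g_def\<close>)
  have inj: "inj_on g {0<..}"
    by (rule inj_on_inverseI[where g="\<lambda>y. (y / c) powr (1 / p)"]) (use c p in \<open>auto simp: g_def powr_powr\<close>)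
  have der: "(g has_field_derivative g' x) (at x within {0<..})" if "x \<in> {0<..}" for x
    using that unfolding g_def g'_def by (auto intro!: derivative_eq_intros)
  have "((\<lambda>x. \<bar>g' x\<bar> * f (g x)) has_integral Gamma (a / p)) {0<..}"
    unfolding f_def by (rule Gamma_integral_change_of_variables[OF ap _ der inj im]) auto
  then have "((\<lambda>x. (p * c powr (a / p)) * (x powr (a - 1) * exp (- c * x powr p))) has_integral Gamma (a / p)) {0<..}"
  proof (rule has_integral_eq[rotated])
    fix x :: real assume "x \<in> {0<..}"
    then have x: "x > 0" by simp
    have "\<bar>g' x\<bar> * f (g x) = c * p * x powr (p - 1) * (c powr (a / p - 1) * (x powr p) powr (a / p - 1)) * exp (- (c * x powr p))"
      using x c p by (simp add: g'_def f_def g_def powr_mult exp_minus field_simps)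
    also have "(x powr p) powr (a / p - 1) = x powr (a - p)"
    proof -
      have "p * (a / p - 1) = a - p" using p by (simp add: right_diff_distrib)
      then show ?thesis by (simp only: powr_powr)
    qed
    also have "c * p * x powr (p - 1) * (c powr (a / p - 1) * x powr (a - p)) =
        p * (c powr 1 * c powr (a / p - 1)) * (x powr (p - 1) * x powr (a - p))"
      using c by simp
    also have "\<dots> = p * c powr (a / p) * x powr (a - 1)"
      unfolding powr_add[symmetric] by simp
    finally show "\<bar>g' x\<bar> * f (g x) = (p * c powr (a / p)) * (x powr (a - 1) * exp (- c * x powr p))"
      by simp
  qed
  then have "((\<lambda>x. inverse (p * c powr (a / p)) * ((p * c powr (a / p)) * (x powr (a - 1) * exp (- c * x powr p))))
     has_integral inverse (p * c powr (a / p)) * Gamma (a / p)) {0<..}"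
    by (rule has_integral_mult_right)
  then have "((\<lambda>x. x powr (a - 1) * exp (- c * x powr p)) has_integral Gamma (a / p) / (p * c powr (a / p))) {0<..}"
    using p c by (simp add: field_simps)
  from nn_integral_has_integral_lebesgue[OF _ this] show ?thesis by simp
qed

lemma nn_integral_lborel_even:
  fixes f :: "real \<Rightarrow> ennreal"
  assumes [measurable]: "f \<in> borel_measurable borel"
  shows "(\<integral>\<^sup>+x. f \<bar>x\<bar> \<partial>lborel) = 2 * (\<integral>\<^sup>+x. indicator {0<..} x * f x \<partial>lborel)"
proof -
  have "(\<integral>\<^sup>+x. f \<bar>x\<bar> \<partial>lborel) = (\<integral>\<^sup>+x. indicator {0<..} x * f x + indicator {0<..} (-x) * f (-x) \<partial>lborel)"
    by (rule nn_integral_cong_AE) (use AE_lborel_singleton[of "0::real"] in eventually_elim, auto simp: indicator_def)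
  also have "\<dots> = (\<integral>\<^sup>+x. indicator {0<..} x * f x \<partial>lborel) + (\<integral>\<^sup>+x. indicator {0<..} (-x) * f (-x) \<partial>lborel)"
    by (rule nn_integral_add) auto
  also have "(\<integral>\<^sup>+x. indicator {0<..} (-x) * f (-x) \<partial>lborel) = (\<integral>\<^sup>+x. indicator {0<..} x * f x \<partial>lborel)"
    by (subst nn_integral_real_affine[of "\<lambda>x. indicator {0<..} x * f x" "-1" 0]) auto
  finally show ?thesis by (simp add: mult_2)
qed

definition gauss_p_norm :: "real \<Rightarrow> real" where
  "gauss_p_norm p = 2 * p powr (1 / p - 1) * Gamma (1 / p)"

definition gauss_p_density :: "real \<Rightarrow> real \<Rightarrow> real" where
  "gauss_p_density p x = exp (- (\<bar>x\<bar> powr p / p)) / gauss_p_norm p"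

definition gauss_p :: "real \<Rightarrow> real measure" where
  "gauss_p p = density lborel (\<lambda>x. ennreal (gauss_p_density p x))"

definition gauss_p_vec :: "nat \<Rightarrow> real \<Rightarrow> (nat \<Rightarrow> real) measure" where
  "gauss_p_vec n p = Pi\<^sub>M {..<n} (\<lambda>_. gauss_p p)"

lemma gauss_p_norm_pos: "p > 0 \<Longrightarrow> gauss_p_norm p > 0"
  by (simp add: gauss_p_norm_def Gamma_real_pos)

lemma sets_gauss_p [measurable_cong, simp]: "sets (gauss_p p) = sets borel"
  and space_gauss_p [simp]: "space (gauss_p p) = UNIV"
  by (simp_all add: gauss_p_def)

text \<open>
  The exponential factor with \<open>c > 0\<close> provides the exponential moments, \<open>c = 0\<close> the absolute moments.
\<close>

lemma gauss_p_nn_integral_powr: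
  assumes p: "p > 0" and q: "q \<ge> 0" and c: "c < 1 / p"
  shows "(\<integral>\<^sup>+x. ennreal (\<bar>x\<bar> powr q * exp (c * \<bar>x\<bar> powr p)) \<partial>gauss_p p) =
    ennreal (2 * Gamma ((q + 1) / p) / (p * (1 / p - c) powr ((q + 1) / p)) / gauss_p_norm p)"
proof -
  let ?Z = "gauss_p_norm p"
  have Z: "?Z > 0" by (rule gauss_p_norm_pos[OF p])
  define f where "f x = ennreal (inverse ?Z) * ennreal (x powr q * exp (- (1 / p - c) * x powr p))" for x
  have "(\<integral>\<^sup>+x. ennreal (\<bar>x\<bar> powr q * exp (c * \<bar>x\<bar> powr p)) \<partial>gauss_p p) = (\<integral>\<^sup>+x. f \<bar>x\<bar> \<partial>lborel)"
    unfolding gauss_p_def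
  proof (subst nn_integral_density)
    show "(\<integral>\<^sup>+x. ennreal (gauss_p_density p x) * ennreal (\<bar>x\<bar> powr q * exp (c * \<bar>x\<bar> powr p)) \<partial>lborel) = (\<integral>\<^sup>+x. f \<bar>x\<bar> \<partial>lborel)"
    proof (rule nn_integral_cong)
      fix x :: real
      have "exp (- (\<bar>x\<bar> powr p / p)) * exp (c * \<bar>x\<bar> powr p) = exp (- (1 / p - c) * \<bar>x\<bar> powr p)"
        unfolding exp_add[symmetric] by (simp add: algebra_simps)
      then have "gauss_p_density p x * (\<bar>x\<bar> powr q * exp (c * \<bar>x\<bar> powr p)) =
          inverse ?Z * (\<bar>x\<bar> powr q * exp (- (1 / p - c) * \<bar>x\<bar> powr p))"
        by (simp add: gauss_p_density_def field_simps)
      then show "ennreal (gauss_p_density p x) * ennreal (\<bar>x\<bar> powr q * exp (c * \<bar>x\<bar> powr p)) = f \<bar>x\<bar>"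
        using Z unfolding f_def by (simp add: ennreal_mult'[symmetric] gauss_p_density_def)
    qed
  qed (auto simp: gauss_p_density_def)
  also have "\<dots> = 2 * (\<integral>\<^sup>+x. indicator {0<..} x * f x \<partial>lborel)"
    by (rule nn_integral_lborel_even) (simp add: f_def)
  also have "(\<integral>\<^sup>+x. indicator {0<..} x * f x \<partial>lborel) =
    (\<integral>\<^sup>+x. ennreal (inverse ?Z) * ennreal (indicator {0<..} x * (x powr ((q + 1) - 1) * exp (- (1 / p - c) * x powr p))) \<partial>lborel)"
    by (rule nn_integral_cong) (simp add: f_def indicator_def)
  also have "\<dots> = ennreal (inverse ?Z) * ennreal (Gamma ((q + 1) / p) / (p * (1 / p - c) powr ((q + 1) / p)))"
    by (subst nn_integral_cmult) (use Gamma_nn_integral_powr[of "q + 1" p "1 / p - c"] p q c in auto)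
  also have "2 * \<dots> = ennreal (2 * (inverse ?Z * (Gamma ((q + 1) / p) / (p * (1 / p - c) powr ((q + 1) / p)))))"
    using Z p q by (simp add: ennreal_mult'[symmetric] Gamma_real_pos less_imp_le flip: ennreal_numeral)
  finally show ?thesis by (simp add: field_simps)
qed

lemma gauss_p_abs_moment:
  assumes p: "p > 0" and q: "q \<ge> 0"
  shows "integrable (gauss_p p) (\<lambda>x. \<bar>x\<bar> powr q)"
    and "(\<integral>x. \<bar>x\<bar> powr q \<partial>gauss_p p) = p powr (q / p) * Gamma ((q + 1) / p) / Gamma (1 / p)"
proof -
  define R where "R = 2 * Gamma ((q + 1) / p) / (p * (1 / p) powr ((q + 1) / p)) / gauss_p_norm p"
  have pos: "Gamma (1 / p) > 0" "Gamma ((q + 1) / p) > 0"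
    using p q by (auto intro!: Gamma_real_pos)
  have "R = p powr (q / p) * Gamma ((q + 1) / p) / Gamma (1 / p)"
  proof -
    have "p powr (q / p) * (p * (1 / p) powr ((q + 1) / p) * p powr (1 / p - 1)) = 1"
    proof -
      have "(1 / p) powr ((q + 1) / p) = p powr (- ((q + 1) / p))"
        using p by (simp add: powr_minus divide_inverse inverse_powr)
      then have "p powr (q / p) * (p * (1 / p) powr ((q + 1) / p) * p powr (1 / p - 1)) =
        p powr (q / p) * (p powr 1 * p powr (- ((q + 1) / p)) * p powr (1 / p - 1))"
        using p by simp
      also have "\<dots> = p powr (q / p + (1 + - ((q + 1) / p) + (1 / p - 1)))"
        by (simp only: powr_add)
      also have "q / p + (1 + - ((q + 1) / p) + (1 / p - 1)) = 0"
        by (simp add: add_divide_distrib)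
      finally show ?thesis using p by simp
    qed
    moreover have "2 * G / B / (2 * D * G1) = C * G / G1" if "C * (B * D) = 1" for B C D G G1 :: real
    proof -
      have "B \<noteq> 0" "D \<noteq> 0" using that by auto
      have "2 * G / B / (2 * D * G1) = (1 * G) / ((B * D) * G1)" by simp
      also have "\<dots> = (C * (B * D) * G) / ((B * D) * G1)" by (simp only: that)
      also have "\<dots> = C * G / G1" using \<open>B \<noteq> 0\<close> \<open>D \<noteq> 0\<close> by simp
      finally show ?thesis .
    qed
    ultimately show ?thesis
      unfolding R_def gauss_p_norm_def by blast
  qed note R = this
  have R0: "R \<ge> 0" unfolding R using pos by simp
  have nn: "(\<integral>\<^sup>+x. ennreal (\<bar>x\<bar> powr q) \<partial>gauss_p p) = ennreal R"
    using gauss_p_nn_integral_powr[OF p q, of 0] p by (simp add: R_def)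
  show "integrable (gauss_p p) (\<lambda>x. \<bar>x\<bar> powr q)"
    by (rule integrableI_nn_integral_finite[OF _ _ nn]) (use R0 in auto)
  show "(\<integral>x. \<bar>x\<bar> powr q \<partial>gauss_p p) = p powr (q / p) * Gamma ((q + 1) / p) / Gamma (1 / p)"
    unfolding R[symmetric] by (rule integral_eq_nn_integral[of "\<lambda>x. \<bar>x\<bar> powr q", THEN trans]) (use nn R0 in auto)
qed

lemma prob_space_gauss_p:
  assumes p: "p > 0"
  shows "prob_space (gauss_p p)"
proof
  have pos: "Gamma (1 / p) > 0" using p by (auto intro!: Gamma_real_pos)
  have "emeasure (gauss_p p) (space (gauss_p p)) = (\<integral>\<^sup>+x. 1 \<partial>gauss_p p)" by simp
  also have "\<dots> = (\<integral>\<^sup>+x. ennreal (\<bar>x\<bar> powr 0) \<partial>gauss_p p)"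
  proof (rule nn_integral_cong_AE)
    have "AE x in gauss_p p. x \<noteq> 0"
      unfolding gauss_p_def using AE_lborel_singleton[of "0::real"]
      by (subst AE_density) (auto simp: gauss_p_density_def)
    then show "AE x in gauss_p p. 1 = ennreal (\<bar>x\<bar> powr 0)" by eventually_elim simp
  qed
  also have "\<dots> = ennreal (\<integral>x. \<bar>x\<bar> powr 0 \<partial>gauss_p p)"
    by (rule nn_integral_eq_integral[OF gauss_p_abs_moment(1)[OF p]]) auto
  also have "\<dots> = 1" unfolding gauss_p_abs_moment(2)[OF p order_refl] using p less_imp_neq[OF pos] by simp
  finally show "emeasure (gauss_p p) (space (gauss_p p)) = 1" .
qed

lemma sets_gauss_p_vec: "sets (gauss_p_vec n p) = sets (Rn n)"
  unfolding gauss_p_vec_def Rn_def by (intro sets_PiM_cong) auto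

lemma prob_space_gauss_p_vec: "p > 0 \<Longrightarrow> prob_space (gauss_p_vec n p)"
  unfolding gauss_p_vec_def by (intro prob_space_PiM prob_space_gauss_p)

lemma gauss_p_vec_density:
  assumes p: "p > 0"
  shows "gauss_p_vec n p = density (lebesgue_Rn n) (\<lambda>y. ennreal (exp (- (pnorm n p y powr p / p)) / gauss_p_norm p ^ n))"
proof -
  interpret G: prob_space "gauss_p p" by (rule prob_space_gauss_p[OF p])
  interpret G: product_sigma_finite "\<lambda>_::nat. gauss_p p" by standard
  interpret L: product_sigma_finite "\<lambda>_::nat. lborel :: real measure" by standard
  have [measurable]: "gauss_p_density p \<in> borel_measurable borel"
    by (simp add: gauss_p_density_def[abs_def])
  have dens: "exp (- (pnorm n p y powr p / p)) / gauss_p_norm p ^ n = (\<Prod>i<n. gauss_p_density p (y i))" for y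
    by (simp add: pnorm_powr[OF p] gauss_p_density_def prod_dividef exp_sum[symmetric] sum_negf sum_divide_distrib)
  have nonneg: "gauss_p_density p x \<ge> 0" for x
    using gauss_p_norm_pos[OF p] by (simp add: gauss_p_density_def)
  have "density (lebesgue_Rn n) (\<lambda>y. ennreal (exp (- (pnorm n p y powr p / p)) / gauss_p_norm p ^ n)) = Pi\<^sub>M {..<n} (\<lambda>_. gauss_p p)"
  proof (rule G.PiM_eqI)
    fix A :: "nat \<Rightarrow> real set" assume A: "\<And>i. i \<in> {..<n} \<Longrightarrow> A i \<in> sets (gauss_p p)"
    have As: "Pi\<^sub>E {..<n} A \<in> sets (lebesgue_Rn n)"
      unfolding lebesgue_Rn_def using A by (intro sets_PiM_I_finite) auto
    have "emeasure (density (lebesgue_Rn n) (\<lambda>y. ennreal (exp (- (pnorm n p y powr p / p)) / gauss_p_norm p ^ n))) (Pi\<^sub>E {..<n} A)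
      = (\<integral>\<^sup>+y. ennreal (exp (- (pnorm n p y powr p / p)) / gauss_p_norm p ^ n) * indicator (Pi\<^sub>E {..<n} A) y \<partial>lebesgue_Rn n)"
      by (rule emeasure_density[OF _ As]) (simp add: measurable_lebesgue_Rn_cong)
    also have "\<dots> = (\<integral>\<^sup>+y. (\<Prod>i<n. ennreal (gauss_p_density p (y i)) * indicator (A i) (y i)) \<partial>lebesgue_Rn n)"
    proof (rule nn_integral_cong)
      fix y assume "y \<in> space (lebesgue_Rn n)"
      then have "indicator (Pi\<^sub>E {..<n} A) y = (\<Prod>i<n. indicator (A i) (y i) :: ennreal)"
        by (auto simp: space_lebesgue_Rn space_Rn indicator_def PiE_iff prod_zero_iff)
      then show "ennreal (exp (- (pnorm n p y powr p / p)) / gauss_p_norm p ^ n) * indicator (Pi\<^sub>E {..<n} A) y =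
        (\<Prod>i<n. ennreal (gauss_p_density p (y i)) * indicator (A i) (y i))"
        unfolding dens using nonneg by (simp add: prod.distrib prod_ennreal)
    qed
    also have "\<dots> = (\<Prod>i<n. \<integral>\<^sup>+x. ennreal (gauss_p_density p x) * indicator (A i) x \<partial>lborel)"
      unfolding lebesgue_Rn_def
    proof (rule L.product_nn_integral_prod)
      fix i assume "i \<in> {..<n}"
      then have [measurable]: "A i \<in> sets borel" using A by simp
      show "(\<lambda>x. ennreal (gauss_p_density p x) * indicator (A i) x) \<in> borel_measurable lborel"
        by simp
    qed simp
    also have "\<dots> = (\<Prod>i<n. emeasure (gauss_p p) (A i))"
      using A unfolding gauss_p_def by (intro prod.cong refl emeasure_density[symmetric]) auto
    finally show "emeasure (density (lebesgue_Rn n) (\<lambda>y. ennreal (exp (- (pnorm n p y powr p / p)) / gauss_p_norm p ^ n))) (Pi\<^sub>E {..<n} A)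
       = (\<Prod>i\<in>{..<n}. emeasure (gauss_p p) (A i))" .
  qed (simp_all add: sets_lebesgue_Rn gauss_p_vec_def[symmetric] sets_gauss_p_vec)
  then show ?thesis by (simp add: gauss_p_vec_def)
qed

text \<open>
  The density depends on the \<open>p\<close>-norm only, so in polar coordinates norm and direction are independent.
\<close>

lemma gauss_p_vec_polar:
  assumes n: "n \<ge> 1" and p: "p > 0" and A: "A \<in> sets (Rn n)" and f [measurable]: "f \<in> borel_measurable borel"
  shows "(\<integral>\<^sup>+y. f (pnorm n p y) * indicator A (normalize_p n p y) \<partial>gauss_p_vec n p) =
    emeasure (cone_measure n p) A * (\<integral>\<^sup>+y. f (pnorm n p y) \<partial>gauss_p_vec n p)"
proof -
  define h where "h r = ennreal (exp (- (r powr p / p)) / gauss_p_norm p ^ n) * f r" for r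
  have h [measurable]: "h \<in> borel_measurable borel" by (simp add: h_def[abs_def])
  have *: "(\<integral>\<^sup>+y. f (pnorm n p y) * indicator A (normalize_p n p y) \<partial>gauss_p_vec n p) =
      (\<integral>\<^sup>+y. h (pnorm n p y) * indicator A (normalize_p n p y) \<partial>lebesgue_Rn n)" if [measurable]: "A \<in> sets (Rn n)" for A
    unfolding gauss_p_vec_density[OF p]
    by (subst nn_integral_density) (auto simp: measurable_lebesgue_Rn_cong h_def mult_ac)
  define V where "V = emeasure (lebesgue_Rn n) (p_ball n p) *
      (\<integral>\<^sup>+r. h r * ennreal (real n * r ^ (n - 1)) * indicator {0<..} r \<partial>lborel)"
  have V: "(\<integral>\<^sup>+y. f (pnorm n p y) * indicator A (normalize_p n p y) \<partial>gauss_p_vec n p) =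
      emeasure (cone_measure n p) A * V" if "A \<in> sets (Rn n)" for A
    unfolding *[OF that] polar_nn_integral[OF n p that h] V_def by (simp add: mult_ac)
  have "(\<integral>\<^sup>+y. f (pnorm n p y) \<partial>gauss_p_vec n p) =
      (\<integral>\<^sup>+y. f (pnorm n p y) * indicator (space (Rn n)) (normalize_p n p y) \<partial>gauss_p_vec n p)"
    by (intro nn_integral_cong) (simp add: normalize_p_def scale_Rn_def space_Rn)
  also have "\<dots> = V"
    unfolding V[OF sets.top] cone_measure_basic(2)[OF n p] by simp
  finally show ?thesis by (simp only: V[OF A])
qed

lemma gauss_p_vec_normalize:
  assumes n: "n \<ge> 1" and p: "p > 0"
  shows "distr (gauss_p_vec n p) (Rn n) (normalize_p n p) = cone_measure n p"
proof (rule measure_eqI)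
  interpret prob_space "gauss_p_vec n p" by (rule prob_space_gauss_p_vec[OF p])
  fix A assume "A \<in> sets (distr (gauss_p_vec n p) (Rn n) (normalize_p n p))"
  then have A: "A \<in> sets (Rn n)" by simp
  have m: "normalize_p n p \<in> gauss_p_vec n p \<rightarrow>\<^sub>M Rn n"
    using measurable_normalize_p measurable_cong_sets[OF sets_gauss_p_vec refl] by blast
  have "emeasure (distr (gauss_p_vec n p) (Rn n) (normalize_p n p)) A =
      (\<integral>\<^sup>+y. indicator A y \<partial>distr (gauss_p_vec n p) (Rn n) (normalize_p n p))"
    using A by simp
  also have "\<dots> = (\<integral>\<^sup>+y. 1 * indicator A (normalize_p n p y) \<partial>gauss_p_vec n p)"
    using A by (subst nn_integral_distr[OF m]) auto
  also have "\<dots> = emeasure (cone_measure n p) A"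
    by (subst gauss_p_vec_polar[OF n p A]) (auto simp: emeasure_space_1)
  finally show "emeasure (distr (gauss_p_vec n p) (Rn n) (normalize_p n p)) A = emeasure (cone_measure n p) A" .
qed (simp add: cone_measure_basic(1)[OF n p])


section \<open>The Beta law of the squared length of a random projection\<close>

text \<open>
  Independence of norm and direction, now for a function of the direction.
\<close>

lemma gauss_p_vec_polar_fun:
  assumes n: "n \<ge> 1" and p: "p > 0"
    and f [measurable]: "f \<in> borel_measurable borel" and g: "g \<in> borel_measurable (Rn n)"
  shows "(\<integral>\<^sup>+y. f (pnorm n p y) * g (normalize_p n p y) \<partial>gauss_p_vec n p) =
    (\<integral>\<^sup>+y. g (normalize_p n p y) \<partial>gauss_p_vec n p) * (\<integral>\<^sup>+y. f (pnorm n p y) \<partial>gauss_p_vec n p)"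
proof -
  let ?G = "gauss_p_vec n p" and ?C = "cone_measure n p"
  have mG: "measurable ?G N = measurable (Rn n) N" for N :: "'x measure"
    by (rule measurable_cong_sets[OF sets_gauss_p_vec refl])
  have fm: "(\<lambda>y. f (pnorm n p y)) \<in> borel_measurable ?G"
    unfolding mG by measurable
  define F where "F = (\<integral>\<^sup>+y. f (pnorm n p y) \<partial>?G)"
  have nm: "normalize_p n p \<in> ?G \<rightarrow>\<^sub>M Rn n" unfolding mG by measurable
  have nm': "normalize_p n p \<in> density ?G (\<lambda>y. f (pnorm n p y)) \<rightarrow>\<^sub>M Rn n"
    using nm by simp
  have gC: "g \<in> borel_measurable ?C"
    using g measurable_cong_sets[OF cone_measure_basic(1)[OF n p] refl] by blast
  have "distr (density ?G (\<lambda>y. f (pnorm n p y))) (Rn n) (normalize_p n p) = density ?C (\<lambda>_. F)"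
  proof (rule measure_eqI)
    fix A assume "A \<in> sets (distr (density ?G (\<lambda>y. f (pnorm n p y))) (Rn n) (normalize_p n p))"
    then have A: "A \<in> sets (Rn n)" by simp
    have "emeasure (distr (density ?G (\<lambda>y. f (pnorm n p y))) (Rn n) (normalize_p n p)) A =
      (\<integral>\<^sup>+y. indicator A y \<partial>distr (density ?G (\<lambda>y. f (pnorm n p y))) (Rn n) (normalize_p n p))"
      using A by simp
    also have "\<dots> = (\<integral>\<^sup>+y. indicator A (normalize_p n p y) \<partial>density ?G (\<lambda>y. f (pnorm n p y)))"
      using A by (intro nn_integral_distr[OF nm']) auto
    also have "\<dots> = (\<integral>\<^sup>+y. f (pnorm n p y) * indicator A (normalize_p n p y) \<partial>?G)"
      by (rule nn_integral_density[OF fm]) (use A in \<open>unfold mG, measurable\<close>)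
    also have "\<dots> = emeasure ?C A * F"
      unfolding F_def by (rule gauss_p_vec_polar[OF n p A f])
    also have "\<dots> = emeasure (density ?C (\<lambda>_. F)) A"
      using A by (subst emeasure_density_const) (auto simp: cone_measure_basic(1)[OF n p] mult.commute)
    finally show "emeasure (distr (density ?G (\<lambda>y. f (pnorm n p y))) (Rn n) (normalize_p n p)) A
      = emeasure (density ?C (\<lambda>_. F)) A" .
  qed (simp add: cone_measure_basic(1)[OF n p])
  then have "(\<integral>\<^sup>+y. g y \<partial>distr (density ?G (\<lambda>y. f (pnorm n p y))) (Rn n) (normalize_p n p)) =
    (\<integral>\<^sup>+y. g y \<partial>density ?C (\<lambda>_. F))" by simp
  moreover have "(\<integral>\<^sup>+y. g y \<partial>distr (density ?G (\<lambda>y. f (pnorm n p y))) (Rn n) (normalize_p n p)) =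
     (\<integral>\<^sup>+y. f (pnorm n p y) * g (normalize_p n p y) \<partial>?G)"
  proof -
    have "(\<integral>\<^sup>+y. g y \<partial>distr (density ?G (\<lambda>y. f (pnorm n p y))) (Rn n) (normalize_p n p)) =
      (\<integral>\<^sup>+y. g (normalize_p n p y) \<partial>density ?G (\<lambda>y. f (pnorm n p y)))"
      by (rule nn_integral_distr[OF nm']) (use g in simp)
    also have "\<dots> = (\<integral>\<^sup>+y. f (pnorm n p y) * g (normalize_p n p y) \<partial>?G)"
      by (rule nn_integral_density[OF fm]) (use g in \<open>unfold mG, measurable\<close>)
    finally show ?thesis .
  qed
  moreover have "(\<integral>\<^sup>+y. g y \<partial>density ?C (\<lambda>_. F)) = (\<integral>\<^sup>+y. g y \<partial>?C) * F"
    by (subst nn_integral_density[OF _ gC]) (simp_all add: nn_integral_cmult[OF gC] mult.commute)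
  moreover have "(\<integral>\<^sup>+y. g y \<partial>?C) = (\<integral>\<^sup>+y. g (normalize_p n p y) \<partial>?G)"
    unfolding gauss_p_vec_normalize[OF n p, symmetric] by (rule nn_integral_distr[OF nm]) (use g in simp)
  ultimately show ?thesis by (simp add: F_def)
qed

text \<open>
  The product \<open>k (k + 2) \<dots> (k + 2 j - 2)\<close>, which is the moment of order \<open>j\<close> of the chi-square law with
  \<open>k\<close> degrees of freedom.
\<close>

definition double_rising :: "nat \<Rightarrow> nat \<Rightarrow> real" where
  "double_rising k j = (\<Prod>i<j. real k + 2 * real i)"

lemma double_rising_pos: "k \<ge> 1 \<Longrightarrow> double_rising k j > 0"
  unfolding double_rising_def by (intro prod_pos) auto

text \<open>
  In polar coordinates the moments are Gamma integrals up to a common factor, so the functional equation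
  of the Gamma function yields their quotients; the common factor is fixed by the total mass.
\<close>

lemma gaussian_norm_moment:
  assumes n: "n \<ge> 1"
  shows "(\<integral>\<^sup>+y. ennreal (pnorm n 2 y ^ (2 * j)) \<partial>gauss_p_vec n 2) = ennreal (double_rising n j)"
proof -
  interpret prob_space "gauss_p_vec n 2" by (rule prob_space_gauss_p_vec) simp
  define c where "c = 1 / gauss_p_norm 2 ^ n"
  have c: "c > 0" using gauss_p_norm_pos[of 2] by (simp add: c_def)
  define V where "V = emeasure (lebesgue_Rn n) (p_ball n 2)"
  define g where "g j = Gamma ((real n + 2 * real j) / 2) / (2 * (1 / 2) powr ((real n + 2 * real j) / 2))" for j
  have M: "(\<integral>\<^sup>+y. ennreal (pnorm n 2 y ^ (2 * j)) \<partial>gauss_p_vec n 2) = V * ennreal (c * real n) * ennreal (g j)" for j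
  proof -
    define f where "f r = ennreal (exp (- (r powr 2 / 2)) / gauss_p_norm 2 ^ n) * ennreal (r ^ (2 * j))" for r :: real
    have f: "f \<in> borel_measurable borel" by (simp add: f_def[abs_def])
    have "(\<integral>\<^sup>+y. ennreal (pnorm n 2 y ^ (2 * j)) \<partial>gauss_p_vec n 2) =
       (\<integral>\<^sup>+y. f (pnorm n 2 y) * indicator (space (Rn n)) (normalize_p n 2 y) \<partial>lebesgue_Rn n)"
      unfolding gauss_p_vec_density[of 2, simplified]
      by (subst nn_integral_density)
         (auto simp: measurable_lebesgue_Rn_cong f_def normalize_p_def scale_Rn_def space_Rn)
    also have "\<dots> = V * (\<integral>\<^sup>+r. f r * ennreal (real n * r ^ (n - 1)) * indicator {0<..} r \<partial>lborel)"
      using polar_nn_integral[OF n _ sets.top f, of 2] cone_measure_basic(2)[OF n, of 2] by (simp add: V_def)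
    also have "(\<integral>\<^sup>+r. f r * ennreal (real n * r ^ (n - 1)) * indicator {0<..} r \<partial>lborel) =
      (\<integral>\<^sup>+r. ennreal (c * real n) * ennreal (indicator {0<..} r * (r powr ((real n + 2 * real j) - 1) * exp (- (1 / 2) * r powr 2))) \<partial>lborel)"
    proof (rule nn_integral_cong)
      fix r :: real
      show "f r * ennreal (real n * r ^ (n - 1)) * indicator {0<..} r =
        ennreal (c * real n) * ennreal (indicator {0<..} r * (r powr ((real n + 2 * real j) - 1) * exp (- (1 / 2) * r powr 2)))"
      proof (cases "r > 0")
        case True
        have "r powr ((real n + 2 * real j) - 1) = r powr real (2 * j + (n - 1))"
          using n by (simp add: of_nat_diff add_ac diff_add_eq)
        also have "\<dots> = r ^ (2 * j) * r ^ (n - 1)"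
          by (simp only: powr_realpow[OF True] power_add)
        finally show ?thesis
          using True c gauss_p_norm_pos[of 2] unfolding f_def c_def
          by (simp add: ennreal_mult'[symmetric] field_simps)
      qed simp
    qed
    also have "\<dots> = ennreal (c * real n) * ennreal (g j)"
      by (subst nn_integral_cmult)
         (use Gamma_nn_integral_powr[of "real n + 2 * real j" 2 "1 / 2"] n in \<open>auto simp: g_def\<close>)
    finally show ?thesis by (simp add: mult.assoc)
  qed
  have gSuc: "g (Suc j) = (real n + 2 * real j) * g j" for j
  proof -
    define a where "a = (real n + 2 * real j) / 2"
    have a: "a > 0" using n by (simp add: a_def)
    have "(real n + 2 * real (Suc j)) / 2 = a + 1" by (simp add: a_def add_divide_distrib)
    then have "g (Suc j) = Gamma (a + 1) / (2 * (1 / 2) powr (a + 1))" by (simp only: g_def)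
    also have "\<dots> = (a * Gamma a) / (2 * ((1 / 2) powr a * (1 / 2)))"
      using Gamma_plus1_pos[OF a] by (simp add: powr_add)
    also have "\<dots> = (2 * a) * (Gamma a / (2 * (1 / 2) powr a))" by simp
    also have "\<dots> = (2 * a) * g j" by (simp only: g_def a_def)
    also have "2 * a = real n + 2 * real j" by (simp add: a_def)
    finally show ?thesis .
  qed
  show ?thesis
  proof (induction j)
    case 0
    show ?case by (simp add: double_rising_def emeasure_space_1)
  next
    case (Suc j)
    have "(\<integral>\<^sup>+y. ennreal (pnorm n 2 y ^ (2 * Suc j)) \<partial>gauss_p_vec n 2) =
      V * ennreal (c * real n) * ennreal ((real n + 2 * real j) * g j)"
      unfolding M gSuc ..
    also have "\<dots> = ennreal (real n + 2 * real j) * (V * ennreal (c * real n) * ennreal (g j))"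
    proof -
      have "ennreal ((real n + 2 * real j) * g j) = ennreal (real n + 2 * real j) * ennreal (g j)"
        by (rule ennreal_mult') simp
      then show ?thesis by (simp only: mult_ac)
    qed
    also have "\<dots> = ennreal (real n + 2 * real j) * ennreal (double_rising n j)"
      unfolding M[symmetric] Suc.IH ..
    also have "\<dots> = ennreal (double_rising n (Suc j))"
    proof -
      have "ennreal (real n + 2 * real j) * ennreal (double_rising n j) = ennreal ((real n + 2 * real j) * double_rising n j)"
        by (rule ennreal_mult'[symmetric]) simp
      then show ?thesis by (simp add: double_rising_def mult.commute)
    qed
    finally show ?case .
  qed
qed

lemma sum_squares_pnorm: "(\<Sum>i<k. (y i)\<^sup>2) ^ j = pnorm k 2 y ^ (2 * j)"
proof -
  have "pnorm k 2 y ^ 2 = (\<Sum>i<k. (y i)\<^sup>2)"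
    by (simp add: pnorm_2_eq dotp_self_nonneg) (simp add: dotp_def power2_eq_square)
  then show ?thesis by (simp add: power_mult)
qed

lemma gaussian_partial_moment:
  assumes k: "1 \<le> k" "k \<le> n"
  shows "(\<integral>\<^sup>+y. ennreal ((\<Sum>i<k. (y i)\<^sup>2) ^ j) \<partial>gauss_p_vec n 2) = ennreal (double_rising k j)"
proof -
  interpret G: prob_space "gauss_p 2" by (rule prob_space_gauss_p) simp
  interpret P: product_prob_space "\<lambda>_::nat. gauss_p 2" "{..<n}"
    by standard
  have r: "gauss_p_vec k 2 = distr (gauss_p_vec n 2) (gauss_p_vec k 2) (\<lambda>f. restrict f {..<k})"
    unfolding gauss_p_vec_def using k by (intro P.distr_restrict) auto
  have m: "(\<lambda>f. restrict f {..<k}) \<in> gauss_p_vec n 2 \<rightarrow>\<^sub>M gauss_p_vec k 2"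
    unfolding gauss_p_vec_def using k by (intro measurable_restrict_subset) auto
  have m2: "(\<lambda>y. ennreal (pnorm k 2 y ^ (2 * j))) \<in> borel_measurable (gauss_p_vec k 2)"
    unfolding measurable_cong_sets[OF sets_gauss_p_vec refl] by measurable
  have "ennreal (double_rising k j) = (\<integral>\<^sup>+y. ennreal (pnorm k 2 y ^ (2 * j)) \<partial>gauss_p_vec k 2)"
    using gaussian_norm_moment[OF k(1)] by simp
  also have "\<dots> = (\<integral>\<^sup>+y. ennreal (pnorm k 2 (restrict y {..<k}) ^ (2 * j)) \<partial>gauss_p_vec n 2)"
    by (subst r) (rule nn_integral_distr[OF m], use m2 in simp)
  also have "\<dots> = (\<integral>\<^sup>+y. ennreal ((\<Sum>i<k. (y i)\<^sup>2) ^ j) \<partial>gauss_p_vec n 2)"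
    unfolding sum_squares_pnorm[symmetric] by (intro nn_integral_cong) simp
  finally show ?thesis ..
qed

definition beta_ratio :: "nat \<Rightarrow> nat \<Rightarrow> (nat \<Rightarrow> real) \<Rightarrow> real" where
  "beta_ratio n k y = (\<Sum>i<k. (y i)\<^sup>2) / (\<Sum>i<n. (y i)\<^sup>2)"

lemma measurable_beta_ratio [measurable]: 
  assumes "k \<le> n"
  shows "beta_ratio n k \<in> borel_measurable (Rn n)"
proof -
  have [measurable]: "(\<lambda>x. x i) \<in> borel_measurable (Rn n)" if "i \<in> {..<n}" for i
    using that measurable_component_Rn by simp
  have [measurable]: "(\<lambda>x. x i) \<in> borel_measurable (Rn n)" if "i \<in> {..<k}" for i
    using that assms measurable_component_Rn by simp
  show ?thesis unfolding beta_ratio_def[abs_def] by measurable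
qed

lemma beta_ratio_bounds: "k \<le> n \<Longrightarrow> 0 \<le> beta_ratio n k y" "k \<le> n \<Longrightarrow> beta_ratio n k y \<le> 1"
proof -
  assume k: "k \<le> n"
  have "(\<Sum>i<k. (y i)\<^sup>2) \<le> (\<Sum>i<n. (y i)\<^sup>2)"
    using k by (intro sum_mono2) auto
  then show "beta_ratio n k y \<le> 1"
    unfolding beta_ratio_def by (intro divide_le_eq_1[THEN iffD2]) (auto simp: sum_nonneg less_le)
  show "0 \<le> beta_ratio n k y" unfolding beta_ratio_def by (intro divide_nonneg_nonneg sum_nonneg) auto
qed

text \<open>
  The numerator is the product of the ratio with the squared norm. These are independent, the ratio being
  a function of the direction, so its moments are quotients of chi-square moments.
\<close>

lemma beta_ratio_moment:
  assumes k: "1 \<le> k" "k \<le> n"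
  shows "(\<integral>y. beta_ratio n k y ^ j \<partial>gauss_p_vec n 2) = double_rising k j / double_rising n j"
proof -
  let ?G = "gauss_p_vec n 2"
  have n: "n \<ge> 1" using k by simp
  have mG: "measurable ?G N = measurable (Rn n) N" for N :: "'x measure"
    by (rule measurable_cong_sets[OF sets_gauss_p_vec refl])
  have bm: "(\<lambda>y. beta_ratio n k y ^ j) \<in> borel_measurable ?G"
    unfolding mG using k by measurable
  have [measurable]: "(\<lambda>x. x i) \<in> borel_measurable (Rn n)" if "i \<in> {..<k}" for i
    using that k measurable_component_Rn by simp
  define g where "g y = ennreal ((\<Sum>i<k. (y i)\<^sup>2) ^ j)" for y :: "nat \<Rightarrow> real"
  have g: "g \<in> borel_measurable (Rn n)"
    unfolding g_def by measurable
  have nz: "pnorm n 2 y \<noteq> 0 \<or> (\<forall>i<n. y i = 0)" for y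
    by (auto simp: pnorm_2_eq dotp_self_eq_0)
  have pn: "(\<Sum>i<n. (y i)\<^sup>2) = (pnorm n 2 y)\<^sup>2" for y
    using sum_squares_pnorm[of y n 1] by simp
  have gn: "g (normalize_p n 2 y) = ennreal (beta_ratio n k y ^ j)" for y
  proof -
    have "(\<Sum>i<k. (normalize_p n 2 y i)\<^sup>2) = (\<Sum>i<k. (inverse (pnorm n 2 y))\<^sup>2 * (y i)\<^sup>2)"
      using k by (intro sum.cong) (auto simp: normalize_p_def scale_Rn_def power_mult_distrib)
    also have "\<dots> = beta_ratio n k y"
      unfolding beta_ratio_def pn by (simp add: sum_distrib_left[symmetric] power_inverse divide_inverse)
    finally show ?thesis by (simp add: g_def)
  qed
  have "ennreal (double_rising k j) = (\<integral>\<^sup>+y. g y \<partial>?G)"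
    unfolding g_def using gaussian_partial_moment[OF k] by simp
  also have "\<dots> = (\<integral>\<^sup>+y. ennreal (pnorm n 2 y ^ (2 * j)) * g (normalize_p n 2 y) \<partial>?G)"
  proof (rule nn_integral_cong)
    fix y
    have "(\<Sum>i<k. (y i)\<^sup>2) = (pnorm n 2 y)\<^sup>2 * beta_ratio n k y"
      unfolding beta_ratio_def pn using nz[of y] k by auto
    then have "(\<Sum>i<k. (y i)\<^sup>2) ^ j = pnorm n 2 y ^ (2 * j) * beta_ratio n k y ^ j"
      by (simp add: power_mult_distrib power_mult)
    then show "g y = ennreal (pnorm n 2 y ^ (2 * j)) * g (normalize_p n 2 y)"
      unfolding gn unfolding g_def by (simp add: ennreal_mult' pnorm_nonneg)
  qed
  also have "\<dots> = (\<integral>\<^sup>+y. g (normalize_p n 2 y) \<partial>?G) * (\<integral>\<^sup>+y. ennreal (pnorm n 2 y ^ (2 * j)) \<partial>?G)"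
    by (rule gauss_p_vec_polar_fun[OF n _ _ g, of 2 "\<lambda>r. ennreal (r ^ (2 * j))"]) auto
  also have "\<dots> = (\<integral>\<^sup>+y. ennreal (beta_ratio n k y ^ j) \<partial>?G) * ennreal (double_rising n j)"
    unfolding gn gaussian_norm_moment[OF n] ..
  finally have eq: "(\<integral>\<^sup>+y. ennreal (beta_ratio n k y ^ j) \<partial>?G) * ennreal (double_rising n j) = ennreal (double_rising k j)" ..
  interpret prob_space ?G by (rule prob_space_gauss_p_vec) simp
  have int: "integrable ?G (\<lambda>y. beta_ratio n k y ^ j)"
    by (rule integrable_const_bound[where B=1, OF _ bm])
       (use beta_ratio_bounds[OF k(2)] in \<open>auto intro!: power_le_one\<close>)
  have "ennreal ((\<integral>y. beta_ratio n k y ^ j \<partial>?G) * double_rising n j) = ennreal (double_rising k j)"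
    unfolding eq[symmetric] using double_rising_pos[OF n, of j] beta_ratio_bounds[OF k(2)]
    by (subst nn_integral_eq_integral[OF int]) (auto simp: ennreal_mult'' less_imp_le)
  then have "(\<integral>y. beta_ratio n k y ^ j \<partial>?G) * double_rising n j = double_rising k j"
    using double_rising_pos[OF n, of j] double_rising_pos[OF k(1), of j] beta_ratio_bounds[OF k(2)]
    by (subst (asm) ennreal_inj) (auto simp: less_imp_le intro!: mult_nonneg_nonneg integral_nonneg)
  then show ?thesis using double_rising_pos[OF n, of j] by (simp add: field_simps)
qed

lemma haar_moment_double_rising:
  assumes haar: "haar_grassmannian n k \<mu>" and n: "n \<ge> 1"
  shows "haar_moment n \<mu> j = double_rising k j / double_rising n j"
proof (induction j)
  case 0
  interpret prob_space \<mu> using haar by (simp add: haar_grassmannian_def)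
  show ?case by (simp add: haar_moment_def double_rising_def prob_space)
next
  case (Suc j)
  have "haar_moment n \<mu> (Suc j) = (real k + 2 * real j) * haar_moment n \<mu> j / (real n + 2 * real j)"
    using haar_moment_Suc[OF haar n, of j] n by (simp add: field_simps)
  then show ?case unfolding Suc.IH by (simp add: double_rising_def mult.commute)
qed

text \<open>
  Both laws live on the unit interval, and their moments agree by the recursion \<open>haar_moment_Suc\<close> and by
  \<open>beta_ratio_moment\<close>.
\<close>

lemma haar_qform_law:
  assumes haar: "haar_grassmannian n k \<mu>" and k: "1 \<le> k" "k \<le> n" and x: "dotp n x x \<noteq> 0"
  shows "distr \<mu> borel (\<lambda>E. qform n E x / dotp n x x) = distr (gauss_p_vec n 2) borel (beta_ratio n k)"
proof (rule moments_determine_law_unit_interval)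
  have n: "n \<ge> 1" using k by simp
  let ?G = "gauss_p_vec n 2"
  interpret mu: prob_space \<mu> using haar by (simp add: haar_grassmannian_def)
  interpret G: prob_space ?G by (rule prob_space_gauss_p_vec) simp
  have qm: "(\<lambda>E. qform n E x / dotp n x x) \<in> borel_measurable \<mu>"
    by (intro borel_measurable_divide haar_measurable[OF haar measurable_qform]) auto
  have bm: "beta_ratio n k \<in> borel_measurable ?G"
    unfolding measurable_cong_sets[OF sets_gauss_p_vec refl] using k by measurable
  show "real_distribution (distr \<mu> borel (\<lambda>E. qform n E x / dotp n x x))"
    using qm by (intro mu.real_distribution_distr)
  show "real_distribution (distr ?G borel (beta_ratio n k))"
    using bm by (intro G.real_distribution_distr)
  show "AE x in distr \<mu> borel (\<lambda>E. qform n E x / dotp n x x). \<bar>x\<bar> \<le> 1"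
  proof (subst AE_distr_iff[OF qm], simp, rule AE_I2)
    fix E assume "E \<in> space \<mu>"
    then have "E \<in> subspaces n k" using haar_space[OF haar] by simp
    from qform_bounds[OF this, of x] show "\<bar>qform n E x / dotp n x x\<bar> \<le> 1"
      using dotp_self_nonneg[of n x] x by (simp add: divide_le_eq_1 less_le)
  qed
  show "AE x in distr ?G borel (beta_ratio n k). \<bar>x\<bar> \<le> 1"
    by (subst AE_distr_iff[OF bm]) (use beta_ratio_bounds[OF k(2)] in auto)
  show "(\<integral>y. y ^ j \<partial>distr \<mu> borel (\<lambda>E. qform n E x / dotp n x x)) = (\<integral>y. y ^ j \<partial>distr ?G borel (beta_ratio n k))" for j
  proof -
    have "(\<integral>y. y ^ j \<partial>distr \<mu> borel (\<lambda>E. qform n E x / dotp n x x)) = (\<integral>E. qform n E x ^ j \<partial>\<mu>) / dotp n x x ^ j"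
      by (subst integral_distr[OF qm]) (auto simp: power_divide)
    also have "\<dots> = haar_moment n \<mu> j"
      using x by (simp add: haar_moment_eq[OF haar n])
    also have "\<dots> = (\<integral>y. beta_ratio n k y ^ j \<partial>?G)"
      unfolding haar_moment_double_rising[OF haar n] beta_ratio_moment[OF k] ..
    also have "\<dots> = (\<integral>y. y ^ j \<partial>distr ?G borel (beta_ratio n k))"
      by (subst integral_distr[OF bm]) auto
    finally show ?thesis .
  qed
qed


section \<open>Direction and norm of a point with law \<open>P_dist\<close>\<close>

text \<open>
  The density of \<open>P_dist\<close> at distance \<open>r\<close> when the mixing measure is the unit mass at \<open>s\<close>. A
  general mixing measure averages it (\<open>h_density_mixture\<close>).
\<close>

definition radial_density :: "nat \<Rightarrow> real \<Rightarrow> real \<Rightarrow> real \<Rightarrow> real" where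
  "radial_density n p s r = 1 / (p powr (n / p) * Gamma (1 + n / p)) * (1 / (1 - r powr p) powr (1 + n / p)) *
     (s powr (n / p) * exp (- (1 / p) * s * r powr p * inverse (1 - r powr p)))"

lemma radial_density_nonneg: "p > 0 \<Longrightarrow> 0 \<le> radial_density n p s r"
  unfolding radial_density_def using Gamma_real_pos[of "1 + n / p"]
  by (intro mult_nonneg_nonneg divide_nonneg_nonneg) (auto simp: add_pos_nonneg less_imp_le)

lemma h_density_mixture:
  assumes p: "p > 0" and W: "sets W = sets (restrict_space borel {0..})"
  shows "h_density W n p r = (\<integral>\<^sup>+s. ennreal (radial_density n p s r) \<partial>W)"
proof -
  have c: "0 \<le> 1 / (p powr (n / p) * Gamma (1 + n / p)) * (1 / (1 - r powr p) powr (1 + n / p))"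
    using p Gamma_real_pos[of "1 + n / p"]
    by (intro mult_nonneg_nonneg divide_nonneg_nonneg) (auto simp: add_pos_nonneg less_imp_le)
  have m: "(\<lambda>s. ennreal (s powr (n / p) * exp (- (1 / p) * s * r powr p * inverse (1 - r powr p)))) \<in> borel_measurable W"
    unfolding measurable_cong_sets[OF W refl] by (intro measurable_restrict_space1) measurable
  show ?thesis
    unfolding h_density_def
    by (subst nn_integral_cmult[OF m, symmetric]) (simp only: radial_density_def ennreal_mult'[OF c])
qed

lemma uniform_ball_radial:
  assumes n: "n \<ge> 1" and p: "p > 0" and f [measurable]: "f \<in> borel_measurable borel"
  shows "(\<integral>\<^sup>+x. f (pnorm n p x) \<partial>uniform_ball n p) =
    (\<integral>\<^sup>+r. f r * ennreal (real n * r ^ (n - 1)) * indicator {0<..1} r \<partial>lborel)"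
proof -
  define V where "V = emeasure (lebesgue_Rn n) (p_ball n p)"
  have V: "V \<noteq> 0" "V \<noteq> \<top>" using emeasure_p_ball[OF p n] by (simp_all add: V_def)
  have fm: "(\<lambda>x. f (pnorm n p x)) \<in> borel_measurable (lebesgue_Rn n)"
    unfolding measurable_lebesgue_Rn_cong by measurable
  have "(\<integral>\<^sup>+x. f (pnorm n p x) \<partial>uniform_ball n p) = (\<integral>\<^sup>+x. f (pnorm n p x) * indicator (p_ball n p) x \<partial>lebesgue_Rn n) / V"
    unfolding uniform_ball_def V_def
    by (rule nn_integral_uniform_measure[OF fm]) (simp add: sets_lebesgue_Rn sets_p_ball)
  also have "(\<integral>\<^sup>+x. f (pnorm n p x) * indicator (p_ball n p) x \<partial>lebesgue_Rn n) =
      (\<integral>\<^sup>+x. (f (pnorm n p x) * indicator {..1} (pnorm n p x)) * indicator (space (Rn n)) (normalize_p n p x) \<partial>lebesgue_Rn n)"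
    by (rule nn_integral_cong) (auto simp: p_ball_def space_lebesgue_Rn indicator_def normalize_p_def scale_Rn_def space_Rn)
  also have "\<dots> = V * (\<integral>\<^sup>+r. (f r * indicator {..1} r) * ennreal (real n * r ^ (n - 1)) * indicator {0<..} r \<partial>lborel)"
    by (subst polar_nn_integral[OF n p sets.top, of "\<lambda>r. f r * indicator {..1} r"])
       (simp_all add: cone_measure_basic(2)[OF n p] V_def)
  also have "(\<integral>\<^sup>+r. (f r * indicator {..1} r) * ennreal (real n * r ^ (n - 1)) * indicator {0<..} r \<partial>lborel) =
     (\<integral>\<^sup>+r. f r * ennreal (real n * r ^ (n - 1)) * indicator {0<..1} r \<partial>lborel)"
    by (rule nn_integral_cong) (auto simp: indicator_def)
  also have "V * (\<integral>\<^sup>+r. f r * ennreal (real n * r ^ (n - 1)) * indicator {0<..1} r \<partial>lborel) / V =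
     (\<integral>\<^sup>+r. f r * ennreal (real n * r ^ (n - 1)) * indicator {0<..1} r \<partial>lborel)"
    using V by (simp add: mult.commute[of V] mult_divide_eq_ennreal)
  finally show ?thesis .
qed

lemma measurable_radial_density [measurable]: "(\<lambda>r. radial_density n p s r) \<in> borel_measurable borel"
  unfolding radial_density_def by measurable

text \<open>
  The substitution \<open>u = s r\<^sup>p / (p (1 - r\<^sup>p))\<close> turns the radial integral into the Gamma integral; this is
  the formula \<open>r\<^sup>p = G / (G + s)\<close> with \<open>G = p u\<close>.
\<close>

lemma radial_density_total_mass:
  assumes n: "n \<ge> 1" and p: "p > 0" and s: "s > 0"
  shows "(\<integral>\<^sup>+x. ennreal (radial_density n p s (pnorm n p x)) \<partial>uniform_ball n p) = 1"
proof -
  define a where "a = real n / p"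
  have a: "a > 0" using n p by (simp add: a_def)
  define g where "g r = (s / p) * (r powr p / (1 - r powr p))" for r :: real
  define g' where "g' r = s * r powr (p - 1) / (1 - r powr p)\<^sup>2" for r :: real
  have lt1: "r powr p < 1" if "0 < r" "r < 1" for r :: real
    using powr_less_mono2[OF p, of r 1] that by simp
  have der: "(g has_field_derivative g' r) (at r within {0<..<1})" if "r \<in> {0<..<1}" for r
  proof -
    have r: "0 < r" "1 - r powr p \<noteq> 0" using that lt1[of r] by auto
    have d1: "((\<lambda>r. r powr p) has_field_derivative p * r powr (p - 1)) (at r within {0<..<1})"
      using r by (auto intro!: derivative_eq_intros)
    have d2: "((\<lambda>r. 1 - r powr p) has_field_derivative 0 - p * r powr (p - 1)) (at r within {0<..<1})"
      by (intro DERIV_diff DERIV_const d1)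
    have "(g has_field_derivative (s / p) * (((p * r powr (p - 1)) * (1 - r powr p) - r powr p * (0 - p * r powr (p - 1))) / ((1 - r powr p) * (1 - r powr p)))) (at r within {0<..<1})"
      unfolding g_def by (rule DERIV_cmult[OF DERIV_divide[OF d1 d2 r(2)]])
    also have "(s / p) * (((p * r powr (p - 1)) * (1 - r powr p) - r powr p * (0 - p * r powr (p - 1))) / ((1 - r powr p) * (1 - r powr p))) = g' r"
    proof -
      have "(p * r powr (p - 1)) * (1 - r powr p) - r powr p * (0 - p * r powr (p - 1)) = p * r powr (p - 1)"
        by (simp add: algebra_simps)
      then show ?thesis using p by (simp add: g'_def power2_eq_square)
    qed
    finally show ?thesis .
  qed
  define gi where "gi t = ((p * t / s) / (1 + p * t / s)) powr (1 / p)" for t :: real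
  have gi: "gi (g r) = r" if "r \<in> {0<..<1}" for r
  proof -
    have r: "0 < r" "1 - r powr p > 0" using that lt1[of r] by auto
    have e: "p * g r / s = r powr p / (1 - r powr p)" using s p by (simp add: g_def)
    have "(p * g r / s) / (1 + p * g r / s) = r powr p"
      unfolding e using r by (simp add: field_simps)
    then show ?thesis using r p by (simp add: gi_def powr_powr)
  qed
  have inj: "inj_on g {0<..<1}" by (rule inj_on_inverseI[of _ gi]) (rule gi)
  have im: "g ` {0<..<1} = {0<..}"
  proof (intro equalityI subsetI)
    fix y assume "y \<in> g ` {0<..<1}"
    then show "y \<in> {0<..}" using lt1 s p by (auto simp: g_def)
  next
    fix t :: real assume "t \<in> {0<..}"
    then have t: "p * t / s > 0" using p s by simp
    define u where "u = (p * t / s) / (1 + p * t / s)"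
    have "0 < z / (1 + z)" "z / (1 + z) < 1" "(z / (1 + z)) / (1 - z / (1 + z)) = z" if "z > 0" for z :: real
      using that by (auto simp: field_simps)
    from this[OF t] have u: "0 < u" "u < 1" "u / (1 - u) = p * t / s"
      unfolding u_def .
    have giu: "gi t = u powr (1 / p)" by (simp only: gi_def u_def)
    have "gi t powr p = u" using u p by (simp add: giu powr_powr)
    then have "g (gi t) = t" using u p s by (simp add: g_def)
    moreover have "gi t \<in> {0<..<1}"
      using u p powr_less_mono2[of "1 / p" u 1] by (simp add: giu)
    ultimately show "t \<in> g ` {0<..<1}" by (metis imageI)
  qed
  have "((\<lambda>r. \<bar>g' r\<bar> * (g r powr (a - 1) / exp (g r))) has_integral Gamma a) {0<..<1}"
    by (rule Gamma_integral_change_of_variables[OF a _ der inj im]) auto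
  then have "((\<lambda>r. inverse (Gamma a) * (\<bar>g' r\<bar> * (g r powr (a - 1) / exp (g r)))) has_integral inverse (Gamma a) * Gamma a) {0<..<1}"
    by (rule has_integral_mult_right)
  also have "inverse (Gamma a) * Gamma a = 1" using Gamma_real_pos[OF a] by simp
  finally have "((\<lambda>r. radial_density n p s r * (real n * r ^ (n - 1))) has_integral 1) {0<..<1}"
  proof (rule has_integral_eq[rotated])
    fix r :: real assume "r \<in> {0<..<1}"
    then have r: "0 < r" "r < 1" "1 - r powr p > 0" using lt1[of r] by auto
    define d where "d = 1 - r powr p"
    have d: "d > 0" using r by (simp add: d_def)
    have "r ^ (n - 1) = r powr (real n - 1)"
      using r n by (simp add: powr_realpow[symmetric] of_nat_diff)
    also have "real n - 1 = (p - 1) + p * (a - 1)"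
      using p by (simp add: a_def right_diff_distrib)
    finally have e1: "r ^ (n - 1) = r powr (p - 1) * (r powr p) powr (a - 1)"
      by (simp add: powr_add powr_powr)
    have e2: "s powr a = s * s powr (a - 1)" "p powr a = p * p powr (a - 1)" "d powr (1 + a) = d\<^sup>2 * d powr (a - 1)"
      using s p d powr_add[of s 1 "a - 1"] powr_add[of p 1 "a - 1"] powr_add[of d 2 "a - 1"] by simp_all
    have e3: "g r powr (a - 1) = s powr (a - 1) * (r powr p) powr (a - 1) / (p powr (a - 1) * d powr (a - 1))"
      using s p d by (simp add: g_def d_def[symmetric] powr_mult powr_divide)
    have e4: "Gamma (1 + a) = a * Gamma a" using Gamma_plus1_pos[OF a] by (simp add: add.commute)
    have e5: "(1 / p) * s * r powr p * inverse d = g r" by (simp add: g_def d_def divide_inverse)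
    have h: "radial_density n p s r = 1 / (p powr a * Gamma (1 + a)) * (1 / d powr (1 + a)) * (s powr a * exp (- g r))"
      unfolding radial_density_def a_def[symmetric] d_def[symmetric] using e5 by simp
    have na: "real n = p * a" using p by (simp add: a_def)
    have pos: "p powr (a - 1) > 0" "d powr (a - 1) > 0" "Gamma a > 0" using p d a by (auto intro: Gamma_real_pos)
    have "radial_density n p s r * (real n * r ^ (n - 1)) =
      1 / (p * p powr (a - 1) * (a * Gamma a)) * (1 / (d\<^sup>2 * d powr (a - 1))) * (s * s powr (a - 1) * exp (- g r)) *
        (p * a * (r powr (p - 1) * (r powr p) powr (a - 1)))"
      unfolding h e1 e2 e4 na ..
    also have "\<dots> = inverse (Gamma a) * (s * r powr (p - 1) / d\<^sup>2 * (s powr (a - 1) * (r powr p) powr (a - 1) / (p powr (a - 1) * d powr (a - 1)) / exp (g r)))"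
      using pos a p by (simp add: exp_minus divide_inverse) (simp add: field_simps)
    also have "\<dots> = inverse (Gamma a) * (\<bar>g' r\<bar> * (g r powr (a - 1) / exp (g r)))"
      unfolding e3 using s by (simp add: g'_def d_def)
    finally show "inverse (Gamma a) * (\<bar>g' r\<bar> * (g r powr (a - 1) / exp (g r))) = radial_density n p s r * (real n * r ^ (n - 1))" ..
  qed
  from nn_integral_has_integral_lebesgue[OF _ this]
  have "(\<integral>\<^sup>+r. ennreal (indicator {0<..<1} r * (radial_density n p s r * (real n * r ^ (n - 1)))) \<partial>lborel) = 1"
    using radial_density_nonneg[OF p] by simp
  moreover have "(\<integral>\<^sup>+r. ennreal (indicator {0<..<1} r * (radial_density n p s r * (real n * r ^ (n - 1)))) \<partial>lborel) =
     (\<integral>\<^sup>+r. ennreal (radial_density n p s r) * ennreal (real n * r ^ (n - 1)) * indicator {0<..1} r \<partial>lborel)"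
    by (rule nn_integral_cong_AE, use AE_lborel_singleton[of "1::real"] in eventually_elim)
       (use radial_density_nonneg[OF p] in \<open>auto simp: indicator_def ennreal_mult'\<close>)
  ultimately show ?thesis
    by (subst uniform_ball_radial[OF n p]) auto
qed

text \<open>
  A Chernoff bound for the Gamma variable in disguise. With \<open>y = s r\<^sup>p / (1 - r\<^sup>p)\<close>, which is at most
  \<open>n / 2\<close> here, replacing \<open>exp (- y / p)\<close> by \<open>exp (- 2 y / p)\<close> costs at most \<open>exp (n / (2 p))\<close>, and
  doubling the exponent is the same as doubling \<open>s\<close>. So no Gamma tail has to be estimated: the
  comparison density has total mass \<open>1\<close>.
\<close>

lemma radial_density_tail_compare:
  assumes p: "p > 0" and s: "0 < s" "s \<le> e * real n / 2" and r: "0 \<le> r" "r powr p \<le> 1 - e" and e: "e > 0"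
  shows "radial_density n p s r \<le> (exp (1 / 2) / 2) powr (n / p) * radial_density n p (2 * s) r"
proof -
  define a where "a = real n / p"
  define y where "y = s * r powr p * inverse (1 - r powr p)"
  have d: "1 - r powr p \<ge> e" using r by simp
  have "y \<le> real n / 2"
  proof -
    have "y \<le> s * 1 * inverse e"
      unfolding y_def using s r e d by (intro mult_mono le_imp_inverse_le) auto
    also have "\<dots> \<le> (e * real n / 2) * 1 * inverse e"
      using s e by (intro mult_right_mono) auto
    finally show ?thesis using e by (simp add: field_simps)
  qed
  then have y: "y / p \<le> a / 2" using divide_right_mono[of y "real n / 2" p] p by (simp add: a_def mult.commute)
  have "s powr a * exp (- (y / p)) \<le> s powr a * (exp (a / 2) * exp (- 2 * (y / p)))"
    unfolding exp_add[symmetric] using y by (intro mult_left_mono) auto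
  also have "\<dots> = (exp (1 / 2) / 2) powr a * ((2 * s) powr a * exp (- 2 * (y / p)))"
  proof -
    have "(exp (1 / 2) / 2) powr a * (2 * s) powr a = exp (a / 2) * s powr a"
      using s by (simp add: powr_mult powr_divide) (simp add: exp_powr_real)
    then show ?thesis by (simp add: mult_ac)
  qed
  finally have main: "s powr a * exp (- (y / p)) \<le> (exp (1 / 2) / 2) powr a * ((2 * s) powr a * exp (- 2 * (y / p)))" .
  define K where "K = 1 / (p powr a * Gamma (1 + a)) * (1 / (1 - r powr p) powr (1 + a))"
  have K: "K \<ge> 0"
    unfolding K_def using p Gamma_real_pos[of "1 + a"]
    by (intro mult_nonneg_nonneg divide_nonneg_nonneg) (auto simp: add_pos_nonneg less_imp_le a_def)
  have h: "radial_density n p s' r = K * (s' powr a * exp (- (1 / p) * s' * r powr p * inverse (1 - r powr p)))" for s'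
    by (simp add: radial_density_def K_def a_def)
  have "radial_density n p s r = K * (s powr a * exp (- (y / p)))"
    unfolding h by (simp add: y_def)
  also have "\<dots> \<le> K * ((exp (1 / 2) / 2) powr a * ((2 * s) powr a * exp (- 2 * (y / p))))"
    using main K by (rule mult_left_mono)
  also have "\<dots> = (exp (1 / 2) / 2) powr a * radial_density n p (2 * s) r"
    unfolding h by (simp add: y_def mult_ac)
  finally show ?thesis by (simp add: a_def)
qed

text \<open>
  The cone measure part has norm \<open>1\<close>. In the other part, parameters above \<open>e n / 2\<close> are bounded by
  their probability, and for the remaining ones \<open>radial_density_tail_compare\<close> applies. The first term is
  exponentially small because \<open>exp (1 / 2) < 2\<close>.
\<close>

lemma P_dist_radial_tail:
  assumes n: "n \<ge> 1" and p: "p > 0" and e: "e > 0"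
    and W: "prob_space W" and sW: "sets W = sets (restrict_space borel {0..})"
  shows "emeasure (P_dist W n p) {x \<in> space (Rn n). pnorm n p x powr p < 1 - e} \<le>
    ennreal ((exp (1 / 2) / 2) powr (n / p)) + emeasure W {e * real n / 2<..}"
proof -
  define S where "S = {x \<in> space (Rn n). pnorm n p x powr p < 1 - e}"
  define s0 where "s0 = e * real n / 2"
  define C where "C = (exp (1 / 2) / 2) powr (n / p)"
  let ?U = "uniform_ball n p"
  have s0: "s0 > 0" using e n by (simp add: s0_def)
  interpret W: prob_space W by (rule W)
  have Sm: "S \<in> sets (Rn n)" unfolding S_def by measurable
  have mU: "measurable ?U N = measurable (Rn n) N" for N :: "'x measure"
    by (rule measurable_cong_sets[OF sets_uniform_ball refl])
  have sfU: "sigma_finite_measure ?U"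
  proof -
    have "emeasure ?U (space (Rn n)) \<le> 1"
      unfolding emeasure_uniform_ball[OF sets.top]
      using emeasure_p_ball[OF p n] by (simp add: ennreal_divide_self less_top Int_absorb2 p_ball_def)
    then have "finite_measure ?U"
      by (intro finite_measureI) (auto simp: space_uniform_ball top_unique)
    then show ?thesis by (simp add: finite_measure.axioms(1))
  qed
  interpret UW: pair_sigma_finite ?U W
    using sfU W.sigma_finite_measure_axioms by (simp add: pair_sigma_finite_def)
  have cone0: "emeasure (cone_measure n p) S = 0"
  proof -
    have "cone_over n p S = {}"
      using p e by (auto simp: cone_over_def S_def p_sphere_def)
    then show ?thesis by (simp add: emeasure_cone_measure[OF n p Sm])
  qed
  have ident [measurable]: "(\<lambda>s. s) \<in> W \<rightarrow>\<^sub>M borel"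
    unfolding measurable_cong_sets[OF sW refl] by (intro measurable_restrict_space1) simp
  have hm: "(\<lambda>x. h_density W n p (pnorm n p x)) \<in> borel_measurable ?U"
  proof -
    have "(\<lambda>r. \<integral>\<^sup>+s. ennreal (radial_density n p s r) \<partial>W) \<in> borel_measurable borel"
      unfolding radial_density_def by measurable
    then show ?thesis unfolding mU h_density_mixture[OF p sW] by measurable
  qed
  define \<phi> where "\<phi> s = (\<integral>\<^sup>+x. ennreal (radial_density n p s (pnorm n p x)) * indicator S x \<partial>?U)" for s
  have "emeasure (P_dist W n p) S = (\<integral>\<^sup>+x. h_density W n p (pnorm n p x) * indicator S x \<partial>?U)"
    unfolding emeasure_P_dist[OF Sm] cone0
    using Sm by (subst emeasure_density[OF hm]) (auto simp: sets_uniform_ball)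
  also have "\<dots> = (\<integral>\<^sup>+x. (\<integral>\<^sup>+s. ennreal (radial_density n p s (pnorm n p x)) * indicator S x \<partial>W) \<partial>?U)"
  proof (rule nn_integral_cong)
    fix x
    have "(\<lambda>s. ennreal (radial_density n p s (pnorm n p x))) \<in> borel_measurable W"
      unfolding radial_density_def using ident by measurable
    then show "h_density W n p (pnorm n p x) * indicator S x = (\<integral>\<^sup>+s. ennreal (radial_density n p s (pnorm n p x)) * indicator S x \<partial>W)"
      unfolding h_density_mixture[OF p sW] by (rule nn_integral_multc[symmetric])
  qed
  also have "\<dots> = (\<integral>\<^sup>+s. \<phi> s \<partial>W)"
  proof -
    have [measurable]: "pnorm n p \<in> borel_measurable ?U" "S \<in> sets ?U"
      using Sm by (simp_all add: mU sets_uniform_ball)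
    have "(\<lambda>(x, s). ennreal (radial_density n p s (pnorm n p x)) * indicator S x) \<in> borel_measurable (?U \<Otimes>\<^sub>M W)"
      unfolding radial_density_def by measurable
    from UW.Fubini[OF this] show ?thesis by (simp add: \<phi>_def)
  qed
  also have "\<dots> \<le> (\<integral>\<^sup>+s. ennreal C + indicator {s0<..} s \<partial>W)"
  proof (rule nn_integral_mono)
    fix s assume "s \<in> space W"
    then have s: "s \<ge> 0" using sets_eq_imp_space_eq[OF sW] by (simp add: space_restrict_space)
    have le1: "(\<integral>\<^sup>+x. ennreal (radial_density n p s (pnorm n p x)) \<partial>?U) \<le> 1" if "s \<ge> 0" for s
    proof (cases "s = 0")
      case True
      then show ?thesis by (simp add: radial_density_def)
    qed (use radial_density_total_mass[OF n p, of s] that in auto)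
    show "\<phi> s \<le> ennreal C + indicator {s0<..} s"
    proof (cases "s > s0")
      case True
      have "\<phi> s \<le> (\<integral>\<^sup>+x. ennreal (radial_density n p s (pnorm n p x)) \<partial>?U)"
        unfolding \<phi>_def by (intro nn_integral_mono) (auto simp: indicator_def)
      also have "\<dots> \<le> 1" by (rule le1[OF s])
      finally show ?thesis using True by (simp add: add_increasing)
    next
      case False
      have "\<phi> s \<le> (\<integral>\<^sup>+x. ennreal C * ennreal (radial_density n p (2 * s) (pnorm n p x)) \<partial>?U)"
        unfolding \<phi>_def
      proof (rule nn_integral_mono)
        fix x
        have "radial_density n p s (pnorm n p x) \<le> C * radial_density n p (2 * s) (pnorm n p x)" if "x \<in> S"
        proof (cases "s = 0")
          case True
          then show ?thesis by (simp add: radial_density_def)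
        next
          case nz: False
          show ?thesis unfolding C_def
            by (rule radial_density_tail_compare[OF p _ _ pnorm_nonneg _ e])
               (use nz s False that in \<open>auto simp: s0_def S_def\<close>)
        qed
        then show "ennreal (radial_density n p s (pnorm n p x)) * indicator S x \<le> ennreal C * ennreal (radial_density n p (2 * s) (pnorm n p x))"
          by (auto simp: indicator_def C_def ennreal_mult'[symmetric] intro!: ennreal_leI)
      qed
      also have "\<dots> = ennreal C * (\<integral>\<^sup>+x. ennreal (radial_density n p (2 * s) (pnorm n p x)) \<partial>?U)"
        by (rule nn_integral_cmult) (unfold mU, measurable)
      also have "\<dots> \<le> ennreal C * 1"
        using s by (intro mult_left_mono le1) auto
      finally show ?thesis using False by simp
    qed
  qed
  also have "(\<integral>\<^sup>+s. ennreal C + indicator {s0<..} s \<partial>W) = ennreal C + emeasure W {s0<..}"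
  proof -
    have "space W = {0..}"
      using sets_eq_imp_space_eq[OF sW] by (simp add: space_restrict_space)
    moreover have "{s0<..} \<subseteq> {0..}"
      by (rule subsetI) (use s0 in simp)
    ultimately have "{s0<..} \<inter> space W = {s0<..}"
      by (simp only: Int_absorb2)
    moreover have "{s0<..} \<inter> space W \<in> sets W"
      using measurable_sets[OF ident, of "{s0<..}"] by simp
    ultimately have A: "{s0<..} \<in> sets W" by (simp only:)
    show ?thesis
      using A by (subst nn_integral_add) (auto simp: W.emeasure_space_1)
  qed
  finally show ?thesis by (simp add: S_def s0_def C_def)
qed

text \<open>
  Both parts of \<open>P_dist\<close> have the cone measure as law of the direction, up to their masses, and these
  add up to \<open>1\<close>.
\<close>

lemma P_dist_normalize:
  assumes n: "n \<ge> 1" and p: "p > 0" and P: "prob_space (P_dist W n p)"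
    and W: "prob_space W" "sets W = sets (restrict_space borel {0..})"
  shows "distr (P_dist W n p) (Rn n) (normalize_p n p) = cone_measure n p"
    and "AE x in P_dist W n p. 0 < pnorm n p x \<and> pnorm n p x \<le> 1"
proof -
  let ?U = "uniform_ball n p" and ?P = "P_dist W n p" and ?C = "cone_measure n p"
  interpret P: prob_space ?P by (rule P)
  interpret W: prob_space W by (rule W)
  define h where "h r = h_density W n p r" for r
  have ident [measurable]: "(\<lambda>s. s) \<in> W \<rightarrow>\<^sub>M borel"
    unfolding measurable_cong_sets[OF W(2) refl] by (intro measurable_restrict_space1) simp
  have h [measurable]: "h \<in> borel_measurable borel"
  proof -
    have "(\<lambda>r. \<integral>\<^sup>+s. ennreal (radial_density n p s r) \<partial>W) \<in> borel_measurable borel"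
      unfolding radial_density_def by measurable
    then show ?thesis unfolding h_def h_density_mixture[OF p W(2)] .
  qed
  have mU: "measurable ?U N = measurable (Rn n) N" for N :: "'x measure"
    by (rule measurable_cong_sets[OF sets_uniform_ball refl])
  have mP: "measurable ?P N = measurable (Rn n) N" for N :: "'x measure"
    by (rule measurable_cong_sets[OF sets_P_dist refl])
  have hm: "(\<lambda>x. h (pnorm n p x)) \<in> borel_measurable ?U" unfolding mU by measurable
  define V where "V = emeasure (lebesgue_Rn n) (p_ball n p)"
  have V: "V \<noteq> 0" "V \<noteq> \<top>" using emeasure_p_ball[OF p n] by (simp_all add: V_def)
  have spP: "space ?P = space (Rn n)" by (rule sets_eq_imp_space_eq[OF sets_P_dist])
  have emP: "emeasure ?P A = emeasure W {0} * emeasure ?C A + (\<integral>\<^sup>+x. h (pnorm n p x) * indicator A x \<partial>?U)"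
    if A: "A \<in> sets (Rn n)" for A
    unfolding emeasure_P_dist[OF A] h_def[symmetric]
    using A by (subst emeasure_density[OF hm]) (auto simp: sets_uniform_ball)
  define m where "m = (\<integral>\<^sup>+r. (h r * indicator {..1} r) * ennreal (real n * r ^ (n - 1)) * indicator {0<..} r \<partial>lborel)"
  have dens: "(\<integral>\<^sup>+x. h (pnorm n p x) * indicator (normalize_p n p -` A \<inter> space (Rn n)) x \<partial>?U) = emeasure ?C A * m"
    if A: "A \<in> sets (Rn n)" for A
  proof -
    have nA: "normalize_p n p -` A \<inter> space (Rn n) \<in> sets (Rn n)"
      using A by measurable
    have "(\<integral>\<^sup>+x. h (pnorm n p x) * indicator (normalize_p n p -` A \<inter> space (Rn n)) x \<partial>?U) =
      (\<integral>\<^sup>+x. (h (pnorm n p x) * indicator (normalize_p n p -` A \<inter> space (Rn n)) x) * indicator (p_ball n p) x \<partial>lebesgue_Rn n) / V"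
      unfolding uniform_ball_def V_def
    proof (rule nn_integral_uniform_measure)
      show "(\<lambda>x. h (pnorm n p x) * indicator (normalize_p n p -` A \<inter> space (Rn n)) x) \<in> borel_measurable (lebesgue_Rn n)"
        unfolding measurable_lebesgue_Rn_cong using nA by measurable
    qed (simp add: sets_lebesgue_Rn sets_p_ball)
    also have "(\<integral>\<^sup>+x. (h (pnorm n p x) * indicator (normalize_p n p -` A \<inter> space (Rn n)) x) * indicator (p_ball n p) x \<partial>lebesgue_Rn n) =
       (\<integral>\<^sup>+x. (h (pnorm n p x) * indicator {..1} (pnorm n p x)) * indicator A (normalize_p n p x) \<partial>lebesgue_Rn n)"
      by (rule nn_integral_cong) (auto simp: p_ball_def space_lebesgue_Rn indicator_def)
    also have "\<dots> = V * emeasure ?C A * m"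
      unfolding m_def V_def by (rule polar_nn_integral[OF n p A]) measurable
    also have "V * emeasure ?C A * m / V = emeasure ?C A * m"
    proof -
      have "V * emeasure ?C A * m / V = emeasure ?C A * m * V / V" by (simp add: mult_ac)
      then show ?thesis using V by (simp add: mult_divide_eq_ennreal)
    qed
    finally show ?thesis .
  qed
  have C_pre: "emeasure ?C (normalize_p n p -` A \<inter> space (Rn n)) = emeasure ?C A" if A: "A \<in> sets (Rn n)" for A
  proof -
    have nA: "normalize_p n p -` A \<inter> space (Rn n) \<in> sets (Rn n)"
      using A by measurable
    have "normalize_p n p x = x" if "x \<in> p_sphere n p" for x
      using that by (auto simp: normalize_p_def p_sphere_def scale_Rn_def space_Rn fun_eq_iff PiE_iff extensional_def)
    then have "(normalize_p n p -` A \<inter> space (Rn n)) \<inter> p_sphere n p = A \<inter> p_sphere n p"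
      using sets.sets_into_space[OF A] by auto
    then have "cone_over n p (normalize_p n p -` A \<inter> space (Rn n)) = cone_over n p A"
      by (simp add: cone_over_def)
    then show ?thesis
      by (simp add: emeasure_cone_measure[OF n p A] emeasure_cone_measure[OF n p nA])
  qed
  have pre: "emeasure ?P (normalize_p n p -` A \<inter> space (Rn n)) = (emeasure W {0} + m) * emeasure ?C A"
    if A: "A \<in> sets (Rn n)" for A
  proof -
    have nA: "normalize_p n p -` A \<inter> space (Rn n) \<in> sets (Rn n)"
      using A by measurable
    show ?thesis
      unfolding emP[OF nA] dens[OF A] C_pre[OF A] by (simp only: distrib_right mult.commute[of m])
  qed
  have total: "emeasure W {0} + m = 1"
  proof -
    have "normalize_p n p -` space (Rn n) \<inter> space (Rn n) = space (Rn n)"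
      by (auto simp: normalize_p_def scale_Rn_def space_Rn)
    then show ?thesis
      using pre[OF sets.top] P.emeasure_space_1 cone_measure_basic(2)[OF n p] spP by simp
  qed
  have nm: "normalize_p n p \<in> ?P \<rightarrow>\<^sub>M Rn n" unfolding mP by measurable
  show "distr ?P (Rn n) (normalize_p n p) = ?C"
  proof (rule measure_eqI)
    fix A assume "A \<in> sets (distr ?P (Rn n) (normalize_p n p))"
    then have A: "A \<in> sets (Rn n)" by simp
    then have "emeasure (distr ?P (Rn n) (normalize_p n p)) A = emeasure ?P (normalize_p n p -` A \<inter> space (Rn n))"
      by (subst emeasure_distr[OF nm]) (auto simp: spP)
    also have "\<dots> = emeasure ?C A" unfolding pre[OF A] total by simp
    finally show "emeasure (distr ?P (Rn n) (normalize_p n p)) A = emeasure ?C A" .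
  qed (simp add: cone_measure_basic(1)[OF n p])
  define B where "B = {x \<in> space (Rn n). \<not> (0 < pnorm n p x \<and> pnorm n p x \<le> 1)}"
  have B: "B \<in> sets (Rn n)" unfolding B_def by measurable
  have "emeasure ?C B = 0"
  proof -
    have "cone_over n p B = {}"
      by (auto simp: cone_over_def B_def p_sphere_def)
    then show ?thesis by (simp add: emeasure_cone_measure[OF n p B])
  qed
  moreover have "(\<integral>\<^sup>+x. h (pnorm n p x) * indicator B x \<partial>?U) = 0"
  proof -
    have "emeasure ?U B = 0"
    proof -
      have "p_ball n p \<inter> B \<subseteq> {\<lambda>i\<in>{..<n}. 0}"
        using pnorm_eq_0_iff[OF p] pnorm_nonneg[of n p] by (auto simp: p_ball_def B_def less_le)
      then have "emeasure (lebesgue_Rn n) (p_ball n p \<inter> B) \<le> emeasure (lebesgue_Rn n) {\<lambda>i\<in>{..<n}. 0}"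
        using null_setsD2[OF null_sets_origin_lebesgue[OF n]] by (rule emeasure_mono)
      then show ?thesis
        unfolding emeasure_uniform_ball[OF B] using null_setsD1[OF null_sets_origin_lebesgue[OF n]] by simp
    qed
    then have "AE x in ?U. x \<notin> B"
      using B by (intro AE_not_in) (simp add: null_sets_def sets_uniform_ball)
    then have "(\<integral>\<^sup>+x. h (pnorm n p x) * indicator B x \<partial>?U) = (\<integral>\<^sup>+x. 0 \<partial>?U)"
      by (intro nn_integral_cong_AE) (auto elim!: eventually_mono)
    then show ?thesis by simp
  qed
  ultimately have "emeasure ?P B = 0" unfolding emP[OF B] by simp
  then have "AE x in ?P. x \<notin> B"
    using B by (intro AE_not_in) (simp add: null_sets_def sets_P_dist)
  then show "AE x in ?P. 0 < pnorm n p x \<and> pnorm n p x \<le> 1"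
    using AE_space by eventually_elim (auto simp: B_def spP)
qed


section \<open>Deviation estimates at a given speed\<close>

text \<open>
  Negligible at speed \<open>s\<close>: the logarithm divided by \<open>s\<close> tends to minus infinity.
\<close>

definition superexp :: "(nat \<Rightarrow> real) \<Rightarrow> (nat \<Rightarrow> real) \<Rightarrow> bool" where
  "superexp s a \<longleftrightarrow> (\<forall>c. \<forall>\<^sub>F n in sequentially. a n \<le> exp (- c * s n))"

lemma superexpD: "superexp s a \<Longrightarrow> \<forall>\<^sub>F n in sequentially. a n \<le> exp (- c * s n)"
  by (simp add: superexp_def)

lemma eventually_two_exp_le:
  assumes s: "filterlim s at_top sequentially" and c: "c < c'"
  shows "\<forall>\<^sub>F n in sequentially. 2 * exp (- c' * s n) \<le> exp (- c * s n :: real)"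
proof -
  have "\<forall>\<^sub>F n in sequentially. s n \<ge> ln 2 / (c' - c)"
    using s by (simp add: filterlim_at_top)
  then show ?thesis
  proof eventually_elim
    case (elim n)
    then have "ln 2 \<le> (c' - c) * s n"
      using c by (simp add: pos_divide_le_eq mult.commute)
    then have "exp (ln 2) \<le> exp ((c' - c) * s n)" by (simp only: exp_le_cancel_iff)
    then have "2 * exp (- c' * s n) \<le> exp ((c' - c) * s n) * exp (- c' * s n)"
      by (intro mult_right_mono) auto
    also have "\<dots> = exp (- c * s n)"
      unfolding exp_add[symmetric] by (simp add: algebra_simps)
    finally show ?case .
  qed
qed

text \<open>
  The deviation bounds of the rate function \<open>x \<mapsto> x\<^sup>2 / (2 v)\<close>. For such a rate only the complements of
  symmetric intervals and small neighbourhoods of points matter. The points are written as \<open>v \<theta>\<close>, of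
  rate \<open>v \<theta>\<^sup>2 / 2\<close>, so that \<open>v = 0\<close> is covered: there the origin is the only point of finite rate.
\<close>

definition gauss_mdp :: "(nat \<Rightarrow> 'w measure) \<Rightarrow> (nat \<Rightarrow> 'w \<Rightarrow> real) \<Rightarrow> (nat \<Rightarrow> real) \<Rightarrow> real \<Rightarrow> bool" where
  "gauss_mdp M X s v \<longleftrightarrow>
     (\<forall>d>0. \<forall>c. 2 * v * c < d\<^sup>2 \<longrightarrow>
        (\<forall>\<^sub>F n in sequentially. measure (M n) {\<omega> \<in> space (M n). \<bar>X n \<omega>\<bar> \<ge> d} \<le> exp (- c * s n))) \<and>
     (\<forall>\<theta>. \<forall>\<delta>>0. \<forall>c > v * \<theta>\<^sup>2 / 2.
        (\<forall>\<^sub>F n in sequentially. exp (- c * s n) \<le> measure (M n) {\<omega> \<in> space (M n). \<bar>X n \<omega> - v * \<theta>\<bar> < \<delta>}))"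

lemma gauss_mdp_upper:
  "gauss_mdp M X s v \<Longrightarrow> d > 0 \<Longrightarrow> 2 * v * c < d\<^sup>2 \<Longrightarrow>
     \<forall>\<^sub>F n in sequentially. measure (M n) {\<omega> \<in> space (M n). \<bar>X n \<omega>\<bar> \<ge> d} \<le> exp (- c * s n)"
  by (simp add: gauss_mdp_def)

lemma gauss_mdp_lower:
  "gauss_mdp M X s v \<Longrightarrow> \<delta> > 0 \<Longrightarrow> c > v * \<theta>\<^sup>2 / 2 \<Longrightarrow>
     \<forall>\<^sub>F n in sequentially. exp (- c * s n) \<le> measure (M n) {\<omega> \<in> space (M n). \<bar>X n \<omega> - v * \<theta>\<bar> < \<delta>}"
  by (simp add: gauss_mdp_def)

text \<open>
  Only eventually, since the hypotheses of the theorem say nothing about \<open>n = 0\<close>.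
\<close>

definition random_reals :: "(nat \<Rightarrow> 'w measure) \<Rightarrow> (nat \<Rightarrow> 'w \<Rightarrow> real) \<Rightarrow> bool" where
  "random_reals M X \<longleftrightarrow> (\<forall>\<^sub>F n in sequentially. prob_space (M n) \<and> X n \<in> borel_measurable (M n))"

text \<open>
  Convergence of \<open>ln (E (exp (s \<theta> X))) / s\<close> to \<open>v \<theta>\<^sup>2 / 2\<close>, in exponentiated form.
\<close>

definition quadratic_cumulant :: "(nat \<Rightarrow> 'w measure) \<Rightarrow> (nat \<Rightarrow> 'w \<Rightarrow> real) \<Rightarrow> (nat \<Rightarrow> real) \<Rightarrow> real \<Rightarrow> bool" where
  "quadratic_cumulant M X s v \<longleftrightarrow> (\<forall>\<theta>. \<forall>\<epsilon>>0. \<forall>\<^sub>F n in sequentially.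
     integrable (M n) (\<lambda>\<omega>. exp (s n * \<theta> * X n \<omega>)) \<and>
     exp (s n * (v * \<theta>\<^sup>2 / 2 - \<epsilon>)) \<le> (\<integral>\<omega>. exp (s n * \<theta> * X n \<omega>) \<partial>M n) \<and>
     (\<integral>\<omega>. exp (s n * \<theta> * X n \<omega>) \<partial>M n) \<le> exp (s n * (v * \<theta>\<^sup>2 / 2 + \<epsilon>)))"

lemma (in prob_space) chernoff:
  fixes a :: real
  assumes X: "X \<in> borel_measurable M" and int: "integrable M (\<lambda>\<omega>. exp (a * X \<omega>))" and a: "a \<ge> 0"
  shows "prob {\<omega> \<in> space M. X \<omega> \<ge> d} \<le> exp (- a * d) * expectation (\<lambda>\<omega>. exp (a * X \<omega>))"
proof -
  have S: "{\<omega> \<in> space M. X \<omega> \<ge> d} \<in> events" using X by measurable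
  have "prob {\<omega> \<in> space M. X \<omega> \<ge> d} = expectation (indicator {\<omega> \<in> space M. X \<omega> \<ge> d})"
    using S by simp
  also have "\<dots> \<le> expectation (\<lambda>\<omega>. exp (- a * d) * exp (a * X \<omega>))"
  proof (rule integral_mono)
    show "integrable M (indicator {\<omega> \<in> space M. X \<omega> \<ge> d} :: 'a \<Rightarrow> real)"
      using S by (intro integrable_real_indicator) (auto simp: emeasure_eq_measure)
    show "integrable M (\<lambda>\<omega>. exp (- a * d) * exp (a * X \<omega>))" using int by simp
    fix \<omega>
    have "a * (X \<omega> - d) \<ge> 0" if "X \<omega> \<ge> d" using that a by simp
    then show "indicator {\<omega> \<in> space M. X \<omega> \<ge> d} \<omega> \<le> exp (- a * d) * exp (a * X \<omega>)"
      by (auto simp: indicator_def exp_add[symmetric] algebra_simps)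
  qed
  also have "\<dots> = exp (- a * d) * expectation (\<lambda>\<omega>. exp (a * X \<omega>))" by simp
  finally show ?thesis .
qed

text \<open>
  The Gaertner-Ellis argument. The upper bound is Chernoff's inequality. For the lower bound at
  \<open>x = v \<theta>\<close>, most of the mass of \<open>E (exp (s \<theta> X))\<close> comes from \<open>X\<close> near \<open>x\<close>, because changing \<open>\<theta>\<close> by
  a small \<open>\<eta>\<close> to either side shows that the contributions from \<open>X\<close> beyond \<open>x + \<delta>\<close> or \<open>x - \<delta>\<close> are
  exponentially smaller; near \<open>x\<close> the integrand is at most \<open>exp (s (\<theta> x + \<bar>\<theta>\<bar> \<delta>))\<close>.
\<close>

lemma quadratic_cumulant_imp_gauss_mdp:
  assumes s: "filterlim s at_top sequentially" and rr: "random_reals M X"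
    and qc: "quadratic_cumulant M X s v" and v: "v \<ge> 0"
  shows "gauss_mdp M X s v"
  unfolding gauss_mdp_def
proof (intro conjI allI impI)
  note qcD = qc[unfolded quadratic_cumulant_def, rule_format]
  note rrD = rr[unfolded random_reals_def]
  have s0: "\<forall>\<^sub>F n in sequentially. s n > 0"
    using s by (simp add: filterlim_at_top_dense)
  fix d c :: real assume d: "d > 0" and c: "2 * v * c < d\<^sup>2"
  obtain \<theta> where \<theta>: "\<theta> \<ge> 0" "\<theta> * d - v * \<theta>\<^sup>2 / 2 > c"
  proof (cases "v = 0")
    case True
    then show ?thesis
      using that[of "(\<bar>c\<bar> + 1) / d"] d by (simp add: abs_le_D1)
  next
    case False
    then have v: "v > 0" using v by simp
    have "(d / v) * d - v * (d / v)\<^sup>2 / 2 = d\<^sup>2 / (2 * v)"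
      using v by (simp add: field_simps power2_eq_square)
    moreover have "d\<^sup>2 / (2 * v) > c" using c v by (simp add: field_simps)
    ultimately show ?thesis using that[of "d / v"] d v by simp
  qed
  define \<epsilon> where "\<epsilon> = (\<theta> * d - v * \<theta>\<^sup>2 / 2 - c) / 2"
  have \<epsilon>: "\<epsilon> > 0" "\<theta> * d - v * \<theta>\<^sup>2 / 2 - \<epsilon> = c + \<epsilon>" using \<theta> by (auto simp: \<epsilon>_def field_simps)
  have "c < c + \<epsilon>" using \<epsilon> by simp
  from qcD[OF \<epsilon>(1), of \<theta>] qcD[OF \<epsilon>(1), of "-\<theta>"] rrD eventually_two_exp_le[OF s this] s0
  show "\<forall>\<^sub>F n in sequentially. measure (M n) {\<omega> \<in> space (M n). d \<le> \<bar>X n \<omega>\<bar>} \<le> exp (- c * s n)"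
  proof eventually_elim
    case (elim n)
    interpret prob_space "M n" using elim by simp
    have X: "X n \<in> borel_measurable (M n)" using elim by simp
    have bound: "exp (- (s n * \<theta>) * d) * exp (s n * (v * \<theta>\<^sup>2 / 2 + \<epsilon>)) = exp (- (c + \<epsilon>) * s n)"
    proof -
      have "- (s n * \<theta>) * d + s n * (v * \<theta>\<^sup>2 / 2 + \<epsilon>) = - (\<theta> * d - v * \<theta>\<^sup>2 / 2 - \<epsilon>) * s n"
        by (simp add: algebra_simps)
      then show ?thesis unfolding exp_add[symmetric] \<epsilon>(2) by simp
    qed
    have "prob {\<omega> \<in> space (M n). X n \<omega> \<ge> d} \<le> exp (- (s n * \<theta>) * d) * expectation (\<lambda>\<omega>. exp (s n * \<theta> * X n \<omega>))"
      using elim \<theta> by (intro chernoff X) auto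
    also have "\<dots> \<le> exp (- (s n * \<theta>) * d) * exp (s n * (v * \<theta>\<^sup>2 / 2 + \<epsilon>))"
      using elim by (intro mult_left_mono) auto
    finally have 1: "prob {\<omega> \<in> space (M n). X n \<omega> \<ge> d} \<le> exp (- (c + \<epsilon>) * s n)" unfolding bound .
    have "prob {\<omega> \<in> space (M n). - X n \<omega> \<ge> d} \<le> exp (- (s n * \<theta>) * d) * expectation (\<lambda>\<omega>. exp (s n * \<theta> * - X n \<omega>))"
      using elim \<theta> X by (intro chernoff) auto
    also have "\<dots> \<le> exp (- (s n * \<theta>) * d) * exp (s n * (v * \<theta>\<^sup>2 / 2 + \<epsilon>))"
      using elim by (intro mult_left_mono) auto
    finally have 2: "prob {\<omega> \<in> space (M n). - X n \<omega> \<ge> d} \<le> exp (- (c + \<epsilon>) * s n)" unfolding bound .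
    have "prob {\<omega> \<in> space (M n). d \<le> \<bar>X n \<omega>\<bar>} \<le>
        prob ({\<omega> \<in> space (M n). X n \<omega> \<ge> d} \<union> {\<omega> \<in> space (M n). - X n \<omega> \<ge> d})"
      using X by (intro finite_measure_mono) auto
    also have "\<dots> \<le> prob {\<omega> \<in> space (M n). X n \<omega> \<ge> d} + prob {\<omega> \<in> space (M n). - X n \<omega> \<ge> d}"
      using X by (intro measure_Un_le) auto
    finally show ?case using 1 2 elim by linarith
  qed
next
  note qcD = qc[unfolded quadratic_cumulant_def, rule_format]
  note rrD = rr[unfolded random_reals_def]
  have s0: "\<forall>\<^sub>F n in sequentially. s n > 0"
    using s by (simp add: filterlim_at_top_dense)
  fix \<theta> \<delta>0 c :: real assume \<delta>0: "\<delta>0 > 0" and c: "c > v * \<theta>\<^sup>2 / 2"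
  define A where "A = v * \<theta>\<^sup>2 / 2"
  define x where "x = v * \<theta>"
  \<comment> \<open>Shrinking the neighbourhood makes the error \<open>\<bar>\<theta>\<bar> \<delta>\<close> in the exponent smaller than the slack
    \<open>c - A\<close>.\<close>
  define \<delta> where "\<delta> = min \<delta>0 (min 1 ((c - A) / (1 + \<bar>\<theta>\<bar>)))"
  have \<delta>: "\<delta> > 0" "\<delta> \<le> \<delta>0" "\<delta> \<le> 1" using \<delta>0 c by (auto simp: \<delta>_def A_def)
  have \<delta>c: "\<delta> * (1 + \<bar>\<theta>\<bar>) \<le> c - A"
  proof -
    have "\<delta> \<le> (c - A) / (1 + \<bar>\<theta>\<bar>)" by (simp add: \<delta>_def)
    then show ?thesis by (simp add: pos_le_divide_eq)
  qed
  \<comment> \<open>This \<open>\<eta>\<close> makes the gain \<open>\<eta> \<delta>\<close> from leaving the neighbourhood at least twice the loss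
    \<open>v \<eta>\<^sup>2 / 2\<close> in the cumulant; \<open>\<kappa>\<close> is the remaining net gain.\<close>
  define \<eta> where "\<eta> = \<delta> / (v + 1)"
  have \<eta>: "\<eta> > 0" "\<eta> \<le> \<delta>" using \<delta> v by (auto simp: \<eta>_def pos_divide_le_eq mult_le_cancel_left1)
  define \<kappa> where "\<kappa> = \<eta> * \<delta> / 2"
  have \<kappa>: "\<kappa> > 0" using \<eta> \<delta> by (simp add: \<kappa>_def)
  have v\<eta>: "v * \<eta>\<^sup>2 / 2 - \<eta> * \<delta> \<le> - \<kappa>"
  proof -
    have "v * \<eta> \<le> \<delta>" using v \<delta> by (simp add: \<eta>_def field_simps)
    then have "\<eta> * (v * \<eta>) \<le> \<eta> * \<delta>" using \<eta> by (intro mult_left_mono) auto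
    then show ?thesis by (simp add: \<kappa>_def power2_eq_square mult_ac)
  qed
  have \<kappa>4: "\<kappa> / 4 > 0" using \<kappa> by simp
  have lt: "\<kappa> / 2 - A < 3 * \<kappa> / 4 - A" "\<kappa> / 4 - A < \<kappa> / 2 - A" using \<kappa> by auto
  from qcD[OF \<kappa>4, of \<theta>] qcD[OF \<kappa>4, of "\<theta> + \<eta>"] qcD[OF \<kappa>4, of "\<theta> - \<eta>"] rrD
    eventually_two_exp_le[OF s lt(1)] eventually_two_exp_le[OF s lt(2)] s0
  show "\<forall>\<^sub>F n in sequentially. exp (- c * s n) \<le> measure (M n) {\<omega> \<in> space (M n). \<bar>X n \<omega> - v * \<theta>\<bar> < \<delta>0}"
  proof eventually_elim
    case (elim n)
    interpret prob_space "M n" using elim by simp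
    have X: "X n \<in> borel_measurable (M n)" using elim by simp
    define S where "S = {\<omega> \<in> space (M n). \<bar>X n \<omega> - x\<bar> < \<delta>}"
    have S: "S \<in> events" unfolding S_def using X by measurable
    have sn: "s n > 0" using elim by simp
    define K where "K = exp (s n * (\<theta> * x + \<bar>\<theta>\<bar> * \<delta>))"
    have K0: "0 \<le> K" by (simp add: K_def)
    have pt: "exp (s n * \<theta> * X n \<omega>) \<le> K * indicator S \<omega> +
        exp (- (s n * \<eta>) * (x + \<delta>)) * exp (s n * (\<theta> + \<eta>) * X n \<omega>) +
        exp (s n * \<eta> * (x - \<delta>)) * exp (s n * (\<theta> - \<eta>) * X n \<omega>)" if w: "\<omega> \<in> space (M n)" for \<omega>
    proof -
      consider "\<bar>X n \<omega> - x\<bar> < \<delta>" | "X n \<omega> \<ge> x + \<delta>" | "X n \<omega> \<le> x - \<delta>" by linarith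
      then show ?thesis
      proof cases
        case 1
        have "\<theta> * (X n \<omega> - x) \<le> \<bar>\<theta>\<bar> * \<delta>"
        proof -
          have "\<theta> * (X n \<omega> - x) \<le> \<bar>\<theta>\<bar> * \<bar>X n \<omega> - x\<bar>"
            by (metis abs_ge_self abs_mult)
          also have "\<dots> \<le> \<bar>\<theta>\<bar> * \<delta>" using 1 by (intro mult_left_mono) auto
          finally show ?thesis .
        qed
        then have "\<theta> * X n \<omega> \<le> \<theta> * x + \<bar>\<theta>\<bar> * \<delta>" by (simp add: algebra_simps)
        then have "s n * (\<theta> * X n \<omega>) \<le> s n * (\<theta> * x + \<bar>\<theta>\<bar> * \<delta>)"
          using sn by (intro mult_left_mono) auto
        then have "exp (s n * \<theta> * X n \<omega>) \<le> K" unfolding K_def by (simp add: mult.assoc)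
        then show ?thesis using 1 w K0 by (simp add: S_def add_increasing2)
      next
        case 2
        have "s n * \<theta> * X n \<omega> \<le> - (s n * \<eta>) * (x + \<delta>) + s n * (\<theta> + \<eta>) * X n \<omega>"
        proof -
          have "0 \<le> (s n * \<eta>) * (X n \<omega> - (x + \<delta>))" using 2 sn \<eta> by simp
          then show ?thesis by (simp add: algebra_simps)
        qed
        then have "exp (s n * \<theta> * X n \<omega>) \<le> exp (- (s n * \<eta>) * (x + \<delta>)) * exp (s n * (\<theta> + \<eta>) * X n \<omega>)"
          unfolding exp_add[symmetric] by simp
        then show ?thesis by (simp add: K_def add_increasing add_increasing2)
      next
        case 3
        have "s n * \<theta> * X n \<omega> \<le> s n * \<eta> * (x - \<delta>) + s n * (\<theta> - \<eta>) * X n \<omega>"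
        proof -
          have "0 \<le> (s n * \<eta>) * ((x - \<delta>) - X n \<omega>)" using 3 sn \<eta> by simp
          then show ?thesis by (simp add: algebra_simps)
        qed
        then have "exp (s n * \<theta> * X n \<omega>) \<le> exp (s n * \<eta> * (x - \<delta>)) * exp (s n * (\<theta> - \<eta>) * X n \<omega>)"
          unfolding exp_add[symmetric] by simp
        then show ?thesis by (simp add: K_def add_increasing)
      qed
    qed
    have indS: "integrable (M n) (indicator S :: 'a \<Rightarrow> real)"
      using S by (intro integrable_real_indicator) (auto simp: emeasure_eq_measure)
    have "exp (s n * (A - \<kappa> / 4)) \<le> expectation (\<lambda>\<omega>. exp (s n * \<theta> * X n \<omega>))"
      using elim by (simp add: A_def)
    also have "\<dots> \<le> expectation (\<lambda>\<omega>. K * indicator S \<omega> +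
        exp (- (s n * \<eta>) * (x + \<delta>)) * exp (s n * (\<theta> + \<eta>) * X n \<omega>) +
        exp (s n * \<eta> * (x - \<delta>)) * exp (s n * (\<theta> - \<eta>) * X n \<omega>))"
      using elim indS pt by (intro integral_mono) auto
    also have "\<dots> = K * prob S + exp (- (s n * \<eta>) * (x + \<delta>)) * expectation (\<lambda>\<omega>. exp (s n * (\<theta> + \<eta>) * X n \<omega>))
        + exp (s n * \<eta> * (x - \<delta>)) * expectation (\<lambda>\<omega>. exp (s n * (\<theta> - \<eta>) * X n \<omega>))"
      using elim indS S by simp
    also have "\<dots> \<le> K * prob S + exp (- (s n * \<eta>) * (x + \<delta>)) * exp (s n * (v * (\<theta> + \<eta>)\<^sup>2 / 2 + \<kappa> / 4))
        + exp (s n * \<eta> * (x - \<delta>)) * exp (s n * (v * (\<theta> - \<eta>)\<^sup>2 / 2 + \<kappa> / 4))"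
      using elim K0 by (intro add_mono mult_left_mono) auto
    also have "\<dots> = K * prob S + 2 * exp (s n * (A + (v * \<eta>\<^sup>2 / 2 - \<eta> * \<delta>) + \<kappa> / 4))"
    proof -
      have "- (s n * \<eta>) * (x + \<delta>) + s n * (v * (\<theta> + \<eta>)\<^sup>2 / 2 + \<kappa> / 4) = s n * (A + (v * \<eta>\<^sup>2 / 2 - \<eta> * \<delta>) + \<kappa> / 4)"
        by (simp add: A_def x_def power2_eq_square field_simps)
      moreover have "s n * \<eta> * (x - \<delta>) + s n * (v * (\<theta> - \<eta>)\<^sup>2 / 2 + \<kappa> / 4) = s n * (A + (v * \<eta>\<^sup>2 / 2 - \<eta> * \<delta>) + \<kappa> / 4)"
        by (simp add: A_def x_def power2_eq_square field_simps)
      ultimately show ?thesis unfolding exp_add[symmetric] by simp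
    qed
    also have "\<dots> \<le> K * prob S + 2 * exp (- (3 * \<kappa> / 4 - A) * s n)"
    proof -
      have "s n * (A + (v * \<eta>\<^sup>2 / 2 - \<eta> * \<delta>) + \<kappa> / 4) \<le> s n * (A - \<kappa> + \<kappa> / 4)"
        using v\<eta> sn by (intro mult_left_mono) auto
      also have "\<dots> = - (3 * \<kappa> / 4 - A) * s n" by (simp add: algebra_simps)
      finally show ?thesis by simp
    qed
    finally have 1: "exp (s n * (A - \<kappa> / 4)) \<le> K * prob S + 2 * exp (- (3 * \<kappa> / 4 - A) * s n)" .
    have "exp (s n * (A - \<kappa> / 4)) = exp (- (\<kappa> / 4 - A) * s n)" by (simp add: algebra_simps)
    with 1 elim have "exp (- (\<kappa> / 2 - A) * s n) \<le> K * prob S" by linarith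
    then have "exp (- (\<kappa> / 2 - A) * s n) * inverse K \<le> prob S"
      by (simp add: K_def field_simps)
    moreover have "exp (- (\<kappa> / 2 - A) * s n) * inverse K = exp (- (A + \<kappa> / 2 + \<bar>\<theta>\<bar> * \<delta>) * s n)"
    proof -
      have "\<theta> * x = 2 * A" by (simp add: x_def A_def power2_eq_square)
      then have "- (\<kappa> / 2 - A) * s n + - (s n * (\<theta> * x + \<bar>\<theta>\<bar> * \<delta>)) = - (A + \<kappa> / 2 + \<bar>\<theta>\<bar> * \<delta>) * s n"
        by (simp add: algebra_simps)
      then show ?thesis unfolding K_def exp_minus[symmetric] exp_add[symmetric] by simp
    qed
    moreover have "exp (- c * s n) \<le> exp (- (A + \<kappa> / 2 + \<bar>\<theta>\<bar> * \<delta>) * s n)"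
    proof -
      have "\<kappa> / 2 \<le> \<delta>"
      proof -
        have "\<eta> * \<delta> \<le> 1 * \<delta>" using \<eta> \<delta> by (intro mult_right_mono) auto
        then show ?thesis using \<kappa> \<delta> by (simp add: \<kappa>_def)
      qed
      then have "A + \<kappa> / 2 + \<bar>\<theta>\<bar> * \<delta> \<le> c" using \<delta>c by (simp add: algebra_simps)
      then have "(A + \<kappa> / 2 + \<bar>\<theta>\<bar> * \<delta>) * s n \<le> c * s n"
        using sn by (intro mult_right_mono) auto
      then show ?thesis by (simp only: exp_le_cancel_iff mult_minus_left neg_le_iff_le)
    qed
    moreover have "prob S \<le> prob {\<omega> \<in> space (M n). \<bar>X n \<omega> - v * \<theta>\<bar> < \<delta>0}"
      using X \<delta> by (intro finite_measure_mono) (auto simp: S_def x_def)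
    ultimately show ?case by linarith
  qed
qed

lemma gauss_mdp_exponentially_equivalent:
  assumes s: "filterlim s at_top sequentially" and v: "v \<ge> 0"
    and X: "random_reals M X" and Y: "random_reals M Y" and mdp: "gauss_mdp M X s v"
    and eq: "\<And>\<epsilon>. \<epsilon> > 0 \<Longrightarrow> superexp s (\<lambda>n. measure (M n) {\<omega> \<in> space (M n). \<epsilon> < \<bar>Y n \<omega> - X n \<omega>\<bar>})"
  shows "gauss_mdp M Y s v"
  unfolding gauss_mdp_def
proof (intro conjI allI impI)
  fix d c :: real assume d: "d > 0" and c: "2 * v * c < d\<^sup>2"
  \<comment> \<open>Room for both the factor \<open>2\<close> from the union bound (\<open>c < c'\<close>) and the smaller distance
    \<open>d - \<epsilon>\<close>; the denominator keeps \<open>2 v c' < d\<^sup>2\<close> also for \<open>v = 0\<close>.\<close>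
  define c' where "c' = c + (d\<^sup>2 - 2 * v * c) / (4 * (v + 1))"
  have c': "c < c'" using c v by (simp add: c'_def)
  have vc': "2 * v * c' < d\<^sup>2"
  proof -
    have "2 * v / (4 * (v + 1)) \<le> 1 / 2" using v by (simp add: field_simps)
    then have "(d\<^sup>2 - 2 * v * c) * (2 * v / (4 * (v + 1))) \<le> (d\<^sup>2 - 2 * v * c) * (1 / 2)"
      using c by (intro mult_left_mono) auto
    moreover have "2 * v * c' = 2 * v * c + (d\<^sup>2 - 2 * v * c) * (2 * v / (4 * (v + 1)))"
      by (simp add: c'_def distrib_left)
    ultimately show ?thesis using c by simp
  qed
  define \<epsilon> where "\<epsilon> = min (d / 2) ((d\<^sup>2 - 2 * v * c') / (4 * d))"
  have \<epsilon>: "\<epsilon> > 0" "\<epsilon> < d" using d vc' by (auto simp: \<epsilon>_def)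
  have d\<epsilon>: "2 * v * c' < (d - \<epsilon>)\<^sup>2"
  proof -
    have "\<epsilon> \<le> (d\<^sup>2 - 2 * v * c') / (4 * d)" by (simp add: \<epsilon>_def)
    then have "\<epsilon> * (4 * d) \<le> d\<^sup>2 - 2 * v * c'" using d by (simp add: pos_le_divide_eq)
    moreover have "(d - \<epsilon>)\<^sup>2 = d\<^sup>2 - 2 * (\<epsilon> * d) + \<epsilon>\<^sup>2" by (simp add: power2_eq_square algebra_simps)
    moreover have "\<epsilon>\<^sup>2 > 0" using \<epsilon> by simp
    moreover have "\<epsilon> * (4 * d) = 4 * (\<epsilon> * d)" by simp
    ultimately show ?thesis using vc' by linarith
  qed
  have "d - \<epsilon> > 0" using \<epsilon> by simp
  from gauss_mdp_upper[OF mdp this d\<epsilon>] superexpD[OF eq[OF \<epsilon>(1)], of c'] eventually_two_exp_le[OF s c']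
    X[unfolded random_reals_def] Y[unfolded random_reals_def]
  show "\<forall>\<^sub>F n in sequentially. measure (M n) {\<omega> \<in> space (M n). d \<le> \<bar>Y n \<omega>\<bar>} \<le> exp (- c * s n)"
  proof eventually_elim
    case (elim n)
    interpret prob_space "M n" using elim by simp
    have m [measurable]: "X n \<in> borel_measurable (M n)" "Y n \<in> borel_measurable (M n)" using elim by auto
    have "prob {\<omega> \<in> space (M n). d \<le> \<bar>Y n \<omega>\<bar>} \<le>
      prob ({\<omega> \<in> space (M n). d - \<epsilon> \<le> \<bar>X n \<omega>\<bar>} \<union> {\<omega> \<in> space (M n). \<epsilon> < \<bar>Y n \<omega> - X n \<omega>\<bar>})"
      by (intro finite_measure_mono) auto
    also have "\<dots> \<le> prob {\<omega> \<in> space (M n). d - \<epsilon> \<le> \<bar>X n \<omega>\<bar>} + prob {\<omega> \<in> space (M n). \<epsilon> < \<bar>Y n \<omega> - X n \<omega>\<bar>}"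
      by (intro measure_Un_le) auto
    finally show ?case using elim by linarith
  qed
next
  fix \<theta> \<delta> c :: real assume \<delta>: "\<delta> > 0" and c: "c > v * \<theta>\<^sup>2 / 2"
  define c1 where "c1 = (c + v * \<theta>\<^sup>2 / 2) / 2"
  have c1: "v * \<theta>\<^sup>2 / 2 < c1" "c1 < c" using c by (auto simp: c1_def)
  have \<delta>2: "\<delta> / 2 > 0" using \<delta> by simp
  from gauss_mdp_lower[OF mdp \<delta>2 c1(1)] superexpD[OF eq[OF \<delta>2], of c] eventually_two_exp_le[OF s c1(2)]
    X[unfolded random_reals_def] Y[unfolded random_reals_def]
  show "\<forall>\<^sub>F n in sequentially. exp (- c * s n) \<le> measure (M n) {\<omega> \<in> space (M n). \<bar>Y n \<omega> - v * \<theta>\<bar> < \<delta>}"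
  proof eventually_elim
    case (elim n)
    interpret prob_space "M n" using elim by simp
    have m [measurable]: "X n \<in> borel_measurable (M n)" "Y n \<in> borel_measurable (M n)" using elim by auto
    have "prob {\<omega> \<in> space (M n). \<bar>X n \<omega> - v * \<theta>\<bar> < \<delta> / 2} \<le>
      prob ({\<omega> \<in> space (M n). \<bar>Y n \<omega> - v * \<theta>\<bar> < \<delta>} \<union> {\<omega> \<in> space (M n). \<delta> / 2 < \<bar>Y n \<omega> - X n \<omega>\<bar>})"
    proof (intro finite_measure_mono subsetI)
      fix \<omega> assume w: "\<omega> \<in> {\<omega> \<in> space (M n). \<bar>X n \<omega> - v * \<theta>\<bar> < \<delta> / 2}"
      then have "\<bar>X n \<omega> - v * \<theta>\<bar> < \<delta> / 2" by simp
      then have "\<bar>Y n \<omega> - v * \<theta>\<bar> < \<delta> \<or> \<delta> / 2 < \<bar>Y n \<omega> - X n \<omega>\<bar>" by linarith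
      then show "\<omega> \<in> {\<omega> \<in> space (M n). \<bar>Y n \<omega> - v * \<theta>\<bar> < \<delta>} \<union> {\<omega> \<in> space (M n). \<delta> / 2 < \<bar>Y n \<omega> - X n \<omega>\<bar>}"
        using w by auto
    qed measurable
    also have "\<dots> \<le> prob {\<omega> \<in> space (M n). \<bar>Y n \<omega> - v * \<theta>\<bar> < \<delta>} + prob {\<omega> \<in> space (M n). \<delta> / 2 < \<bar>Y n \<omega> - X n \<omega>\<bar>}"
      by (intro measure_Un_le) auto
    finally show ?case using elim by linarith
  qed
qed

lemma gauss_mdp_same_law:
  assumes X: "random_reals M X" and Y: "random_reals N Y" and mdp: "gauss_mdp M X s v"
    and law: "\<forall>\<^sub>F n in sequentially. distr (M n) borel (X n) = distr (N n) borel (Y n)"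
  shows "gauss_mdp N Y s v"
proof -
  have ev: "\<forall>\<^sub>F n in sequentially. \<forall>B\<in>sets borel. measure (M n) {\<omega> \<in> space (M n). X n \<omega> \<in> B} = measure (N n) {\<omega> \<in> space (N n). Y n \<omega> \<in> B}"
    using law X[unfolded random_reals_def] Y[unfolded random_reals_def]
  proof eventually_elim
    case (elim n)
    show ?case
    proof
      fix B :: "real set" assume B: "B \<in> sets borel"
      have "measure (M n) {\<omega> \<in> space (M n). X n \<omega> \<in> B} = measure (distr (M n) borel (X n)) B"
        using elim B by (subst measure_distr) (auto intro!: arg_cong[where f="measure (M n)"])
      also have "\<dots> = measure (N n) {\<omega> \<in> space (N n). Y n \<omega> \<in> B}"
        using elim B by (simp, subst measure_distr) (auto intro!: arg_cong[where f="measure (N n)"])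
      finally show "measure (M n) {\<omega> \<in> space (M n). X n \<omega> \<in> B} = measure (N n) {\<omega> \<in> space (N n). Y n \<omega> \<in> B}" .
    qed
  qed
  show ?thesis
    unfolding gauss_mdp_def
  proof (intro conjI allI impI)
    fix d c :: real assume "d > 0" "2 * v * c < d\<^sup>2"
    from gauss_mdp_upper[OF mdp this] ev
    show "\<forall>\<^sub>F n in sequentially. measure (N n) {\<omega> \<in> space (N n). d \<le> \<bar>Y n \<omega>\<bar>} \<le> exp (- c * s n)"
    proof eventually_elim
      case (elim n)
      have "{y :: real. d \<le> \<bar>y\<bar>} \<in> sets borel" by measurable
      from elim(2)[rule_format, OF this] elim(1) show ?case by simp
    qed
  next
    fix \<theta> \<delta> c :: real assume "\<delta> > 0" "c > v * \<theta>\<^sup>2 / 2"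
    from gauss_mdp_lower[OF mdp this] ev
    show "\<forall>\<^sub>F n in sequentially. exp (- c * s n) \<le> measure (N n) {\<omega> \<in> space (N n). \<bar>Y n \<omega> - v * \<theta>\<bar> < \<delta>}"
    proof eventually_elim
      case (elim n)
      have "{y :: real. \<bar>y - v * \<theta>\<bar> < \<delta>} \<in> sets borel" by measurable
      from elim(2)[rule_format, OF this] elim(1) show ?case by simp
    qed
  qed
qed

lemma elog_mono: "x \<le> y \<Longrightarrow> elog x \<le> elog y"
  by (auto simp: elog_def)

lemma elog_exp: "elog (exp x) = ereal x"
  by (simp add: elog_def)

text \<open>
  For a rate that is an increasing function of \<open>\<bar>x\<bar>\<close>, the infimum over a closed set is attained at a
  point closest to the origin, and the set lies outside the corresponding interval.
\<close>

lemma gauss_mdp_imp_satisfies_MDP: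
  assumes s: "filterlim s at_top sequentially" and v: "v \<ge> 0" and X: "random_reals M X"
    and mdp: "gauss_mdp M X s v"
    and K: "v > 0 \<Longrightarrow> K = ereal (1 / (2 * v))" "v = 0 \<Longrightarrow> K = \<infinity>"
  shows "satisfies_MDP M X s (\<lambda>x::real. K * ereal (x\<^sup>2))"
  unfolding satisfies_MDP_def
proof (intro conjI allI ballI)
  have s0: "\<forall>\<^sub>F n in sequentially. s n > 0"
    using s by (simp add: filterlim_at_top_dense)
  have K0: "0 \<le> K" using K v by (cases "v = 0") auto
  show I0: "0 \<le> K * ereal (x\<^sup>2)" for x using K0 by simp
  show "K * ereal (x\<^sup>2) \<le> Liminf (at x) (\<lambda>x. K * ereal (x\<^sup>2))" for x :: real
  proof (cases "v = 0")
    case False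
    then have Kv: "K = ereal (1 / (2 * v))" using v K by simp
    have "((\<lambda>x. ereal (1 / (2 * v) * x\<^sup>2)) \<longlongrightarrow> ereal (1 / (2 * v) * x\<^sup>2)) (at x)"
      by (intro tendsto_intros)
    then have "Liminf (at x) (\<lambda>x. K * ereal (x\<^sup>2)) = K * ereal (x\<^sup>2)"
      unfolding Kv by (intro lim_imp_Liminf) auto
    then show ?thesis by simp
  next
    case True
    show ?thesis
    proof (cases "x = 0")
      case x: True
      have "0 \<le> Liminf (at x) (\<lambda>x. K * ereal (x\<^sup>2))"
        using I0 by (intro Liminf_bounded) simp
      then show ?thesis using x by (simp add: zero_ereal_def[symmetric])
    next
      case x: False
      have "\<forall>\<^sub>F y in at x. y \<noteq> 0"
        using x by (intro tendsto_imp_eventually_ne[of "\<lambda>y. y" x]) (auto intro: tendsto_ident_at)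
      then have "\<forall>\<^sub>F y in at x. K * ereal (x\<^sup>2) \<le> K * ereal (y\<^sup>2)"
        by eventually_elim (simp add: K(2)[OF True])
      then show ?thesis by (rule Liminf_bounded)
    qed
  qed
  show "compact {x. K * ereal (x\<^sup>2) \<le> ereal \<alpha>}" for \<alpha>
  proof (cases "v = 0")
    case True
    have "K * ereal (x\<^sup>2) = (if x = 0 then 0 else \<infinity>)" for x :: real
      unfolding K(2)[OF True] by simp
    then have "{x. K * ereal (x\<^sup>2) \<le> ereal \<alpha>} = (if \<alpha> \<ge> 0 then {0} else {})"
      by (auto split: if_splits)
    then show ?thesis by simp
  next
    case False
    then have v0: "v > 0" using v by simp
    have "{x. K * ereal (x\<^sup>2) \<le> ereal \<alpha>} = {x. x\<^sup>2 \<le> 2 * v * \<alpha>}"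
      unfolding K(1)[OF v0] using v0 by (simp add: field_simps)
    moreover have "closed {x::real. x\<^sup>2 \<le> 2 * v * \<alpha>}"
      by (intro closed_Collect_le continuous_intros)
    moreover have "bounded {x::real. x\<^sup>2 \<le> 2 * v * \<alpha>}"
    proof (rule boundedI)
      fix x :: real assume "x \<in> {x. x\<^sup>2 \<le> 2 * v * \<alpha>}"
      then have "sqrt (x\<^sup>2) \<le> sqrt (2 * v * \<alpha>)" by (simp only: mem_Collect_eq real_sqrt_le_iff)
      then show "norm x \<le> sqrt (2 * v * \<alpha>)" by simp
    qed
    ultimately show ?thesis by (simp add: compact_eq_bounded_closed)
  qed
  fix A :: "real set" assume A: "A \<in> sets borel"
  define L where "L n = ereal (1 / s n) * elog (measure (M n) {\<omega> \<in> space (M n). X n \<omega> \<in> A})" for n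
  have meas: "\<forall>\<^sub>F n in sequentially. prob_space (M n) \<and> X n \<in> borel_measurable (M n)"
    using X by (simp add: random_reals_def)
  have L_upper: "limsup L \<le> ereal (- c)"
    if "\<forall>\<^sub>F n in sequentially. measure (M n) {\<omega> \<in> space (M n). X n \<omega> \<in> A} \<le> exp (- c * s n)" for c
  proof (rule Limsup_bounded)
    from that s0 show "\<forall>\<^sub>F n in sequentially. L n \<le> ereal (- c)"
    proof eventually_elim
      case (elim n)
      have "L n \<le> ereal (1 / s n) * elog (exp (- c * s n))"
        unfolding L_def using elim by (intro ereal_mult_left_mono elog_mono) auto
      also have "\<dots> = ereal (- c)" using elim by (simp add: elog_exp)
      finally show ?case .
    qed
  qed
  have L_lower: "ereal (- c) \<le> liminf L"
    if "\<forall>\<^sub>F n in sequentially. exp (- c * s n) \<le> measure (M n) {\<omega> \<in> space (M n). X n \<omega> \<in> A}" for c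
  proof (rule Liminf_bounded)
    from that s0 show "\<forall>\<^sub>F n in sequentially. ereal (- c) \<le> L n"
    proof eventually_elim
      case (elim n)
      have "ereal (- c) = ereal (1 / s n) * elog (exp (- c * s n))" using elim by (simp add: elog_exp)
      also have "\<dots> \<le> L n"
        unfolding L_def using elim by (intro ereal_mult_left_mono elog_mono) auto
      finally show ?case .
    qed
  qed
  show "- (INF x\<in>interior A. K * ereal (x\<^sup>2)) \<le> liminf (\<lambda>n. ereal (1 / s n) * elog (measure (M n) {\<omega> \<in> space (M n). X n \<omega> \<in> A}))"
    unfolding L_def[symmetric] ereal_INF_uminus_eq[symmetric]
  proof (rule ereal_uminus_le_reorder[THEN iffD1], rule INF_greatest)
    fix x assume x: "x \<in> interior A"
    show "- liminf L \<le> K * ereal (x\<^sup>2)"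
    proof (cases "v = 0 \<and> x \<noteq> 0")
      case True
      then show ?thesis using K(2) by simp
    next
      case False
      obtain \<theta> where \<theta>: "x = v * \<theta>" "K * ereal (x\<^sup>2) = ereal (v * \<theta>\<^sup>2 / 2)"
      proof (cases "v = 0")
        case True
        then show ?thesis using that[of 0] False by (simp add: zero_ereal_def[symmetric])
      next
        case nz: False
        then have v0: "v > 0" using v by simp
        show ?thesis
          using v0 by (intro that[of "x / v"]) (auto simp: K(1)[OF v0] power2_eq_square)
      qed
      obtain \<delta> where \<delta>: "\<delta> > 0" "ball x \<delta> \<subseteq> A"
        using x by (auto simp: mem_interior)
      have low: "ereal (- c) \<le> liminf L" if c: "v * \<theta>\<^sup>2 / 2 < c" for c
      proof (rule L_lower)
        from gauss_mdp_lower[OF mdp \<delta>(1) c] meas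
        show "\<forall>\<^sub>F n in sequentially. exp (- c * s n) \<le> measure (M n) {\<omega> \<in> space (M n). X n \<omega> \<in> A}"
        proof eventually_elim
          case (elim n)
          interpret prob_space "M n" using elim by simp
          have m [measurable]: "X n \<in> borel_measurable (M n)" using elim by simp
          have "{\<omega> \<in> space (M n). X n \<omega> \<in> A} \<in> events"
            using A by measurable
          then have "prob {\<omega> \<in> space (M n). \<bar>X n \<omega> - v * \<theta>\<bar> < \<delta>} \<le> prob {\<omega> \<in> space (M n). X n \<omega> \<in> A}"
            using \<delta> \<theta> by (intro finite_measure_mono) (auto simp: dist_real_def subset_iff abs_minus_commute)
          then show ?case using elim by linarith
        qed
      qed
      show ?thesis
        unfolding \<theta>(2)
      proof (rule ccontr)
        assume "\<not> - liminf L \<le> ereal (v * \<theta>\<^sup>2 / 2)"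
        then have "ereal (v * \<theta>\<^sup>2 / 2) < - liminf L" by simp
        then obtain c where c: "ereal (v * \<theta>\<^sup>2 / 2) < ereal c" "ereal c < - liminf L"
          using ereal_dense2 by blast
        have "ereal (- c) \<le> liminf L" using c by (intro low) simp
        then have "- liminf L \<le> ereal c" using ereal_uminus_le_reorder by fastforce
        then show False using c by simp
      qed
    qed
  qed
  show "limsup (\<lambda>n. ereal (1 / s n) * elog (measure (M n) {\<omega> \<in> space (M n). X n \<omega> \<in> A})) \<le> - (INF x\<in>closure A. K * ereal (x\<^sup>2))"
    unfolding L_def[symmetric]
  proof (cases "A = {}")
    case True
    have "limsup L \<le> ereal (- c)" for c
      using True by (intro L_upper) simp
    then have "limsup L = -\<infinity>" by (metis ereal_bot minus_equation_iff)
    then show "limsup L \<le> - (INF x\<in>closure A. K * ereal (x\<^sup>2))" by simp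
  next
    case False
    then obtain a where a: "a \<in> closure A" "\<And>y. y \<in> closure A \<Longrightarrow> dist 0 a \<le> dist 0 y"
      using distance_attains_inf[of "closure A" 0] by auto
    have "limsup L \<le> - (K * ereal (a\<^sup>2))"
    proof (cases "a = 0")
      case True
      have "limsup L \<le> ereal (- 0)"
      proof (rule L_upper)
        from meas show "\<forall>\<^sub>F n in sequentially. measure (M n) {\<omega> \<in> space (M n). X n \<omega> \<in> A} \<le> exp (- 0 * s n)"
          by eventually_elim (simp add: prob_space.prob_le_1)
      qed
      then show ?thesis using True by (simp add: zero_ereal_def[symmetric])
    next
      case a0: False
      have up: "limsup L \<le> ereal (- c)" if c: "2 * v * c < \<bar>a\<bar>\<^sup>2" for c
      proof (rule L_upper)
        have "\<bar>a\<bar> > 0" using a0 by simp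
        from gauss_mdp_upper[OF mdp this c] meas
        show "\<forall>\<^sub>F n in sequentially. measure (M n) {\<omega> \<in> space (M n). X n \<omega> \<in> A} \<le> exp (- c * s n)"
        proof eventually_elim
          case (elim n)
          interpret prob_space "M n" using elim by simp
          have m [measurable]: "X n \<in> borel_measurable (M n)" using elim by simp
          have "prob {\<omega> \<in> space (M n). X n \<omega> \<in> A} \<le> prob {\<omega> \<in> space (M n). \<bar>a\<bar> \<le> \<bar>X n \<omega>\<bar>}"
            using a(2) closure_subset[of A] by (intro finite_measure_mono) (auto simp: subset_iff)
          then show ?case using elim by linarith
        qed
      qed
      show ?thesis
      proof (rule ccontr)
        assume "\<not> limsup L \<le> - (K * ereal (a\<^sup>2))"
        then have "- (K * ereal (a\<^sup>2)) < limsup L" by simp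
        then obtain r where r: "- (K * ereal (a\<^sup>2)) < ereal r" "ereal r < limsup L"
          using ereal_dense2 by blast
        have "2 * v * (- r) < \<bar>a\<bar>\<^sup>2"
        proof (cases "v = 0")
          case True
          then show ?thesis using a0 by simp
        next
          case nz: False
          then have v0: "v > 0" using v by simp
          from r(1) have "- (1 / (2 * v) * a\<^sup>2) < r" unfolding K(1)[OF v0] by simp
          then show ?thesis using v0 by (simp add: field_simps)
        qed
        from up[OF this] r(2) show False by simp
      qed
    qed
    also have "\<dots> \<le> - (INF x\<in>closure A. K * ereal (x\<^sup>2))"
      using INF_lower[OF a(1), of "\<lambda>x. K * ereal (x\<^sup>2)"] by simp
    finally show "limsup L \<le> - (INF x\<in>closure A. K * ereal (x\<^sup>2))" .
  qed
qed


section \<open>Moment generating functions of weighted independent sums\<close>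

lemma exp_third_order:
  fixes z :: real
  shows "\<bar>exp z - 1 - z - z\<^sup>2 / 2\<bar> \<le> \<bar>z\<bar> ^ 3 * exp \<bar>z\<bar> / 6"
proof -
  obtain t where t: "\<bar>t\<bar> \<le> \<bar>z\<bar>" "exp z = (\<Sum>m<3. z ^ m / fact m) + exp t / fact 3 * z ^ 3"
    using Maclaurin_exp_le[of z 3] by blast
  have "(\<Sum>m<3. z ^ m / fact m) = 1 + z + z\<^sup>2 / 2"
    by (simp add: numeral_eq_Suc)
  then have "exp z - 1 - z - z\<^sup>2 / 2 = exp t / 6 * z ^ 3"
    using t(2) by (simp add: fact_numeral)
  then have "\<bar>exp z - 1 - z - z\<^sup>2 / 2\<bar> = \<bar>exp t / 6 * z ^ 3\<bar>" by (simp only:)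
  also have "\<bar>exp t / 6 * z ^ 3\<bar> \<le> exp \<bar>z\<bar> / 6 * \<bar>z\<bar> ^ 3"
    using t(1) by (simp add: abs_mult power_abs mult_right_mono)
  also have "\<dots> = \<bar>z\<bar> ^ 3 * exp \<bar>z\<bar> / 6" by simp
  finally show ?thesis .
qed

text \<open>
  The logarithm of the moment generating function is \<open>a\<^sup>2 v / 2 + o(a\<^sup>2)\<close> at the origin, in exponentiated
  form.
\<close>

definition log_mgf_quadratic :: "'w measure \<Rightarrow> ('w \<Rightarrow> real) \<Rightarrow> real \<Rightarrow> bool" where
  "log_mgf_quadratic M X v \<longleftrightarrow> (\<forall>\<epsilon>>0. \<exists>\<delta>>0. \<forall>a. \<bar>a\<bar> < \<delta> \<longrightarrow>
     integrable M (\<lambda>\<omega>. exp (a * X \<omega>)) \<and>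
     exp (a\<^sup>2 * (v / 2 - \<epsilon>)) \<le> (\<integral>\<omega>. exp (a * X \<omega>) \<partial>M) \<and>
     (\<integral>\<omega>. exp (a * X \<omega>) \<partial>M) \<le> exp (a\<^sup>2 * (v / 2 + \<epsilon>)))"

text \<open>
  The cubic remainder of the exponential series is dominated by a multiple of \<open>exp (\<eta> \<bar>X\<bar>)\<close>, since
  \<open>\<bar>X\<bar>\<^sup>3\<close> is dominated by a multiple of \<open>exp (\<eta> \<bar>X\<bar> / 2)\<close>.
\<close>

lemma (in prob_space) log_mgf_quadraticI:
  fixes X :: "'a \<Rightarrow> real"
  assumes X [measurable]: "X \<in> borel_measurable M" and \<eta>: "\<eta> > 0" and int: "integrable M (\<lambda>\<omega>. exp (\<eta> * \<bar>X \<omega>\<bar>))"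
    and mean: "expectation X = 0" and var: "expectation (\<lambda>\<omega>. (X \<omega>)\<^sup>2) = v"
  shows "log_mgf_quadratic M X v"
proof -
  define E where "E = expectation (\<lambda>\<omega>. exp (\<eta> * \<bar>X \<omega>\<bar>))"
  have E: "E \<ge> 0" by (simp add: E_def)
  define C where "C = 8 / \<eta> ^ 3 * E"
  have C: "C \<ge> 0" using E \<eta> by (simp add: C_def)
  have exp_ge: "y \<le> exp y" "y\<^sup>2 / 2 \<le> exp y" "y ^ 3 / 6 \<le> exp y" if "y \<ge> 0" for y :: real
  proof -
    show "y \<le> exp y" using exp_ge_add_one_self[of y] by linarith
    show "y\<^sup>2 / 2 \<le> exp y" using exp_lower_Taylor_quadratic[OF that] that by linarith
    obtain t where t: "exp y = (\<Sum>m<4. y ^ m / fact m) + exp t / fact 4 * y ^ 4" "\<bar>t\<bar> \<le> \<bar>y\<bar>"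
      using Maclaurin_exp_le[of y 4] by blast
    have "(\<Sum>m<4. y ^ m / fact m) = 1 + y + y\<^sup>2 / 2 + y ^ 3 / 6"
      by (simp add: numeral_eq_Suc)
    moreover have "exp t / fact 4 * y ^ 4 \<ge> 0" using that by simp
    moreover have "y\<^sup>2 / 2 \<ge> 0" by simp
    ultimately show "y ^ 3 / 6 \<le> exp y" using t(1) that by linarith
  qed
  have int1: "integrable M X"
  proof (rule Bochner_Integration.integrable_bound[OF integrable_mult_right[OF int, of "1 / \<eta>"]])
    show "AE \<omega> in M. norm (X \<omega>) \<le> norm (1 / \<eta> * exp (\<eta> * \<bar>X \<omega>\<bar>))"
      using exp_ge(1)[of "\<eta> * \<bar>X _\<bar>"] \<eta> by (intro AE_I2) (simp add: field_simps)
  qed simp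
  have int2: "integrable M (\<lambda>\<omega>. (X \<omega>)\<^sup>2)"
  proof (rule Bochner_Integration.integrable_bound[OF integrable_mult_right[OF int, of "2 / \<eta>\<^sup>2"]])
    show "AE \<omega> in M. norm ((X \<omega>)\<^sup>2) \<le> norm (2 / \<eta>\<^sup>2 * exp (\<eta> * \<bar>X \<omega>\<bar>))"
      using exp_ge(2)[of "\<eta> * \<bar>X _\<bar>"] \<eta> by (intro AE_I2) (simp add: field_simps power_mult_distrib)
  qed simp
  have v: "v \<ge> 0" unfolding var[symmetric] by simp
  have cube: "\<bar>X \<omega>\<bar> ^ 3 \<le> 48 / \<eta> ^ 3 * exp (\<eta> / 2 * \<bar>X \<omega>\<bar>)" for \<omega>
    using exp_ge(3)[of "\<eta> / 2 * \<bar>X \<omega>\<bar>"] \<eta> by (simp add: field_simps power_mult_distrib)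
  have expansion: "integrable M (\<lambda>\<omega>. exp (a * X \<omega>)) \<and>
     \<bar>expectation (\<lambda>\<omega>. exp (a * X \<omega>)) - (1 + a\<^sup>2 * v / 2)\<bar> \<le> C * \<bar>a\<bar> ^ 3" if a: "\<bar>a\<bar> \<le> \<eta> / 2" for a
  proof
    show ia: "integrable M (\<lambda>\<omega>. exp (a * X \<omega>))"
    proof (rule Bochner_Integration.integrable_bound[OF int])
      have "a * X \<omega> \<le> \<eta> * \<bar>X \<omega>\<bar>" for \<omega>
      proof -
        have "a * X \<omega> \<le> \<bar>a\<bar> * \<bar>X \<omega>\<bar>" by (metis abs_ge_self abs_mult)
        also have "\<dots> \<le> \<eta> * \<bar>X \<omega>\<bar>" using a \<eta> by (intro mult_right_mono) auto
        finally show ?thesis .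
      qed
      then show "AE \<omega> in M. norm (exp (a * X \<omega>)) \<le> norm (exp (\<eta> * \<bar>X \<omega>\<bar>))" by simp
    qed simp
    define R where "R \<omega> = exp (a * X \<omega>) - 1 - a * X \<omega> - (a * X \<omega>)\<^sup>2 / 2" for \<omega>
    have R: "\<bar>R \<omega>\<bar> \<le> 8 / \<eta> ^ 3 * \<bar>a\<bar> ^ 3 * exp (\<eta> * \<bar>X \<omega>\<bar>)" for \<omega>
    proof -
      have "\<bar>R \<omega>\<bar> \<le> \<bar>a * X \<omega>\<bar> ^ 3 * exp \<bar>a * X \<omega>\<bar> / 6"
        unfolding R_def by (rule exp_third_order)
      also have "\<dots> = \<bar>a\<bar> ^ 3 / 6 * (\<bar>X \<omega>\<bar> ^ 3 * exp (\<bar>a\<bar> * \<bar>X \<omega>\<bar>))"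
        by (simp add: abs_mult power_mult_distrib)
      also have "\<dots> \<le> \<bar>a\<bar> ^ 3 / 6 * ((48 / \<eta> ^ 3 * exp (\<eta> / 2 * \<bar>X \<omega>\<bar>)) * exp (\<eta> / 2 * \<bar>X \<omega>\<bar>))"
      proof -
        have "\<bar>a\<bar> * \<bar>X \<omega>\<bar> \<le> \<eta> / 2 * \<bar>X \<omega>\<bar>" using a by (intro mult_right_mono) auto
        then have "exp (\<bar>a\<bar> * \<bar>X \<omega>\<bar>) \<le> exp (\<eta> / 2 * \<bar>X \<omega>\<bar>)" by (simp only: exp_le_cancel_iff)
        with cube[of \<omega>] \<eta> show ?thesis by (intro mult_left_mono mult_mono) auto
      qed
      also have "\<dots> = 8 / \<eta> ^ 3 * \<bar>a\<bar> ^ 3 * (exp (\<eta> / 2 * \<bar>X \<omega>\<bar>) * exp (\<eta> / 2 * \<bar>X \<omega>\<bar>))"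
        by simp
      also have "exp (\<eta> / 2 * \<bar>X \<omega>\<bar>) * exp (\<eta> / 2 * \<bar>X \<omega>\<bar>) = exp (\<eta> * \<bar>X \<omega>\<bar>)"
        unfolding exp_add[symmetric] by simp
      finally show ?thesis .
    qed
    have Rint: "integrable M R"
      unfolding R_def power_mult_distrib using ia int1 int2 by simp
    have "expectation R = expectation (\<lambda>\<omega>. exp (a * X \<omega>)) - (1 + a\<^sup>2 * v / 2)"
      unfolding R_def power_mult_distrib using ia int1 int2 mean var by (simp add: prob_space)
    moreover have "\<bar>expectation R\<bar> \<le> expectation (\<lambda>\<omega>. \<bar>R \<omega>\<bar>)"
      by (rule integral_abs_bound)
    moreover have "expectation (\<lambda>\<omega>. \<bar>R \<omega>\<bar>) \<le> expectation (\<lambda>\<omega>. 8 / \<eta> ^ 3 * \<bar>a\<bar> ^ 3 * exp (\<eta> * \<bar>X \<omega>\<bar>))"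
      using R Rint int by (intro integral_mono integrable_abs integrable_mult_right) auto
    moreover have "expectation (\<lambda>\<omega>. 8 / \<eta> ^ 3 * \<bar>a\<bar> ^ 3 * exp (\<eta> * \<bar>X \<omega>\<bar>)) = C * \<bar>a\<bar> ^ 3"
      by (simp add: C_def E_def)
    ultimately show "\<bar>expectation (\<lambda>\<omega>. exp (a * X \<omega>)) - (1 + a\<^sup>2 * v / 2)\<bar> \<le> C * \<bar>a\<bar> ^ 3" by linarith
  qed
  show ?thesis
    unfolding log_mgf_quadratic_def
  proof (intro allI impI)
    fix \<epsilon> :: real assume \<epsilon>: "\<epsilon> > 0"
    define D where "D = v / 2 + C"
    have D: "D \<ge> 0" using v C by (simp add: D_def)
    define \<delta> where "\<delta> = min (min 1 (\<eta> / 2)) (min (\<epsilon> / (C + 2 * D\<^sup>2 + 1)) (1 / (2 * (D + 1))))"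
    have \<delta>: "\<delta> > 0" using \<eta> \<epsilon> C D by (simp add: \<delta>_def add_nonneg_pos)
    show "\<exists>\<delta>>0. \<forall>a. \<bar>a\<bar> < \<delta> \<longrightarrow> integrable M (\<lambda>\<omega>. exp (a * X \<omega>)) \<and>
       exp (a\<^sup>2 * (v / 2 - \<epsilon>)) \<le> expectation (\<lambda>\<omega>. exp (a * X \<omega>)) \<and>
       expectation (\<lambda>\<omega>. exp (a * X \<omega>)) \<le> exp (a\<^sup>2 * (v / 2 + \<epsilon>))"
    proof (intro exI[of _ \<delta>] conjI allI impI \<delta>)
      fix a :: real assume "\<bar>a\<bar> < \<delta>"
      then have a: "\<bar>a\<bar> \<le> 1" "\<bar>a\<bar> \<le> \<eta> / 2" "\<bar>a\<bar> \<le> \<epsilon> / (C + 2 * D\<^sup>2 + 1)" "\<bar>a\<bar> \<le> 1 / (2 * (D + 1))"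
        by (auto simp: \<delta>_def)
      have a3: "\<bar>a\<bar> * (C + 2 * D\<^sup>2 + 1) \<le> \<epsilon>"
        using a(3) C by (simp add: pos_le_divide_eq add_nonneg_pos)
      have aD: "\<bar>a\<bar> * D \<le> 1 / 2"
      proof -
        have "\<bar>a\<bar> * (2 * (D + 1)) \<le> 1" using a(4) D by (simp add: pos_le_divide_eq)
        then show ?thesis using D by (simp add: algebra_simps)
      qed
      note ex = expansion[OF a(2)]
      show "integrable M (\<lambda>\<omega>. exp (a * X \<omega>))" using ex by simp
      have aC: "C * \<bar>a\<bar> ^ 3 = a\<^sup>2 * (C * \<bar>a\<bar>)"
        by (simp add: power3_eq_cube power2_eq_square)
      have aC\<epsilon>: "C * \<bar>a\<bar> + 2 * (\<bar>a\<bar> * D\<^sup>2) \<le> \<epsilon>"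
        using a3 by (simp add: algebra_simps)
      have nn: "0 \<le> 2 * (\<bar>a\<bar> * D\<^sup>2)" by simp
      have "expectation (\<lambda>\<omega>. exp (a * X \<omega>)) \<le> 1 + a\<^sup>2 * (v / 2 + C * \<bar>a\<bar>)"
        using ex unfolding aC by (simp add: algebra_simps abs_le_iff)
      also have "\<dots> \<le> exp (a\<^sup>2 * (v / 2 + C * \<bar>a\<bar>))" by (rule exp_ge_add_one_self)
      also have "\<dots> \<le> exp (a\<^sup>2 * (v / 2 + \<epsilon>))"
      proof -
        have "C * \<bar>a\<bar> \<le> \<epsilon>" using aC\<epsilon> nn by linarith
        then have "a\<^sup>2 * (v / 2 + C * \<bar>a\<bar>) \<le> a\<^sup>2 * (v / 2 + \<epsilon>)" by (intro mult_left_mono) auto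
        then show ?thesis by (simp only: exp_le_cancel_iff)
      qed
      finally show "expectation (\<lambda>\<omega>. exp (a * X \<omega>)) \<le> exp (a\<^sup>2 * (v / 2 + \<epsilon>))" .
      define u where "u = a\<^sup>2 * (v / 2 - C * \<bar>a\<bar>)"
      have uD: "\<bar>u\<bar> \<le> a\<^sup>2 * D"
      proof -
        have "\<bar>v / 2 - C * \<bar>a\<bar>\<bar> \<le> D"
          using mult_left_mono[OF a(1) C] mult_nonneg_nonneg[OF C abs_ge_zero[of a]] v C
          unfolding D_def abs_le_iff by (intro conjI) linarith+
        then show ?thesis by (simp add: u_def abs_mult mult_left_mono)
      qed
      have a2: "a\<^sup>2 \<le> \<bar>a\<bar>"
        using a(1) mult_left_mono[OF a(1), of "\<bar>a\<bar>"] by (simp add: power2_eq_square)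
      have "a\<^sup>2 * D \<le> \<bar>a\<bar> * D" using a2 D by (rule mult_right_mono)
      then have u12: "\<bar>u\<bar> \<le> 1 / 2" using uD aD by linarith
      have "u\<^sup>2 \<le> a\<^sup>2 * (\<bar>a\<bar> * D\<^sup>2)"
      proof -
        have "u\<^sup>2 \<le> (a\<^sup>2 * D)\<^sup>2" using uD by (metis abs_ge_zero power2_abs power_mono)
        also have "\<dots> = a\<^sup>2 * (a\<^sup>2 * D\<^sup>2)" by (simp add: power2_eq_square)
        also have "\<dots> \<le> a\<^sup>2 * (\<bar>a\<bar> * D\<^sup>2)"
          using a2 by (intro mult_left_mono mult_right_mono) auto
        finally show ?thesis .
      qed
      moreover have "a\<^sup>2 * (C * \<bar>a\<bar> + 2 * (\<bar>a\<bar> * D\<^sup>2)) \<le> a\<^sup>2 * \<epsilon>"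
        using aC\<epsilon> by (rule mult_left_mono) simp
      ultimately have "a\<^sup>2 * (v / 2 - \<epsilon>) \<le> u - 2 * u\<^sup>2"
        by (simp add: u_def algebra_simps)
      also have "\<dots> \<le> ln (1 + u)"
        using abs_ln_one_plus_x_minus_x_bound[OF u12] by linarith
      finally have "exp (a\<^sup>2 * (v / 2 - \<epsilon>)) \<le> exp (ln (1 + u))" by simp
      also have "\<dots> = 1 + u" using u12 by (simp add: abs_le_iff)
      also have "\<dots> \<le> expectation (\<lambda>\<omega>. exp (a * X \<omega>))"
        using ex unfolding aC by (simp add: u_def algebra_simps abs_le_iff)
      finally show "exp (a\<^sup>2 * (v / 2 - \<epsilon>)) \<le> expectation (\<lambda>\<omega>. exp (a * X \<omega>))" .
    qed
  qed
qed

text \<open>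
  All averages that occur below, and the linear combination of them that matters, are sums of functions of
  this shape.
\<close>

definition pfun :: "real \<Rightarrow> real \<Rightarrow> real \<Rightarrow> real \<Rightarrow> real \<Rightarrow> real" where
  "pfun p \<alpha> \<beta> \<gamma> x = \<alpha> * x\<^sup>2 + \<beta> * \<bar>x\<bar> powr p + \<gamma>"

definition gauss_p_moment :: "real \<Rightarrow> real \<Rightarrow> real" where
  "gauss_p_moment p q = p powr (q / p) * Gamma ((q + 1) / p) / Gamma (1 / p)"

lemma measurable_pfun [measurable]: "pfun p \<alpha> \<beta> \<gamma> \<in> borel_measurable borel"
  by (simp add: pfun_def[abs_def])

text \<open>
  This rests on \<open>p \<ge> 2\<close>: the square is dominated by \<open>1 + \<bar>x\<bar>\<^sup>p\<close>, and the latter has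
  exponential moments under a density proportional to \<open>exp (- \<bar>x\<bar>\<^sup>p / p)\<close>.
\<close>

lemma pfun_exp_integrable:
  assumes p: "p \<ge> 2"
  shows "\<exists>\<eta>>0. integrable (gauss_p p) (\<lambda>x. exp (\<eta> * \<bar>pfun p \<alpha> \<beta> \<gamma> x\<bar>))"
proof -
  interpret prob_space "gauss_p p" using p by (intro prob_space_gauss_p) simp
  define K where "K = \<bar>\<alpha>\<bar> + \<bar>\<beta>\<bar> + \<bar>\<gamma>\<bar> + 1"
  have K: "K > 0" by (simp add: K_def)
  define \<eta> where "\<eta> = 1 / (2 * p * K)"
  have \<eta>: "\<eta> > 0" using K p by (simp add: \<eta>_def)
  have bound: "\<bar>pfun p \<alpha> \<beta> \<gamma> x\<bar> \<le> K * (1 + \<bar>x\<bar> powr p)" for x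
  proof -
    have x2: "x\<^sup>2 \<le> 1 + \<bar>x\<bar> powr p"
    proof (cases "\<bar>x\<bar> \<le> 1")
      case True
      then have "x\<^sup>2 \<le> 1" by (simp add: abs_square_le_1)
      then show ?thesis by (simp add: add_increasing2)
    next
      case False
      then have "x\<^sup>2 = \<bar>x\<bar> powr 2" by simp
      also have "\<dots> \<le> \<bar>x\<bar> powr p" using False p by (intro powr_mono) auto
      finally show ?thesis by simp
    qed
    have "\<bar>pfun p \<alpha> \<beta> \<gamma> x\<bar> \<le> \<bar>\<alpha> * x\<^sup>2\<bar> + \<bar>\<beta> * \<bar>x\<bar> powr p\<bar> + \<bar>\<gamma>\<bar>"
      unfolding pfun_def by linarith
    also have "\<dots> = \<bar>\<alpha>\<bar> * x\<^sup>2 + \<bar>\<beta>\<bar> * \<bar>x\<bar> powr p + \<bar>\<gamma>\<bar> * 1" by (simp add: abs_mult)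
    also have "\<dots> \<le> \<bar>\<alpha>\<bar> * (1 + \<bar>x\<bar> powr p) + \<bar>\<beta>\<bar> * (1 + \<bar>x\<bar> powr p) + \<bar>\<gamma>\<bar> * (1 + \<bar>x\<bar> powr p)"
      using x2 by (intro add_mono mult_left_mono) auto
    also have "\<dots> \<le> K * (1 + \<bar>x\<bar> powr p)"
    proof -
      have "0 \<le> 1 + \<bar>x\<bar> powr p" by (simp add: add_nonneg_nonneg)
      then show ?thesis unfolding K_def distrib_right by simp
    qed
    finally show ?thesis .
  qed
  have int: "integrable (gauss_p p) (\<lambda>x. \<bar>x\<bar> powr 0 * exp (1 / (2 * p) * \<bar>x\<bar> powr p))"
  proof (rule integrableI_nn_integral_finite)
    show "(\<integral>\<^sup>+x. ennreal (\<bar>x\<bar> powr 0 * exp (1 / (2 * p) * \<bar>x\<bar> powr p)) \<partial>gauss_p p) =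
      ennreal (2 * Gamma ((0 + 1) / p) / (p * (1 / p - 1 / (2 * p)) powr ((0 + 1) / p)) / gauss_p_norm p)"
      by (rule gauss_p_nn_integral_powr) (use p in \<open>auto simp: field_simps\<close>)
  qed auto
  have ae: "AE x in gauss_p p. x \<noteq> 0"
    unfolding gauss_p_def using AE_lborel_singleton[of "0::real"]
    by (subst AE_density) (auto simp: gauss_p_density_def)
  have "integrable (gauss_p p) (\<lambda>x. exp (\<eta> * K) * (\<bar>x\<bar> powr 0 * exp (1 / (2 * p) * \<bar>x\<bar> powr p)))"
    using int by simp
  then have "integrable (gauss_p p) (\<lambda>x. exp (\<eta> * \<bar>pfun p \<alpha> \<beta> \<gamma> x\<bar>))"
  proof (rule Bochner_Integration.integrable_bound)
    show "AE x in gauss_p p. norm (exp (\<eta> * \<bar>pfun p \<alpha> \<beta> \<gamma> x\<bar>)) \<le>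
        norm (exp (\<eta> * K) * (\<bar>x\<bar> powr 0 * exp (1 / (2 * p) * \<bar>x\<bar> powr p)))"
      using ae
    proof eventually_elim
      case (elim x)
      have "\<eta> * \<bar>pfun p \<alpha> \<beta> \<gamma> x\<bar> \<le> \<eta> * (K * (1 + \<bar>x\<bar> powr p))"
        using bound \<eta> by (intro mult_left_mono) auto
      also have "\<dots> = \<eta> * K + 1 / (2 * p) * \<bar>x\<bar> powr p"
        using K p by (simp add: \<eta>_def distrib_left)
      finally have "exp (\<eta> * \<bar>pfun p \<alpha> \<beta> \<gamma> x\<bar>) \<le> exp (\<eta> * K) * exp (1 / (2 * p) * \<bar>x\<bar> powr p)"
        unfolding exp_add[symmetric] by simp
      then show ?case using elim by simp
    qed
  qed simp
  then show ?thesis using \<eta> by blast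
qed

lemma abs_powr_2: "\<bar>x\<bar> powr 2 = (x::real)\<^sup>2"
  by (cases "x = 0") auto

lemma pfun_log_mgf:
  assumes p: "p \<ge> 2"
    and mean: "\<alpha> * gauss_p_moment p 2 + \<beta> * gauss_p_moment p p + \<gamma> = 0"
    and var: "v = \<alpha>\<^sup>2 * gauss_p_moment p 4 + \<beta>\<^sup>2 * gauss_p_moment p (2 * p) + \<gamma>\<^sup>2
      + 2 * \<alpha> * \<beta> * gauss_p_moment p (p + 2) + 2 * \<alpha> * \<gamma> * gauss_p_moment p 2 + 2 * \<beta> * \<gamma> * gauss_p_moment p p"
  shows "log_mgf_quadratic (gauss_p p) (pfun p \<alpha> \<beta> \<gamma>) v" and "0 \<le> v"
proof -
  have p0: "p > 0" using p by simp
  interpret prob_space "gauss_p p" by (rule prob_space_gauss_p[OF p0])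
  have pU: "prob UNIV = 1" using prob_space by simp
  note mom = gauss_p_abs_moment[OF p0, folded gauss_p_moment_def]
  obtain \<eta> where \<eta>: "\<eta> > 0" "integrable (gauss_p p) (\<lambda>x. exp (\<eta> * \<bar>pfun p \<alpha> \<beta> \<gamma> x\<bar>))"
    using pfun_exp_integrable[OF p] by blast
  have x4: "\<bar>x\<bar> powr 4 = x ^ 4" for x :: real by (cases "x = 0") auto
  have i2: "integrable (gauss_p p) (\<lambda>x. x\<^sup>2)" "(\<integral>x. x\<^sup>2 \<partial>gauss_p p) = gauss_p_moment p 2"
    using mom[of 2] by (simp_all add: abs_powr_2)
  have i4: "integrable (gauss_p p) (\<lambda>x. x ^ 4)" "(\<integral>x. x ^ 4 \<partial>gauss_p p) = gauss_p_moment p 4"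
    using mom[of 4] by (simp_all add: x4)
  have ip: "integrable (gauss_p p) (\<lambda>x. \<bar>x\<bar> powr p)" "(\<integral>x. \<bar>x\<bar> powr p \<partial>gauss_p p) = gauss_p_moment p p"
    using mom[of p] p by simp_all
  have i2p: "integrable (gauss_p p) (\<lambda>x. \<bar>x\<bar> powr (2 * p))" "(\<integral>x. \<bar>x\<bar> powr (2 * p) \<partial>gauss_p p) = gauss_p_moment p (2 * p)"
    using mom[of "2 * p"] p by simp_all
  have ip2: "integrable (gauss_p p) (\<lambda>x. \<bar>x\<bar> powr (p + 2))" "(\<integral>x. \<bar>x\<bar> powr (p + 2) \<partial>gauss_p p) = gauss_p_moment p (p + 2)"
    using mom[of "p + 2"] p by simp_all
  have sq: "(pfun p \<alpha> \<beta> \<gamma> x)\<^sup>2 = \<alpha>\<^sup>2 * x ^ 4 + \<beta>\<^sup>2 * \<bar>x\<bar> powr (2 * p) + \<gamma>\<^sup>2 + 2 * \<alpha> * \<beta> * \<bar>x\<bar> powr (p + 2)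
      + 2 * \<alpha> * \<gamma> * x\<^sup>2 + 2 * \<beta> * \<gamma> * \<bar>x\<bar> powr p" for x
  proof -
    have "\<bar>x\<bar> powr (2 * p) = (\<bar>x\<bar> powr p)\<^sup>2"
      using powr_add[of "\<bar>x\<bar>" p p] by (simp add: power2_eq_square)
    moreover have "\<bar>x\<bar> powr (p + 2) = \<bar>x\<bar> powr p * x\<^sup>2"
      unfolding powr_add abs_powr_2 ..
    ultimately show ?thesis
      by (simp add: pfun_def power2_eq_square power4_eq_xxxx algebra_simps)
  qed
  have second: "expectation (\<lambda>x. (pfun p \<alpha> \<beta> \<gamma> x)\<^sup>2) = v"
    unfolding sq var using i2 i4 ip i2p ip2 by (simp add: pU)
  show "0 \<le> v" unfolding second[symmetric] by (rule integral_nonneg_AE) simp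
  show "log_mgf_quadratic (gauss_p p) (pfun p \<alpha> \<beta> \<gamma>) v"
  proof (rule log_mgf_quadraticI[OF _ \<eta>])
    show "expectation (pfun p \<alpha> \<beta> \<gamma>) = 0"
      unfolding pfun_def using i2 ip mean by (simp add: pU)
    show "expectation (\<lambda>x. (pfun p \<alpha> \<beta> \<gamma> x)\<^sup>2) = v" by (rule second)
  qed simp
qed

lemma prob_pair_nonneg_product:
  assumes M: "prob_space M" and N: "prob_space N"
    and f: "integrable M f" "\<And>x. 0 \<le> f x" and g: "integrable N g" "\<And>y. 0 \<le> g y"
  shows "integrable (M \<Otimes>\<^sub>M N) (\<lambda>z. f (fst z) * g (snd z))"
    and "(\<integral>z. f (fst z) * g (snd z) \<partial>(M \<Otimes>\<^sub>M N)) = (\<integral>x. f x \<partial>M) * (\<integral>y. g y \<partial>N :: real)"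
proof -
  interpret M: prob_space M by (rule M)
  interpret N: prob_space N by (rule N)
  interpret P: pair_prob_space M N ..
  have m [measurable]: "f \<in> borel_measurable M" "g \<in> borel_measurable N" using f g by auto
  have "(\<integral>\<^sup>+z. ennreal (f (fst z) * g (snd z)) \<partial>(M \<Otimes>\<^sub>M N)) = (\<integral>\<^sup>+x. \<integral>\<^sup>+y. ennreal (f x * g y) \<partial>N \<partial>M)"
    by (subst N.nn_integral_fst[symmetric]) auto
  also have "\<dots> = (\<integral>\<^sup>+x. ennreal (f x) * ennreal (\<integral>y. g y \<partial>N) \<partial>M)"
  proof (rule nn_integral_cong)
    fix x
    have "(\<integral>\<^sup>+y. ennreal (f x * g y) \<partial>N) = (\<integral>\<^sup>+y. ennreal (f x) * ennreal (g y) \<partial>N)"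
      using f g by (simp add: ennreal_mult)
    also have "\<dots> = ennreal (f x) * (\<integral>\<^sup>+y. ennreal (g y) \<partial>N)" by (rule nn_integral_cmult) simp
    also have "(\<integral>\<^sup>+y. ennreal (g y) \<partial>N) = ennreal (\<integral>y. g y \<partial>N)"
      using g by (intro nn_integral_eq_integral) auto
    finally show "(\<integral>\<^sup>+y. ennreal (f x * g y) \<partial>N) = ennreal (f x) * ennreal (\<integral>y. g y \<partial>N)" .
  qed
  also have "\<dots> = (\<integral>\<^sup>+x. ennreal (f x) \<partial>M) * ennreal (\<integral>y. g y \<partial>N)"
    by (rule nn_integral_multc) simp
  also have "(\<integral>\<^sup>+x. ennreal (f x) \<partial>M) = ennreal (\<integral>x. f x \<partial>M)"
    using f by (intro nn_integral_eq_integral) auto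
  also have "ennreal (\<integral>x. f x \<partial>M) * ennreal (\<integral>y. g y \<partial>N) = ennreal ((\<integral>x. f x \<partial>M) * (\<integral>y. g y \<partial>N))"
    using f g by (simp add: ennreal_mult)
  finally have eq: "(\<integral>\<^sup>+z. ennreal (f (fst z) * g (snd z)) \<partial>(M \<Otimes>\<^sub>M N)) = ennreal ((\<integral>x. f x \<partial>M) * (\<integral>y. g y \<partial>N))" .
  have nn: "0 \<le> (\<integral>x. f x \<partial>M) * (\<integral>y. g y \<partial>N)" using f g by simp
  show "integrable (M \<Otimes>\<^sub>M N) (\<lambda>z. f (fst z) * g (snd z))"
    by (rule integrableI_nn_integral_finite[OF _ _ eq]) (use f g in auto)
  show "(\<integral>z. f (fst z) * g (snd z) \<partial>(M \<Otimes>\<^sub>M N)) = (\<integral>x. f x \<partial>M) * (\<integral>y. g y \<partial>N)"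
    by (subst integral_eq_nn_integral) (use f g eq nn in auto)
qed

lemma gauss_p_vec_exp_sum:
  fixes f :: "real \<Rightarrow> real" and a :: "nat \<Rightarrow> real"
  assumes p: "p > 0" and int: "\<And>i. i < n \<Longrightarrow> integrable (gauss_p p) (\<lambda>x. exp (a i * f x))"
  shows "integrable (gauss_p_vec n p) (\<lambda>y. exp (\<Sum>i<n. a i * f (y i)))"
    and "(\<integral>y. exp (\<Sum>i<n. a i * f (y i)) \<partial>gauss_p_vec n p) = (\<Prod>i<n. \<integral>x. exp (a i * f x) \<partial>gauss_p p)"
proof -
  interpret prob_space "gauss_p p" by (rule prob_space_gauss_p[OF p])
  interpret product_sigma_finite "\<lambda>_::nat. gauss_p p" by standard
  show "integrable (gauss_p_vec n p) (\<lambda>y. exp (\<Sum>i<n. a i * f (y i)))"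
    unfolding gauss_p_vec_def exp_sum[OF finite_lessThan]
    by (rule product_integrable_prod[where f="\<lambda>i x. exp (a i * f x)"]) (use int in auto)
  show "(\<integral>y. exp (\<Sum>i<n. a i * f (y i)) \<partial>gauss_p_vec n p) = (\<Prod>i<n. \<integral>x. exp (a i * f x) \<partial>gauss_p p)"
    unfolding gauss_p_vec_def exp_sum[OF finite_lessThan]
    by (rule product_integral_prod[where f="\<lambda>i x. exp (a i * f x)"]) (use int in auto)
qed

text \<open>
  The first component represents the direction of the random point, the second one the random subspace.
\<close>

definition reference_space :: "nat \<Rightarrow> real \<Rightarrow> ((nat \<Rightarrow> real) \<times> (nat \<Rightarrow> real)) measure" where
  "reference_space n p = gauss_p_vec n p \<Otimes>\<^sub>M gauss_p_vec n 2"

lemma prob_space_reference: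
  assumes "p > 0"
  shows "prob_space (reference_space n p)"
proof -
  interpret A: prob_space "gauss_p_vec n p" by (rule prob_space_gauss_p_vec[OF assms])
  interpret B: prob_space "gauss_p_vec n 2" by (rule prob_space_gauss_p_vec) simp
  interpret pair_prob_space "gauss_p_vec n p" "gauss_p_vec n 2" ..
  show ?thesis unfolding reference_space_def by (rule prob_space_axioms)
qed

text \<open>
  The bound on the weights is independent of the number of terms, so the estimate can be used with
  \<open>n\<close> growing.
\<close>

lemma reference_exp_sum:
  assumes p: "p > 0" and f: "log_mgf_quadratic (gauss_p p) f v" and g: "log_mgf_quadratic (gauss_p 2) g w"
    and \<epsilon>: "\<epsilon> > 0"
  shows "\<exists>\<delta>>0. \<forall>n a b. (\<forall>i<n. \<bar>a i\<bar> < \<delta>) \<longrightarrow> (\<forall>i<n. \<bar>b i\<bar> < \<delta>) \<longrightarrow>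
     integrable (reference_space n p) (\<lambda>z. exp ((\<Sum>i<n. a i * f (fst z i)) + (\<Sum>i<n. b i * g (snd z i)))) \<and>
     exp ((v / 2 - \<epsilon>) * (\<Sum>i<n. (a i)\<^sup>2) + (w / 2 - \<epsilon>) * (\<Sum>i<n. (b i)\<^sup>2)) \<le>
       (\<integral>z. exp ((\<Sum>i<n. a i * f (fst z i)) + (\<Sum>i<n. b i * g (snd z i))) \<partial>reference_space n p) \<and>
     (\<integral>z. exp ((\<Sum>i<n. a i * f (fst z i)) + (\<Sum>i<n. b i * g (snd z i))) \<partial>reference_space n p) \<le>
       exp ((v / 2 + \<epsilon>) * (\<Sum>i<n. (a i)\<^sup>2) + (w / 2 + \<epsilon>) * (\<Sum>i<n. (b i)\<^sup>2))"
proof -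
  have single: "\<exists>\<delta>>0. \<forall>(n::nat) a. (\<forall>i<n. \<bar>a i\<bar> < \<delta>) \<longrightarrow>
     integrable (gauss_p_vec n p) (\<lambda>y. exp (\<Sum>i<n. a i * f (y i))) \<and>
     exp ((v / 2 - \<epsilon>) * (\<Sum>i<n. (a i)\<^sup>2)) \<le> (\<integral>y. exp (\<Sum>i<n. a i * f (y i)) \<partial>gauss_p_vec n p) \<and>
     (\<integral>y. exp (\<Sum>i<n. a i * f (y i)) \<partial>gauss_p_vec n p) \<le> exp ((v / 2 + \<epsilon>) * (\<Sum>i<n. (a i)\<^sup>2))"
    if p: "p > 0" and f: "log_mgf_quadratic (gauss_p p) f v" for p f v
  proof -
    obtain \<delta> where \<delta>: "\<delta> > 0" and *: "\<And>a. \<bar>a\<bar> < \<delta> \<Longrightarrow> integrable (gauss_p p) (\<lambda>x. exp (a * f x)) \<and>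
     exp (a\<^sup>2 * (v / 2 - \<epsilon>)) \<le> (\<integral>x. exp (a * f x) \<partial>gauss_p p) \<and> (\<integral>x. exp (a * f x) \<partial>gauss_p p) \<le> exp (a\<^sup>2 * (v / 2 + \<epsilon>))"
      using f \<epsilon> unfolding log_mgf_quadratic_def by blast
    show ?thesis
    proof (intro exI[of _ \<delta>] conjI allI impI \<delta>)
      fix n :: nat and a :: "nat \<Rightarrow> real" assume a: "\<forall>i<n. \<bar>a i\<bar> < \<delta>"
      have int: "integrable (gauss_p p) (\<lambda>x. exp (a i * f x))" if "i < n" for i
        using * a that by blast
      note e = gauss_p_vec_exp_sum[OF p, of n a f, OF int]
      show "integrable (gauss_p_vec n p) (\<lambda>y. exp (\<Sum>i<n. a i * f (y i)))" by (rule e)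
      have ex: "(\<Prod>i<n. exp ((a i)\<^sup>2 * c)) = exp (c * (\<Sum>i<n. (a i)\<^sup>2))" for c
        by (simp add: exp_sum[symmetric] sum_distrib_left mult.commute)
      have "exp ((v / 2 - \<epsilon>) * (\<Sum>i<n. (a i)\<^sup>2)) \<le> (\<Prod>i<n. \<integral>x. exp (a i * f x) \<partial>gauss_p p)"
        unfolding ex[symmetric] using * a by (intro prod_mono) auto
      also have "\<dots> = (\<integral>y. exp (\<Sum>i<n. a i * f (y i)) \<partial>gauss_p_vec n p)"
        by (rule e(2)[symmetric])
      finally show "exp ((v / 2 - \<epsilon>) * (\<Sum>i<n. (a i)\<^sup>2)) \<le> (\<integral>y. exp (\<Sum>i<n. a i * f (y i)) \<partial>gauss_p_vec n p)" .
      have "(\<integral>y. exp (\<Sum>i<n. a i * f (y i)) \<partial>gauss_p_vec n p) = (\<Prod>i<n. \<integral>x. exp (a i * f x) \<partial>gauss_p p)"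
        by (rule e(2))
      also have "\<dots> \<le> exp ((v / 2 + \<epsilon>) * (\<Sum>i<n. (a i)\<^sup>2))"
        unfolding ex[symmetric] using * a by (intro prod_mono) auto
      finally show "(\<integral>y. exp (\<Sum>i<n. a i * f (y i)) \<partial>gauss_p_vec n p) \<le> exp ((v / 2 + \<epsilon>) * (\<Sum>i<n. (a i)\<^sup>2))" .
    qed
  qed
  obtain \<delta>1 where \<delta>1: "\<delta>1 > 0" and s1: "\<And>n a. (\<forall>i<n. \<bar>a i\<bar> < \<delta>1) \<Longrightarrow>
     integrable (gauss_p_vec n p) (\<lambda>y. exp (\<Sum>i<n. a i * f (y i))) \<and>
     exp ((v / 2 - \<epsilon>) * (\<Sum>i<n. (a i)\<^sup>2)) \<le> (\<integral>y. exp (\<Sum>i<n. a i * f (y i)) \<partial>gauss_p_vec n p) \<and>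
     (\<integral>y. exp (\<Sum>i<n. a i * f (y i)) \<partial>gauss_p_vec n p) \<le> exp ((v / 2 + \<epsilon>) * (\<Sum>i<n. (a i)\<^sup>2))"
    using single[OF p f] by blast
  have two: "(2::real) > 0" by simp
  obtain \<delta>2 where \<delta>2: "\<delta>2 > 0" and s2: "\<And>n b. (\<forall>i<n. \<bar>b i\<bar> < \<delta>2) \<Longrightarrow>
     integrable (gauss_p_vec n 2) (\<lambda>y. exp (\<Sum>i<n. b i * g (y i))) \<and>
     exp ((w / 2 - \<epsilon>) * (\<Sum>i<n. (b i)\<^sup>2)) \<le> (\<integral>y. exp (\<Sum>i<n. b i * g (y i)) \<partial>gauss_p_vec n 2) \<and>
     (\<integral>y. exp (\<Sum>i<n. b i * g (y i)) \<partial>gauss_p_vec n 2) \<le> exp ((w / 2 + \<epsilon>) * (\<Sum>i<n. (b i)\<^sup>2))"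
    using single[OF two g] by blast
  show ?thesis
  proof (intro exI[of _ "min \<delta>1 \<delta>2"] conjI allI impI)
    show "min \<delta>1 \<delta>2 > 0" using \<delta>1 \<delta>2 by simp
    fix n :: nat and a b :: "nat \<Rightarrow> real"
    assume "\<forall>i<n. \<bar>a i\<bar> < min \<delta>1 \<delta>2" "\<forall>i<n. \<bar>b i\<bar> < min \<delta>1 \<delta>2"
    then have a: "\<forall>i<n. \<bar>a i\<bar> < \<delta>1" and b: "\<forall>i<n. \<bar>b i\<bar> < \<delta>2" by auto
    note a = s1[OF a] and b = s2[OF b]
    note pr = prob_pair_nonneg_product[OF prob_space_gauss_p_vec[OF p] prob_space_gauss_p_vec[OF two],
      OF conjunct1[OF a] _ conjunct1[OF b], simplified, folded reference_space_def]
    show "integrable (reference_space n p) (\<lambda>z. exp ((\<Sum>i<n. a i * f (fst z i)) + (\<Sum>i<n. b i * g (snd z i))))"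
      unfolding exp_add by (rule pr)
    show "exp ((v / 2 - \<epsilon>) * (\<Sum>i<n. (a i)\<^sup>2) + (w / 2 - \<epsilon>) * (\<Sum>i<n. (b i)\<^sup>2)) \<le>
       (\<integral>z. exp ((\<Sum>i<n. a i * f (fst z i)) + (\<Sum>i<n. b i * g (snd z i))) \<partial>reference_space n p)"
      unfolding exp_add pr(2) using a b by (intro mult_mono) auto
    show "(\<integral>z. exp ((\<Sum>i<n. a i * f (fst z i)) + (\<Sum>i<n. b i * g (snd z i))) \<partial>reference_space n p) \<le>
       exp ((v / 2 + \<epsilon>) * (\<Sum>i<n. (a i)\<^sup>2) + (w / 2 + \<epsilon>) * (\<Sum>i<n. (b i)\<^sup>2))"
      unfolding exp_add pr(2) using a b by (intro mult_mono) auto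
  qed
qed


section \<open>The statistic in independent coordinates\<close>

lemma gauss_p_moment_values:
  assumes p: "p > 0"
  shows "gauss_p_moment p p = 1" "gauss_p_moment p (2 * p) = p + 1"
    "gauss_p_moment p (p + 2) = 3 * gauss_p_moment p 2" "gauss_p_moment p 2 > 0"
proof -
  have p1: "1 / p > 0" "3 / p > 0" "1 + 1 / p > 0" using p by (auto intro: add_pos_pos)
  have g0: "Gamma (1 / p) > 0" using p1 by (intro Gamma_real_pos)
  have g1: "Gamma (1 / p + 1) = 1 / p * Gamma (1 / p)" by (rule Gamma_plus1_pos[OF p1(1)])
  have g2: "Gamma (1 + 1 / p + 1) = (1 + 1 / p) * Gamma (1 / p + 1)"
    using Gamma_plus1_pos[OF p1(3)] by (simp add: add.commute)
  have g3: "Gamma (3 / p + 1) = 3 / p * Gamma (3 / p)" by (rule Gamma_plus1_pos[OF p1(2)])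
  have e1: "(p + 1) / p = 1 / p + 1" "(2 * p + 1) / p = 1 + 1 / p + 1" "(p + 2 + 1) / p = 3 / p + 1"
    using p by (auto simp: field_simps)
  have g00: "Gamma (1 / p) \<noteq> 0" using g0 by (rule less_imp_neq[symmetric])
  show "gauss_p_moment p p = 1"
    unfolding gauss_p_moment_def e1 g1 using p g00 by simp
  show "gauss_p_moment p (2 * p) = p + 1"
  proof -
    have "p powr (2 * p / p) = p\<^sup>2" using p by simp
    then have "gauss_p_moment p (2 * p) = p\<^sup>2 * ((1 + 1 / p) * (1 / p * Gamma (1 / p))) / Gamma (1 / p)"
      unfolding gauss_p_moment_def e1 g2 g1 by simp
    also have "\<dots> = p\<^sup>2 * ((1 + 1 / p) * (1 / p))" using g00 by simp
    also have "\<dots> = p + 1" using p by (simp add: power2_eq_square field_simps)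
    finally show ?thesis .
  qed
  show "gauss_p_moment p (p + 2) = 3 * gauss_p_moment p 2"
  proof -
    have "p powr ((p + 2) / p) = p * p powr (2 / p)"
      using p by (simp add: add_divide_distrib powr_add)
    then have "gauss_p_moment p (p + 2) = p * p powr (2 / p) * (3 / p * Gamma (3 / p)) / Gamma (1 / p)"
      unfolding gauss_p_moment_def e1 g3 by simp
    also have "\<dots> = 3 * (p powr (2 / p) * Gamma (3 / p) / Gamma (1 / p))" using p by simp
    also have "p powr (2 / p) * Gamma (3 / p) / Gamma (1 / p) = gauss_p_moment p 2" by (simp add: gauss_p_moment_def)
    finally show ?thesis .
  qed
  show "gauss_p_moment p 2 > 0"
    unfolding gauss_p_moment_def using p1 p by (intro divide_pos_pos mult_pos_pos Gamma_real_pos) auto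
qed

text \<open>
  The variance of \<open>Y\<^sup>2 / (2 \<sigma>\<^sup>2) - \<bar>Y\<bar>\<^sup>p / p\<close> for a generalized Gaussian variable \<open>Y\<close> with second
  moment \<open>\<sigma>\<^sup>2\<close> (\<open>linear_statistic_log_mgf\<close>). That function is the first order fluctuation of the
  logarithm of the quotient of the Euclidean norm by the \<open>p\<close>-norm. The variance vanishes for
  \<open>p = 2\<close>.
\<close>

definition ratio_variance :: "real \<Rightarrow> real" where
  "ratio_variance p = gauss_p_moment p 4 / (4 * (gauss_p_moment p 2)\<^sup>2) - 1 / p - 1 / 4"

lemma linear_statistic_log_mgf:
  assumes p: "p \<ge> 2"
  shows "log_mgf_quadratic (gauss_p 2) (pfun 2 1 0 (-1)) 2"
    and "log_mgf_quadratic (gauss_p p) (pfun p (1 / (2 * gauss_p_moment p 2)) (- 1 / p) (1 / p - 1 / 2)) (ratio_variance p)"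
    and "0 \<le> ratio_variance p"
    and "\<exists>v. log_mgf_quadratic (gauss_p p) (pfun p (1 / gauss_p_moment p 2) 0 (-1)) v"
    and "\<exists>v. log_mgf_quadratic (gauss_p p) (pfun p 0 1 (-1)) v"
proof -
  have p0: "p > 0" using p by simp
  note m = gauss_p_moment_values[OF p0]
  have two: "(2::real) > 0" by simp
  have m2: "gauss_p_moment 2 2 = 1" "gauss_p_moment 2 4 = 3"
    using gauss_p_moment_values[OF two] by simp_all
  show "log_mgf_quadratic (gauss_p 2) (pfun 2 1 0 (-1)) 2"
    by (rule pfun_log_mgf(1)) (simp_all add: m2)
  define S where "S = gauss_p_moment p 2"
  have S: "S > 0" using m by (simp add: S_def)
  have mean: "1 / (2 * S) * S + - 1 / p * 1 + (1 / p - 1 / 2) = 0"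
    and var: "ratio_variance p = (1 / (2 * S))\<^sup>2 * gauss_p_moment p 4 + (- 1 / p)\<^sup>2 * (p + 1) + (1 / p - 1 / 2)\<^sup>2 +
      2 * (1 / (2 * S)) * (- 1 / p) * (3 * S) + 2 * (1 / (2 * S)) * (1 / p - 1 / 2) * S + 2 * (- 1 / p) * (1 / p - 1 / 2) * 1"
  proof -
    show "1 / (2 * S) * S + - 1 / p * 1 + (1 / p - 1 / 2) = 0" using S by simp
    define q where "q = 1 / p"
    have q: "p * q = 1" using p0 by (simp add: q_def)
    have h1: "(1 / (2 * S))\<^sup>2 * gauss_p_moment p 4 = gauss_p_moment p 4 / (4 * S\<^sup>2)"
      by (simp add: power2_eq_square)
    have h2: "(- 1 / p)\<^sup>2 * (p + 1) = q + q\<^sup>2"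
    proof -
      have "(- 1 / p)\<^sup>2 * (p + 1) = q * (p * q) + q\<^sup>2" by (simp add: q_def power2_eq_square field_simps)
      then show ?thesis by (simp add: q)
    qed
    have h3: "2 * (1 / (2 * S)) * (- 1 / p) * (3 * S) = - 3 * q" using S by (simp add: q_def)
    have h4: "2 * (1 / (2 * S)) * (1 / p - 1 / 2) * S = q - 1 / 2" using S by (simp add: q_def)
    have h5: "(1 / p - 1 / 2)\<^sup>2 = q\<^sup>2 - q + 1 / 4" by (simp add: q_def power2_eq_square algebra_simps)
    have h6: "2 * (- 1 / p) * (1 / p - 1 / 2) * 1 = - 2 * q\<^sup>2 + q" by (simp add: q_def power2_eq_square algebra_simps)
    show "ratio_variance p = (1 / (2 * S))\<^sup>2 * gauss_p_moment p 4 + (- 1 / p)\<^sup>2 * (p + 1) + (1 / p - 1 / 2)\<^sup>2 +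
      2 * (1 / (2 * S)) * (- 1 / p) * (3 * S) + 2 * (1 / (2 * S)) * (1 / p - 1 / 2) * S + 2 * (- 1 / p) * (1 / p - 1 / 2) * 1"
      unfolding h1 h2 h3 h4 h5 h6 by (simp add: ratio_variance_def S_def[symmetric] q_def)
  qed
  note lin = pfun_log_mgf[OF p, of "1 / (2 * gauss_p_moment p 2)" "- 1 / p" "1 / p - 1 / 2" "ratio_variance p",
    unfolded m S_def[symmetric], OF mean var]
  show "log_mgf_quadratic (gauss_p p) (pfun p (1 / (2 * gauss_p_moment p 2)) (- 1 / p) (1 / p - 1 / 2)) (ratio_variance p)"
    using lin(1) by (simp only: S_def)
  show "0 \<le> ratio_variance p" by (rule lin(2))
  show "\<exists>v. log_mgf_quadratic (gauss_p p) (pfun p (1 / gauss_p_moment p 2) 0 (-1)) v"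
    by (rule exI, rule pfun_log_mgf(1)[OF p _ refl]) (use S in \<open>simp add: S_def\<close>)
  show "\<exists>v. log_mgf_quadratic (gauss_p p) (pfun p 0 1 (-1)) v"
    by (rule exI, rule pfun_log_mgf(1)[OF p _ refl]) (simp add: m)
qed

text \<open>
  Linearize the logarithm first, where the product becomes a sum, and then the exponential function; each
  step has a quadratic error.
\<close>

lemma linearization_error:
  fixes w1 w2 w3 w4 e p :: real
  assumes w: "\<bar>w1\<bar> \<le> e" "\<bar>w2\<bar> \<le> e" "\<bar>w3\<bar> \<le> e" "\<bar>w4\<bar> \<le> e" and e: "e \<le> 1 / 8" and p: "p \<ge> 2"
  shows "\<bar>sqrt ((1 + w1) / (1 + w2) * (1 + w3)) / (1 + w4) powr (1 / p) - 1 - (w1 / 2 - w2 / 2 + w3 / 2 - w4 / p)\<bar> \<le> 22 * e\<^sup>2"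
proof -
  have e0: "e \<ge> 0" using w(1) by linarith
  define R where "R w = ln (1 + w) - w" for w :: real
  have R: "\<bar>R w\<bar> \<le> 2 * e\<^sup>2" and pos: "1 + w > 0" if "\<bar>w\<bar> \<le> e" for w
  proof -
    have "\<bar>w\<bar> \<le> 1 / 2" using that e by linarith
    then have "\<bar>R w\<bar> \<le> 2 * w\<^sup>2" unfolding R_def by (rule abs_ln_one_plus_x_minus_x_bound)
    also have "w\<^sup>2 \<le> e\<^sup>2" using that by (metis abs_ge_zero power2_abs power_mono)
    finally show "\<bar>R w\<bar> \<le> 2 * e\<^sup>2" by simp
    show "1 + w > 0" using \<open>\<bar>w\<bar> \<le> 1 / 2\<close> by linarith
  qed
  note pos = pos[OF w(1)] pos[OF w(2)] pos[OF w(3)] pos[OF w(4)]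
  define F where "F = sqrt ((1 + w1) / (1 + w2) * (1 + w3)) / (1 + w4) powr (1 / p)"
  define l where "l = w1 / 2 - w2 / 2 + w3 / 2 - w4 / p"
  have arg: "(1 + w1) / (1 + w2) * (1 + w3) > 0" using pos by simp
  have F: "F > 0" using arg pos by (simp add: F_def)
  have "ln F = (ln (1 + w1) - ln (1 + w2) + ln (1 + w3)) / 2 - ln (1 + w4) / p"
    unfolding F_def using arg pos
    by (simp add: ln_div ln_sqrt ln_mult ln_powr)
  then have lnF: "ln F - l = (R w1 - R w2 + R w3) / 2 - R w4 / p"
    by (simp add: l_def R_def diff_divide_distrib add_divide_distrib)
  have R4: "\<bar>R w4 / p\<bar> \<le> e\<^sup>2"
  proof -
    have "\<bar>R w4 / p\<bar> = \<bar>R w4\<bar> / p" using p by simp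
    also have "\<dots> \<le> (2 * e\<^sup>2) / 2" using R[OF w(4)] p by (intro frac_le) auto
    finally show ?thesis by simp
  qed
  have d1: "\<bar>ln F - l\<bar> \<le> 4 * e\<^sup>2"
  proof -
    have "\<bar>(a - b + c) / 2 - x\<bar> \<le> 4 * E"
      if "\<bar>a\<bar> \<le> 2 * E" "\<bar>b\<bar> \<le> 2 * E" "\<bar>c\<bar> \<le> 2 * E" "\<bar>x\<bar> \<le> E" for a b c x E :: real
      using that by (auto simp: abs_le_iff field_simps)
    from this[OF R[OF w(1)] R[OF w(2)] R[OF w(3)] R4] show ?thesis unfolding lnF .
  qed
  have l: "\<bar>l\<bar> \<le> 2 * e"
  proof -
    have "\<bar>w4 / p\<bar> \<le> e / 2"
    proof -
      have "\<bar>w4 / p\<bar> = \<bar>w4\<bar> / p" using p by simp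
      also have "\<dots> \<le> e / 2" using w(4) p by (intro frac_le) auto
      finally show ?thesis .
    qed
    moreover have "\<bar>w1 / 2 - w2 / 2 + w3 / 2 - x\<bar> \<le> 2 * e" if "\<bar>x\<bar> \<le> e / 2" for x
      using that w(1-3) by (auto simp: abs_le_iff field_simps)
    ultimately show ?thesis unfolding l_def by blast
  qed
  have e2: "4 * e\<^sup>2 \<le> e"
    using mult_left_mono[OF e, of "4 * e"] e0 by (simp add: power2_eq_square)
  have L: "\<bar>ln F\<bar> \<le> 3 * e" using d1 l e2 by linarith
  have "\<bar>exp (ln F) - 1 - ln F\<bar> \<le> 2 * (ln F)\<^sup>2"
  proof -
    obtain t where t: "\<bar>t\<bar> \<le> \<bar>ln F\<bar>" "exp (ln F) = (\<Sum>m<2. ln F ^ m / fact m) + exp t / fact 2 * ln F ^ 2"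
      using Maclaurin_exp_le[of "ln F" 2] by blast
    have eq: "exp (ln F) - 1 - ln F = exp t / 2 * (ln F)\<^sup>2"
      using t(2) by (simp add: numeral_eq_Suc)
    have "exp t \<le> 4"
    proof -
      have "exp t \<le> exp (1 / 2)" using t(1) L e by simp
      also have "\<dots> \<le> 1 + 2 * (1 / 2)" using exp_bound_lemma[of "1 / 2 :: real"] by simp
      finally show ?thesis by simp
    qed
    then show ?thesis
      unfolding eq using mult_right_mono[of "exp t / 2" 2 "(ln F)\<^sup>2"] by (subst abs_of_nonneg) auto
  qed
  moreover have "(ln F)\<^sup>2 \<le> 9 * e\<^sup>2"
  proof -
    have "\<bar>ln F\<bar>\<^sup>2 \<le> (3 * e)\<^sup>2" using L by (intro power_mono) auto
    then show ?thesis by (simp add: power2_eq_square)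
  qed
  ultimately have "\<bar>F - 1 - ln F\<bar> \<le> 18 * e\<^sup>2" using F by simp
  then have "\<bar>F - 1 - l\<bar> \<le> 22 * e\<^sup>2" using d1 by linarith
  then show ?thesis by (simp add: F_def l_def)
qed

locale moderate_scaling =
  fixes p lam :: real and k :: "nat \<Rightarrow> nat" and t :: "nat \<Rightarrow> real"
  assumes p: "p \<ge> 2"
    and k: "\<And>n. n \<ge> 1 \<Longrightarrow> 1 \<le> k n \<and> k n \<le> n"
    and t: "\<And>n. n \<ge> 1 \<Longrightarrow> 0 < t n"
    and lam: "(\<lambda>n. real (k n) / real n) \<longlonglongrightarrow> lam"
    and t_top: "filterlim t at_top sequentially"
    and tk: "(\<lambda>n. t n / sqrt (real (k n))) \<longlonglongrightarrow> 0"
begin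

lemma p0: "p > 0" using p by simp

lemma lam_bounds: "0 \<le> lam" "lam \<le> 1"
proof -
  have ev: "\<forall>\<^sub>F n in sequentially. 0 \<le> real (k n) / real n \<and> real (k n) / real n \<le> 1"
    using eventually_ge_at_top[of 1] by eventually_elim (use k in auto)
  show "0 \<le> lam" by (rule tendsto_lowerbound[OF lam]) (use ev in \<open>auto elim: eventually_mono\<close>)
  show "lam \<le> 1" by (rule tendsto_upperbound[OF lam]) (use ev in \<open>auto elim: eventually_mono\<close>)
qed

lemma speed: "filterlim (\<lambda>n. (t n)\<^sup>2) at_top sequentially"
  by (rule filterlim_pow_at_top[OF _ t_top]) simp

abbreviation "S \<equiv> gauss_p_moment p 2"

definition w1 where "w1 n z = (\<Sum>i<k n. pfun 2 1 0 (-1) (snd z i)) / real (k n)"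
definition w2 where "w2 n z = (\<Sum>i<n. pfun 2 1 0 (-1) (snd z i)) / real n"
definition w3 where "w3 n z = (\<Sum>i<n. pfun p (1 / S) 0 (-1) (fst z i)) / real n"
definition w4 where "w4 n z = (\<Sum>i<n. pfun p 0 1 (-1) (fst z i)) / real n"

definition linear_part :: "nat \<Rightarrow> (nat \<Rightarrow> real) \<times> (nat \<Rightarrow> real) \<Rightarrow> real" where
  "linear_part n z = sqrt (real (k n)) / t n * (w1 n z / 2 - w2 n z / 2 + w3 n z / 2 - w4 n z / p)"

definition reference_statistic :: "nat \<Rightarrow> (nat \<Rightarrow> real) \<times> (nat \<Rightarrow> real) \<Rightarrow> real" where
  "reference_statistic n z = 1 / t n * (real n powr (1 / p) * sqrt (1 / S) *
     (pnorm n 2 (normalize_p n p (fst z)) * sqrt (beta_ratio n (k n) (snd z))) - sqrt (real (k n)))"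

lemma sets_reference: "sets (reference_space n p) = sets (Rn n \<Otimes>\<^sub>M Rn n)"
  unfolding reference_space_def by (intro sets_pair_measure_cong sets_gauss_p_vec)

lemma measurable_reference:
  assumes n: "n \<ge> 1"
  shows "w1 n \<in> borel_measurable (reference_space n p)" "w2 n \<in> borel_measurable (reference_space n p)"
    "w3 n \<in> borel_measurable (reference_space n p)" "w4 n \<in> borel_measurable (reference_space n p)"
    "linear_part n \<in> borel_measurable (reference_space n p)"
    "reference_statistic n \<in> borel_measurable (reference_space n p)"
proof -
  have m: "measurable (reference_space n p) N = measurable (Rn n \<Otimes>\<^sub>M Rn n) N" for N :: "'x measure"
    by (rule measurable_cong_sets[OF sets_reference refl])
  have [measurable]: "(\<lambda>x. x i) \<in> borel_measurable (Rn n)" if "i \<in> {..<n}" for i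
    using that measurable_component_Rn by simp
  have [measurable]: "(\<lambda>x. x i) \<in> borel_measurable (Rn n)" if "i \<in> {..<k n}" for i
    using that k[OF n] measurable_component_Rn by simp
  show w: "w1 n \<in> borel_measurable (reference_space n p)" "w2 n \<in> borel_measurable (reference_space n p)"
    "w3 n \<in> borel_measurable (reference_space n p)" "w4 n \<in> borel_measurable (reference_space n p)"
    unfolding m w1_def[abs_def] w2_def[abs_def] w3_def[abs_def] w4_def[abs_def] by measurable
  show "linear_part n \<in> borel_measurable (reference_space n p)"
    unfolding linear_part_def[abs_def] using w by measurable
  have b: "beta_ratio n (k n) \<in> borel_measurable (Rn n)"
    using k[OF n] by (intro measurable_beta_ratio) simp
  show "reference_statistic n \<in> borel_measurable (reference_space n p)"
    unfolding m reference_statistic_def[abs_def] using b by measurable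
qed

lemma random_reals_reference:
  "random_reals (\<lambda>n. reference_space n p) linear_part"
  "random_reals (\<lambda>n. reference_space n p) reference_statistic"
  unfolding random_reals_def
  by (use eventually_ge_at_top[of 1] in \<open>eventually_elim, simp add: prob_space_reference[OF p0] measurable_reference\<close>)+

text \<open>
  The averages \<open>w1\<close>, \<open>w2\<close>, \<open>w3\<close>, \<open>w4\<close> are the relative deviations of the numerator and the denominator of
  the Beta ratio and of the powers \<open>\<parallel>Y\<parallel>\<^sub>2\<^sup>2\<close> and \<open>\<parallel>Y\<parallel>\<^sub>p\<^sup>p\<close> from their means.
\<close>

lemma reference_statistic_eq:
  assumes n: "n \<ge> 1" and pos: "1 + w2 n z > 0" "1 + w3 n z > 0" "1 + w4 n z > 0" "1 + w1 n z > 0"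
  shows "reference_statistic n z = sqrt (real (k n)) / t n *
    (sqrt ((1 + w1 n z) / (1 + w2 n z) * (1 + w3 n z)) / (1 + w4 n z) powr (1 / p) - 1)"
proof -
  have S: "S > 0" by (rule gauss_p_moment_values(4)[OF p0])
  have n0: "real n > 0" using n by simp
  have k0: "real (k n) > 0" using k[OF n] by simp
  obtain y g where z: "z = (y, g)" by (cases z)
  have s1: "(\<Sum>i<k n. (g i)\<^sup>2) = real (k n) * (1 + w1 n z)"
    using k0 by (simp add: w1_def z pfun_def sum_subtractf field_simps)
  have s2: "(\<Sum>i<n. (g i)\<^sup>2) = real n * (1 + w2 n z)"
    using n0 by (simp add: w2_def z pfun_def sum_subtractf field_simps)
  have s3: "(\<Sum>i<n. (y i)\<^sup>2) = real n * S * (1 + w3 n z)"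
    using n0 S by (simp add: w3_def z pfun_def sum_subtractf sum_divide_distrib[symmetric] field_simps)
  have s4: "(\<Sum>i<n. \<bar>y i\<bar> powr p) = real n * (1 + w4 n z)"
    using n0 by (simp add: w4_def z pfun_def sum_subtractf field_simps)
  have pn: "pnorm n p y = real n powr (1 / p) * (1 + w4 n z) powr (1 / p)"
    unfolding pnorm_def s4 using n0 pos by (simp add: powr_mult)
  have pn0: "pnorm n p y > 0" unfolding pn using n0 pos by simp
  have p2: "pnorm n 2 y = sqrt (real n * S * (1 + w3 n z))"
    unfolding s3[symmetric] pnorm_2_eq by (simp add: dotp_def power2_eq_square)
  have nrm: "pnorm n 2 (normalize_p n p y) = pnorm n 2 y / pnorm n p y"
    unfolding normalize_p_def using pn0 by (subst pnorm_scale) (auto simp: field_simps)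
  have "real n powr (1 / p) * sqrt (1 / S) * (pnorm n 2 (normalize_p n p y) * sqrt (beta_ratio n (k n) g)) =
    (sqrt (1 / S) * sqrt (real n * S * (1 + w3 n z)) * sqrt (beta_ratio n (k n) g)) / (1 + w4 n z) powr (1 / p)"
    unfolding nrm pn p2 using n0 pos by simp
  also have "sqrt (1 / S) * sqrt (real n * S * (1 + w3 n z)) * sqrt (beta_ratio n (k n) g) =
    sqrt ((1 / S) * (real n * S * (1 + w3 n z)) * beta_ratio n (k n) g)"
    by (simp only: real_sqrt_mult)
  also have "(1 / S) * (real n * S * (1 + w3 n z)) * beta_ratio n (k n) g = real (k n) * ((1 + w1 n z) / (1 + w2 n z) * (1 + w3 n z))"
  proof -
    have "(1 / s) * (m * s * c) * ((j * a) / (m * b)) = j * (a / b * c)" if "s > 0" "m > 0" for s m c j a b :: real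
      using that by simp
    from this[OF S n0] show ?thesis unfolding beta_ratio_def s1 s2 .
  qed
  also have "sqrt \<dots> = sqrt (real (k n)) * sqrt ((1 + w1 n z) / (1 + w2 n z) * (1 + w3 n z))"
    by (rule real_sqrt_mult)
  finally show ?thesis
    unfolding reference_statistic_def z fst_conv snd_conv by (simp add: right_diff_distrib diff_divide_distrib)
qed

text \<open>
  Chernoff's inequality with parameter \<open>1\<close>, since the weights already contain the tilting parameter.
\<close>

lemma reference_sum_tight:
  fixes \<alpha> \<beta> :: "nat \<Rightarrow> nat \<Rightarrow> real"
  assumes f: "log_mgf_quadratic (gauss_p p) f v" and g: "log_mgf_quadratic (gauss_p 2) g w"
    and fm: "f \<in> borel_measurable borel" and gm: "g \<in> borel_measurable borel"
    and small: "\<And>n i. n \<ge> 1 \<Longrightarrow> i < n \<Longrightarrow> \<bar>\<alpha> n i\<bar> \<le> t n / sqrt (real (k n))"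
      "\<And>n i. n \<ge> 1 \<Longrightarrow> i < n \<Longrightarrow> \<bar>\<beta> n i\<bar> \<le> t n / sqrt (real (k n))"
    and sq: "\<And>n. n \<ge> 1 \<Longrightarrow> (\<Sum>i<n. (\<alpha> n i)\<^sup>2) \<le> (t n)\<^sup>2" "\<And>n. n \<ge> 1 \<Longrightarrow> (\<Sum>i<n. (\<beta> n i)\<^sup>2) \<le> (t n)\<^sup>2"
  shows "\<exists>K0. \<forall>K\<ge>K0. \<forall>\<^sub>F n in sequentially. measure (reference_space n p) {z \<in> space (reference_space n p).
     K * (t n)\<^sup>2 \<le> \<bar>(\<Sum>i<n. \<alpha> n i * f (fst z i)) + (\<Sum>i<n. \<beta> n i * g (snd z i))\<bar>} \<le> exp (- c * (t n)\<^sup>2)"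
proof -
  define B where "B = \<bar>v\<bar> / 2 + 1 + (\<bar>w\<bar> / 2 + 1)"
  obtain \<delta> where \<delta>: "\<delta> > 0" and bd: "\<And>n a b. (\<forall>i<n. \<bar>a i\<bar> < \<delta>) \<Longrightarrow> (\<forall>i<n. \<bar>b i\<bar> < \<delta>) \<Longrightarrow>
     integrable (reference_space n p) (\<lambda>z. exp ((\<Sum>i<n. a i * f (fst z i)) + (\<Sum>i<n. b i * g (snd z i)))) \<and>
     (\<integral>z. exp ((\<Sum>i<n. a i * f (fst z i)) + (\<Sum>i<n. b i * g (snd z i))) \<partial>reference_space n p) \<le>
       exp ((v / 2 + 1) * (\<Sum>i<n. (a i)\<^sup>2) + (w / 2 + 1) * (\<Sum>i<n. (b i)\<^sup>2))"
    using reference_exp_sum[OF p0 f g zero_less_one] by blast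
  have sm: "\<forall>\<^sub>F n in sequentially. \<bar>t n / sqrt (real (k n))\<bar> < \<delta>"
    using tendstoD[OF tk \<delta>] by (simp add: dist_real_def)
  have cc: "c < c + 1" by simp
  show ?thesis
  proof (intro exI[of _ "c + 1 + B"] allI impI)
    fix K assume K: "c + 1 + B \<le> K"
    from sm eventually_two_exp_le[OF speed cc] eventually_ge_at_top[of 1]
    show "\<forall>\<^sub>F n in sequentially. measure (reference_space n p) {z \<in> space (reference_space n p).
     K * (t n)\<^sup>2 \<le> \<bar>(\<Sum>i<n. \<alpha> n i * f (fst z i)) + (\<Sum>i<n. \<beta> n i * g (snd z i))\<bar>} \<le> exp (- c * (t n)\<^sup>2)"
    proof eventually_elim
      case (elim n)
      interpret prob_space "reference_space n p" by (rule prob_space_reference[OF p0])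
      have m: "measurable (reference_space n p) N = measurable (Rn n \<Otimes>\<^sub>M Rn n) N" for N :: "'x measure"
        by (rule measurable_cong_sets[OF sets_reference refl])
      define X where "X z = (\<Sum>i<n. \<alpha> n i * f (fst z i)) + (\<Sum>i<n. \<beta> n i * g (snd z i))" for z
      have [measurable]: "(\<lambda>x. x i) \<in> borel_measurable (Rn n)" if "i \<in> {..<n}" for i
        using that measurable_component_Rn by simp
      have X: "X \<in> borel_measurable (reference_space n p)"
        unfolding m X_def using fm gm by measurable
      have one: "prob {z \<in> space (reference_space n p). r * X z \<ge> K * (t n)\<^sup>2} \<le> exp (- (c + 1) * (t n)\<^sup>2)"
        if r: "r = 1 \<or> r = -1" for r
      proof -
        have rabs: "\<bar>r\<bar> = 1" "r\<^sup>2 = 1" using r by auto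
        have a: "\<forall>i<n. \<bar>r * \<alpha> n i\<bar> < \<delta>" "\<forall>i<n. \<bar>r * \<beta> n i\<bar> < \<delta>"
        proof -
          have lt: "t n / sqrt (real (k n)) < \<delta>" using elim(1) by (rule order.strict_trans1[OF abs_ge_self])
          show "\<forall>i<n. \<bar>r * \<alpha> n i\<bar> < \<delta>" "\<forall>i<n. \<bar>r * \<beta> n i\<bar> < \<delta>"
            unfolding abs_mult rabs mult_1
            using order.strict_trans1[OF small(1)[OF elim(3)] lt] order.strict_trans1[OF small(2)[OF elim(3)] lt]
            by blast+
        qed
        have rX: "(\<Sum>i<n. (r * \<alpha> n i) * f (fst z i)) + (\<Sum>i<n. (r * \<beta> n i) * g (snd z i)) = 1 * (r * X z)" for z
          by (simp add: X_def sum_distrib_left distrib_left mult.assoc)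
        note b = bd[OF a, unfolded rX]
        have rXm: "(\<lambda>z. r * X z) \<in> borel_measurable (reference_space n p)" using X by measurable
        have "prob {z \<in> space (reference_space n p). r * X z \<ge> K * (t n)\<^sup>2} \<le>
          exp (- 1 * (K * (t n)\<^sup>2)) * expectation (\<lambda>z. exp (1 * (r * X z)))"
          using b by (intro chernoff rXm) auto
        also have "\<dots> \<le> exp (- 1 * (K * (t n)\<^sup>2)) * exp (B * (t n)\<^sup>2)"
        proof (intro mult_left_mono)
          have "(v / 2 + 1) * (\<Sum>i<n. (r * \<alpha> n i)\<^sup>2) + (w / 2 + 1) * (\<Sum>i<n. (r * \<beta> n i)\<^sup>2) \<le>
             (\<bar>v\<bar> / 2 + 1) * (t n)\<^sup>2 + (\<bar>w\<bar> / 2 + 1) * (t n)\<^sup>2"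
            unfolding power_mult_distrib rabs using sq[of n] elim
            by (intro add_mono mult_mono) (auto intro: sum_nonneg)
          also have "\<dots> = B * (t n)\<^sup>2" by (simp add: B_def algebra_simps)
          finally show "expectation (\<lambda>z. exp (1 * (r * X z))) \<le> exp (B * (t n)\<^sup>2)"
            using b by (meson exp_le_cancel_iff order_trans)
        qed simp
        also have "\<dots> = exp ((B - K) * (t n)\<^sup>2)" unfolding exp_add[symmetric] by (simp add: algebra_simps)
        also have "\<dots> \<le> exp (- (c + 1) * (t n)\<^sup>2)"
          unfolding exp_le_cancel_iff using K by (intro mult_right_mono) auto
        finally show ?thesis .
      qed
      have "prob {z \<in> space (reference_space n p). K * (t n)\<^sup>2 \<le> \<bar>X z\<bar>} \<le>
        prob ({z \<in> space (reference_space n p). 1 * X z \<ge> K * (t n)\<^sup>2} \<union> {z \<in> space (reference_space n p). -1 * X z \<ge> K * (t n)\<^sup>2})"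
        using X by (intro finite_measure_mono) auto
      also have "\<dots> \<le> prob {z \<in> space (reference_space n p). 1 * X z \<ge> K * (t n)\<^sup>2} + prob {z \<in> space (reference_space n p). -1 * X z \<ge> K * (t n)\<^sup>2}"
        using X by (intro measure_Un_le) auto
      finally show ?case
        using one[of 1] one[of "-1"] elim unfolding X_def by linarith
    qed
  qed
qed

end


section \<open>Moderate deviations of the statistic in independent coordinates\<close>

context moderate_scaling
begin

text \<open>
  The first summand stems from the random subspace, the second one from the direction of the point.
\<close>

definition limit_variance :: real where
  "limit_variance = (1 - lam) / 2 + lam * ratio_variance p"

lemma limit_variance_nonneg: "0 \<le> limit_variance"
  unfolding limit_variance_def using lam_bounds linear_statistic_log_mgf(3)[OF p] by simp

lemma sum_initial_segment:
  fixes h :: "nat \<Rightarrow> real"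
  assumes "m \<le> n"
  shows "(\<Sum>i<n. if i < m then h i else 0) = (\<Sum>i<m. h i)"
proof -
  have "(\<Sum>i<n. if i < m then h i else 0) = (\<Sum>i\<in>{..<n} \<inter> {i. i < m}. h i)"
    by (simp add: sum.inter_restrict)
  also have "{..<n} \<inter> {i. i < m} = {..<m}" using assms by auto
  finally show ?thesis .
qed

text \<open>
  As a sum over single coordinates, the linear part multiplied by \<open>t\<^sup>2 \<theta>\<close> has, with
  \<open>\<tau> = \<theta> t sqrt k\<close>, the weights \<open>\<tau> / n\<close> in the first component and
  \<open>(\<tau> / 2) (1 / k - 1 / n)\<close> or \<open>- \<tau> / (2 n)\<close> in the second one, according to whether the
  index is below \<open>k\<close>. Their sums of squares are \<open>\<theta>\<^sup>2 t\<^sup>2 k / n\<close> and \<open>\<theta>\<^sup>2 t\<^sup>2 (1 - k / n) / 4\<close>. The latter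
  has to be multiplied by the variance \<open>2\<close> of the square of a standard normal variable.
\<close>

lemma linear_part_cumulant:
  "quadratic_cumulant (\<lambda>n. reference_space n p) linear_part (\<lambda>n. (t n)\<^sup>2) limit_variance"
  unfolding quadratic_cumulant_def
proof (intro allI impI)
  fix \<theta> e :: real assume e: "e > 0"
  define r where "r = ratio_variance p"
  define \<epsilon> where "\<epsilon> = e / (2 * (\<theta>\<^sup>2 + 1))"
  have \<theta>1: "\<theta>\<^sup>2 + 1 > 0" by (simp add: add_nonneg_pos)
  have \<epsilon>: "\<epsilon> > 0" "\<epsilon> * \<theta>\<^sup>2 \<le> e / 2"
  proof -
    show "\<epsilon> > 0" using e \<theta>1 by (simp add: \<epsilon>_def)
    then have "\<epsilon> * \<theta>\<^sup>2 \<le> \<epsilon> * (\<theta>\<^sup>2 + 1)" by (intro mult_left_mono) auto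
    also have "\<dots> = e / 2"
    proof -
      have "e / (2 * x) * x = e / 2" if "x > 0" for x using that by simp
      from this[OF \<theta>1] show ?thesis unfolding \<epsilon>_def .
    qed
    finally show "\<epsilon> * \<theta>\<^sup>2 \<le> e / 2" .
  qed
  define fY where "fY = pfun p (1 / (2 * S)) (- 1 / p) (1 / p - 1 / 2)"
  define fG where "fG = pfun 2 1 0 (-1)"
  obtain \<delta> where \<delta>: "\<delta> > 0" and bd: "\<And>n a b. (\<forall>i<n. \<bar>a i\<bar> < \<delta>) \<Longrightarrow> (\<forall>i<n. \<bar>b i\<bar> < \<delta>) \<Longrightarrow>
     integrable (reference_space n p) (\<lambda>z. exp ((\<Sum>i<n. a i * fY (fst z i)) + (\<Sum>i<n. b i * fG (snd z i)))) \<and>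
     exp ((r / 2 - \<epsilon>) * (\<Sum>i<n. (a i)\<^sup>2) + (2 / 2 - \<epsilon>) * (\<Sum>i<n. (b i)\<^sup>2)) \<le>
       (\<integral>z. exp ((\<Sum>i<n. a i * fY (fst z i)) + (\<Sum>i<n. b i * fG (snd z i))) \<partial>reference_space n p) \<and>
     (\<integral>z. exp ((\<Sum>i<n. a i * fY (fst z i)) + (\<Sum>i<n. b i * fG (snd z i))) \<partial>reference_space n p) \<le>
       exp ((r / 2 + \<epsilon>) * (\<Sum>i<n. (a i)\<^sup>2) + (2 / 2 + \<epsilon>) * (\<Sum>i<n. (b i)\<^sup>2))"
    using reference_exp_sum[OF p0 linear_statistic_log_mgf(2,1)[OF p] \<epsilon>(1), folded r_def fY_def fG_def] by blast
  have "(\<lambda>n. \<bar>\<theta>\<bar> * (t n / sqrt (real (k n)))) \<longlonglongrightarrow> \<bar>\<theta>\<bar> * 0"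
    by (intro tendsto_intros tk)
  then have ev1: "\<forall>\<^sub>F n in sequentially. \<bar>\<theta>\<bar> * (t n / sqrt (real (k n))) < \<delta>"
    using \<delta> by (intro order_tendstoD(2)) auto
  have "(\<lambda>n. \<theta>\<^sup>2 * (real (k n) / real n * (r / 2) + (1 - real (k n) / real n) / 4)) \<longlonglongrightarrow>
     \<theta>\<^sup>2 * (lam * (r / 2) + (1 - lam) / 4)"
    by (intro tendsto_intros lam) simp
  moreover have "\<theta>\<^sup>2 * (lam * (r / 2) + (1 - lam) / 4) = limit_variance * \<theta>\<^sup>2 / 2"
    by (simp add: limit_variance_def r_def field_simps)
  ultimately have lim: "(\<lambda>n. \<theta>\<^sup>2 * (real (k n) / real n * (r / 2) + (1 - real (k n) / real n) / 4)) \<longlonglongrightarrow> limit_variance * \<theta>\<^sup>2 / 2"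
    by (simp only:)
  have e2: "e / 2 > 0" using e by simp
  from tendstoD[OF lim e2]
  have ev2: "\<forall>\<^sub>F n in sequentially. \<bar>\<theta>\<^sup>2 * (real (k n) / real n * (r / 2) + (1 - real (k n) / real n) / 4) - limit_variance * \<theta>\<^sup>2 / 2\<bar> < e / 2"
    by (simp add: dist_real_def)
  from ev1 ev2 eventually_ge_at_top[of 1]
  show "\<forall>\<^sub>F n in sequentially.
     integrable (reference_space n p) (\<lambda>\<omega>. exp ((t n)\<^sup>2 * \<theta> * linear_part n \<omega>)) \<and>
     exp ((t n)\<^sup>2 * (limit_variance * \<theta>\<^sup>2 / 2 - e)) \<le> (\<integral>\<omega>. exp ((t n)\<^sup>2 * \<theta> * linear_part n \<omega>) \<partial>reference_space n p) \<and>
     (\<integral>\<omega>. exp ((t n)\<^sup>2 * \<theta> * linear_part n \<omega>) \<partial>reference_space n p) \<le> exp ((t n)\<^sup>2 * (limit_variance * \<theta>\<^sup>2 / 2 + e))"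
  proof eventually_elim
    case (elim n)
    have n: "n \<ge> 1" by fact
    define N where "N = real n"
    define J where "J = real (k n)"
    define T where "T = t n"
    have N: "N > 0" and J: "J > 0" and JN: "J \<le> N" and T: "T > 0"
      using n k[OF n] t[OF n] by (auto simp: N_def J_def T_def)
    have kn: "k n \<le> n" using k[OF n] by simp
    define \<tau> where "\<tau> = \<theta> * T * sqrt J"
    define a where "a = (\<lambda>i::nat. \<tau> / N)"
    define b where "b = (\<lambda>i. \<tau> / 2 * ((if i < k n then 1 / J else 0) - 1 / N))"
    have sJ: "sqrt J > 0" "sqrt J * sqrt J = J" using J by auto
    have tJ: "\<bar>\<tau>\<bar> / J = \<bar>\<theta>\<bar> * (T / sqrt J)"
    proof -
      have "\<bar>\<tau>\<bar> / J = \<bar>\<theta>\<bar> * T * sqrt J / (sqrt J * sqrt J)"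
        unfolding sJ(2) using T J by (simp add: \<tau>_def abs_mult)
      also have "\<dots> = \<bar>\<theta>\<bar> * (T / sqrt J)"
      proof -
        have "x * y * z / (z * z) = x * (y / z)" if "z > 0" for x y z :: real using that by simp
        from this[OF sJ(1)] show ?thesis .
      qed
      finally show ?thesis .
    qed
    have small: "\<bar>\<tau>\<bar> / J < \<delta>" unfolding tJ using elim(1) by (simp add: T_def J_def)
    have a: "\<forall>i<n. \<bar>a i\<bar> < \<delta>"
    proof (intro allI impI)
      fix i
      have "\<bar>a i\<bar> = \<bar>\<tau>\<bar> / N" using N by (simp add: a_def)
      also have "\<dots> \<le> \<bar>\<tau>\<bar> / J" using J JN by (intro divide_left_mono) auto
      finally show "\<bar>a i\<bar> < \<delta>" using small by simp
    qed
    have b: "\<forall>i<n. \<bar>b i\<bar> < \<delta>"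
    proof (intro allI impI)
      fix i
      have NJ: "0 \<le> 1 / N" "1 / N \<le> 1 / J" using N J JN by (auto simp: frac_le)
      have "\<bar>(if i < k n then 1 / J else 0) - 1 / N\<bar> \<le> 1 / J" using NJ by auto
      then have "\<bar>b i\<bar> \<le> \<bar>\<tau> / 2\<bar> * (1 / J)" unfolding b_def abs_mult by (intro mult_left_mono) auto
      also have "\<dots> \<le> \<bar>\<tau>\<bar> / J" using J by (simp add: field_simps)
      finally show "\<bar>b i\<bar> < \<delta>" using small by simp
    qed
    have sa: "(\<Sum>i<n. (a i)\<^sup>2) = \<theta>\<^sup>2 * T\<^sup>2 * (J / N)"
    proof -
      have "(\<Sum>i<n. (a i)\<^sup>2) = N * (\<tau> / N)\<^sup>2" by (simp add: a_def N_def)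
      also have "\<dots> = \<tau>\<^sup>2 / N" using N by (simp add: power2_eq_square)
      also have "\<tau>\<^sup>2 = \<theta>\<^sup>2 * T\<^sup>2 * J" using J by (simp add: \<tau>_def power_mult_distrib)
      finally show ?thesis by simp
    qed
    have sb: "(\<Sum>i<n. (b i)\<^sup>2) = \<theta>\<^sup>2 * T\<^sup>2 * ((1 - J / N) / 4)"
    proof -
      have "(\<Sum>i<n. (b i)\<^sup>2) = (\<Sum>i<n. (\<tau>\<^sup>2 / 4) * ((if i < k n then 1 / J\<^sup>2 - 2 / (J * N) else 0) + 1 / N\<^sup>2))"
        by (intro sum.cong refl) (simp add: b_def power2_eq_square algebra_simps)
      also have "\<dots> = (\<tau>\<^sup>2 / 4) * (J * (1 / J\<^sup>2 - 2 / (J * N)) + N * (1 / N\<^sup>2))"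
        unfolding sum_distrib_left[symmetric] sum.distrib sum_initial_segment[OF kn] by (simp add: J_def N_def)
      also have "J * (1 / J\<^sup>2 - 2 / (J * N)) + N * (1 / N\<^sup>2) = (1 - J / N) / J"
        using N J by (simp add: power2_eq_square field_simps)
      also have "\<tau>\<^sup>2 = \<theta>\<^sup>2 * T\<^sup>2 * J" using J by (simp add: \<tau>_def power_mult_distrib)
      finally show ?thesis using J by simp
    qed
    have lin: "(t n)\<^sup>2 * \<theta> * linear_part n z = (\<Sum>i<n. a i * fY (fst z i)) + (\<Sum>i<n. b i * fG (snd z i))" for z
    proof -
      have "(\<Sum>i<n. a i * fY (fst z i)) = (\<Sum>i<n. (\<tau> / N) * (pfun p (1 / S) 0 (-1) (fst z i) / 2 - pfun p 0 1 (-1) (fst z i) / p))"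
        unfolding a_def fY_def using p0 by (intro sum.cong refl arg_cong2[where f="(*)"]) (simp add: pfun_def field_simps)
      also have "\<dots> = \<tau> * (w3 n z / 2 - w4 n z / p)"
        unfolding sum_distrib_left[symmetric] sum_subtractf w3_def w4_def sum_divide_distrib[symmetric] N_def
        by (simp add: diff_divide_distrib right_diff_distrib)
      finally have 1: "(\<Sum>i<n. a i * fY (fst z i)) = \<tau> * (w3 n z / 2 - w4 n z / p)" .
      have "(\<Sum>i<n. b i * fG (snd z i)) = (\<Sum>i<n. (\<tau> / 2) * ((if i < k n then fG (snd z i) / J else 0) - fG (snd z i) / N))"
        by (intro sum.cong refl) (simp add: b_def field_simps)
      also have "\<dots> = (\<tau> / 2) * ((\<Sum>i<k n. fG (snd z i)) / J - (\<Sum>i<n. fG (snd z i)) / N)"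
        unfolding sum_distrib_left[symmetric] sum_subtractf sum_initial_segment[OF kn] sum_divide_distrib[symmetric] ..
      also have "\<dots> = \<tau> * (w1 n z / 2 - w2 n z / 2)"
        by (simp add: w1_def w2_def fG_def J_def N_def right_diff_distrib)
      finally have 2: "(\<Sum>i<n. b i * fG (snd z i)) = \<tau> * (w1 n z / 2 - w2 n z / 2)" .
      have "(t n)\<^sup>2 * \<theta> * linear_part n z = \<tau> * (w1 n z / 2 - w2 n z / 2 + w3 n z / 2 - w4 n z / p)"
        using T by (simp add: linear_part_def \<tau>_def T_def[symmetric] J_def[symmetric] power2_eq_square)
      then show ?thesis unfolding 1 2 by (simp add: algebra_simps)
    qed
    note B = bd[OF a b, folded lin, unfolded sa sb]
    define A where "A = \<theta>\<^sup>2 * (J / N * (r / 2) + (1 - J / N) / 4)"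
    define D where "D = \<epsilon> * \<theta>\<^sup>2 * (J / N + (1 - J / N) / 4)"
    have JN1: "0 \<le> J / N" "J / N \<le> 1" using J N JN by auto
    have D: "0 \<le> D" "D \<le> e / 2"
    proof -
      have "0 \<le> x + (1 - x) / 4" "x + (1 - x) / 4 \<le> 1" if "0 \<le> x" "x \<le> 1" for x :: real
        using that by (simp_all add: field_simps)
      note f = this[OF JN1]
      show "0 \<le> D" unfolding D_def using f \<epsilon>(1) by (intro mult_nonneg_nonneg) auto
      have "D \<le> \<epsilon> * \<theta>\<^sup>2 * 1" unfolding D_def using f \<epsilon>(1) by (intro mult_left_mono) auto
      then show "D \<le> e / 2" using \<epsilon>(2) by simp
    qed
    have A: "\<bar>A - limit_variance * \<theta>\<^sup>2 / 2\<bar> < e / 2"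
      using elim(2) by (simp add: A_def J_def N_def)
    have ex1: "(r / 2 - \<epsilon>) * (\<theta>\<^sup>2 * T\<^sup>2 * (J / N)) + (2 / 2 - \<epsilon>) * (\<theta>\<^sup>2 * T\<^sup>2 * ((1 - J / N) / 4)) = T\<^sup>2 * (A - D)"
    proof -
      have "(r / 2 - \<epsilon>) * (q * u * x) + (2 / 2 - \<epsilon>) * (q * u * y) = u * (q * (x * (r / 2) + y) - \<epsilon> * q * (x + y))" for q u x y
        by (simp add: algebra_simps)
      then show ?thesis unfolding A_def D_def .
    qed
    have ex2: "(r / 2 + \<epsilon>) * (\<theta>\<^sup>2 * T\<^sup>2 * (J / N)) + (2 / 2 + \<epsilon>) * (\<theta>\<^sup>2 * T\<^sup>2 * ((1 - J / N) / 4)) = T\<^sup>2 * (A + D)"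
    proof -
      have "(r / 2 + \<epsilon>) * (q * u * x) + (2 / 2 + \<epsilon>) * (q * u * y) = u * (q * (x * (r / 2) + y) + \<epsilon> * q * (x + y))" for q u x y
        by (simp add: algebra_simps)
      then show ?thesis unfolding A_def D_def .
    qed
    have le: "limit_variance * \<theta>\<^sup>2 / 2 - e \<le> A - D" "A + D \<le> limit_variance * \<theta>\<^sup>2 / 2 + e"
      using A D by linarith+
    have b1: "exp ((t n)\<^sup>2 * (limit_variance * \<theta>\<^sup>2 / 2 - e)) \<le> exp (T\<^sup>2 * (A - D))"
      unfolding exp_le_cancel_iff T_def[symmetric] by (intro mult_left_mono le) simp
    have b2: "exp (T\<^sup>2 * (A + D)) \<le> exp ((t n)\<^sup>2 * (limit_variance * \<theta>\<^sup>2 / 2 + e))"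
      unfolding exp_le_cancel_iff T_def[symmetric] by (intro mult_left_mono le) simp
    from B show ?case
      unfolding ex1 ex2 using b1 b2 by (meson order_trans)
  qed
qed

text \<open>
  The averages over \<open>n\<close> terms even fluctuate on the scale \<open>t / sqrt n\<close>, which is at most
  \<open>t / sqrt k\<close>.
\<close>

lemma empirical_errors_tight:
  shows "\<exists>K>0. \<forall>\<^sub>F n in sequentially. measure (reference_space n p) {z \<in> space (reference_space n p).
     K * (t n / sqrt (real (k n))) \<le> \<bar>w1 n z\<bar> \<or> K * (t n / sqrt (real (k n))) \<le> \<bar>w2 n z\<bar> \<or>
     K * (t n / sqrt (real (k n))) \<le> \<bar>w3 n z\<bar> \<or> K * (t n / sqrt (real (k n))) \<le> \<bar>w4 n z\<bar>} \<le> exp (- c * (t n)\<^sup>2)"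
proof -
  define fG where "fG = pfun 2 1 0 (-1)"
  define f3 where "f3 = pfun p (1 / S) 0 (-1)"
  define f4 where "f4 = pfun p 0 1 (-1)"
  have meas: "fG \<in> borel_measurable borel" "f3 \<in> borel_measurable borel" "f4 \<in> borel_measurable borel"
    by (simp_all add: fG_def f3_def f4_def)
  have G: "log_mgf_quadratic (gauss_p 2) fG 2" unfolding fG_def by (rule linear_statistic_log_mgf(1)[OF p])
  obtain v3 where v3: "log_mgf_quadratic (gauss_p p) f3 v3" unfolding f3_def using linear_statistic_log_mgf(4)[OF p] by blast
  obtain v4 where v4: "log_mgf_quadratic (gauss_p p) f4 v4" unfolding f4_def using linear_statistic_log_mgf(5)[OF p] by blast
  define \<gamma> where "\<gamma> n = t n / sqrt (real (k n))" for n
  define \<eta> where "\<eta> n = t n / sqrt (real n)" for n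
  have \<gamma>0: "\<gamma> n > 0" if "n \<ge> 1" for n using t[OF that] k[OF that] by (simp add: \<gamma>_def)
  have \<eta>0: "\<eta> n > 0" if "n \<ge> 1" for n using t[OF that] that by (simp add: \<eta>_def)
  have \<eta>\<gamma>: "\<eta> n \<le> \<gamma> n" if "n \<ge> 1" for n
    unfolding \<eta>_def \<gamma>_def using t[OF that] k[OF that] by (intro divide_left_mono) auto
  have kk: "real (k n) * (\<gamma> n)\<^sup>2 = (t n)\<^sup>2" if "n \<ge> 1" for n
    using k[OF that] by (simp add: \<gamma>_def power_divide)
  have nn: "real n * (\<eta> n)\<^sup>2 = (t n)\<^sup>2" if "n \<ge> 1" for n
    using that by (simp add: \<eta>_def power_divide)
  define \<beta>1 where "\<beta>1 n i = (if i < k n then \<gamma> n else 0)" for n i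
  have sq1: "(\<Sum>i<n. (\<beta>1 n i)\<^sup>2) \<le> (t n)\<^sup>2" if n: "n \<ge> 1" for n
  proof -
    have "(\<Sum>i<n. (\<beta>1 n i)\<^sup>2) = (\<Sum>i<n. if i < k n then (\<gamma> n)\<^sup>2 else 0)"
      by (intro sum.cong) (auto simp: \<beta>1_def)
    also have "\<dots> = real (k n) * (\<gamma> n)\<^sup>2"
      using k[OF n] by (subst sum_initial_segment) auto
    finally show ?thesis using kk[OF n] by simp
  qed
  have sq2: "(\<Sum>i<n. (\<eta> n)\<^sup>2) \<le> (t n)\<^sup>2" if "n \<ge> 1" for n
    using nn[OF that] by simp
  have z: "(\<Sum>i<n. (0::real)\<^sup>2) \<le> (t n)\<^sup>2" for n by simp
  have sm0: "\<bar>0\<bar> \<le> t n / sqrt (real (k n))" if "n \<ge> 1" for n :: nat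
    using \<gamma>0[OF that(1)] by (simp add: \<gamma>_def less_imp_le)
  have sm1: "\<bar>\<beta>1 n i\<bar> \<le> t n / sqrt (real (k n))" if "n \<ge> 1" for n i
    using \<gamma>0[OF that(1)] by (simp add: \<beta>1_def \<gamma>_def less_imp_le)
  have sm2: "\<bar>\<eta> n\<bar> \<le> t n / sqrt (real (k n))" if "n \<ge> 1" for n :: nat
    using \<eta>\<gamma>[OF that(1)] \<eta>0[OF that(1)] by (simp add: \<gamma>_def)
  obtain K1 where K1: "\<And>K. K \<ge> K1 \<Longrightarrow> \<forall>\<^sub>F n in sequentially. measure (reference_space n p) {z \<in> space (reference_space n p).
     K * (t n)\<^sup>2 \<le> \<bar>(\<Sum>i<n. 0 * f4 (fst z i)) + (\<Sum>i<n. \<beta>1 n i * fG (snd z i))\<bar>} \<le> exp (- (c + 2) * (t n)\<^sup>2)"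
    using reference_sum_tight[OF v4 G meas(3,1), of "\<lambda>_ _. 0" "\<beta>1" "c + 2", OF sm0 sm1 z sq1] by blast
  obtain K2 where K2: "\<And>K. K \<ge> K2 \<Longrightarrow> \<forall>\<^sub>F n in sequentially. measure (reference_space n p) {z \<in> space (reference_space n p).
     K * (t n)\<^sup>2 \<le> \<bar>(\<Sum>i<n. 0 * f4 (fst z i)) + (\<Sum>i<n. \<eta> n * fG (snd z i))\<bar>} \<le> exp (- (c + 2) * (t n)\<^sup>2)"
    using reference_sum_tight[OF v4 G meas(3,1), of "\<lambda>_ _. 0" "\<lambda>n _. \<eta> n" "c + 2", OF sm0 sm2 z sq2] by blast
  obtain K3 where K3: "\<And>K. K \<ge> K3 \<Longrightarrow> \<forall>\<^sub>F n in sequentially. measure (reference_space n p) {z \<in> space (reference_space n p).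
     K * (t n)\<^sup>2 \<le> \<bar>(\<Sum>i<n. \<eta> n * f3 (fst z i)) + (\<Sum>i<n. 0 * fG (snd z i))\<bar>} \<le> exp (- (c + 2) * (t n)\<^sup>2)"
    using reference_sum_tight[OF v3 G meas(2,1), of "\<lambda>n _. \<eta> n" "\<lambda>_ _. 0" "c + 2", OF sm2 sm0 sq2 z] by blast
  obtain K4 where K4: "\<And>K. K \<ge> K4 \<Longrightarrow> \<forall>\<^sub>F n in sequentially. measure (reference_space n p) {z \<in> space (reference_space n p).
     K * (t n)\<^sup>2 \<le> \<bar>(\<Sum>i<n. \<eta> n * f4 (fst z i)) + (\<Sum>i<n. 0 * fG (snd z i))\<bar>} \<le> exp (- (c + 2) * (t n)\<^sup>2)"
    using reference_sum_tight[OF v4 G meas(3,1), of "\<lambda>n _. \<eta> n" "\<lambda>_ _. 0" "c + 2", OF sm2 sm0 sq2 z] by blast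
  define K where "K = max 1 (max (max K1 K2) (max K3 K4))"
  have K: "K > 0" "K \<ge> K1" "K \<ge> K2" "K \<ge> K3" "K \<ge> K4" by (auto simp: K_def)
  have cc: "c + 1 < c + 2" "c < c + 1" by simp_all
  have "\<forall>\<^sub>F n in sequentially. measure (reference_space n p) {z \<in> space (reference_space n p).
     K * \<gamma> n \<le> \<bar>w1 n z\<bar> \<or> K * \<gamma> n \<le> \<bar>w2 n z\<bar> \<or> K * \<gamma> n \<le> \<bar>w3 n z\<bar> \<or> K * \<gamma> n \<le> \<bar>w4 n z\<bar>} \<le> exp (- c * (t n)\<^sup>2)"
    using K1[OF K(2)] K2[OF K(3)] K3[OF K(4)] K4[OF K(5)] eventually_two_exp_le[OF speed cc(1)]
      eventually_two_exp_le[OF speed cc(2)] eventually_ge_at_top[of 1]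
  proof eventually_elim
    case (elim n)
    have n: "n \<ge> 1" by fact
    interpret prob_space "reference_space n p" by (rule prob_space_reference[OF p0])
    note m [measurable] = measurable_reference(1-4)[OF n]
    let ?\<Omega> = "space (reference_space n p)"
    have rn: "real n > 0" and rk: "real (k n) > 0" using k[OF n] n by auto
    have up: "K * (t n)\<^sup>2 \<le> \<bar>real n * \<eta> n * w\<bar>" if "K * \<gamma> n \<le> \<bar>w\<bar>" for w
    proof -
      have "K * (t n)\<^sup>2 = real n * \<eta> n * (K * \<eta> n)" unfolding nn[OF n, symmetric] by (simp add: power2_eq_square)
      also have "\<dots> \<le> real n * \<eta> n * (K * \<gamma> n)"
        using \<eta>\<gamma>[OF n] \<eta>0[OF n] K(1) rn by (intro mult_left_mono) auto
      also have "\<dots> \<le> real n * \<eta> n * \<bar>w\<bar>" using that \<eta>0[OF n] rn by (intro mult_left_mono) auto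
      also have "\<dots> = \<bar>real n * \<eta> n * w\<bar>" using \<eta>0[OF n] by (simp add: abs_mult)
      finally show ?thesis .
    qed
    have up1: "K * (t n)\<^sup>2 \<le> \<bar>real (k n) * \<gamma> n * w\<bar>" if "K * \<gamma> n \<le> \<bar>w\<bar>" for w
    proof -
      have "K * (t n)\<^sup>2 = real (k n) * \<gamma> n * (K * \<gamma> n)" unfolding kk[OF n, symmetric] by (simp add: power2_eq_square)
      also have "\<dots> \<le> real (k n) * \<gamma> n * \<bar>w\<bar>" using that \<gamma>0[OF n] rk by (intro mult_left_mono) auto
      also have "\<dots> = \<bar>real (k n) * \<gamma> n * w\<bar>" using \<gamma>0[OF n] by (simp add: abs_mult)
      finally show ?thesis .
    qed
    have s1: "(\<Sum>i<n. 0 * f4 (fst z i)) + (\<Sum>i<n. \<beta>1 n i * fG (snd z i)) = real (k n) * \<gamma> n * w1 n z" for z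
    proof -
      have "(\<Sum>i<n. \<beta>1 n i * fG (snd z i)) = (\<Sum>i<n. if i < k n then \<gamma> n * fG (snd z i) else 0)"
        by (intro sum.cong) (auto simp: \<beta>1_def)
      also have "\<dots> = \<gamma> n * (\<Sum>i<k n. fG (snd z i))"
        using k[OF n] by (subst sum_initial_segment) (auto simp: sum_distrib_left)
      finally show ?thesis using rk by (simp add: w1_def fG_def)
    qed
    have s2: "(\<Sum>i<n. 0 * f4 (fst z i)) + (\<Sum>i<n. \<eta> n * fG (snd z i)) = real n * \<eta> n * w2 n z" for z
      using rn by (simp add: w2_def fG_def sum_distrib_left[symmetric])
    have s3: "(\<Sum>i<n. \<eta> n * f3 (fst z i)) + (\<Sum>i<n. 0 * fG (snd z i)) = real n * \<eta> n * w3 n z" for z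
      using rn by (simp add: w3_def f3_def sum_distrib_left[symmetric])
    have s4: "(\<Sum>i<n. \<eta> n * f4 (fst z i)) + (\<Sum>i<n. 0 * fG (snd z i)) = real n * \<eta> n * w4 n z" for z
      using rn by (simp add: w4_def f4_def sum_distrib_left[symmetric])
    define A1 where "A1 = {z \<in> ?\<Omega>. K * (t n)\<^sup>2 \<le> \<bar>real (k n) * \<gamma> n * w1 n z\<bar>}"
    define A2 where "A2 = {z \<in> ?\<Omega>. K * (t n)\<^sup>2 \<le> \<bar>real n * \<eta> n * w2 n z\<bar>}"
    define A3 where "A3 = {z \<in> ?\<Omega>. K * (t n)\<^sup>2 \<le> \<bar>real n * \<eta> n * w3 n z\<bar>}"
    define A4 where "A4 = {z \<in> ?\<Omega>. K * (t n)\<^sup>2 \<le> \<bar>real n * \<eta> n * w4 n z\<bar>}"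
    have A: "A1 \<in> events" "A2 \<in> events" "A3 \<in> events" "A4 \<in> events"
      unfolding A1_def A2_def A3_def A4_def by measurable
    have "prob {z \<in> ?\<Omega>. K * \<gamma> n \<le> \<bar>w1 n z\<bar> \<or> K * \<gamma> n \<le> \<bar>w2 n z\<bar> \<or> K * \<gamma> n \<le> \<bar>w3 n z\<bar> \<or> K * \<gamma> n \<le> \<bar>w4 n z\<bar>}
      \<le> prob ((A1 \<union> A2) \<union> (A3 \<union> A4))"
    proof (intro finite_measure_mono subsetI)
      fix z assume "z \<in> {z \<in> ?\<Omega>. K * \<gamma> n \<le> \<bar>w1 n z\<bar> \<or> K * \<gamma> n \<le> \<bar>w2 n z\<bar> \<or> K * \<gamma> n \<le> \<bar>w3 n z\<bar> \<or> K * \<gamma> n \<le> \<bar>w4 n z\<bar>}"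
      then show "z \<in> (A1 \<union> A2) \<union> (A3 \<union> A4)"
        using up up1 unfolding A1_def A2_def A3_def A4_def by blast
    qed (use A in auto)
    also have "\<dots> \<le> prob (A1 \<union> A2) + prob (A3 \<union> A4)" using A by (intro measure_Un_le) auto
    also have "\<dots> \<le> (prob A1 + prob A2) + (prob A3 + prob A4)" using A by (intro add_mono measure_Un_le) auto
    finally show ?case
      using elim unfolding s1 s2 s3 s4 A1_def[symmetric] A2_def[symmetric] A3_def[symmetric] A4_def[symmetric] by linarith
  qed
  then show ?thesis using K(1) unfolding \<gamma>_def by blast
qed

text \<open>
  Outside the exceptional event of \<open>empirical_errors_tight\<close> the linearization error is at most
  \<open>22 (K t / sqrt k)\<^sup>2\<close>. The prefactor \<open>sqrt k / t\<close> leaves \<open>22 K\<^sup>2 t / sqrt k\<close>, which tends to \<open>0\<close>.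
\<close>

lemma reference_equivalent:
  assumes e: "e > 0"
  shows "superexp (\<lambda>n. (t n)\<^sup>2) (\<lambda>n. measure (reference_space n p)
     {z \<in> space (reference_space n p). e < \<bar>reference_statistic n z - linear_part n z\<bar>})"
  unfolding superexp_def
proof
  fix c
  define \<gamma> where "\<gamma> n = t n / sqrt (real (k n))" for n
  obtain K where K: "K > 0" and ev: "\<forall>\<^sub>F n in sequentially. measure (reference_space n p) {z \<in> space (reference_space n p).
     K * \<gamma> n \<le> \<bar>w1 n z\<bar> \<or> K * \<gamma> n \<le> \<bar>w2 n z\<bar> \<or> K * \<gamma> n \<le> \<bar>w3 n z\<bar> \<or> K * \<gamma> n \<le> \<bar>w4 n z\<bar>} \<le> exp (- c * (t n)\<^sup>2)"
    unfolding \<gamma>_def using empirical_errors_tight[of c] by blast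
  have \<gamma>: "\<gamma> \<longlonglongrightarrow> 0" unfolding \<gamma>_def by (rule tk)
  have "(\<lambda>n. K * \<gamma> n) \<longlonglongrightarrow> K * 0" by (intro tendsto_intros \<gamma>)
  then have ev1: "\<forall>\<^sub>F n in sequentially. K * \<gamma> n < 1 / 8" by (intro order_tendstoD(2)) auto
  have "(\<lambda>n. 22 * K\<^sup>2 * \<gamma> n) \<longlonglongrightarrow> 22 * K\<^sup>2 * 0" by (intro tendsto_intros \<gamma>)
  then have ev2: "\<forall>\<^sub>F n in sequentially. 22 * K\<^sup>2 * \<gamma> n < e" using e by (intro order_tendstoD(2)) auto
  from ev ev1 ev2 eventually_ge_at_top[of 1]
  show "\<forall>\<^sub>F n in sequentially. measure (reference_space n p)
     {z \<in> space (reference_space n p). e < \<bar>reference_statistic n z - linear_part n z\<bar>} \<le> exp (- c * (t n)\<^sup>2)"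
  proof eventually_elim
    case (elim n)
    have n: "n \<ge> 1" by fact
    interpret prob_space "reference_space n p" by (rule prob_space_reference[OF p0])
    note m [measurable] = measurable_reference(1-4)[OF n]
    have tn: "t n > 0" and rk: "real (k n) > 0" using t[OF n] k[OF n] by auto
    have "prob {z \<in> space (reference_space n p). e < \<bar>reference_statistic n z - linear_part n z\<bar>} \<le>
      prob {z \<in> space (reference_space n p).
     K * \<gamma> n \<le> \<bar>w1 n z\<bar> \<or> K * \<gamma> n \<le> \<bar>w2 n z\<bar> \<or> K * \<gamma> n \<le> \<bar>w3 n z\<bar> \<or> K * \<gamma> n \<le> \<bar>w4 n z\<bar>}"
    proof (intro finite_measure_mono subsetI)
      fix z assume z: "z \<in> {z \<in> space (reference_space n p). e < \<bar>reference_statistic n z - linear_part n z\<bar>}"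
      show "z \<in> {z \<in> space (reference_space n p).
         K * \<gamma> n \<le> \<bar>w1 n z\<bar> \<or> K * \<gamma> n \<le> \<bar>w2 n z\<bar> \<or> K * \<gamma> n \<le> \<bar>w3 n z\<bar> \<or> K * \<gamma> n \<le> \<bar>w4 n z\<bar>}"
      proof (rule ccontr)
        assume "\<not> ?thesis"
        then have w: "\<bar>w1 n z\<bar> \<le> K * \<gamma> n" "\<bar>w2 n z\<bar> \<le> K * \<gamma> n" "\<bar>w3 n z\<bar> \<le> K * \<gamma> n" "\<bar>w4 n z\<bar> \<le> K * \<gamma> n"
          using z by auto
        have le: "K * \<gamma> n \<le> 1 / 8" using elim by simp
        have pos: "1 + w2 n z > 0" "1 + w3 n z > 0" "1 + w4 n z > 0" "1 + w1 n z > 0"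
          using w le by (auto simp: abs_le_iff)
        define F where "F = sqrt ((1 + w1 n z) / (1 + w2 n z) * (1 + w3 n z)) / (1 + w4 n z) powr (1 / p) - 1"
        define l where "l = w1 n z / 2 - w2 n z / 2 + w3 n z / 2 - w4 n z / p"
        have err: "\<bar>F - l\<bar> \<le> 22 * (K * \<gamma> n)\<^sup>2"
          unfolding F_def l_def by (rule linearization_error[OF w le p])
        have "reference_statistic n z - linear_part n z = sqrt (real (k n)) / t n * (F - l)"
          unfolding reference_statistic_eq[OF n pos] linear_part_def F_def l_def by (simp only: right_diff_distrib)
        then have "\<bar>reference_statistic n z - linear_part n z\<bar> = inverse (\<gamma> n) * \<bar>F - l\<bar>"
          using tn rk by (simp add: abs_mult \<gamma>_def)
        also have "\<dots> \<le> inverse (\<gamma> n) * (22 * (K * \<gamma> n)\<^sup>2)"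
          using err tn rk by (intro mult_left_mono) (auto simp: \<gamma>_def)
        also have "\<dots> = 22 * K\<^sup>2 * \<gamma> n"
        proof -
          have "\<gamma> n > 0" using tn rk by (simp add: \<gamma>_def)
          then show ?thesis by (simp add: power2_eq_square)
        qed
        also have "\<dots> < e" using elim by simp
        finally show False using z by simp
      qed
    qed measurable
    also have "\<dots> \<le> exp (- c * (t n)\<^sup>2)" by fact
    finally show ?case .
  qed
qed

theorem reference_mdp:
  "gauss_mdp (\<lambda>n. reference_space n p) reference_statistic (\<lambda>n. (t n)\<^sup>2) limit_variance"
  by (rule gauss_mdp_exponentially_equivalent[OF speed limit_variance_nonneg random_reals_reference
      quadratic_cumulant_imp_gauss_mdp[OF speed random_reals_reference(1) linear_part_cumulant limit_variance_nonneg]])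
     (rule reference_equivalent)

end


section \<open>Transfer to the random projection\<close>

text \<open>
  Integrate over the subspace first: for every point with nonzero norm the inner integral is one with
  respect to the Beta law, and what remains is a function of the direction, whose law is the cone measure.
\<close>

lemma direction_law:
  assumes n: "n \<ge> 1" and k: "1 \<le> k" "k \<le> n" and p: "p > 0" and M: "prob_space M"
    and X: "X \<in> M \<rightarrow>\<^sub>M Rn n" and E: "E \<in> M \<rightarrow>\<^sub>M grassmannian n k"
    and XP: "distr M (Rn n) X = P_dist W n p"
    and W: "prob_space W" "sets W = sets (restrict_space borel {0..})"
    and haar: "haar_grassmannian n k (distr M (grassmannian n k) E)"
    and indep: "prob_space.indep_set M (sets (vimage_algebra (space M) X (Rn n)))
           (sets (vimage_algebra (space M) E (grassmannian n k)))"
    and \<Phi>: "(\<lambda>(x, r). \<Phi> x r) \<in> Rn n \<Otimes>\<^sub>M borel \<rightarrow>\<^sub>M (borel :: real measure)"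
  shows "distr M borel (\<lambda>\<omega>. \<Phi> (normalize_p n p (X \<omega>)) (qform n (E \<omega>) (X \<omega>) / dotp n (X \<omega>) (X \<omega>))) =
    distr (reference_space n p) borel (\<lambda>z. \<Phi> (normalize_p n p (fst z)) (beta_ratio n k (snd z)))"
proof (rule measure_eqI)
  interpret M: prob_space M by (rule M)
  define P where "P = P_dist W n p"
  define \<mu> where "\<mu> = distr M (grassmannian n k) E"
  define G where "G = gauss_p_vec n p"
  define G2 where "G2 = gauss_p_vec n 2"
  have P: "P = distr M (Rn n) X" by (simp add: P_def XP)
  interpret P: prob_space P unfolding P by (rule M.prob_space_distr[OF X])
  interpret \<mu>: prob_space \<mu> unfolding \<mu>_def by (rule M.prob_space_distr[OF E])
  interpret G: prob_space G unfolding G_def by (rule prob_space_gauss_p_vec[OF p])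
  interpret G2: prob_space G2 unfolding G2_def by (rule prob_space_gauss_p_vec) simp
  define \<beta> where "\<beta> = distr G2 borel (beta_ratio n k)"
  have bm: "beta_ratio n k \<in> borel_measurable G2"
    unfolding G2_def measurable_cong_sets[OF sets_gauss_p_vec refl] using k by measurable
  interpret \<beta>: prob_space \<beta> unfolding \<beta>_def by (rule G2.prob_space_distr[OF bm])
  have sets_eq: "sets P = sets (Rn n)" "sets \<mu> = sets (grassmannian n k)" "sets G = sets (Rn n)" "sets G2 = sets (Rn n)" "sets \<beta> = sets borel"
    by (simp_all add: P_def sets_P_dist \<mu>_def G_def G2_def sets_gauss_p_vec \<beta>_def)
  note [measurable_cong] = sets_eq
  have joint: "P \<Otimes>\<^sub>M \<mu> = distr M (Rn n \<Otimes>\<^sub>M grassmannian n k) (\<lambda>\<omega>. (X \<omega>, E \<omega>))"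
  proof -
    have XE: "(\<lambda>\<omega>. (X \<omega>, E \<omega>)) \<in> M \<rightarrow>\<^sub>M Rn n \<Otimes>\<^sub>M grassmannian n k"
      using X E by (rule measurable_Pair)
    show ?thesis
    proof (rule pair_measure_eqI[OF P.sigma_finite_measure_axioms \<mu>.sigma_finite_measure_axioms])
      show "sets (P \<Otimes>\<^sub>M \<mu>) = sets (distr M (Rn n \<Otimes>\<^sub>M grassmannian n k) (\<lambda>\<omega>. (X \<omega>, E \<omega>)))"
        unfolding sets_distr by (intro sets_pair_measure_cong sets_eq)
      fix A B assume AB: "A \<in> sets P" "B \<in> sets \<mu>"
      then have A: "A \<in> sets (Rn n)" and B: "B \<in> sets (grassmannian n k)"
        by (simp_all only: sets_eq)
      let ?a = "X -` A \<inter> space M" and ?b = "E -` B \<inter> space M"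
      have "?a \<in> sets (vimage_algebra (space M) X (Rn n))" "?b \<in> sets (vimage_algebra (space M) E (grassmannian n k))"
        using A B by (simp_all add: in_vimage_algebra)
      then have "M.prob (?a \<inter> ?b) = M.prob ?a * M.prob ?b"
        using M.indep_setD[OF indep] by blast
      moreover have "(\<lambda>\<omega>. (X \<omega>, E \<omega>)) -` (A \<times> B) \<inter> space M = ?a \<inter> ?b" by auto
      ultimately show "emeasure P A * emeasure \<mu> B = emeasure (distr M (Rn n \<Otimes>\<^sub>M grassmannian n k) (\<lambda>\<omega>. (X \<omega>, E \<omega>))) (A \<times> B)"
        unfolding P \<mu>_def using X E XE A B
        by (simp add: emeasure_distr M.emeasure_eq_measure ennreal_mult'')
    qed
  qed
  fix B assume "B \<in> sets (distr M borel (\<lambda>\<omega>. \<Phi> (normalize_p n p (X \<omega>)) (qform n (E \<omega>) (X \<omega>) / dotp n (X \<omega>) (X \<omega>))))"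
  then have B [measurable]: "B \<in> sets borel" by simp
  define h where "h x r = (indicator B (\<Phi> x r) :: ennreal)" for x r
  have h [measurable]: "(\<lambda>(x, r). h x r) \<in> borel_measurable (Rn n \<Otimes>\<^sub>M borel)"
  proof -
    have "(\<lambda>(x, r). h x r) = (\<lambda>z. indicator B ((\<lambda>(x, r). \<Phi> x r) z))"
      by (auto simp: h_def fun_eq_iff)
    then show ?thesis using \<Phi> B by simp
  qed
  have dm [measurable]: "(\<lambda>x. dotp n x x) \<in> borel_measurable (Rn n)"
  proof -
    have [measurable]: "(\<lambda>x. x i) \<in> borel_measurable (Rn n)" if "i \<in> {..<n}" for i
      using that measurable_component_Rn by simp
    show ?thesis unfolding dotp_def by measurable
  qed
  define q where "q x E = qform n E x / dotp n x x" for x E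
  have q [measurable]: "(\<lambda>(x, E). q x E) \<in> borel_measurable (Rn n \<Otimes>\<^sub>M grassmannian n k)"
  proof -
    have "(\<lambda>(x, E). q x E) = (\<lambda>z. (\<lambda>(x, E). qform n E x) z / dotp n (fst z) (fst z))"
      by (auto simp: q_def fun_eq_iff)
    then show ?thesis using measurable_qform_pair[of n k] by simp
  qed
  define g where "g x = (\<integral>\<^sup>+r. h x r \<partial>\<beta>)" for x
  have g [measurable]: "g \<in> borel_measurable (Rn n)"
    unfolding g_def by measurable
  have hq: "(\<lambda>(x, E). h (normalize_p n p x) (q x E)) \<in> borel_measurable (Rn n \<Otimes>\<^sub>M grassmannian n k)"
    by measurable
  have emeasure_h: "emeasure (distr N borel f) B = (\<integral>\<^sup>+\<omega>. indicator B (f \<omega>) \<partial>N)"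
    if f: "f \<in> borel_measurable N" for N :: "'z measure" and f
  proof -
    have "emeasure (distr N borel f) B = (\<integral>\<^sup>+y. indicator B y \<partial>distr N borel f)" by simp
    also have "\<dots> = (\<integral>\<^sup>+\<omega>. indicator B (f \<omega>) \<partial>N)" by (rule nn_integral_distr[OF f]) simp
    finally show ?thesis .
  qed
  have lm: "(\<lambda>\<omega>. \<Phi> (normalize_p n p (X \<omega>)) (qform n (E \<omega>) (X \<omega>) / dotp n (X \<omega>) (X \<omega>))) \<in> borel_measurable M"
  proof -
    have "(\<lambda>\<omega>. (\<lambda>(x, r). \<Phi> x r) (normalize_p n p (X \<omega>), (\<lambda>(x, E). q x E) (X \<omega>, E \<omega>))) \<in> borel_measurable M"
      using X E by (intro measurable_compose[OF _ \<Phi>] measurable_Pair measurable_compose[OF X measurable_normalize_p]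
        measurable_compose[OF _ q]) auto
    then show ?thesis by (simp add: q_def)
  qed
  have "emeasure (distr M borel (\<lambda>\<omega>. \<Phi> (normalize_p n p (X \<omega>)) (qform n (E \<omega>) (X \<omega>) / dotp n (X \<omega>) (X \<omega>)))) B =
     (\<integral>\<^sup>+\<omega>. h (normalize_p n p (X \<omega>)) (q (X \<omega>) (E \<omega>)) \<partial>M)"
    unfolding emeasure_h[OF lm] by (simp add: h_def q_def)
  also have "\<dots> = (\<integral>\<^sup>+z. (\<lambda>(x, E). h (normalize_p n p x) (q x E)) z \<partial>(P \<Otimes>\<^sub>M \<mu>))"
    unfolding joint using X E hq by (subst nn_integral_distr) auto
  also have "\<dots> = (\<integral>\<^sup>+x. \<integral>\<^sup>+E. h (normalize_p n p x) (q x E) \<partial>\<mu> \<partial>P)"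
    by (subst \<mu>.nn_integral_fst[symmetric]) auto
  also have "\<dots> = (\<integral>\<^sup>+x. g (normalize_p n p x) \<partial>P)"
  proof (rule nn_integral_cong_AE)
    have "AE x in P. 0 < pnorm n p x \<and> pnorm n p x \<le> 1"
      unfolding P_def using P.prob_space_axioms by (intro P_dist_normalize(2)[OF n p _ W]) (simp add: P_def)
    then show "AE x in P. (\<integral>\<^sup>+E. h (normalize_p n p x) (q x E) \<partial>\<mu>) = g (normalize_p n p x)"
      using AE_space
    proof eventually_elim
      case (elim x)
      have "dotp n x x \<noteq> 0"
      proof
        assume "dotp n x x = 0"
        then have "pnorm n p x = 0" by (simp add: dotp_self_eq_0 pnorm_def)
        then show False using elim by simp
      qed
      then have law: "distr \<mu> borel (\<lambda>E. q x E) = \<beta>"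
        unfolding q_def \<beta>_def G2_def using haar k by (intro haar_qform_law) (simp_all add: \<mu>_def)
      have qx: "(\<lambda>E. q x E) \<in> borel_measurable \<mu>"
        unfolding q_def by (intro borel_measurable_divide borel_measurable_const) measurable
      have nx: "normalize_p n p x \<in> space (Rn n)" by (simp add: normalize_p_def scale_Rn_def space_Rn)
      have hx: "h (normalize_p n p x) \<in> borel_measurable borel"
        using measurable_Pair2[OF h nx] by simp
      have "g (normalize_p n p x) = (\<integral>\<^sup>+r. h (normalize_p n p x) r \<partial>distr \<mu> borel (\<lambda>E. q x E))"
        unfolding g_def law ..
      also have "\<dots> = (\<integral>\<^sup>+E. h (normalize_p n p x) (q x E) \<partial>\<mu>)"
        by (rule nn_integral_distr[OF qx]) (use hx in simp)
      finally show ?case ..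
    qed
  qed
  also have "\<dots> = (\<integral>\<^sup>+x. g x \<partial>distr P (Rn n) (normalize_p n p))"
    by (rule nn_integral_distr[symmetric]) measurable
  also have "distr P (Rn n) (normalize_p n p) = distr G (Rn n) (normalize_p n p)"
    unfolding G_def gauss_p_vec_normalize[OF n p] P_def
    using P.prob_space_axioms by (intro P_dist_normalize(1)[OF n p _ W]) (simp add: P_def)
  also have "(\<integral>\<^sup>+x. g x \<partial>distr G (Rn n) (normalize_p n p)) = (\<integral>\<^sup>+y. g (normalize_p n p y) \<partial>G)"
    by (rule nn_integral_distr) measurable
  also have "\<dots> = (\<integral>\<^sup>+y. \<integral>\<^sup>+u. h (normalize_p n p y) (beta_ratio n k u) \<partial>G2 \<partial>G)"
  proof (rule nn_integral_cong)
    fix y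
    have ny: "normalize_p n p y \<in> space (Rn n)" by (simp add: normalize_p_def scale_Rn_def space_Rn)
    have hy: "h (normalize_p n p y) \<in> borel_measurable borel"
      using measurable_Pair2[OF h ny] by simp
    show "g (normalize_p n p y) = (\<integral>\<^sup>+u. h (normalize_p n p y) (beta_ratio n k u) \<partial>G2)"
      unfolding g_def \<beta>_def by (rule nn_integral_distr[OF bm]) (use hy in simp)
  qed
  also have "\<dots> = (\<integral>\<^sup>+z. h (normalize_p n p (fst z)) (beta_ratio n k (snd z)) \<partial>(G \<Otimes>\<^sub>M G2))"
  proof -
    note [measurable] = bm
    have "(\<lambda>z. h (normalize_p n p (fst z)) (beta_ratio n k (snd z))) \<in> borel_measurable (G \<Otimes>\<^sub>M G2)"
      by measurable
    from G2.nn_integral_fst[OF this] show ?thesis by simp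
  qed
  also have "\<dots> = emeasure (distr (reference_space n p) borel (\<lambda>z. \<Phi> (normalize_p n p (fst z)) (beta_ratio n k (snd z)))) B"
  proof -
    note [measurable] = bm
    have "(\<lambda>z. (\<lambda>(x, r). \<Phi> x r) (normalize_p n p (fst z), beta_ratio n k (snd z))) \<in> borel_measurable (G \<Otimes>\<^sub>M G2)"
      by (rule measurable_compose[OF _ \<Phi>]) measurable
    then have rm: "(\<lambda>z. \<Phi> (normalize_p n p (fst z)) (beta_ratio n k (snd z))) \<in> borel_measurable (reference_space n p)"
      by (simp add: reference_space_def G_def G2_def)
    show ?thesis unfolding emeasure_h[OF rm] by (simp add: h_def reference_space_def G_def G2_def)
  qed
  finally show "emeasure (distr M borel (\<lambda>\<omega>. \<Phi> (normalize_p n p (X \<omega>)) (qform n (E \<omega>) (X \<omega>) / dotp n (X \<omega>) (X \<omega>)))) B =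
    emeasure (distr (reference_space n p) borel (\<lambda>z. \<Phi> (normalize_p n p (fst z)) (beta_ratio n k (snd z)))) B" .
qed simp

lemma mdp_const_limit:
  fixes p lam :: real
  assumes p: "p > 0"
  defines "v \<equiv> (1 - lam) / 2 + lam * ratio_variance p"
  shows "v > 0 \<Longrightarrow> mdp_const p lam = ereal (1 / (2 * v))" and "v = 0 \<Longrightarrow> mdp_const p lam = \<infinity>"
proof -
  define A where "A = Gamma (1 / p)"
  define B where "B = Gamma (3 / p)"
  define C where "C = Gamma (5 / p)"
  have pos: "A > 0" "B > 0" using p by (auto simp: A_def B_def intro: Gamma_real_pos)
  define N where "N = 2 * A * B\<^sup>2"
  have N: "N > 0" using pos by (simp add: N_def)
  have G1: "Gamma (1 + 1 / p) = A / p"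
    using Gamma_plus1_pos[of "1 / p"] p by (simp add: A_def add.commute)
  have rv: "ratio_variance p = A * C / (4 * B\<^sup>2) - 1 / p - 1 / 4"
  proof -
    define u where "u = p powr (2 / p)"
    have u: "u > 0" using p by (simp add: u_def)
    have "gauss_p_moment p 2 = u * B / A" by (simp add: gauss_p_moment_def u_def B_def A_def)
    moreover have "p powr (4 / p) = u * u" unfolding u_def powr_add[symmetric] by simp
    then have "gauss_p_moment p 4 = u * u * C / A" by (simp add: gauss_p_moment_def C_def A_def)
    moreover have "u * u * C / A / (4 * (u * B / A)\<^sup>2) = A * C / (4 * B\<^sup>2)"
      using u pos by (simp add: power2_eq_square field_simps)
    ultimately show ?thesis by (simp add: ratio_variance_def)
  qed
  have den: "(2 * p - lam * (4 + 3 * p)) * (A / p) * B\<^sup>2 + lam * A\<^sup>2 * C = N * (2 * v)"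
  proof -
    have "(2 * p - lam * (4 + 3 * p)) * (A / p) * B\<^sup>2 = A * B\<^sup>2 * (2 - lam * (4 * (1 / p) + 3))"
      using p by (simp add: field_simps)
    moreover have "N * (2 * v) = A * B\<^sup>2 * (2 * (1 - lam) - lam * (4 * (1 / p) + 1)) + lam * A\<^sup>2 * C"
    proof -
      define x where "x = A * C / (4 * B\<^sup>2)"
      have x: "4 * (A * B\<^sup>2 * x) = A\<^sup>2 * C" using pos by (simp add: x_def power2_eq_square)
      have v2: "2 * v = (1 - lam) + 2 * lam * (x - 1 / p - 1 / 4)"
        by (simp add: v_def rv x_def[symmetric])
      have "N * (2 * v) = A * B\<^sup>2 * (2 * (1 - lam) - lam * (4 * (1 / p) + 1)) + lam * (4 * (A * B\<^sup>2 * x))"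
        unfolding N_def v2 by (simp add: algebra_simps)
      then show ?thesis unfolding x by (simp add: mult.assoc)
    qed
    ultimately show ?thesis by (simp add: algebra_simps)
  qed
  have c: "mdp_const p lam = ereal N / ereal (N * (2 * v))"
    unfolding mdp_const_def G1 A_def[symmetric] B_def[symmetric] C_def[symmetric] den N_def[symmetric] ..
  show "mdp_const p lam = ereal (1 / (2 * v))" if "v > 0"
    unfolding c using that N by simp
  show "mdp_const p lam = \<infinity>" if "v = 0"
    unfolding c using that N by (simp add: divide_ereal_def)
qed

lemma superexp_of_elog_limit:
  assumes t: "\<And>n. n \<ge> 1 \<Longrightarrow> 0 < t n"
    and lim: "(\<lambda>n. ereal (1 / (t n)\<^sup>2) * elog (m n)) \<longlonglongrightarrow> -\<infinity>"
  shows "superexp (\<lambda>n. (t n)\<^sup>2) m"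
  unfolding superexp_def
proof
  fix c
  have "\<forall>\<^sub>F n in sequentially. ereal (1 / (t n)\<^sup>2) * elog (m n) < ereal (- c)"
    using lim unfolding tendsto_MInfty by blast
  with eventually_ge_at_top[of 1] show "\<forall>\<^sub>F n in sequentially. m n \<le> exp (- c * (t n)\<^sup>2)"
  proof eventually_elim
    case (elim n)
    show ?case
    proof (cases "m n \<le> 0")
      case True
      then show ?thesis by (meson exp_ge_zero order_trans)
    next
      case False
      then have "1 / (t n)\<^sup>2 * ln (m n) < - c" using elim by (simp add: elog_def)
      then have "ln (m n) < - c * (t n)\<^sup>2" using t[OF elim(1)] by (simp add: field_simps)
      then have "exp (ln (m n)) \<le> exp (- c * (t n)\<^sup>2)" by simp
      then show ?thesis using False by simp
    qed
  qed
qed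


section \<open>The moderate deviations principle\<close>

lemma radial_factor:
  assumes E: "E \<in> subspaces n k" and rho: "pnorm n p x > 0" and p: "p > 0"
  shows "pnorm n 2 (proj n E x) =
    pnorm n p x * (pnorm n 2 (normalize_p n p x) * sqrt (qform n E x / dotp n x x))"
proof -
  have "dotp n x x \<noteq> 0"
  proof
    assume "dotp n x x = 0"
    then have "pnorm n p x = 0" by (simp add: dotp_self_eq_0 pnorm_def)
    then show False using rho by simp
  qed
  then have d: "dotp n x x > 0" using dotp_self_nonneg[of n x] by simp
  have "pnorm n 2 (normalize_p n p x) = inverse (pnorm n p x) * sqrt (dotp n x x)"
    unfolding normalize_p_def using rho by (subst pnorm_scale) (auto simp: pnorm_2_eq)
  then show ?thesis
    unfolding pnorm_proj_eq_qform[OF E] using d rho by (simp add: real_sqrt_divide)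
qed

text \<open>
  With \<open>V + 1 / \<gamma>\<close> the statistic before centring, \<open>\<eta> = t / sqrt n\<close> and \<open>\<gamma> = t / sqrt k\<close>: the norm
  deviates from \<open>1\<close> by at most \<open>\<delta> \<eta>\<close>, which is small even after multiplication by the mean
  \<open>1 / \<gamma>\<close>, as \<open>\<eta> \<le> \<gamma>\<close>.
\<close>

lemma radial_perturbation:
  fixes V r \<delta> \<gamma> K :: real
  assumes r: "1 - \<delta> * \<eta> \<le> r powr p" "0 < r" "r \<le> 1" and p: "p \<ge> 1" and V: "\<bar>V\<bar> \<le> K"
    and \<delta>: "\<delta> > 0" and \<eta>: "0 < \<eta>" "\<eta> \<le> \<gamma>" and K: "K * \<eta> \<le> 1"
  shows "\<bar>(r - 1) * (V + 1 / \<gamma>)\<bar> \<le> 2 * \<delta>"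
proof -
  have \<gamma>: "\<gamma> > 0" using \<eta> by simp
  have "r powr p \<le> r powr 1" using r p by (intro powr_mono') auto
  then have r1: "1 - r \<le> \<delta> * \<eta>" using r by simp
  have "\<bar>(r - 1) * (V + 1 / \<gamma>)\<bar> = (1 - r) * \<bar>V + 1 / \<gamma>\<bar>"
    using r by (simp add: abs_mult)
  also have "\<dots> \<le> (\<delta> * \<eta>) * (K + 1 / \<gamma>)"
  proof (rule mult_mono)
    have "\<bar>V + 1 / \<gamma>\<bar> \<le> \<bar>V\<bar> + \<bar>1 / \<gamma>\<bar>" by (rule abs_triangle_ineq)
    then show "\<bar>V + 1 / \<gamma>\<bar> \<le> K + 1 / \<gamma>" using V \<gamma> by simp
  qed (use r1 \<delta> \<eta> in auto)
  also have "\<dots> = \<delta> * (K * \<eta>) + \<delta> * (\<eta> / \<gamma>)" by (simp add: algebra_simps)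
  also have "\<dots> \<le> \<delta> * 1 + \<delta> * 1"
    using K \<delta> \<eta> \<gamma> by (intro add_mono mult_left_mono) auto
  finally show ?thesis by simp
qed

theorem theorem5p1:
  fixes p lam :: real
    and k :: "nat \<Rightarrow> nat"
    and t :: "nat \<Rightarrow> real"
    and W :: "nat \<Rightarrow> real measure"
    and M :: "nat \<Rightarrow> 'w measure"
    and X :: "nat \<Rightarrow> 'w \<Rightarrow> (nat \<Rightarrow> real)"
    and E :: "nat \<Rightarrow> 'w \<Rightarrow> (nat \<Rightarrow> real) set"
  assumes "2 \<le> p"
    and "\<And>n. n \<ge> 1 \<Longrightarrow> 1 \<le> k n \<and> k n \<le> n"
    and "0 \<le> lam" "lam \<le> 1"
    and "(\<lambda>n. real (k n) / real n) \<longlonglongrightarrow> lam"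
    and "(\<lambda>n. real (k n)) \<in> \<omega>(\<lambda>_. 1)"
    and "\<And>n. n \<ge> 1 \<Longrightarrow> 0 < t n"
    and "t \<in> \<omega>(\<lambda>_. 1)"
    and "t \<in> o(\<lambda>n. sqrt (real (k n)))"
    and "t \<in> o(\<lambda>n. sqrt (real n - real (k n))) \<or>
         (\<lambda>n. real n - real (k n)) \<in> o(\<lambda>n. sqrt (real (k n)) / t n)"
    and "\<And>n. n \<ge> 1 \<Longrightarrow> prob_space (W n)"
    and "\<And>n. n \<ge> 1 \<Longrightarrow> sets (W n) = sets (restrict_space borel {0..})"
    and "\<And>\<delta>::real. \<delta> > 0 \<Longrightarrow>
           (\<lambda>n. ereal (1 / (t n)\<^sup>2) * elog (measure (W n) {\<delta> * t n * sqrt (real n)<..}))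
             \<longlonglongrightarrow> -\<infinity>"
    and "\<And>n. n \<ge> 1 \<Longrightarrow> prob_space (M n)"
    and "\<And>n. n \<ge> 1 \<Longrightarrow> X n \<in> M n \<rightarrow>\<^sub>M Rn n"
    and "\<And>n. n \<ge> 1 \<Longrightarrow> distr (M n) (Rn n) (X n) = P_dist (W n) n p"
    and "\<And>n. n \<ge> 1 \<Longrightarrow> E n \<in> M n \<rightarrow>\<^sub>M grassmannian n (k n)"
    and "\<And>n. n \<ge> 1 \<Longrightarrow> haar_grassmannian n (k n) (distr (M n) (grassmannian n (k n)) (E n))"
    and "\<And>n. n \<ge> 1 \<Longrightarrow> prob_space.indep_set (M n)
           (sets (vimage_algebra (space (M n)) (X n) (Rn n)))
           (sets (vimage_algebra (space (M n)) (E n) (grassmannian n (k n))))"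
  shows "satisfies_MDP M
           (\<lambda>n \<omega>. (1 / t n) *
              (real n powr (1 / p) * sqrt (Gamma (1 / p) / (p powr (2 / p) * Gamma (3 / p)))
                 * pnorm n 2 (proj n (E n \<omega>) (X n \<omega>))
               - sqrt (real (k n))))
           (\<lambda>n. (t n)\<^sup>2)
           (\<lambda>x::real. mdp_const p lam * ereal (x\<^sup>2))"
proof -
  note kb = assms(2) and tpos = assms(7) and Wprob = assms(11) and Wsets = assms(12) and Wtail = assms(13)
    and Mprob = assms(14) and Xm = assms(15) and Xlaw = assms(16) and Em = assms(17) and Elaw = assms(18) and indep = assms(19)
  have t_top: "filterlim t at_top sequentially"
    unfolding filterlim_at_top
  proof
    fix Z :: real
    have "\<forall>\<^sub>F n in sequentially. norm (t n) \<ge> (\<bar>Z\<bar> + 1) * norm (1 :: real)"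
      by (rule landau_omega.smallD[OF assms(8)]) simp
    with eventually_ge_at_top[of 1] show "\<forall>\<^sub>F n in sequentially. Z \<le> t n"
      by eventually_elim (use tpos in force)
  qed
  have tk: "(\<lambda>n. t n / sqrt (real (k n))) \<longlonglongrightarrow> 0"
    by (rule smalloD_tendsto[OF assms(9)])
  interpret moderate_scaling p lam k t
    by standard (use assms(1,5) kb tpos t_top tk in auto)
  define c where "c = sqrt (1 / gauss_p_moment p 2)"
  have c_eq: "sqrt (Gamma (1 / p) / (p powr (2 / p) * Gamma (3 / p))) = c"
    by (simp add: c_def gauss_p_moment_def)
  define \<Phi> where "\<Phi> n x r = 1 / t n * (real n powr (1 / p) * c * (pnorm n 2 x * sqrt r) - sqrt (real (k n)))"
    for n and x :: "nat \<Rightarrow> real" and r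
  define Y where "Y n \<omega> = (1 / t n) * (real n powr (1 / p) * c * pnorm n 2 (proj n (E n \<omega>) (X n \<omega>)) - sqrt (real (k n)))" for n \<omega>
  define V where "V n \<omega> = \<Phi> n (normalize_p n p (X n \<omega>)) (qform n (E n \<omega>) (X n \<omega>) / dotp n (X n \<omega>) (X n \<omega>))" for n \<omega>
  have \<Phi>m: "(\<lambda>(x, r). \<Phi> n x r) \<in> borel_measurable (Rn n \<Otimes>\<^sub>M borel)" for n
    unfolding \<Phi>_def by measurable
  have Esub: "E n \<omega> \<in> subspaces n (k n)" if "n \<ge> 1" "\<omega> \<in> space (M n)" for n \<omega>
    using measurable_space[OF Em[OF that(1)] that(2)] by (simp add: space_grassmannian)
  have qm: "(\<lambda>\<omega>. qform n (E n \<omega>) (X n \<omega>)) \<in> borel_measurable (M n)" if n: "n \<ge> 1" for n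
    using measurable_compose[OF measurable_Pair[OF Xm[OF n] Em[OF n]] measurable_qform_pair] by simp
  have dm: "(\<lambda>\<omega>. dotp n (X n \<omega>) (X n \<omega>)) \<in> borel_measurable (M n)" if n: "n \<ge> 1" for n
  proof -
    have [measurable]: "(\<lambda>\<omega>. X n \<omega> i) \<in> borel_measurable (M n)" if "i \<in> {..<n}" for i
      using measurable_compose[OF Xm[OF n] measurable_component_Rn[of i n]] that by simp
    show ?thesis unfolding dotp_def by measurable
  qed
  have Ym: "Y n \<in> borel_measurable (M n)" if n: "n \<ge> 1" for n
  proof -
    have "(\<lambda>\<omega>. (1 / t n) * (real n powr (1 / p) * c * sqrt (qform n (E n \<omega>) (X n \<omega>)) - sqrt (real (k n)))) \<in> borel_measurable (M n)"
      using qm[OF n] by measurable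
    also have "?this \<longleftrightarrow> ?thesis"
      by (rule measurable_cong) (simp add: Y_def pnorm_proj_eq_qform[OF Esub[OF n]])
    finally show ?thesis .
  qed
  have Vm: "V n \<in> borel_measurable (M n)" if n: "n \<ge> 1" for n
  proof -
    have "(\<lambda>\<omega>. (\<lambda>(x, r). \<Phi> n x r) (normalize_p n p (X n \<omega>), qform n (E n \<omega>) (X n \<omega>) / dotp n (X n \<omega>) (X n \<omega>))) \<in> borel_measurable (M n)"
      using qm[OF n] dm[OF n]
      by (intro measurable_compose[OF _ \<Phi>m] measurable_Pair measurable_compose[OF Xm[OF n] measurable_normalize_p]) auto
    then show ?thesis by (simp add: V_def[abs_def])
  qed
  have rrY: "random_reals M Y" and rrV: "random_reals M V"
    unfolding random_reals_def
    by (use eventually_ge_at_top[of 1] in \<open>eventually_elim, simp add: Mprob Ym Vm\<close>)+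
  have law: "distr (M n) borel (V n) = distr (reference_space n p) borel (reference_statistic n)" if n: "n \<ge> 1" for n
  proof -
    have "reference_statistic n = (\<lambda>z. \<Phi> n (normalize_p n p (fst z)) (beta_ratio n (k n) (snd z)))"
      by (simp add: reference_statistic_def \<Phi>_def c_def fun_eq_iff)
    then show ?thesis
      unfolding V_def[abs_def] using kb[OF n]
      by (simp only:) (rule direction_law[OF n _ _ p0 Mprob[OF n] Xm[OF n] Em[OF n] Xlaw[OF n] Wprob[OF n] Wsets[OF n] Elaw[OF n] indep[OF n] \<Phi>m], auto)
  qed
  have V_mdp: "gauss_mdp M V (\<lambda>n. (t n)\<^sup>2) limit_variance"
  proof (rule gauss_mdp_same_law[OF random_reals_reference(2) rrV reference_mdp])
    show "\<forall>\<^sub>F n in sequentially. distr (reference_space n p) borel (reference_statistic n) = distr (M n) borel (V n)"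
      using eventually_ge_at_top[of 1] by eventually_elim (simp add: law)
  qed
  define \<eta> where "\<eta> n = t n / sqrt (real n)" for n
  define \<gamma> where "\<gamma> n = t n / sqrt (real (k n))" for n
  have \<eta>\<gamma>: "0 < \<eta> n" "\<eta> n \<le> \<gamma> n" if "n \<ge> 1" for n
    unfolding \<eta>_def \<gamma>_def using tpos[OF that] kb[OF that] that by (auto intro!: divide_left_mono)
  have \<eta>0: "\<eta> \<longlonglongrightarrow> 0"
  proof (rule tendsto_sandwich[OF _ _ tendsto_const tk])
    show "\<forall>\<^sub>F n in sequentially. 0 \<le> \<eta> n" "\<forall>\<^sub>F n in sequentially. \<eta> n \<le> t n / sqrt (real (k n))"
      using eventually_ge_at_top[of 1] by (eventually_elim, use \<eta>\<gamma> in \<open>force simp: \<gamma>_def\<close>)+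
  qed
  have equivalent: "superexp (\<lambda>n. (t n)\<^sup>2) (\<lambda>n. measure (M n) {\<omega> \<in> space (M n). e < \<bar>Y n \<omega> - V n \<omega>\<bar>})" if e: "e > 0" for e
    unfolding superexp_def
  proof
    fix C :: real
    \<comment> \<open>The factor \<open>1 / 2\<close> compensates the factor \<open>2\<close> in \<open>radial_perturbation\<close>.\<close>
    define \<delta> where "\<delta> = e / 2"
    have \<delta>: "\<delta> > 0" using e by (simp add: \<delta>_def)
    define m where "m n = measure (W n) {\<delta> / 2 * t n * sqrt (real n)<..}" for n
    have "superexp (\<lambda>n. (t n)\<^sup>2) m"
      unfolding m_def using \<delta> by (intro superexp_of_elog_limit tpos Wtail) auto
    from superexpD[OF this, of "C + 2"]
    have ev1: "\<forall>\<^sub>F n in sequentially. m n \<le> exp (- (C + 2) * (t n)\<^sup>2)" .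
    define b where "b = (ln 2 - 1 / 2) / p"
    have b: "b > 0" using ln2_ge_two_thirds p0 by (simp add: b_def)
    have base: "(exp (1 / 2) / 2) powr (n / p) = exp (- b * n)" for n :: nat
      by (simp add: powr_def ln_div b_def algebra_simps diff_divide_distrib)
    have "(\<lambda>n. (C + 2) * (\<eta> n)\<^sup>2) \<longlonglongrightarrow> (C + 2) * 0\<^sup>2"
      by (intro tendsto_intros \<eta>0)
    then have "\<forall>\<^sub>F n in sequentially. (C + 2) * (\<eta> n)\<^sup>2 < b"
      using b by (intro order_tendstoD(2)) auto
    with eventually_ge_at_top[of 1]
    have ev2: "\<forall>\<^sub>F n in sequentially. (exp (1 / 2) / 2) powr (n / p) \<le> exp (- (C + 2) * (t n)\<^sup>2)"
    proof eventually_elim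
      case (elim n)
      have "(t n)\<^sup>2 = (\<eta> n)\<^sup>2 * real n" using elim by (simp add: \<eta>_def power_divide)
      then have "(C + 2) * (t n)\<^sup>2 \<le> b * real n" using elim by (simp add: mult.assoc[symmetric] mult_right_mono)
      then show ?case unfolding base by (simp only: exp_le_cancel_iff mult_minus_left neg_le_iff_le)
    qed
    obtain K :: real where K: "K > 0" "2 * limit_variance * (C + 2) < K\<^sup>2"
    proof -
      define u where "u = 2 * limit_variance * (C + 2)"
      have "u < (\<bar>u\<bar> + 1)\<^sup>2"
      proof -
        have "(\<bar>u\<bar> + 1)\<^sup>2 = \<bar>u\<bar>\<^sup>2 + 2 * \<bar>u\<bar> + 1" by (simp add: power2_eq_square algebra_simps)
        then show ?thesis using zero_le_power2[of "\<bar>u\<bar>"] abs_ge_self[of u] abs_ge_zero[of u] by linarith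
      qed
      then show ?thesis using that[of "\<bar>u\<bar> + 1"] by (simp add: u_def)
    qed
    note ev3 = gauss_mdp_upper[OF V_mdp K]
    have "(\<lambda>n. K * \<eta> n) \<longlonglongrightarrow> K * 0" by (intro tendsto_intros \<eta>0)
    then have ev4: "\<forall>\<^sub>F n in sequentially. K * \<eta> n < 1" by (intro order_tendstoD(2)) auto
    have cc: "C + 1 < C + 2" "C < C + 1" by simp_all
    from ev1 ev2 ev3 ev4 eventually_two_exp_le[OF speed cc(1)] eventually_two_exp_le[OF speed cc(2)] eventually_ge_at_top[of 1]
    show "\<forall>\<^sub>F n in sequentially. measure (M n) {\<omega> \<in> space (M n). e < \<bar>Y n \<omega> - V n \<omega>\<bar>} \<le> exp (- C * (t n)\<^sup>2)"
    proof eventually_elim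
      case (elim n)
      have n: "n \<ge> 1" by fact
      interpret prob_space "M n" by (rule Mprob[OF n])
      interpret W: prob_space "W n" by (rule Wprob[OF n])
      note [measurable] = Ym[OF n] Vm[OF n] Xm[OF n]
      have tn: "t n > 0" and kn: "real (k n) > 0" using tpos[OF n] kb[OF n] by auto
      define S where "S = {x \<in> space (Rn n). pnorm n p x powr p < 1 - \<delta> * \<eta> n}"
      have S [measurable]: "S \<in> sets (Rn n)" unfolding S_def by measurable
      define A1 where "A1 = {\<omega> \<in> space (M n). X n \<omega> \<in> S}"
      define A2 where "A2 = {\<omega> \<in> space (M n). K \<le> \<bar>V n \<omega>\<bar>}"
      define A0 where "A0 = {\<omega> \<in> space (M n). \<not> (0 < pnorm n p (X n \<omega>) \<and> pnorm n p (X n \<omega>) \<le> 1)}"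
      have ev: "A0 \<in> events" "A1 \<in> events" "A2 \<in> events"
        unfolding A0_def A1_def A2_def by measurable
      have P0: "prob A0 = 0"
      proof -
        have PP: "prob_space (P_dist (W n) n p)"
          unfolding Xlaw[OF n, symmetric] by (rule prob_space_distr[OF Xm[OF n]])
        have "AE x in distr (M n) (Rn n) (X n). 0 < pnorm n p x \<and> pnorm n p x \<le> 1"
          unfolding Xlaw[OF n] by (rule P_dist_normalize(2)[OF n p0 PP Wprob[OF n] Wsets[OF n]])
        then have "AE \<omega> in M n. 0 < pnorm n p (X n \<omega>) \<and> pnorm n p (X n \<omega>) \<le> 1"
          by (subst (asm) AE_distr_iff[OF Xm[OF n]]) auto
        then have "AE \<omega> in M n. \<omega> \<notin> A0" by eventually_elim (auto simp: A0_def)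
        then show ?thesis using ev(1) by (simp add: prob_eq_0)
      qed
      have P1: "prob A1 \<le> exp (- (C + 2) * (t n)\<^sup>2) + exp (- (C + 2) * (t n)\<^sup>2)"
      proof -
        have "emeasure (M n) A1 = emeasure (distr (M n) (Rn n) (X n)) S"
          using S Xm[OF n] by (subst emeasure_distr) (auto simp: A1_def intro!: arg_cong[where f="emeasure (M n)"])
        also have "\<dots> \<le> ennreal ((exp (1 / 2) / 2) powr (n / p)) + emeasure (W n) {\<delta> * \<eta> n * real n / 2<..}"
          unfolding Xlaw[OF n] S_def using \<delta> \<eta>\<gamma>[OF n]
          by (intro P_dist_radial_tail[OF n p0 _ Wprob[OF n] Wsets[OF n]]) simp
        also have "\<delta> * \<eta> n * real n / 2 = \<delta> / 2 * t n * sqrt (real n)"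
        proof -
          have "x / s * (s * s) = x * s" if "s > 0" for x s :: real using that by simp
          from this[of "sqrt (real n)" "t n"] have "\<eta> n * real n = t n * sqrt (real n)"
            using n by (simp add: \<eta>_def)
          then show ?thesis by (simp add: mult.assoc)
        qed
        also have "ennreal ((exp (1 / 2) / 2) powr (n / p)) + emeasure (W n) {\<delta> / 2 * t n * sqrt (real n)<..} =
          ennreal ((exp (1 / 2) / 2) powr (n / p) + m n)"
          unfolding m_def W.emeasure_eq_measure by simp
        finally have "ennreal (prob A1) \<le> ennreal ((exp (1 / 2) / 2) powr (n / p) + m n)"
          unfolding emeasure_eq_measure .
        then have "prob A1 \<le> (exp (1 / 2) / 2) powr (n / p) + m n"
          by (subst (asm) ennreal_le_iff) (simp_all add: m_def)
        then show ?thesis using elim by linarith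
      qed
      have P2: "prob A2 \<le> exp (- (C + 2) * (t n)\<^sup>2)" unfolding A2_def using elim by simp
      have "prob {\<omega> \<in> space (M n). e < \<bar>Y n \<omega> - V n \<omega>\<bar>} \<le> prob (A0 \<union> (A1 \<union> A2))"
      proof (intro finite_measure_mono subsetI)
        fix \<omega> assume w: "\<omega> \<in> {\<omega> \<in> space (M n). e < \<bar>Y n \<omega> - V n \<omega>\<bar>}"
        show "\<omega> \<in> A0 \<union> (A1 \<union> A2)"
        proof (rule ccontr)
          assume "\<omega> \<notin> A0 \<union> (A1 \<union> A2)"
          define r where "r = pnorm n p (X n \<omega>)"
          have Xs: "X n \<omega> \<in> space (Rn n)" using measurable_space[OF Xm[OF n]] w by simp
          have r: "0 < r" "r \<le> 1" "1 - \<delta> * \<eta> n \<le> r powr p" "\<bar>V n \<omega>\<bar> \<le> K"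
            using \<open>\<omega> \<notin> A0 \<union> (A1 \<union> A2)\<close> w Xs by (auto simp: A0_def A1_def A2_def S_def r_def)
          define Q where "Q = pnorm n 2 (normalize_p n p (X n \<omega>)) * sqrt (qform n (E n \<omega>) (X n \<omega>) / dotp n (X n \<omega>) (X n \<omega>))"
          have "pnorm n 2 (proj n (E n \<omega>) (X n \<omega>)) = r * Q"
            unfolding r_def Q_def using w r by (intro radial_factor[OF Esub[OF n] _ p0]) (auto simp: r_def)
          then have "Y n \<omega> - V n \<omega> = (1 / t n) * (r - 1) * (real n powr (1 / p) * c * Q)"
            unfolding Y_def V_def \<Phi>_def Q_def[symmetric] by (simp add: algebra_simps diff_divide_distrib)
          moreover have "V n \<omega> + 1 / \<gamma> n = (1 / t n) * (real n powr (1 / p) * c * Q)"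
            unfolding V_def \<Phi>_def Q_def[symmetric] \<gamma>_def using tn kn by (simp add: field_simps)
          ultimately have "Y n \<omega> - V n \<omega> = (r - 1) * (V n \<omega> + 1 / \<gamma> n)" by simp
          moreover have "\<bar>(r - 1) * (V n \<omega> + 1 / \<gamma> n)\<bar> \<le> 2 * \<delta>"
            using r p \<delta> \<eta>\<gamma>[OF n] elim(4) by (intro radial_perturbation[of \<delta> "\<eta> n" r p "V n \<omega>" K]) auto
          ultimately show False using w by (simp add: \<delta>_def)
        qed
      qed (use ev in auto)
      also have "\<dots> \<le> prob A0 + prob (A1 \<union> A2)" using ev by (intro measure_Un_le) auto
      also have "\<dots> \<le> prob A0 + (prob A1 + prob A2)" using ev by (intro add_left_mono measure_Un_le) auto
      finally have fin: "prob {\<omega> \<in> space (M n). e < \<bar>Y n \<omega> - V n \<omega>\<bar>} \<le> 3 * exp (- (C + 2) * (t n)\<^sup>2)"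
        using P0 P1 P2 by linarith
      have "exp (- (C + 2) * (t n)\<^sup>2) \<ge> 0" by simp
      with fin show ?case using elim(5,6) by linarith
    qed
  qed
  have "gauss_mdp M Y (\<lambda>n. (t n)\<^sup>2) limit_variance"
    by (rule gauss_mdp_exponentially_equivalent[OF speed limit_variance_nonneg rrV rrY V_mdp equivalent])
  then have "satisfies_MDP M Y (\<lambda>n. (t n)\<^sup>2) (\<lambda>x. mdp_const p lam * ereal (x\<^sup>2))"
    by (rule gauss_mdp_imp_satisfies_MDP[OF speed limit_variance_nonneg rrY])
       (use mdp_const_limit[OF p0, of lam] in \<open>simp_all add: limit_variance_def\<close>)
  then show ?thesis
    unfolding c_eq Y_def[abs_def] .
qed

end
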